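(* Let $(\mathcal{A},d\mu)$ be a probability space and, for $\mu$-a.e. $a\in\mathcal{A}$, let $s\in\mathbb{R}/\mathbb{Z}\mapsto X_0(s,a)\in\mathbb{T}^d$ be a loop. Let $B_0$ ($\mathbb{R}^d$-valued) and $\rho_0\ge 0$ (real-valued) be the Borel measures on $\mathbb{T}^d$ defined by $$(B_0,\rho_0)(x)=\int_{a\in\mathcal{A}}\left(\int_{\mathbb{R}/\mathbb{Z}}\delta(x-X_0(s,a))\,(\partial_sX_0(s,a),1)\,ds\right)d\mu(a),$$ and assume that the loops are chosen so that $$\int_{x\in\mathbb{T}^d}\frac{\left|\int_{\mathcal{A}\times\mathbb{R}/\mathbb{Z}}\delta(x-X_0(s,a))\,\partial_sX_0(s,a)\,ds\,d\mu(a)\right|^2}{\int_{\mathcal{A}\times\mathbb{R}/\mathbb{Z}}\delta(x-X_0(s,a))\,ds\,d\mu(a)}=\int_{\mathcal{A}\times\mathbb{R}/\mathbb{Z}}|\partial_sX_0(s,a)|^2\,ds\,d\mu(a)<+\infty$$ (the left-hand side being $\int_{\mathbb{T}^d}|B_0|^2/\rho_0$). For $\mu$-a.e. $a$, let $X(\cdot,\cdot,a)$ be the solution of the heat equation $$\partial_tX(t,s,a)=\partial^2_{ss}X(t,s,a),\qquad X(0,s,a)=X_0(s,a).$$ Then $$(B,\rho,P)(t,x)=\int_{a\in\mathcal{A}}\left(\int_{\mathbb{R}/\mathbb{Z}}\delta(x-X(t,s,a))\,(\partial_sX,1,\partial_tX)(t,s,a)\,ds\right)d\mu(a)$$ is a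 global dissipative solution (that is, a dissipative solution on $[0,T]$ for every $T>0$) of the Eulerian heat equation with initial data $(B_0,\rho_0)$.
   Context: Notation. $\mathbb{T}^d=(\mathbb{R}/\mathbb{Z})^d$ is the flat torus. Spaces $C(\cdot)'$ are duals of spaces of continuous functions, i.e. spaces of finite (vector-valued) Borel measures. $C([0,T],C(\mathbb{T}^d,\mathbb{R}^m)'_{w^*})$ denotes maps from $[0,T]$ to measures that are continuous for the weak-* topology. Loops. A loop is a Lipschitz map $s\in\mathbb{R}/\mathbb{Z}\mapsto X(s)\in\mathbb{T}^d$. It is identified with a Lipschitz lift $X:\mathbb{R}\to\mathbb{R}^d$ such that $X(s+1)=X(s)+N$ for some $N\in\mathbb{Z}^d$; the heat equation is solved for the lift, with $X(t,s+1,a)=X(t,s,a)+N(a)$ for all $t$. The dependence on $(s,a)$ is assumed measurable. Delta notation. For a map $X(s,a)$ and a density $g(s,a)$, the expression $\int_{\mathcal{A}}\int_{\mathbb{R}/\mathbb{Z}}\delta(x-X(s,a))\,g(s,a)\,ds\,d\mu(a)$ is the measure on $\mathbb{T}^d$ whose pairing with a continuous test function $\phi$ is $\int_{\mathcal{A}}\int_{\mathbb{R}/\mathbb{Z}}\phi(X(s,a))\,g(s,a)\,ds\,d\mu(a)$. For $P$, understood as a measure on $[0,T]\times\mathbb{T}^d$, the pairing with $\phi\in C([0,T]\times\mathbb{T}^d;\mathbb{R}^d)$ is $\int_0^T\int_{\mathcal{A}}\int_{\mathbb{R}/\mathbb{Z}}\phi(t,X(t,s,a))\cdot\partial_tX(t,s,a)\,ds\,d\mu(a)\,dt$.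 Integrals with $\rho$ in the denominator. For measures $U$ (vector-valued) and $\rho$ (real-valued), $\int\frac{|U|^2}{2\rho}\in[0,+\infty]$ is the convex, one-homogeneous functional $\sup\{\int\theta\rho+\Theta\cdot U:\ (\theta,\Theta)\text{ continuous},\ \theta+\frac12|\Theta|^2\le0\}$. Equivalently, it is $\frac12\int|u|^2\rho$ if $\rho\ge0$ and $U=\rho u$ with $u\in L^2(\rho)$, and $+\infty$ otherwise. Similarly, for a continuous field $Q$ of symmetric matrices with $Q\ge I$, $\int\frac{U^{T}QU}{2\rho}$ equals $\frac12\int u^{T}Qu\,\rho$ if $\rho\ge0$ and $U=\rho u$ with $u\in L^2(\rho)$, and $+\infty$ otherwise. When time integrals are present, these expressions are understood for measures on space-time, with $\rho(t,dx)\,dt$ as the space-time measure associated with $\rho$. The Eulerian heat equation is the system on $\mathbb{T}^d$ $$\partial_tB^i+\partial_j\left(\frac{B^iP^j-P^iB^j}{\rho}\right)=0,\quad\partial_jB^j=0,\quad\partial_t\rho+\partial_jP^j=0,\quad P^i=\partial_j\left(\frac{B^iB^j}{\rho}\right)$$ (summation over repeated indices). Definition (dissipative solution). Fix $T>0$. A triple $(B,\rho,P)$ with $(B,\rho)\in C([0,T],C(\mathbb{T}^d,\mathbb{R}^d\times\mathbb{R})'_{w^*})$ and $P\in C([0,T]\times\mathbb{T}^d,\mathbb{R}^d)'$ is a dissipative solution of the Eulerian heat equation with initial data $(B_0,\rho_0\ge0)\in C(\mathbb{T}^d;\mathbb{R}^d\times\mathbb{R})'$ if and only if: (i) $(B(0),\rho(0))=(B_0,\rho_0)$,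 and $\nabla\cdot B=0$, $\partial_t\rho+\nabla\cdot P=0$ in the sense of distributions; (ii) for any $b^*,v^*\in C^1([0,T]\times\mathbb{T}^d,\mathbb{R}^d)$, the inequality $$E(t)e^{-rt}+\int_0^te^{-rt'}\left[\int_{\mathbb{T}^d}\frac{\widetilde U^{T}Q_r\widetilde U}{2\rho}(t')-R(t')\right]dt'\le E(0)<+\infty$$ holds for all $t\in[0,T]$ and all $r\ge r_0$, where $$\widetilde U=(B-\rho b^*,\,P-\rho v^* ),\qquad E(t)=\int_{\mathbb{T}^d}\frac{|B-\rho b^*|^2}{2\rho}(t),$$ $$Q_r=\begin{pmatrix}-\nabla v^*-(\nabla v^* )^{T}+rI_d&\nabla b^*-(\nabla b^* )^{T}\\(\nabla b^* )^{T}-\nabla b^*&2I_d\end{pmatrix},\qquad(\nabla w)_{ij}=\partial_jw_i,$$ $$R=\int_{\mathbb{T}^d}\rho\,\mathrm{L}_1+B\cdot\mathrm{L}_2+P\cdot\mathrm{L}_3,$$ $$\mathrm{L}_1=|v^*|^2+D_t^*\left(\frac{|b^*|^2}{2}\right)-(b^*\cdot\nabla)(b^*\cdot v^* ),\qquad D_t^*=\partial_t+v^*\cdot\nabla,$$ $$\mathrm{L}_2=-D_t^*b^*+(b^*\cdot\nabla)v^*,\qquad\mathrm{L}_3=-v^*+(b^*\cdot\nabla)b^*,$$ and $r_0$ is a constant depending on $b^*,v^*$, chosen so that $Q_{r_0}\ge I_{2d}$ for every $(t,x)$ (the inequality is required for every such choice of $r_0$). *)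

theory Defs
  imports "HOL-Analysis.Analysis" "HOL-Probability.Probability"
begin

section \<open>The flat torus\<close>

quotient_type 'n torus = "real ^ 'n" / "\<lambda>x y. \<forall>i::'n::finite. x $ i - y $ i \<in> \<int>"
proof (rule equivpI)
  show "reflp (\<lambda>x y::real^'n. \<forall>i. x $ i - y $ i \<in> \<int>)"
    by (simp add: reflp_def)
  show "symp (\<lambda>x y::real^'n. \<forall>i. x $ i - y $ i \<in> \<int>)"
    by (intro sympI allI) (metis Ints_minus minus_diff_eq)
  show "transp (\<lambda>x y::real^'n. \<forall>i. x $ i - y $ i \<in> \<int>)"
  proof (rule transpI, rule allI)
    fix x y z :: "real^'n" and i
    assume "\<forall>i. x $ i - y $ i \<in> \<int>" "\<forall>i. y $ i - z $ i \<in> \<int>"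
    then have "(x $ i - y $ i) + (y $ i - z $ i) \<in> \<int>" by (intro Ints_add) auto
    then show "x $ i - z $ i \<in> \<int>" by simp
  qed
qed

instantiation torus :: (finite) topological_space
begin

definition open_torus :: "'a torus set \<Rightarrow> bool" where
  "open_torus U \<longleftrightarrow> open (abs_torus -` U)"

instance
proof
  show "open (UNIV :: 'a torus set)" by (simp add: open_torus_def)
  show "open (S \<inter> S')" if "open S" "open S'" for S S' :: "'a torus set"
    using that by (simp add: open_torus_def vimage_Int open_Int)
  show "open (\<Union>K)" if "\<forall>S\<in>K. open S" for K :: "'a torus set set"
    using that by (auto simp: open_torus_def vimage_Union intro: open_UN)
qed

end

section \<open>Differential calculus on the torus\<close>

text \<open>
  A function on the torus is differentiated through its periodic lift
  \<open>f \<circ> abs_torus\<close>; the derivative of the lift is periodic, so the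
  representative chosen by \<open>rep_torus\<close> is irrelevant.
\<close>

definition torus_grad :: "('n::finite torus \<Rightarrow> real) \<Rightarrow> 'n torus \<Rightarrow> real ^ 'n" where
  "torus_grad f p =
     (\<chi> j. frechet_derivative (\<lambda>y. f (abs_torus y)) (at (rep_torus p)) (axis j 1))"

text \<open>The field \<open>(h \<cdot> \<nabla>) f\<close>, with the gradient taken in the space variable only.\<close>

definition dir_deriv ::
  "(real \<times> 'n torus \<Rightarrow> real ^ 'n) \<Rightarrow> (real \<times> 'n::finite torus \<Rightarrow> 'b::real_normed_vector)
    \<Rightarrow> real \<times> 'n torus \<Rightarrow> 'b" where
  "dir_deriv h f z =
     frechet_derivative (\<lambda>y. f (fst z, abs_torus y)) (at (rep_torus (snd z))) (h z)"

definition time_deriv ::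
  "real set \<Rightarrow> (real \<times> 'n::finite torus \<Rightarrow> 'b::real_normed_vector) \<Rightarrow> real \<times> 'n torus \<Rightarrow> 'b" where
  "time_deriv I f z = vector_derivative (\<lambda>t. f (t, snd z)) (at (fst z) within I)"

definition space_jacobian ::
  "(real \<times> 'n torus \<Rightarrow> real ^ 'n) \<Rightarrow> real \<times> 'n::finite torus \<Rightarrow> real ^ 'n ^ 'n" where
  "space_jacobian w z = jacobian (\<lambda>y. w (fst z, abs_torus y)) (at (rep_torus (snd z)))"

definition C1_field :: "real \<Rightarrow> (real \<times> 'n::finite torus \<Rightarrow> real ^ 'n) \<Rightarrow> bool" where
  "C1_field T w \<longleftrightarrow>
     (\<exists>D :: real \<times> 'n torus \<Rightarrow> ((real \<times> (real ^ 'n)) \<Rightarrow>\<^sub>L (real ^ 'n)).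
        continuous_on ({0..T} \<times> UNIV) D \<and>
        (\<forall>t\<in>{0..T}. \<forall>x.
           ((\<lambda>(\<tau>, y). w (\<tau>, abs_torus y)) has_derivative blinfun_apply (D (t, abs_torus x)))
             (at (t, x) within {0..T} \<times> UNIV)))"

text \<open>Infinitely differentiable: differentiable, with all directional derivatives again smooth.\<close>

coinductive smooth_fun :: "('v::real_normed_vector \<Rightarrow> real) \<Rightarrow> bool" where
  "(\<And>x. f differentiable (at x)) \<Longrightarrow>
   (\<And>h. smooth_fun (\<lambda>x. frechet_derivative f (at x) h)) \<Longrightarrow> smooth_fun f"

section \<open>Measures as duals of spaces of continuous functions\<close>

text \<open>
  \<open>cdual S L\<close>: for compact \<open>S\<close>, the functional \<open>L\<close> is an element of \<open>C(S, 'c)'\<close>. Functions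
  are total, so only the values of \<open>L\<close> at functions continuous on \<open>S\<close> are meaningful; the
  bound forces these values to depend only on the restriction of the function to \<open>S\<close>.
\<close>

definition cdual ::
  "'b::topological_space set \<Rightarrow> (('b \<Rightarrow> 'c::real_normed_vector) \<Rightarrow> real) \<Rightarrow> bool" where
  "cdual S L \<longleftrightarrow>
     (\<forall>\<phi> \<psi>. continuous_on S \<phi> \<longrightarrow> continuous_on S \<psi> \<longrightarrow> L (\<lambda>x. \<phi> x + \<psi> x) = L \<phi> + L \<psi>) \<and>
     (\<forall>c \<phi>. continuous_on S \<phi> \<longrightarrow> L (\<lambda>x. c *\<^sub>R \<phi> x) = c * L \<phi>) \<and>
     (\<exists>C. \<forall>\<phi> K. continuous_on S \<phi> \<longrightarrow> (\<forall>x\<in>S. norm (\<phi> x) \<le> K) \<longrightarrow> \<bar>L \<phi>\<bar> \<le> C * K)"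

definition nonneg_on :: "'b::topological_space set \<Rightarrow> (('b \<Rightarrow> real) \<Rightarrow> real) \<Rightarrow> bool" where
  "nonneg_on S L \<longleftrightarrow> (\<forall>\<phi>. continuous_on S \<phi> \<longrightarrow> (\<forall>x\<in>S. 0 \<le> \<phi> x) \<longrightarrow> 0 \<le> L \<phi>)"

definition weak_star_continuous ::
  "real \<Rightarrow> (real \<Rightarrow> ('b::topological_space \<Rightarrow> 'c::real_normed_vector) \<Rightarrow> real) \<Rightarrow> bool" where
  "weak_star_continuous T L \<longleftrightarrow>
     (\<forall>t\<in>{0..T}. cdual UNIV (L t)) \<and>
     (\<forall>\<phi>. continuous_on UNIV \<phi> \<longrightarrow> continuous_on {0..T} (\<lambda>t. L t \<phi>))"

text \<open>\<open>\<integral> |U|\<^sup>2 / (2 \<rho>)\<close> on the compact set \<open>S\<close>.\<close>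

definition kinetic ::
  "'b::topological_space set \<Rightarrow> (('b \<Rightarrow> real) \<Rightarrow> real) \<Rightarrow> (('b \<Rightarrow> real ^ 'm) \<Rightarrow> real) \<Rightarrow> ereal" where
  "kinetic S \<rho> U =
     (SUP (\<theta>, \<Theta>) \<in> {(\<theta>, \<Theta>). continuous_on S \<theta> \<and> continuous_on S \<Theta> \<and>
                          (\<forall>x\<in>S. \<theta> x + (norm (\<Theta> x))\<^sup>2 / 2 \<le> 0)}.
        ereal (\<rho> \<theta> + U \<Theta>))"

text \<open>
  \<open>\<integral> U\<^sup>T Q U / (2 \<rho>)\<close> on the compact set \<open>S\<close>: if \<open>\<rho>\<close> is a nonnegative measure \<open>M\<close> and \<open>U = M u\<close>
  with \<open>u \<in> L\<^sup>2(M)\<close>, then \<open>M\<close> and (almost everywhere) \<open>u\<close> are unique, so the infimum is over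
  the single value \<open>\<integral> u\<^sup>T Q u / 2 dM\<close>; otherwise it is over the empty set, hence infinite.
\<close>

definition quad_energy ::
  "'b::topological_space set \<Rightarrow> ('b \<Rightarrow> real ^ 'm ^ 'm) \<Rightarrow> (('b \<Rightarrow> real) \<Rightarrow> real)
     \<Rightarrow> (('b \<Rightarrow> real ^ 'm) \<Rightarrow> real) \<Rightarrow> ereal" where
  "quad_energy S Q \<rho> U =
     Inf {ereal (LINT z|M. (u z \<bullet> (Q z *v u z)) / 2) | M u.
            finite_measure M \<and> sets M = sets (restrict_space borel S) \<and>
            u \<in> borel_measurable M \<and> integrable M (\<lambda>z. (norm (u z))\<^sup>2) \<and>
            (\<forall>\<phi>. continuous_on S \<phi> \<longrightarrow> \<rho> \<phi> = (LINT z|M. \<phi> z)) \<and>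
            (\<forall>\<Phi>. continuous_on S \<Phi> \<longrightarrow> U \<Phi> = (LINT z|M. \<Phi> z \<bullet> u z))}"

text \<open>The measure \<open>m(s, dx) ds\<close> on \<open>[0,t] \<times> \<bbbT>\<^sup>d\<close>, for a weak-* continuous family \<open>m\<close>.\<close>

definition spacetime ::
  "real \<Rightarrow> (real \<Rightarrow> ('p \<Rightarrow> 'c) \<Rightarrow> real) \<Rightarrow> (real \<times> 'p \<Rightarrow> 'c) \<Rightarrow> real" where
  "spacetime t m \<phi> = (LINT s:{0..t}|lborel. m s (\<lambda>x. \<phi> (s, x)))"

text \<open>
  The restriction to \<open>[0,t] \<times> \<bbbT>\<^sup>d\<close> of a measure \<open>P\<close> on \<open>[0,T] \<times> \<bbbT>\<^sup>d\<close>: the continuous cut-offs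
  \<open>max 0 (1 - n max 0 (s - t))\<close> decrease to the indicator function of \<open>s \<le> t\<close>, so that
  by dominated convergence the limit exists and is the integral of \<open>\<phi>\<close> over \<open>[0,t] \<times> \<bbbT>\<^sup>d\<close>.
  The minimum extends \<open>\<phi>\<close> continuously to later times.
\<close>

definition restrict_time ::
  "real \<Rightarrow> ((real \<times> 'p \<Rightarrow> 'c::real_normed_vector) \<Rightarrow> real) \<Rightarrow> (real \<times> 'p \<Rightarrow> 'c) \<Rightarrow> real" where
  "restrict_time t P \<phi> =
     lim (\<lambda>n::nat. P (\<lambda>(s, x). max 0 (1 - real n * max 0 (s - t)) *\<^sub>R \<phi> (min s t, x)))"

section \<open>Dissipative solutions of the Eulerian heat equation\<close>

definition divergence_free :: "(('n::finite torus \<Rightarrow> real ^ 'n) \<Rightarrow> real) \<Rightarrow> bool" where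
  "divergence_free B \<longleftrightarrow>
     (\<forall>\<phi>. smooth_fun (\<lambda>y. \<phi> (abs_torus y)) \<longrightarrow> B (torus_grad \<phi>) = 0)"

text \<open>\<open>\<partial>\<^sub>t \<rho> + \<nabla> \<cdot> P = 0\<close> as a distribution on the open set \<open>(0,T) \<times> \<bbbT>\<^sup>d\<close>.\<close>

definition continuity_equation ::
  "real \<Rightarrow> (real \<Rightarrow> ('n::finite torus \<Rightarrow> real) \<Rightarrow> real) \<Rightarrow> ((real \<times> 'n torus \<Rightarrow> real ^ 'n) \<Rightarrow> real)
     \<Rightarrow> bool" where
  "continuity_equation T \<rho> P \<longleftrightarrow>
     (\<forall>\<phi> :: real \<times> 'n torus \<Rightarrow> real.
        smooth_fun (\<lambda>(t, y). \<phi> (t, abs_torus y)) \<longrightarrow>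
        (\<exists>\<alpha> \<beta>. 0 < \<alpha> \<and> \<beta> < T \<and> (\<forall>t p. t \<notin> {\<alpha>..\<beta>} \<longrightarrow> \<phi> (t, p) = 0)) \<longrightarrow>
        spacetime T \<rho> (time_deriv UNIV \<phi>) + P (\<lambda>(t, p). torus_grad (\<lambda>q. \<phi> (t, q)) p) = 0)"

definition energy ::
  "(real \<Rightarrow> ('n::finite torus \<Rightarrow> real ^ 'n) \<Rightarrow> real) \<Rightarrow> (real \<Rightarrow> ('n torus \<Rightarrow> real) \<Rightarrow> real)
     \<Rightarrow> (real \<times> 'n torus \<Rightarrow> real ^ 'n) \<Rightarrow> real \<Rightarrow> ereal" where
  "energy B \<rho> b t =
     kinetic UNIV (\<rho> t) (\<lambda>\<Theta>. B t \<Theta> - \<rho> t (\<lambda>x. \<Theta> x \<bullet> b (t, x)))"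

definition Q_matrix ::
  "real \<Rightarrow> (real \<times> 'n::finite torus \<Rightarrow> real ^ 'n) \<Rightarrow> (real \<times> 'n torus \<Rightarrow> real ^ 'n)
     \<Rightarrow> real \<times> 'n torus \<Rightarrow> real ^ ('n + 'n) ^ ('n + 'n)" where
  "Q_matrix r b v z =
     (let Nb = space_jacobian b z; Nv = space_jacobian v z;
          Q11 = - Nv - transpose Nv + r *\<^sub>R mat 1;
          Q12 = Nb - transpose Nb;
          Q21 = transpose Nb - Nb;
          Q22 = 2 *\<^sub>R mat 1
      in (\<chi> I J. case (I, J) of
            (Inl i, Inl j) \<Rightarrow> Q11 $ i $ j
          | (Inl i, Inr j) \<Rightarrow> Q12 $ i $ j
          | (Inr i, Inl j) \<Rightarrow> Q21 $ i $ j
          | (Inr i, Inr j) \<Rightarrow> Q22 $ i $ j))"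

text \<open>\<open>Q\<^sub>r \<ge> I\<close> on \<open>[0,T] \<times> \<bbbT>\<^sup>d\<close>, in the order of symmetric matrices.\<close>

definition Q_ge_id ::
  "real \<Rightarrow> real \<Rightarrow> (real \<times> 'n::finite torus \<Rightarrow> real ^ 'n) \<Rightarrow> (real \<times> 'n torus \<Rightarrow> real ^ 'n) \<Rightarrow> bool"
  where
  "Q_ge_id T r b v \<longleftrightarrow>
     (\<forall>t\<in>{0..T}. \<forall>x. \<forall>\<xi>. \<xi> \<bullet> \<xi> \<le> \<xi> \<bullet> (Q_matrix r b v (t, x) *v \<xi>))"

definition D_star ::
  "real \<Rightarrow> (real \<times> 'n::finite torus \<Rightarrow> real ^ 'n) \<Rightarrow> (real \<times> 'n torus \<Rightarrow> 'b::real_normed_vector)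
     \<Rightarrow> real \<times> 'n torus \<Rightarrow> 'b" where
  "D_star T v f z = time_deriv {0..T} f z + dir_deriv v f z"

definition L1 ::
  "real \<Rightarrow> (real \<times> 'n::finite torus \<Rightarrow> real ^ 'n) \<Rightarrow> (real \<times> 'n torus \<Rightarrow> real ^ 'n)
     \<Rightarrow> real \<times> 'n torus \<Rightarrow> real" where
  "L1 T b v z =
     (norm (v z))\<^sup>2 + D_star T v (\<lambda>y. (norm (b y))\<^sup>2 / 2) z - dir_deriv b (\<lambda>y. b y \<bullet> v y) z"

definition L2 ::
  "real \<Rightarrow> (real \<times> 'n::finite torus \<Rightarrow> real ^ 'n) \<Rightarrow> (real \<times> 'n torus \<Rightarrow> real ^ 'n)
     \<Rightarrow> real \<times> 'n torus \<Rightarrow> real ^ 'n" where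
  "L2 T b v z = - D_star T v b z + dir_deriv b v z"

definition L3 ::
  "(real \<times> 'n::finite torus \<Rightarrow> real ^ 'n) \<Rightarrow> (real \<times> 'n torus \<Rightarrow> real ^ 'n)
     \<Rightarrow> real \<times> 'n torus \<Rightarrow> real ^ 'n" where
  "L3 b v z = - v z + dir_deriv b b z"

text \<open>The measure \<open>(B - \<rho> b, P - \<rho> v)\<close> on \<open>[0,t] \<times> \<bbbT>\<^sup>d\<close>, with values in \<open>\<real>\<^sup>d \<times> \<real>\<^sup>d\<close>.\<close>

definition U_tilde ::
  "(real \<Rightarrow> ('n::finite torus \<Rightarrow> real ^ 'n) \<Rightarrow> real) \<Rightarrow> (real \<Rightarrow> ('n torus \<Rightarrow> real) \<Rightarrow> real)
     \<Rightarrow> ((real \<times> 'n torus \<Rightarrow> real ^ 'n) \<Rightarrow> real)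
     \<Rightarrow> (real \<times> 'n torus \<Rightarrow> real ^ 'n) \<Rightarrow> (real \<times> 'n torus \<Rightarrow> real ^ 'n) \<Rightarrow> real
     \<Rightarrow> (real \<times> 'n torus \<Rightarrow> real ^ ('n + 'n)) \<Rightarrow> real" where
  "U_tilde B \<rho> P b v t \<Theta> =
     (let \<Theta>1 = (\<lambda>z. \<chi> i. \<Theta> z $ Inl i); \<Theta>2 = (\<lambda>z. \<chi> i. \<Theta> z $ Inr i)
      in (spacetime t B \<Theta>1 - spacetime t \<rho> (\<lambda>z. \<Theta>1 z \<bullet> b z))
       + (restrict_time t P \<Theta>2 - spacetime t \<rho> (\<lambda>z. \<Theta>2 z \<bullet> v z)))"

text \<open>\<open>\<integral>\<^sub>0\<^sup>t e\<^sup>-\<^sup>r\<^sup>s R(s) ds\<close>, where \<open>R\<close> is a measure in time because \<open>P\<close> is one in space-time.\<close>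

definition R_integral ::
  "real \<Rightarrow> (real \<Rightarrow> ('n::finite torus \<Rightarrow> real ^ 'n) \<Rightarrow> real) \<Rightarrow> (real \<Rightarrow> ('n torus \<Rightarrow> real) \<Rightarrow> real)
     \<Rightarrow> ((real \<times> 'n torus \<Rightarrow> real ^ 'n) \<Rightarrow> real)
     \<Rightarrow> (real \<times> 'n torus \<Rightarrow> real ^ 'n) \<Rightarrow> (real \<times> 'n torus \<Rightarrow> real ^ 'n) \<Rightarrow> real \<Rightarrow> real \<Rightarrow> real" where
  "R_integral T B \<rho> P b v r t =
     spacetime t \<rho> (\<lambda>z. exp (- r * fst z) * L1 T b v z)
   + spacetime t B (\<lambda>z. exp (- r * fst z) *\<^sub>R L2 T b v z)
   + restrict_time t P (\<lambda>z. exp (- r * fst z) *\<^sub>R L3 b v z)"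

definition dissipation_inequality ::
  "real \<Rightarrow> (real \<Rightarrow> ('n::finite torus \<Rightarrow> real ^ 'n) \<Rightarrow> real) \<Rightarrow> (real \<Rightarrow> ('n torus \<Rightarrow> real) \<Rightarrow> real)
     \<Rightarrow> ((real \<times> 'n torus \<Rightarrow> real ^ 'n) \<Rightarrow> real)
     \<Rightarrow> (real \<times> 'n torus \<Rightarrow> real ^ 'n) \<Rightarrow> (real \<times> 'n torus \<Rightarrow> real ^ 'n) \<Rightarrow> real \<Rightarrow> real \<Rightarrow> bool" where
  "dissipation_inequality T B \<rho> P b v r t \<longleftrightarrow>
     energy B \<rho> b t * ereal (exp (- r * t))
     + (quad_energy ({0..t} \<times> UNIV) (\<lambda>z. exp (- r * fst z) *\<^sub>R Q_matrix r b v z)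
          (spacetime t \<rho>) (U_tilde B \<rho> P b v t)
        - ereal (R_integral T B \<rho> P b v r t))
     \<le> energy B \<rho> b 0
     \<and> energy B \<rho> b 0 < \<infinity>"

definition dissipative_solution ::
  "real \<Rightarrow> (('n::finite torus \<Rightarrow> real ^ 'n) \<Rightarrow> real) \<Rightarrow> (('n torus \<Rightarrow> real) \<Rightarrow> real)
     \<Rightarrow> (real \<Rightarrow> ('n torus \<Rightarrow> real ^ 'n) \<Rightarrow> real) \<Rightarrow> (real \<Rightarrow> ('n torus \<Rightarrow> real) \<Rightarrow> real)
     \<Rightarrow> ((real \<times> 'n torus \<Rightarrow> real ^ 'n) \<Rightarrow> real) \<Rightarrow> bool" where
  "dissipative_solution T B0 \<rho>0 B \<rho> P \<longleftrightarrow>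
     cdual UNIV B0 \<and> cdual UNIV \<rho>0 \<and> nonneg_on UNIV \<rho>0 \<and>
     weak_star_continuous T B \<and> weak_star_continuous T \<rho> \<and> cdual ({0..T} \<times> UNIV) P \<and>
     (\<forall>\<phi>. continuous_on UNIV \<phi> \<longrightarrow> B 0 \<phi> = B0 \<phi>) \<and>
     (\<forall>\<phi>. continuous_on UNIV \<phi> \<longrightarrow> \<rho> 0 \<phi> = \<rho>0 \<phi>) \<and>
     (\<forall>t\<in>{0..T}. divergence_free (B t)) \<and>
     continuity_equation T \<rho> P \<and>
     (\<forall>b v. C1_field T b \<longrightarrow> C1_field T v \<longrightarrow>
        (\<forall>r0. Q_ge_id T r0 b v \<longrightarrow>
           (\<forall>t\<in>{0..T}. \<forall>r\<ge>r0. dissipation_inequality T B \<rho> P b v r t)))"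

section \<open>Loops and the heat equation\<close>

definition is_loop :: "(real \<Rightarrow> real ^ 'n::finite) \<Rightarrow> bool" where
  "is_loop Y \<longleftrightarrow>
     (\<exists>C. C-lipschitz_on UNIV Y) \<and> (\<exists>N. (\<forall>i. N $ i \<in> \<int>) \<and> (\<forall>s. Y (s + 1) = Y s + N))"

text \<open>
  The classical solution with (merely Lipschitz) initial value \<open>Y0\<close>: \<open>C\<^sup>1\<close> in time and \<open>C\<^sup>2\<close> in
  space for positive times, continuous up to time zero; \<open>Y\<^sub>s\<close> is the first space derivative, \<open>Y\<^sub>s\<^sub>s\<close>
  both the second one and the time derivative. It is unique by the maximum principle.
\<close>

definition heat_solution :: "(real \<Rightarrow> real ^ 'n::finite) \<Rightarrow> (real \<Rightarrow> real \<Rightarrow> real ^ 'n) \<Rightarrow> bool" where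
  "heat_solution Y0 Y \<longleftrightarrow>
     (\<forall>s. Y 0 s = Y0 s) \<and>
     (\<exists>N. (\<forall>i. N $ i \<in> \<int>) \<and> (\<forall>t\<ge>0. \<forall>s. Y t (s + 1) = Y t s + N)) \<and>
     continuous_on ({0..} \<times> UNIV) (\<lambda>(t, s). Y t s) \<and>
     (\<exists>Ys Yss.
        continuous_on ({0<..} \<times> UNIV) (\<lambda>(t, s). Ys t s) \<and>
        continuous_on ({0<..} \<times> UNIV) (\<lambda>(t, s). Yss t s) \<and>
        (\<forall>t>0. \<forall>s.
           ((\<lambda>\<sigma>. Y t \<sigma>) has_vector_derivative Ys t s) (at s) \<and>
           ((\<lambda>\<sigma>. Ys t \<sigma>) has_vector_derivative Yss t s) (at s) \<and>
           ((\<lambda>\<tau>. Y \<tau> s) has_vector_derivative Yss t s) (at t)))"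

text \<open>
  Integration over \<open>\<A> \<times> \<real>/\<int>\<close>. Integrands are defined almost everywhere only (derivatives of
  Lipschitz maps, properties of \<open>\<mu>\<close>-almost every loop), hence the completed measures.
\<close>

definition loop_integral :: "'a measure \<Rightarrow> (real \<Rightarrow> 'a \<Rightarrow> real) \<Rightarrow> real" where
  "loop_integral \<mu> g = (LINT a|completion \<mu>. (LINT s:{0..1}|lebesgue. g s a))"

abbreviation loop_deriv :: "(real \<Rightarrow> 'a \<Rightarrow> real ^ 'n::finite) \<Rightarrow> real \<Rightarrow> 'a \<Rightarrow> real ^ 'n" where
  "loop_deriv Y s a \<equiv> vector_derivative (\<lambda>\<sigma>. Y \<sigma> a) (at s)"

definition loop_B :: "'a measure \<Rightarrow> (real \<Rightarrow> 'a \<Rightarrow> real ^ 'n::finite) \<Rightarrow> ('n torus \<Rightarrow> real ^ 'n) \<Rightarrow> real" where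
  "loop_B \<mu> Y \<phi> = loop_integral \<mu> (\<lambda>s a. \<phi> (abs_torus (Y s a)) \<bullet> loop_deriv Y s a)"

definition loop_\<rho> :: "'a measure \<Rightarrow> (real \<Rightarrow> 'a \<Rightarrow> real ^ 'n::finite) \<Rightarrow> ('n torus \<Rightarrow> real) \<Rightarrow> real" where
  "loop_\<rho> \<mu> Y \<phi> = loop_integral \<mu> (\<lambda>s a. \<phi> (abs_torus (Y s a)))"

definition loop_P ::
  "'a measure \<Rightarrow> real \<Rightarrow> (real \<Rightarrow> real \<Rightarrow> 'a \<Rightarrow> real ^ 'n::finite) \<Rightarrow> (real \<times> 'n torus \<Rightarrow> real ^ 'n) \<Rightarrow> real"
  where
  "loop_P \<mu> T X \<phi> =
     (LINT t:{0..T}|lebesgue.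
        loop_integral \<mu> (\<lambda>s a. \<phi> (t, abs_torus (X t s a)) \<bullet> vector_derivative (\<lambda>\<tau>. X \<tau> s a) (at t)))"

definition loop_energy :: "'a measure \<Rightarrow> (real \<Rightarrow> 'a \<Rightarrow> real ^ 'n::finite) \<Rightarrow> ennreal" where
  "loop_energy \<mu> Y =
     (\<integral>\<^sup>+ a. (\<integral>\<^sup>+ s\<in>{0..1}. ennreal ((norm (loop_deriv Y s a))\<^sup>2) \<partial>lebesgue) \<partial>completion \<mu>)"

end

theory Submission
  imports Defs
begin

text \<open>
  Along a single loop \<open>X\<close> solving the heat equation, the energy \<open>e\<^sup>-\<^sup>r\<^sup>t \<integral> |\<partial>\<^sub>s X - b(t,X)|\<^sup>2/2 ds\<close> can be
  differentiated in time; up to the exact derivative in \<open>s\<close> of \<open>v \<bullet> (\<partial>\<^sub>s X - b)\<close>, the result is minus the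
  quadratic form \<open>Q\<^sub>r\<close> at \<open>(\<partial>\<^sub>s X - b, \<partial>\<^sub>t X - v)\<close> plus the terms in \<open>L\<^sub>1, L\<^sub>2, L\<^sub>3\<close>. Integrating over the
  loops gives the dissipation balance with equality. Passing to the measures on the torus
  replaces \<open>\<partial>\<^sub>s X\<close> and \<open>\<partial>\<^sub>t X\<close> by their conditional expectations given \<open>(t, X)\<close>, which by Jensen's
  inequality decreases both the energy at time \<open>t\<close> and the quadratic term; the terms in
  \<open>L\<^sub>1, L\<^sub>2, L\<^sub>3\<close> are linear and do not change. The assumption on the initial loops says that nothing
  is lost in the energy at time zero, so the balance becomes the required inequality.

  The initial loops are only Lipschitz, so time zero needs Rademacher's theorem on the line, and the
  energy inequality is obtained as a limit of the balance on \<open>[\<epsilon>, t]\<close>.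
\<close>

section \<open>Lipschitz functions on the line\<close>

text \<open>Rademacher's theorem on the line comes from differentiation of measures: after
  rescaling, a Lipschitz function has slopes in [0,1], its Stieltjes measure is dominated by
  Lebesgue measure, and Vitali coverings identify the Radon-Nikodym density with the derivative. The
  obstacle at time zero is that the s-derivative exists there only almost everywhere, so its energy
  cannot be differentiated down to t = 0. Decay is proved for the increments X(t,s+h) - X(t,s),
  which are continuous up to t = 0, and then h tends to 0. Decay supplies bounds that are uniform in
  time and integrable over the loops, square integrability of the t-derivative on space-time (its
  squared norm is the rate of dissipation), and the upper bound on the energy at small times from
  which the limit is taken. The functionals use \<open>vector_derivative\<close> and completed
  measures; forward difference limits give jointly measurable representatives, so that Fubini
  applies on an ordinary product. Since \<open>quad_energy\<close> is an infimum, exhibiting one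
  admissible density bounds it from above.\<close>

lemma interval_measure_le_lborel:
  fixes F :: "real \<Rightarrow> real"
  assumes F: "\<And>x y. x \<le> y \<Longrightarrow> 0 \<le> F y - F x \<and> F y - F x \<le> y - x"
    and A: "A \<in> sets borel"
  shows "emeasure (interval_measure F) A \<le> emeasure lborel A"
proof -
  \<comment> \<open>The remainder \<open>G\<close> is again nondecreasing with slopes at most one.
    The Stieltjes measures of \<open>F\<close> and \<open>G\<close> together give each interval its
    length, so their sum is Lebesgue measure and dominates each summand.\<close>
  define G where "G x = x - F x" for x
  have lipF: "\<bar>F y - F x\<bar> \<le> \<bar>y - x\<bar>" for x y
    using F[of x y] F[of y x] by (cases "x \<le> y") auto
  have lipG: "\<bar>G y - G x\<bar> \<le> \<bar>y - x\<bar>" for x y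
    using F[of x y] F[of y x] unfolding G_def by (cases "x \<le> y") auto
  have cont: "continuous_on UNIV H" if "\<And>x y. \<bar>H y - H x\<bar> \<le> \<bar>y - x\<bar>" for H :: "real \<Rightarrow> real"
    using that by (intro lipschitz_on_continuous_on[of 1] lipschitz_onI) (auto simp: dist_real_def)
  have cF: "continuous_on UNIV F" and cG: "continuous_on UNIV G"
    using cont lipF lipG by blast+
  have Icc: "emeasure (interval_measure H) {a..b} = ennreal (H b - H a)"
    if "a \<le> b" "continuous_on UNIV H" "\<And>x y. x \<le> y \<Longrightarrow> H x \<le> H y" for H :: "real \<Rightarrow> real" and a b
    using that by (intro emeasure_interval_measure_Icc) (auto)
  have mF: "\<And>x y. x \<le> y \<Longrightarrow> F x \<le> F y" and mG: "\<And>x y. x \<le> y \<Longrightarrow> G x \<le> G y"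
    using F by (auto simp: G_def) (smt (verit) F)
  \<comment> \<open>Lebesgue measure is recognized on open boxes, whereas the Stieltjes measure is
    computed on closed intervals; continuity makes the endpoints null.\<close>
  have Ioo: "emeasure (interval_measure H) {a<..<b} = ennreal (H b - H a)"
    if "a \<le> b" "continuous_on UNIV H" "\<And>x y. x \<le> y \<Longrightarrow> H x \<le> H y" for H :: "real \<Rightarrow> real" and a b
  proof -
    have null: "{c} \<in> null_sets (interval_measure H)" for c
      using Icc[of c c H] that by (auto simp: null_sets_def)
    have "emeasure (interval_measure H) {a<..<b} = emeasure (interval_measure H) ({a..b} - {a,b})"
      by (rule arg_cong[where f="emeasure _"]) auto
    also have "\<dots> = emeasure (interval_measure H) {a..b}"
      using null_sets.Un[OF null[of a] null[of b]]
      by (intro emeasure_Diff_null_set) (auto simp: insert_commute)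
    finally show ?thesis using Icc that by simp
  qed
  define M where "M = measure_of UNIV (sets borel)
      (\<lambda>A. emeasure (interval_measure F) A + emeasure (interval_measure G) A)"
  have sM: "sets M = sets borel" unfolding M_def
    by (metis sets.sets_measure_of_eq space_borel)
  have eM: "emeasure M A = emeasure (interval_measure F) A + emeasure (interval_measure G) A"
    if "A \<in> sets borel" for A
  proof (rule emeasure_measure_of[OF M_def])
    show "sets borel \<subseteq> Pow (UNIV::real set)" by auto
    show "A \<in> sets M" using that sM by simp
    show "positive (sets M) (\<lambda>A. emeasure (interval_measure F) A + emeasure (interval_measure G) A)"
      by (simp add: positive_def)
    show "countably_additive (sets M) (\<lambda>A. emeasure (interval_measure F) A + emeasure (interval_measure G) A)"
    proof (rule countably_additiveI)
      fix B :: "nat \<Rightarrow> real set"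
      assume B: "range B \<subseteq> sets M" "disjoint_family B" "\<Union> (range B) \<in> sets M"
      have "(\<Sum>i. emeasure (interval_measure F) (B i) + emeasure (interval_measure G) (B i))
        = (\<Sum>i. emeasure (interval_measure F) (B i)) + (\<Sum>i. emeasure (interval_measure G) (B i))"
        by (intro suminf_add[symmetric]) auto
      also have "\<dots> = emeasure (interval_measure F) (\<Union> (range B)) + emeasure (interval_measure G) (\<Union> (range B))"
        using B sM by (subst (1 2) suminf_emeasure) auto
      finally show "(\<Sum>i. emeasure (interval_measure F) (B i) + emeasure (interval_measure G) (B i))
        = emeasure (interval_measure F) (\<Union> (range B)) + emeasure (interval_measure G) (\<Union> (range B))" .
    qed
  qed
  have "lborel = M"
  proof (rule lborel_eqI)
    fix l u :: real assume "\<And>b. b \<in> Basis \<Longrightarrow> l \<bullet> b \<le> u \<bullet> b"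
    then have lu: "l \<le> u" by simp
    have "emeasure M (box l u) = ennreal (F u - F l) + ennreal (G u - G l)"
      using Ioo[OF lu cF mF] Ioo[OF lu cG mG] eM by simp
    also have "\<dots> = ennreal (u - l)"
      using mF[OF lu] mG[OF lu] by (subst ennreal_plus[symmetric]) (auto simp: G_def)
    finally show "emeasure M (box l u) = ennreal (\<Prod>b\<in>Basis. (u - l) \<bullet> b)" by simp
  qed (use sM in auto)
  then have "emeasure lborel A = emeasure (interval_measure F) A + emeasure (interval_measure G) A"
    using eM A by simp
  then show ?thesis by simp
qed

text \<open>Vitali's theorem for balls applies although the intervals only contain the points of
  \<open>S\<close> and need not be centred there. This freedom later admits one-sided difference
  quotients, where the point is an endpoint.\<close>

lemma Vitali_interval_family:
  fixes S :: "real set"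
  assumes U: "open U" "S \<subseteq> U"
    and cov: "\<And>x d. x \<in> S \<Longrightarrow> d > 0 \<Longrightarrow> \<exists>c r. 0 < r \<and> r < d \<and> x \<in> cball c r \<and> P c r"
  obtains C where "countable C" "\<And>c r. (c, r) \<in> C \<Longrightarrow> 0 < r \<and> cball c r \<subseteq> U \<and> P c r"
    "disjoint_family_on (\<lambda>(c, r). cball c r) C" "negligible (S - (\<Union>(c,r)\<in>C. cball c r))"
proof -
  let ?K = "{(c, r). 0 < r \<and> cball c r \<subseteq> U \<and> P c r}"
  have *: "\<exists>i. i \<in> ?K \<and> x \<in> cball (fst i) (snd i) \<and> snd i < d" if x: "x \<in> S" "0 < d" for x d
  proof -
    obtain e where e: "e > 0" "ball x e \<subseteq> U"
      using U x by (meson open_contains_ball subsetD)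
    \<comment> \<open>With radius below \<open>e/2\<close>, an interval through \<open>x\<close> has
      diameter below \<open>e\<close> and stays inside \<open>U\<close>.\<close>
    obtain c r where cr: "0 < r" "r < min d (e/2)" "x \<in> cball c r" "P c r"
      using cov[OF x(1), of "min d (e/2)"] x e by auto
    have "cball c r \<subseteq> ball x e"
    proof
      fix y assume "y \<in> cball c r"
      then have "dist x y \<le> dist c x + dist c y" using dist_triangle[of x y c] by (simp add: dist_commute)
      also have "\<dots> < e" using \<open>y \<in> cball c r\<close> cr by auto
      finally show "y \<in> ball x e" by simp
    qed
    then show ?thesis using cr e by (intro exI[of _ "(c, r)"]) auto
  qed
  obtain C where C: "countable C" "C \<subseteq> ?K"
    "pairwise (\<lambda>i j. disjnt (cball (fst i) (snd i)) (cball (fst j) (snd j))) C"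
    "negligible (S - (\<Union>i\<in>C. cball (fst i) (snd i)))"
    by (rule Vitali_covering_theorem_cballs[of ?K snd S fst]) (use * in auto)
  show thesis
  proof (rule that[of C])
    show "disjoint_family_on (\<lambda>(c, r). cball c r) C"
      using C(3) unfolding pairwise_def disjoint_family_on_def disjnt_def
      by (auto simp: case_prod_beta)
    show "negligible (S - (\<Union>(c,r)\<in>C. cball c r))"
      using C(4) by (simp add: case_prod_beta)
  qed (use C in auto)
qed

text \<open>By outer regularity \<open>G\<close> lies in an open \<open>U\<close> with excess less
  than \<open>e / D\<close>. A disjoint Vitali family inside \<open>U\<close> covers
  \<open>S\<close> up to a null set, and \<open>bound\<close> charges its union \<open>K\<close> to
  \<open>K - G\<close>, a part of the excess; so \<open>K\<close> has measure at most
  \<open>e\<close>.\<close>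

lemma negligible_Vitali_comparison:
  fixes S G :: "real set"
  assumes G: "G \<in> sets borel" "emeasure lborel G < \<infinity>" "S \<subseteq> G"
    and cov: "\<And>x d. x \<in> S \<Longrightarrow> d > 0 \<Longrightarrow> \<exists>c r. 0 < r \<and> r < d \<and> x \<in> cball c r \<and> P c r"
    and bound: "\<And>C K. countable C \<Longrightarrow> (\<And>c r. (c, r) \<in> C \<Longrightarrow> 0 < r \<and> P c r) \<Longrightarrow>
        disjoint_family_on (\<lambda>(c, r). cball c r) C \<Longrightarrow>
        K = (\<Union>(c,r)\<in>C. cball c r) \<Longrightarrow> K \<in> sets borel \<Longrightarrow> emeasure lborel K < \<infinity> \<Longrightarrow>
        measure lborel K \<le> D * measure lborel (K - G)"
    and D: "D > 0"
  shows "negligible S"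
  unfolding negligible_outer_le
proof (intro allI impI)
  fix e :: real assume e: "e > 0"
  obtain U where U: "open U" "G \<subseteq> U" "emeasure lborel (U - G) < ennreal (e / D)"
    using outer_regular_lborel[of G "e / D"] G e D by auto
  have SU: "S \<subseteq> U" using G(3) U(2) by blast
  obtain C where C: "countable C" "\<And>c r. (c, r) \<in> C \<Longrightarrow> 0 < r \<and> cball c r \<subseteq> U \<and> P c r"
    "disjoint_family_on (\<lambda>(c, r). cball c r) C" "negligible (S - (\<Union>(c,r)\<in>C. cball c r))"
    by (rule Vitali_interval_family[OF U(1) SU cov]) auto
  define K where "K = (\<Union>(c,r)\<in>C. cball c r)"
  have K: "K \<in> sets borel" unfolding K_def using C(1) by (intro sets.countable_UN') auto
  have KU: "K \<subseteq> U" using C(2) by (auto simp: K_def)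
  have UG: "emeasure lborel U \<le> emeasure lborel G + emeasure lborel (U - G)"
    using emeasure_subadditive[of G lborel "U - G"] G U by (simp add: Un_absorb1)
  have "emeasure lborel (U - G) < top" using U(3) by (metis less_trans ennreal_less_top)
  then have "emeasure lborel U < \<infinity>" using G(2) UG by (auto simp: ennreal_add_less_top intro: le_less_trans)
  then have fK: "emeasure lborel K < \<infinity>"
    using emeasure_mono[OF KU, of lborel] U by (auto intro: le_less_trans)
  have mK: "measure lborel K \<le> D * measure lborel (K - G)"
  proof (rule bound[OF C(1) _ C(3) K_def K fK])
    show "\<And>c r. (c, r) \<in> C \<Longrightarrow> 0 < r \<and> P c r" using C(2) by simp
  qed
  have "emeasure lborel (K - G) \<le> emeasure lborel (U - G)"
    using KU U G by (intro emeasure_mono) auto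
  then have "measure lborel (K - G) \<le> e / D"
    using U(3) e D unfolding measure_def by (intro enn2real_leI) auto
  then have Ke: "measure lborel K \<le> e"
    using D mK mult_left_mono[of "measure lborel (K - G)" "e / D" D] by simp
  let ?T = "K \<union> (S - K)"
  have neg: "negligible (S - K)" using C(4) by (simp add: K_def)
  have Kl: "K \<in> lmeasurable" using K fK by (intro fmeasurableI) auto
  have "measure lebesgue ?T \<le> measure lebesgue K + measure lebesgue (S - K)"
    using Kl neg by (intro measure_Un_le) (auto dest: negligible_imp_measurable)
  also have "\<dots> \<le> e" using Ke neg K by (simp add: negligible_imp_measure0)
  finally show "\<exists>T. S \<subseteq> T \<and> T \<in> lmeasurable \<and> measure lebesgue T \<le> e"
    using fmeasurable.Un[OF Kl negligible_imp_measurable[OF neg]] by (intro exI[of _ ?T]) auto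
qed

text \<open>Lebesgue differentiation of the Stieltjes measure of \<open>F\<close>: where the density is below \<open>p\<close>
  (above \<open>q\<close>), the slopes over small intervals are almost nowhere frequently above \<open>q\<close> (below \<open>p\<close>).\<close>

lemma bounded_density_slopes:
  fixes F :: "real \<Rightarrow> real"
  assumes F: "\<And>x y. x \<le> y \<Longrightarrow> 0 \<le> F y - F x \<and> F y - F x \<le> y - x"
    and g: "g \<in> borel_measurable borel" and dens: "density lborel g = interval_measure F"
    and pq: "0 \<le> p" "0 < q" "p < q"
  shows "negligible {x. g x \<le> ennreal p \<and> (\<forall>d>0. \<exists>c r. 0 < r \<and> r < d \<and> x \<in> cball c r \<and> q * (2 * r) \<le> F (c + r) - F (c - r))}"
    and "negligible {x. ennreal q \<le> g x \<and> (\<forall>d>0. \<exists>c r. 0 < r \<and> r < d \<and> x \<in> cball c r \<and> F (c + r) - F (c - r) \<le> p * (2 * r))}"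
proof -
  let ?\<nu> = "interval_measure F"
  have cF: "continuous_on UNIV F"
  proof (rule lipschitz_on_continuous_on[of 1], rule lipschitz_onI)
    show "dist (F x) (F y) \<le> 1 * dist x y" for x y
      using F[of x y] F[of y x] by (cases "x \<le> y") (auto simp: dist_real_def)
  qed auto
  have mF: "\<And>x y. x \<le> y \<Longrightarrow> F x \<le> F y" using F by force
  have ball: "emeasure ?\<nu> (cball c r) = ennreal (F (c + r) - F (c - r))" if "r > 0" for c r
    using emeasure_interval_measure_Icc[of "c - r" "c + r" F] that mF cF by (simp add: cball_eq_atLeastAtMost)
  have lball: "emeasure lborel (cball c r) = ennreal (2 * r)" if "r > 0" for c r :: real
    using that by (simp add: cball_eq_atLeastAtMost)
  have le: "emeasure ?\<nu> A \<le> emeasure lborel A" if "A \<in> sets borel" for A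
    using interval_measure_le_lborel[OF F that] by blast
  have eg: "emeasure ?\<nu> A = (\<integral>\<^sup>+x\<in>A. g x \<partial>lborel)" if "A \<in> sets borel" for A
    using that g unfolding dens[symmetric] by (subst emeasure_density) auto
  have sumK: "emeasure N (\<Union>(c,r)\<in>C. cball c r) = (\<integral>\<^sup>+x. emeasure N (case x of (c,r) \<Rightarrow> cball c r) \<partial>count_space C)"
    if "sets N = sets borel" "countable C" "disjoint_family_on (\<lambda>(c, r). cball c r) C" for N :: "real measure" and C
    using that by (intro emeasure_UN_countable) (auto simp: that(1))
  \<comment> \<open>The comparison asks for a set \<open>G\<close> of finite measure, so the line is
    exhausted by bounded pieces.\<close>
  have Un: "negligible S" if "\<And>k::nat. negligible {x \<in> S. \<bar>x\<bar> < real k}" for S :: "real set"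
  proof -
    have "negligible (\<Union>k::nat. {x \<in> S. \<bar>x\<bar> < real k})" using that by (intro negligible_countable_Union) auto
    also have "(\<Union>k::nat. {x \<in> S. \<bar>x\<bar> < real k}) = S" using reals_Archimedean2 by auto
    finally show ?thesis .
  qed
  have fink: "emeasure lborel {x \<in> G. \<bar>x\<bar> < real k} < \<infinity>" if "G \<in> sets borel" for G k
  proof -
    have "emeasure lborel {x \<in> G. \<bar>x\<bar> < real k} \<le> emeasure lborel {- real k .. real k}"
      using that by (intro emeasure_mono) auto
    also have "\<dots> < \<infinity>" by simp
    finally show ?thesis .
  qed
  have split: "emeasure N K = emeasure N (K \<inter> G) + emeasure N (K - G)"
    if "sets N = sets borel" "K \<in> sets borel" "G \<in> sets borel" for N :: "real measure" and K G
    using that by (subst plus_emeasure) (auto intro!: arg_cong[where f="emeasure N"])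
  show "negligible {x. g x \<le> ennreal p \<and> (\<forall>d>0. \<exists>c r. 0 < r \<and> r < d \<and> x \<in> cball c r \<and> q * (2 * r) \<le> F (c + r) - F (c - r))}"
    (is "negligible ?S")
  proof (rule Un)
    fix k :: nat
    let ?G = "{x \<in> {x. g x \<le> ennreal p}. \<bar>x\<bar> < real k}"
    have Gm: "{x. g x \<le> ennreal p} \<in> sets borel" using g by measurable
    have Gb: "?G \<in> sets borel" using g by measurable
    show "negligible {x \<in> ?S. \<bar>x\<bar> < real k}"
    \<comment> \<open>With nu for the Stieltjes measure, q |K| \<le> nu(K) \<le> p |K| + |K - G|:
      the density is at most p on \<open>?G\<close>, and nu is dominated by Lebesgue measure
      elsewhere. This gives the constant \<open>1 / (q - p)\<close>.\<close>
    proof (rule negligible_Vitali_comparison[where G = ?G and P = "\<lambda>c r. q * (2 * r) \<le> F (c + r) - F (c - r)" and D = "1 / (q - p)"])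
      show "?G \<in> sets borel" by (rule Gb)
      show "emeasure lborel ?G < \<infinity>" by (rule fink[OF Gm])
      show "1 / (q - p) > 0" using pq by simp
    next
      fix C K assume C: "countable C" "\<And>c r. (c, r) \<in> C \<Longrightarrow> 0 < r \<and> q * (2 * r) \<le> F (c + r) - F (c - r)"
        "disjoint_family_on (\<lambda>(c, r). cball c r) C" "K = (\<Union>(c,r)\<in>C. cball c r)"
        "K \<in> sets borel" "emeasure lborel K < \<infinity>"
      have fin': "emeasure lborel B = ennreal (measure lborel B)" if "B \<subseteq> K" "B \<in> sets borel" for B
        using C(5,6) emeasure_mono[OF that(1), of lborel] by (intro emeasure_eq_ennreal_measure) (auto simp: top_unique)
      have eK: "emeasure lborel K = ennreal (measure lborel K)" by (intro fin' C(5)) auto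
      have eD: "emeasure lborel (K - ?G) = ennreal (measure lborel (K - ?G))"
        by (intro fin' sets.Diff C(5) Gb) auto
      have eI: "emeasure lborel (K \<inter> ?G) = ennreal (measure lborel (K \<inter> ?G))"
        by (intro fin' sets.Int C(5) Gb) auto
      have "ennreal q * emeasure lborel K = (\<integral>\<^sup>+x. ennreal q * emeasure lborel (case x of (c,r) \<Rightarrow> cball c r) \<partial>count_space C)"
        unfolding C(4) by (subst sumK[OF _ C(1,3)]) (auto simp: nn_integral_cmult)
      also have "\<dots> \<le> (\<integral>\<^sup>+x. emeasure ?\<nu> (case x of (c,r) \<Rightarrow> cball c r) \<partial>count_space C)"
      proof (rule nn_integral_mono)
        fix x assume "x \<in> space (count_space C)"
        then obtain c r where x: "x = (c, r)" "(c, r) \<in> C" by (cases x) auto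
        then show "ennreal q * emeasure lborel (case x of (c,r) \<Rightarrow> cball c r) \<le> emeasure ?\<nu> (case x of (c,r) \<Rightarrow> cball c r)"
          using C(2)[of c r] pq by (simp add: lball ball ennreal_mult[symmetric] ennreal_leI)
      qed
      also have "\<dots> = emeasure ?\<nu> K"
        unfolding C(4) by (subst sumK[OF _ C(1,3)]) auto
      also have "\<dots> = emeasure ?\<nu> (K \<inter> ?G) + emeasure ?\<nu> (K - ?G)"
        by (intro split C(5) Gb) auto
      also have "\<dots> \<le> ennreal p * emeasure lborel (K \<inter> ?G) + emeasure lborel (K - ?G)"
      proof (rule add_mono)
        have "emeasure ?\<nu> (K \<inter> ?G) = (\<integral>\<^sup>+x\<in>K \<inter> ?G. g x \<partial>lborel)" by (intro eg sets.Int C(5) Gb)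
        also have "\<dots> \<le> (\<integral>\<^sup>+x. ennreal p * indicator (K \<inter> ?G) x \<partial>lborel)"
          by (intro nn_integral_mono) (auto split: split_indicator)
        also have "\<dots> = ennreal p * emeasure lborel (K \<inter> ?G)"
          by (intro nn_integral_cmult_indicator, unfold sets_lborel) (intro sets.Int C(5) Gb)
        finally show "emeasure ?\<nu> (K \<inter> ?G) \<le> ennreal p * emeasure lborel (K \<inter> ?G)" .
        show "emeasure ?\<nu> (K - ?G) \<le> emeasure lborel (K - ?G)" by (intro le sets.Diff C(5) Gb)
      qed
      also have "\<dots> \<le> ennreal p * emeasure lborel K + emeasure lborel (K - ?G)"
        using C(5) by (intro add_mono mult_left_mono emeasure_mono order_refl) auto
      finally have "ennreal (q * measure lborel K) \<le> ennreal (p * measure lborel K + measure lborel (K - ?G))"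
        using pq unfolding eK eD by (simp only: ennreal_mult ennreal_plus measure_nonneg mult_nonneg_nonneg less_imp_le)
      then have "q * measure lborel K \<le> p * measure lborel K + measure lborel (K - ?G)"
        using pq by (subst (asm) ennreal_le_iff) auto
      then show "measure lborel K \<le> 1 / (q - p) * measure lborel (K - ?G)"
        using pq by (simp add: field_simps)
    qed auto
  qed
  show "negligible {x. ennreal q \<le> g x \<and> (\<forall>d>0. \<exists>c r. 0 < r \<and> r < d \<and> x \<in> cball c r \<and> F (c + r) - F (c - r) \<le> p * (2 * r))}"
    (is "negligible ?S")
  proof (rule Un)
    fix k :: nat
    let ?G = "{x \<in> {x. ennreal q \<le> g x}. \<bar>x\<bar> < real k}"
    have Gm: "{x. ennreal q \<le> g x} \<in> sets borel" using g by measurable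
    have Gb: "?G \<in> sets borel" using g by measurable
    show "negligible {x \<in> ?S. \<bar>x\<bar> < real k}"
    \<comment> \<open>Now q |K \<inter> G| \<le> nu(K \<inter> G) \<le> nu(K) \<le> p |K|. Adding q
      |K - G| yields (q - p) |K| \<le> q |K - G|, hence the constant
      \<open>q / (q - p)\<close>.\<close>
    proof (rule negligible_Vitali_comparison[where G = ?G and P = "\<lambda>c r. F (c + r) - F (c - r) \<le> p * (2 * r)" and D = "q / (q - p)"])
      show "?G \<in> sets borel" by (rule Gb)
      show "emeasure lborel ?G < \<infinity>" by (rule fink[OF Gm])
      show "q / (q - p) > 0" using pq by simp
    next
      fix C K assume C: "countable C" "\<And>c r. (c, r) \<in> C \<Longrightarrow> 0 < r \<and> F (c + r) - F (c - r) \<le> p * (2 * r)"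
        "disjoint_family_on (\<lambda>(c, r). cball c r) C" "K = (\<Union>(c,r)\<in>C. cball c r)"
        "K \<in> sets borel" "emeasure lborel K < \<infinity>"
      have fin': "emeasure lborel B = ennreal (measure lborel B)" if "B \<subseteq> K" "B \<in> sets borel" for B
        using C(5,6) emeasure_mono[OF that(1), of lborel] by (intro emeasure_eq_ennreal_measure) (auto simp: top_unique)
      have eK: "emeasure lborel K = ennreal (measure lborel K)" by (intro fin' C(5)) auto
      have eD: "emeasure lborel (K - ?G) = ennreal (measure lborel (K - ?G))"
        by (intro fin' sets.Diff C(5) Gb) auto
      have eI: "emeasure lborel (K \<inter> ?G) = ennreal (measure lborel (K \<inter> ?G))"
        by (intro fin' sets.Int C(5) Gb) auto
      have "ennreal q * emeasure lborel (K \<inter> ?G) = (\<integral>\<^sup>+x. ennreal q * indicator (K \<inter> ?G) x \<partial>lborel)"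
        by (intro nn_integral_cmult_indicator[symmetric], unfold sets_lborel) (intro sets.Int C(5) Gb)
      also have "\<dots> \<le> (\<integral>\<^sup>+x\<in>K \<inter> ?G. g x \<partial>lborel)"
        by (intro nn_integral_mono) (auto split: split_indicator)
      also have "\<dots> = emeasure ?\<nu> (K \<inter> ?G)" by (intro eg[symmetric] sets.Int C(5) Gb)
      also have "\<dots> \<le> emeasure ?\<nu> K" using C(5) by (intro emeasure_mono) auto
      also have "\<dots> = (\<integral>\<^sup>+x. emeasure ?\<nu> (case x of (c,r) \<Rightarrow> cball c r) \<partial>count_space C)"
        unfolding C(4) by (subst sumK[OF _ C(1,3)]) auto
      also have "\<dots> \<le> (\<integral>\<^sup>+x. ennreal p * emeasure lborel (case x of (c,r) \<Rightarrow> cball c r) \<partial>count_space C)"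
      proof (rule nn_integral_mono)
        fix x assume "x \<in> space (count_space C)"
        then obtain c r where x: "x = (c, r)" "(c, r) \<in> C" by (cases x) auto
        then show "emeasure ?\<nu> (case x of (c,r) \<Rightarrow> cball c r) \<le> ennreal p * emeasure lborel (case x of (c,r) \<Rightarrow> cball c r)"
          using C(2)[of c r] pq by (simp add: lball ball ennreal_mult[symmetric] ennreal_leI)
      qed
      also have "\<dots> = ennreal p * emeasure lborel K"
        unfolding C(4) by (subst sumK[OF _ C(1,3)]) (auto simp: nn_integral_cmult)
      finally have "ennreal (q * measure lborel (K \<inter> ?G)) \<le> ennreal (p * measure lborel K)"
        using pq unfolding eK eI by (simp only: ennreal_mult measure_nonneg less_imp_le)
      then have *: "q * measure lborel (K \<inter> ?G) \<le> p * measure lborel K"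
        using pq by (subst (asm) ennreal_le_iff) auto
      have "ennreal (measure lborel K) = ennreal (measure lborel (K \<inter> ?G) + measure lborel (K - ?G))"
        using split[OF sets_lborel C(5) Gb] unfolding eK eD eI by (simp only: ennreal_plus measure_nonneg)
      then have "measure lborel K = measure lborel (K \<inter> ?G) + measure lborel (K - ?G)"
        by (subst (asm) ennreal_inj) auto
      then have "q * measure lborel K = q * measure lborel (K \<inter> ?G) + q * measure lborel (K - ?G)"
        by (simp add: distrib_left)
      with * show "measure lborel K \<le> q / (q - p) * measure lborel (K - ?G)"
        using pq by (simp add: field_simps)
    qed auto
  qed
qed

text \<open>The derivative is the Radon-Nikodym density of the Stieltjes measure. Outside the union
  \<open>N\<close> of the exceptional sets for rational p < q, the slopes over small intervals
  containing the point are forced to converge to the density.\<close>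

lemma slope_le_one_derivative:
  fixes F :: "real \<Rightarrow> real"
  assumes F: "\<And>x y. x \<le> y \<Longrightarrow> 0 \<le> F y - F x \<and> F y - F x \<le> y - x"
  obtains g where "g \<in> borel_measurable borel" "AE x in lborel. (F has_real_derivative g x) (at x)"
    "\<And>a b. a \<le> b \<Longrightarrow> (g has_integral F b - F a) {a..b}"
proof -
  let ?\<nu> = "interval_measure F"
  have cF: "continuous_on UNIV F"
  proof (rule lipschitz_on_continuous_on[of 1], rule lipschitz_onI)
    show "dist (F x) (F y) \<le> 1 * dist x y" for x y
      using F[of x y] F[of y x] by (cases "x \<le> y") (auto simp: dist_real_def)
  qed auto
  have mF: "\<And>x y. x \<le> y \<Longrightarrow> F x \<le> F y" using F by force
  have "absolutely_continuous lborel ?\<nu>"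
    unfolding absolutely_continuous_def
  proof
    fix A :: "real set" assume "A \<in> null_sets lborel"
    then show "A \<in> null_sets ?\<nu>"
      using interval_measure_le_lborel[OF F, of A] by (auto simp: null_sets_def)
  qed
  then obtain g0 where g0: "g0 \<in> borel_measurable borel" "density lborel g0 = ?\<nu>"
    using sigma_finite_measure.Radon_Nikodym[OF sigma_finite_lborel, of ?\<nu>] by auto
  define up where "up p q = {x. g0 x \<le> ennreal p \<and> (\<forall>d>0. \<exists>c r. 0 < r \<and> r < d \<and> x \<in> cball c r \<and> q * (2 * r) \<le> F (c + r) - F (c - r))}" for p q
  define low where "low p q = {x. ennreal q \<le> g0 x \<and> (\<forall>d>0. \<exists>c r. 0 < r \<and> r < d \<and> x \<in> cball c r \<and> F (c + r) - F (c - r) \<le> p * (2 * r))}" for p q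
  let ?I = "{(p, q). p \<in> \<rat> \<and> q \<in> \<rat> \<and> 0 \<le> p \<and> 0 < q \<and> p < (q::real)}"
  have cI: "countable ?I"
    by (rule countable_subset[of _ "\<rat> \<times> \<rat>"]) (auto simp: countable_rat)
  define N where "N = (\<Union>(p,q)\<in>?I. up p q \<union> low p q)"
  have negN: "negligible N" unfolding N_def
  proof (rule negligible_countable_Union)
    show "countable ((\<lambda>(p, q). up p q \<union> low p q) ` ?I)" using cI by auto
    show "\<And>S. S \<in> (\<lambda>(p, q). up p q \<union> low p q) ` ?I \<Longrightarrow> negligible S"
      using bounded_density_slopes[OF F g0] unfolding up_def low_def by (auto intro!: negligible_Un)
  qed
  have up: "\<exists>d>0. \<forall>c r. 0 < r \<longrightarrow> r < d \<longrightarrow> x \<in> cball c r \<longrightarrow> F (c + r) - F (c - r) < q * (2 * r)"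
    if "x \<notin> N" "g0 x \<le> ennreal p" "p \<in> \<rat>" "q \<in> \<rat>" "0 \<le> p" "p < q" for x p q
  proof -
    have "x \<notin> up p q" using that unfolding N_def by force
    then show ?thesis using that unfolding up_def by (auto simp: not_le) (meson not_le)
  qed
  have low: "\<exists>d>0. \<forall>c r. 0 < r \<longrightarrow> r < d \<longrightarrow> x \<in> cball c r \<longrightarrow> p * (2 * r) < F (c + r) - F (c - r)"
    if "x \<notin> N" "ennreal q \<le> g0 x" "p \<in> \<rat>" "q \<in> \<rat>" "0 \<le> p" "p < q" for x p q
  proof -
    have "x \<notin> low p q" using that unfolding N_def by force
    then show ?thesis using that unfolding low_def by (auto simp: not_le) (meson not_le)
  qed
  \<comment> \<open>The rational pair is p = 1, q = 2: a density of at least 2 would force slopes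
    above 1 at small scales, against the assumption on \<open>F\<close>. Any finite bound would
    serve to read the extended density as the real function \<open>g\<close>.\<close>
  have le1: "g0 x \<le> 2" if x: "x \<notin> N" for x
  proof (rule ccontr)
    assume "\<not> g0 x \<le> 2"
    then have "ennreal 2 \<le> g0 x" by auto
    then obtain d where d: "d > 0" "\<And>c r. 0 < r \<Longrightarrow> r < d \<Longrightarrow> x \<in> cball c r \<Longrightarrow> 1 * (2 * r) < F (c + r) - F (c - r)"
      using low[OF x, of 2 1] by auto
    have "d < F (x + d / 2) - F (x - d / 2)" using d(2)[of "d/2" x] d(1) by simp
    moreover have "F (x + d / 2) - F (x - d / 2) \<le> d" using F[of "x - d/2" "x + d/2"] d(1) by simp
    ultimately show False by simp
  qed
  define g where "g x = enn2real (g0 x)" for x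
  have g0g: "g0 x = ennreal (g x)" if "x \<notin> N" for x
    unfolding g_def by (intro ennreal_enn2real[symmetric] le_less_trans[OF le1[OF that]]) simp
  have gm: "g \<in> borel_measurable borel" unfolding g_def using g0 by measurable
  have gpos: "0 \<le> g x" for x unfolding g_def by simp
  have der: "(F has_real_derivative g x) (at x)" if x: "x \<notin> N" for x
    unfolding DERIV_def
  proof (rule LIM_I)
    fix e :: real assume e: "e > 0"
    \<comment> \<open>A difference quotient at \<open>x\<close> with increment \<open>h\<close> of
      either sign is the slope over the interval with centre \<open>x + h / 2\<close> and radius
      \<open>\<bar>h / 2\<bar>\<close>, of which \<open>x\<close> is an endpoint.\<close>
    have ball: "x \<in> cball (x + h / 2) \<bar>h / 2\<bar>" for h :: real by (simp add: dist_real_def)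
    have quot: "(F (x + h) - F x) / h = (F (x + h / 2 + \<bar>h / 2\<bar>) - F (x + h / 2 - \<bar>h / 2\<bar>)) / (2 * \<bar>h / 2\<bar>)"
      if "h \<noteq> 0" for h
    proof -
      have "h / 2 + \<bar>h / 2\<bar> = (if h > 0 then h else 0)" "h / 2 - \<bar>h / 2\<bar> = (if h > 0 then 0 else h)"
        "2 * \<bar>h / 2\<bar> = (if h > 0 then h else - h)" using that by auto
      then show ?thesis unfolding add.assoc add_diff_eq[symmetric]
        by (simp add: minus_divide_right[symmetric] diff_divide_distrib)
    qed
    obtain p where p: "p \<in> \<rat>" "g x < p" "p < g x + e" using Rats_dense_in_real[of "g x" "g x + e"] e by auto
    obtain q where q: "q \<in> \<rat>" "p < q" "q < g x + e" using Rats_dense_in_real[of p "g x + e"] p by auto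
    have "0 \<le> p" using p gpos[of x] by simp
    then obtain d1 where d1: "d1 > 0" "\<And>c r. 0 < r \<Longrightarrow> r < d1 \<Longrightarrow> x \<in> cball c r \<Longrightarrow> F (c + r) - F (c - r) < q * (2 * r)"
      using up[OF x _ p(1) q(1)] g0g[OF x] p q by (auto simp: ennreal_leI)
    have u: "(F (x + h) - F x) / h < g x + e" if "h \<noteq> 0" "\<bar>h\<bar> < d1" for h
    proof -
      have "F (x + h / 2 + \<bar>h / 2\<bar>) - F (x + h / 2 - \<bar>h / 2\<bar>) < q * (2 * \<bar>h / 2\<bar>)"
        using that by (intro d1(2) ball) auto
      then have "(F (x + h) - F x) / h < q" unfolding quot[OF that(1)] using that by (simp add: divide_less_eq)
      then show ?thesis using q by simp
    qed
    have "\<exists>d2>0. \<forall>h. h \<noteq> 0 \<longrightarrow> \<bar>h\<bar> < d2 \<longrightarrow> g x - e < (F (x + h) - F x) / h"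
    proof (cases "g x - e < 0")
      \<comment> \<open>A nonnegative rational below \<open>g x\<close> need not exist here, as
        \<open>g x\<close> may be 0; the lower bound comes from the monotonicity of
        \<open>F\<close>.\<close>
      case True
      have "0 \<le> (F (x + h) - F x) / h" if "h \<noteq> 0" for h
        using mF[of x "x+h"] mF[of "x+h" x] that by (cases "h > 0") (auto simp: zero_le_divide_iff)
      then have "g x - e < (F (x + h) - F x) / h" if "h \<noteq> 0" for h
        using True less_le_trans that by blast
      then show ?thesis by (intro exI[of _ 1]) auto
    next
      case False
      obtain p where p: "p \<in> \<rat>" "g x - e < p" "p < g x" using Rats_dense_in_real[of "g x - e" "g x"] e by auto
      obtain q where q: "q \<in> \<rat>" "p < q" "q < g x" using Rats_dense_in_real[of p "g x"] p by auto
      have "0 \<le> p" using p False by simp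
      then obtain d1 where d1: "d1 > 0" "\<And>c r. 0 < r \<Longrightarrow> r < d1 \<Longrightarrow> x \<in> cball c r \<Longrightarrow> p * (2 * r) < F (c + r) - F (c - r)"
        using low[OF x _ p(1) q(1)] g0g[OF x] p q by (auto simp: ennreal_leI)
      have "g x - e < (F (x + h) - F x) / h" if "h \<noteq> 0" "\<bar>h\<bar> < d1" for h
      proof -
        have "p * (2 * \<bar>h / 2\<bar>) < F (x + h / 2 + \<bar>h / 2\<bar>) - F (x + h / 2 - \<bar>h / 2\<bar>)"
          using that by (intro d1(2) ball) auto
        then have "p < (F (x + h) - F x) / h" unfolding quot[OF that(1)] using that by (simp add: less_divide_eq)
        then show ?thesis using p by simp
      qed
      then show ?thesis using d1(1) by auto
    qed
    then obtain d2 where d2: "d2 > 0" "\<And>h. h \<noteq> 0 \<Longrightarrow> \<bar>h\<bar> < d2 \<Longrightarrow> g x - e < (F (x + h) - F x) / h" by auto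
    show "\<exists>s>0. \<forall>h. h \<noteq> 0 \<and> norm (h - 0) < s \<longrightarrow> norm ((F (x + h) - F x) / h - g x) < e"
    proof (intro exI[of _ "min d1 d2"] conjI allI impI)
      fix h :: real assume "h \<noteq> 0 \<and> norm (h - 0) < min d1 d2"
      then show "norm ((F (x + h) - F x) / h - g x) < e"
        using u[of h] d2(2)[of h] by (auto simp: abs_less_iff)
    qed (use d1 d2 in auto)
  qed
  have AEN: "AE x in lborel. x \<notin> N"
    using negN unfolding negligible_iff_null_sets by (metis AE_not_in AE_completion_iff)
  have int: "(g has_integral F b - F a) {a..b}" if ab: "a \<le> b" for a b
  proof -
    have "(\<integral>\<^sup>+x. ennreal (g x * indicator {a..b} x) \<partial>lborel) = (\<integral>\<^sup>+x. g0 x * indicator {a..b} x \<partial>lborel)"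
      using AEN by (intro nn_integral_cong_AE) (auto simp: g0g split: split_indicator)
    also have "\<dots> = emeasure ?\<nu> {a..b}"
      using g0 unfolding g0(2)[symmetric] by (subst emeasure_density) auto
    also have "\<dots> = ennreal (F b - F a)"
      using cF mF ab by (intro emeasure_interval_measure_Icc) auto
    finally have "((\<lambda>x. g x * indicator {a..b} x) has_integral F b - F a) UNIV"
      using gm mF[OF ab] gpos by (intro nn_integral_has_integral) auto
    then have "((\<lambda>x. if x \<in> {a..b} then g x else 0) has_integral F b - F a) UNIV"
      by (rule has_integral_eq[rotated]) (auto split: split_indicator)
    then show ?thesis by (simp only: has_integral_restrict_UNIV)
  qed
  show thesis
    by (rule that[OF gm _ int]) (use AEN der in \<open>auto elim: eventually_mono\<close>)
qed

text \<open>Reduction to slopes in [0,1]: with \<open>L = C + 1\<close>, which is positive even when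
  C = 0, the function \<open>f x / L\<close> has slopes in [-1,1], and averaging it with the
  identity moves them to [0,1].\<close>

lemma lipschitz_real_derivative:
  fixes f :: "real \<Rightarrow> real"
  assumes f: "C-lipschitz_on UNIV f"
  obtains g where "AE x in lborel. (f has_real_derivative g x) (at x)"
    "\<And>a b. a \<le> b \<Longrightarrow> (g has_integral f b - f a) {a..b}"
proof -
  define L where "L = C + 1"
  have C: "C \<ge> 0" using lipschitz_on_nonneg[OF f] .
  have L: "L > 0" using C by (simp add: L_def)
  have lip: "\<bar>f y - f x\<bar> \<le> L * (y - x)" if "x \<le> y" for x y
  proof -
    have "\<bar>f y - f x\<bar> \<le> C * \<bar>y - x\<bar>" using lipschitz_onD[OF f, of y x] by (simp add: dist_real_def)
    also have "\<dots> \<le> L * \<bar>y - x\<bar>" by (intro mult_right_mono) (auto simp: L_def)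
    finally show ?thesis using that by simp
  qed
  define F where "F x = (f x / L + x) / 2" for x
  have F: "0 \<le> F y - F x \<and> F y - F x \<le> y - x" if "x \<le> y" for x y
  proof -
    have "\<bar>(f y - f x) / L\<bar> \<le> y - x" using lip[OF that] L by (simp add: abs_divide pos_divide_le_eq mult.commute)
    then show ?thesis unfolding F_def by (auto simp: diff_divide_distrib add_divide_distrib abs_le_iff) 
  qed
  obtain g where g: "AE x in lborel. (F has_real_derivative g x) (at x)"
    "\<And>a b. a \<le> b \<Longrightarrow> (g has_integral F b - F a) {a..b}"
    by (rule slope_le_one_derivative[OF F]) auto
  have fF: "f = (\<lambda>x. L * (2 * F x - x))" using L by (auto simp: F_def field_simps)
  show thesis
  proof (rule that[of "\<lambda>x. L * (2 * g x - 1)"])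
    show "AE x in lborel. (f has_real_derivative L * (2 * g x - 1)) (at x)"
      using g(1)
    proof eventually_elim
      case (elim x)
      show ?case unfolding fF by (auto intro!: derivative_eq_intros elim)
    qed
    fix a b :: real assume "a \<le> b"
    have "((\<lambda>x. L * (2 * g x - 1)) has_integral L * (2 * (F b - F a) - (b - a))) {a..b}"
      using g(2)[OF \<open>a \<le> b\<close>] has_integral_const_real[of "1::real" a b] \<open>a \<le> b\<close>
      by (intro has_integral_mult_right has_integral_diff) auto
    moreover have "L * (2 * (F b - F a) - (b - a)) = f b - f a" by (simp add: fF algebra_simps)
    ultimately show "((\<lambda>x. L * (2 * g x - 1)) has_integral f b - f a) {a..b}" by simp
  qed
qed

lemma lipschitz_inner:
  fixes f :: "real \<Rightarrow> 'a::real_inner"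
  assumes "C-lipschitz_on S f"
  shows "(C * norm i)-lipschitz_on S (\<lambda>x. f x \<bullet> i)"
proof (rule lipschitz_onI)
  fix x y assume "x \<in> S" "y \<in> S"
  have "dist (f x \<bullet> i) (f y \<bullet> i) = \<bar>(f x - f y) \<bullet> i\<bar>" by (simp add: dist_real_def inner_diff_left)
  also have "\<dots> \<le> dist (f x) (f y) * norm i" unfolding dist_norm by (rule Cauchy_Schwarz_ineq2)
  also have "\<dots> \<le> C * dist x y * norm i"
    using lipschitz_onD[OF assms \<open>x \<in> S\<close> \<open>y \<in> S\<close>] by (rule mult_right_mono) simp
  finally show "dist (f x \<bullet> i) (f y \<bullet> i) \<le> C * norm i * dist x y" by (simp add: ac_simps)
qed (use lipschitz_on_nonneg[OF assms] in simp)

theorem lipschitz_AE_differentiable: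
  fixes f :: "real \<Rightarrow> 'a::euclidean_space"
  assumes f: "C-lipschitz_on UNIV f"
  shows "AE x in lborel. f differentiable (at x)"
proof -
  have "AE x in lborel. \<forall>i\<in>Basis. (\<lambda>x. f x \<bullet> i) differentiable (at x)"
  proof (rule AE_finite_allI)
    fix i :: 'a assume "i \<in> Basis"
    obtain g where "AE x in lborel. ((\<lambda>x. f x \<bullet> i) has_real_derivative g x) (at x)"
      by (rule lipschitz_real_derivative[OF lipschitz_inner[OF f, of i]]) auto
    then show "AE x in lborel. (\<lambda>x. f x \<bullet> i) differentiable (at x)"
      by eventually_elim (metis real_differentiable_def)
  qed simp
  then show ?thesis
    by eventually_elim (rule differentiable_componentwise_within[THEN iffD2])
qed

text \<open>Each coordinate comes with a density that is its derivative almost everywhere and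
  integrates to its increments. Any other almost everywhere derivative agrees with this density off
  a null set, which the integral does not see.\<close>

theorem lipschitz_has_integral_derivative:
  fixes f :: "real \<Rightarrow> 'a::euclidean_space"
  assumes f: "C-lipschitz_on UNIV f"
    and f': "AE x in lborel. (f has_vector_derivative f' x) (at x)" and ab: "a \<le> b"
  shows "(f' has_integral f b - f a) {a..b}"
  unfolding has_integral_componentwise_iff[of f']
proof
  fix i :: 'a assume "i \<in> Basis"
  obtain g where g: "AE x in lborel. ((\<lambda>x. f x \<bullet> i) has_real_derivative g x) (at x)"
    "(g has_integral f b \<bullet> i - f a \<bullet> i) {a..b}"
    by (rule lipschitz_real_derivative[OF lipschitz_inner[OF f, of i]]) (use ab in auto)
  have "AE x in lborel. g x = f' x \<bullet> i"
    using g(1) f'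
  proof eventually_elim
    case (elim x)
    have "((\<lambda>x. f x \<bullet> i) has_real_derivative f' x \<bullet> i) (at x)"
      using elim(2) unfolding has_real_derivative_iff_has_vector_derivative
      by (auto intro: bounded_linear.has_vector_derivative bounded_linear_inner_left)
    then show ?case using elim(1) DERIV_unique by blast
  qed
  then obtain N where N: "N \<in> null_sets lborel" "{x. g x \<noteq> f' x \<bullet> i} \<subseteq> N"
    unfolding eventually_ae_filter by auto
  show "((\<lambda>x. f' x \<bullet> i) has_integral (f b - f a) \<bullet> i) {a..b}"
    unfolding inner_diff_left
  proof (rule has_integral_spike[OF _ _ g(2), of N])
    show "negligible N" using N(1) by (simp add: negligible_iff_null_sets null_sets_completionI)
    show "f' x \<bullet> i = g x" if "x \<in> {a..b} - N" for x using N(2) that by (metis (mono_tags, lifting) DiffD2 mem_Collect_eq subsetD)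
  qed
qed

lemma lipschitz_on_has_integral_derivative:
  fixes f :: "real \<Rightarrow> 'a::euclidean_space"
  assumes f: "C-lipschitz_on {a..b} f" and ab: "a \<le> b"
    and f': "AE x in lborel. x \<in> {a<..<b} \<longrightarrow> (f has_vector_derivative f' x) (at x)"
  shows "(f' has_integral f b - f a) {a..b}"
proof -
  \<comment> \<open>Composition with the clamp \<open>c\<close> extends \<open>f\<close> by
    constants to a Lipschitz function on the line. Its derivative vanishes outside
    \<open>{a..b}\<close>, and the two corners form a null set.\<close>
  define c where "c x = max a (min b x)" for x
  have c: "c x \<in> {a..b}" for x using ab by (auto simp: c_def)
  have "C-lipschitz_on UNIV (\<lambda>x. f (c x))"
  proof (rule lipschitz_onI)
    fix x y
    have "dist (f (c x)) (f (c y)) \<le> C * dist (c x) (c y)" using lipschitz_onD[OF f c c] .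
    also have "dist (c x) (c y) \<le> dist x y" by (auto simp: c_def dist_real_def)
    finally show "dist (f (c x)) (f (c y)) \<le> C * dist x y"
      using lipschitz_on_nonneg[OF f] by (simp add: mult_left_mono)
  qed (rule lipschitz_on_nonneg[OF f])
  moreover have "AE x in lborel. ((\<lambda>x. f (c x)) has_vector_derivative (if x \<in> {a<..<b} then f' x else 0)) (at x)"
  proof -
    have "AE x in lborel. x \<noteq> a \<and> x \<noteq> b" by (simp add: AE_lborel_singleton)
    then show ?thesis using f'
    proof eventually_elim
      case (elim x)
      consider "x < a" | "x \<in> {a<..<b}" | "x > b" using elim(1) by force
      then show ?case
      proof cases
        case 1
        then have "eventually (\<lambda>y. f (c y) = f a) (nhds x)"
          using ab by (auto intro!: eventually_nhds_in_open[of "{..<a}", THEN eventually_mono] simp: c_def)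
        then show ?thesis using 1
          by (subst has_vector_derivative_cong_ev[where g = "\<lambda>_. f a"]) (auto simp: eventually_at_filter c_def elim: eventually_mono)
      next
        case 2
        then have "eventually (\<lambda>y. f (c y) = f y) (nhds x)"
          by (auto intro!: eventually_nhds_in_open[of "{a<..<b}", THEN eventually_mono] simp: c_def)
        then show ?thesis using 2 elim(2)
          by (subst has_vector_derivative_cong_ev[where g = f]) (auto simp: eventually_at_filter c_def elim: eventually_mono)
      next
        case 3
        then have "eventually (\<lambda>y. f (c y) = f b) (nhds x)"
          using ab by (auto intro!: eventually_nhds_in_open[of "{b<..}", THEN eventually_mono] simp: c_def)
        then show ?thesis using 3 ab
          by (subst has_vector_derivative_cong_ev[where g = "\<lambda>_. f b"]) (auto simp: eventually_at_filter c_def elim: eventually_mono)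
      qed
    qed
  qed
  ultimately have "((\<lambda>x. if x \<in> {a<..<b} then f' x else 0) has_integral f (c b) - f (c a)) {a..b}"
    using ab by (rule lipschitz_has_integral_derivative)
  moreover have "f (c b) - f (c a) = f b - f a" using ab by (simp add: c_def)
  ultimately show ?thesis
    by (intro has_integral_spike[of "{a, b}" _ f' "\<lambda>x. if x \<in> {a<..<b} then f' x else 0"]) auto
qed

section \<open>Functions on the torus\<close>

lemma abs_torus_eq_iff: "abs_torus x = abs_torus y \<longleftrightarrow> (\<forall>i. x $ i - y $ i \<in> \<int>)"
  by (rule torus.abs_eq_iff)

lemma abs_torus_rep_torus [simp]: "abs_torus (rep_torus p) = p"
  by (rule Quotient3_abs_rep[OF Quotient3_torus])

lemma abs_torus_add_integer: "(\<And>i. N $ i \<in> \<int>) \<Longrightarrow> abs_torus (x + N) = abs_torus x"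
  by (simp add: abs_torus_eq_iff)

lemma continuous_on_abs_torus: "continuous_on S abs_torus"
  using continuous_on_open_vimage[of UNIV abs_torus]
  by (auto simp: open_torus_def intro: continuous_on_subset)

text \<open>Pulling the image back gives the union of the integer translates of \<open>U\<close>.
  Openness of the projection is what makes products with a time interval manageable.\<close>

lemma open_abs_torus_image:
  assumes "open U"
  shows "open (abs_torus ` U)"
proof -
  have "abs_torus -` (abs_torus ` U) = (\<Union>k\<in>{k. \<forall>i. k $ i \<in> \<int>}. (\<lambda>x. k + x) ` U)"
  proof (intro equalityI subsetI)
    fix x assume "x \<in> abs_torus -` (abs_torus ` U)"
    then obtain y where y: "y \<in> U" "abs_torus x = abs_torus y" by auto
    then have "x = (x - y) + y" "\<forall>i. (x - y) $ i \<in> \<int>" by (auto simp: abs_torus_eq_iff)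
    with y(1) show "x \<in> (\<Union>k\<in>{k. \<forall>i. k $ i \<in> \<int>}. (\<lambda>x. k + x) ` U)" by blast
  next
    fix x assume "x \<in> (\<Union>k\<in>{k. \<forall>i. k $ i \<in> \<int>}. (\<lambda>x. k + x) ` U)"
    then obtain k y where "\<forall>i. k $ i \<in> \<int>" "y \<in> U" "x = k + y" by auto
    then have "abs_torus x = abs_torus y" by (simp add: abs_torus_eq_iff)
    with \<open>y \<in> U\<close> show "x \<in> abs_torus -` (abs_torus ` U)" by auto
  qed
  then show ?thesis using assms unfolding open_torus_def by (auto intro!: open_translation)
qed

text \<open>A quotient map times an identity need not be a quotient map, but the projection to the
  torus is open, hence so is its product with the identity in time; this pushes open sets of the
  lift down to the torus.\<close>

lemma continuous_on_time_torus:
  fixes f :: "real \<times> 'n::finite torus \<Rightarrow> 'b::topological_space"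
  shows "continuous_on (I \<times> UNIV) f \<longleftrightarrow> continuous_on (I \<times> UNIV) (\<lambda>(t, y). f (t, abs_torus y))"
proof
  assume f: "continuous_on (I \<times> UNIV) f"
  have "continuous_on (I \<times> UNIV) (\<lambda>z. f (fst z, abs_torus (snd z)))"
    by (rule continuous_on_compose2[OF f])
      (auto intro!: continuous_intros continuous_on_compose2[OF continuous_on_abs_torus[of UNIV]])
  then show "continuous_on (I \<times> UNIV) (\<lambda>(t, y). f (t, abs_torus y))" by (simp add: case_prod_beta)
next
  assume f: "continuous_on (I \<times> UNIV) (\<lambda>(t, y). f (t, abs_torus y))"
  show "continuous_on (I \<times> UNIV) f"
    unfolding continuous_on_open_invariant
  proof (intro allI impI)
    fix B :: "'b set" assume "open B"
    then obtain A where A: "open A" "A \<inter> I \<times> UNIV = (\<lambda>(t, y). f (t, abs_torus y)) -` B \<inter> I \<times> UNIV"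
      using f unfolding continuous_on_open_invariant by blast
    let ?p = "\<lambda>(t, y). (t, abs_torus y)"
    have op: "open (?p ` A)"
    proof (rule open_prod_intro)
      fix x assume "x \<in> ?p ` A"
      then obtain t y where ty: "(t, y) \<in> A" "x = (t, abs_torus y)" by auto
      obtain V W where VW: "open V" "open W" "(t, y) \<in> V \<times> W" "V \<times> W \<subseteq> A"
        using open_prod_elim[OF A(1) ty(1)] by blast
      show "\<exists>V W. open V \<and> open W \<and> x \<in> V \<times> W \<and> V \<times> W \<subseteq> ?p ` A"
        using VW ty by (intro exI[of _ V] exI[of _ "abs_torus ` W"]) (auto intro: open_abs_torus_image)
    qed
    show "\<exists>A. open A \<and> A \<inter> I \<times> UNIV = f -` B \<inter> I \<times> UNIV"
    proof (intro exI[of _ "?p ` A"] conjI op equalityI subsetI)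
      fix z assume "z \<in> ?p ` A \<inter> I \<times> UNIV"
      then show "z \<in> f -` B \<inter> I \<times> UNIV" using A(2) by auto
    next
      fix z assume z: "z \<in> f -` B \<inter> I \<times> UNIV"
      then have "(fst z, rep_torus (snd z)) \<in> A" using A(2) by (auto simp: case_prod_beta)
      then show "z \<in> ?p ` A \<inter> I \<times> UNIV" using z by (force simp: image_iff)
    qed
  qed
qed

lemma continuous_on_torus:
  fixes f :: "'n::finite torus \<Rightarrow> 'b::topological_space"
  shows "continuous_on UNIV f \<longleftrightarrow> continuous_on UNIV (\<lambda>y. f (abs_torus y))"
proof
  assume f: "continuous_on UNIV f"
  show "continuous_on UNIV (\<lambda>y. f (abs_torus y))"
    by (rule continuous_on_compose2[OF f continuous_on_abs_torus]) auto
next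
  assume f: "continuous_on UNIV (\<lambda>y. f (abs_torus y))"
  show "continuous_on UNIV f"
    unfolding continuous_on_open_vimage[OF open_UNIV]
  proof (intro allI impI)
    fix B :: "'b set" assume "open B"
    then have "open ((\<lambda>y. f (abs_torus y)) -` B)" using f by (simp add: continuous_on_open_vimage)
    then show "open (f -` B \<inter> UNIV)" by (simp add: open_torus_def vimage_def)
  qed
qed

lemma continuous_on_time_section:
  assumes "continuous_on (I \<times> UNIV) f" "t \<in> I"
  shows "continuous_on UNIV (\<lambda>x. f (t, x))"
  by (rule continuous_on_compose2[OF assms(1)]) (use assms(2) in \<open>auto intro!: continuous_intros\<close>)

lemma compact_torus: "compact (UNIV :: 'n::finite torus set)"
proof -
  have "abs_torus y \<in> abs_torus ` cbox 0 (1 :: real ^ 'n)" for y :: "real ^ 'n"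
  proof -
    have "abs_torus y = abs_torus (\<chi> i. frac (y $ i))" by (simp add: abs_torus_eq_iff frac_def)
    moreover have "(\<chi> i. frac (y $ i)) \<in> cbox 0 (1 :: real ^ 'n)"
      by (simp add: mem_box_cart less_imp_le[OF frac_lt_1])
    ultimately show ?thesis by blast
  qed
  then have "abs_torus ` cbox 0 (1 :: real ^ 'n) = UNIV" by (metis UNIV_eq_I abs_torus_rep_torus)
  then show ?thesis
    by (metis compact_cbox compact_continuous_image continuous_on_abs_torus)
qed

lemma continuous_on_torus_bounded:
  fixes f :: "'n::finite torus \<Rightarrow> 'b::real_normed_vector"
  assumes "continuous_on UNIV f"
  obtains K where "\<And>x. norm (f x) \<le> K" "K > 0"
  using compact_imp_bounded[OF compact_continuous_image[OF assms compact_torus]]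
  unfolding bounded_pos by auto

lemma continuous_on_time_torus_bounded:
  fixes f :: "real \<times> 'n::finite torus \<Rightarrow> 'b::real_normed_vector"
  assumes "continuous_on ({a..b} \<times> UNIV) f"
  obtains K where "\<And>t x. t \<in> {a..b} \<Longrightarrow> norm (f (t, x)) \<le> K" "K > 0"
proof -
  obtain K where "K > 0" "\<forall>y\<in>f ` ({a..b} \<times> UNIV). norm y \<le> K"
    using compact_imp_bounded[OF compact_continuous_image[OF assms compact_Times[OF compact_Icc compact_torus]]]
    unfolding bounded_pos by blast
  then show thesis by (intro that[of K]) auto
qed

lemma has_derivative_torus_lift:
  assumes "abs_torus x = abs_torus y"
    and "((\<lambda>z. g (abs_torus z)) has_derivative D) (at x)"
  shows "((\<lambda>z. g (abs_torus z)) has_derivative D) (at y)"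
proof -
  let ?f = "\<lambda>z. g (abs_torus z)"
  have per: "?f (z + (x - y)) = ?f z" for z
    using assms(1) by (subst abs_torus_add_integer) (auto simp: abs_torus_eq_iff)
  have "((\<lambda>z. z + (x - y)) has_derivative (\<lambda>h. h)) (at y)"
    by (auto intro!: derivative_eq_intros)
  moreover have "(?f has_derivative D) (at (y + (x - y)))" using assms(2) by simp
  ultimately have "((\<lambda>z. ?f (z + (x - y))) has_derivative (\<lambda>h. D h)) (at y)"
    by (rule has_derivative_compose)
  then show ?thesis by (simp add: per)
qed

lemma frechet_derivative_torus_lift:
  assumes "abs_torus x = abs_torus y"
  shows "frechet_derivative (\<lambda>z. g (abs_torus z)) (at x) = frechet_derivative (\<lambda>z. g (abs_torus z)) (at y)"
proof -
  have "((\<lambda>z. g (abs_torus z)) has_derivative D) (at x) \<longleftrightarrow> ((\<lambda>z. g (abs_torus z)) has_derivative D) (at y)" for D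
    using has_derivative_torus_lift assms by metis
  then show ?thesis unfolding frechet_derivative_def by simp
qed

lemma torus_grad_abs_torus:
  "torus_grad f (abs_torus y) = (\<chi> j. frechet_derivative (\<lambda>z. f (abs_torus z)) (at y) (axis j 1))"
  unfolding torus_grad_def
  by (subst frechet_derivative_torus_lift[of "rep_torus (abs_torus y)" y]) auto

section \<open>The energy of a loop\<close>

text \<open>The increment in time is divided by \<open>t - t0\<close> by averaging \<open>ft\<close>
  over the segment from \<open>t0\<close> to \<open>t\<close>. The quotient \<open>q\<close> is
  jointly continuous across \<open>t = t0\<close>, so differentiating an integral over
  \<open>s\<close> reduces to the continuity of a parameter integral.\<close>

lemma Hadamard_quotient:
  fixes f ft :: "real \<Rightarrow> real \<Rightarrow> 'a::euclidean_space"
  assumes cont: "continuous_on ({a..b} \<times> S) (\<lambda>(t, s). ft t s)"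
    and der: "\<And>t s. t \<in> {a..b} \<Longrightarrow> s \<in> S \<Longrightarrow>
      ((\<lambda>t. f t s) has_vector_derivative ft t s) (at t within {a..b})"
    and t0: "t0 \<in> {a..b}"
  obtains q where "continuous_on ({a..b} \<times> S) (\<lambda>(t, s). q t s)"
    "\<And>t s. t \<in> {a..b} \<Longrightarrow> s \<in> S \<Longrightarrow> f t s - f t0 s = (t - t0) *\<^sub>R q t s"
    "\<And>s. s \<in> S \<Longrightarrow> q t0 s = ft t0 s"
proof -
  define q where "q t s = integral (cbox 0 1) (\<lambda>\<theta>. ft (t0 + \<theta> * (t - t0)) s)" for t s
  have mem: "t0 + \<theta> * (t - t0) \<in> {a..b}" if "t \<in> {a..b}" "\<theta> \<in> cbox 0 1" for t \<theta>
  proof -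
    have "(1 - \<theta>) *\<^sub>R t0 + \<theta> *\<^sub>R t \<in> {a..b}"
      using that t0 by (intro convexD_alt[OF convex_real_interval(5)]) auto
    then show ?thesis by (simp add: algebra_simps)
  qed
  show thesis
  proof
    have "continuous_on (({a..b} \<times> S) \<times> cbox 0 1) (\<lambda>(x, \<theta>). (case x of (t, s) \<Rightarrow> ft (t0 + \<theta> * (t - t0)) s))"
    proof -
      have "continuous_on (({a..b} \<times> S) \<times> cbox 0 1) (\<lambda>z. (\<lambda>(t, s). ft t s) (t0 + snd z * (fst (fst z) - t0), snd (fst z)))"
        by (rule continuous_on_compose2[OF cont]) (use mem in \<open>force intro!: continuous_intros\<close>)+
      then show ?thesis by (simp add: case_prod_beta)
    qed
    from integral_continuous_on_param[OF this]
    show "continuous_on ({a..b} \<times> S) (\<lambda>(t, s). q t s)"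
      unfolding q_def by (simp add: case_prod_beta)
  next
    fix t s assume ts: "t \<in> {a..b}" "s \<in> S"
    have "((\<lambda>\<theta>. f (t0 + \<theta> * (t - t0)) s) has_vector_derivative (t - t0) *\<^sub>R ft (t0 + \<theta> * (t - t0)) s) (at \<theta> within {0..1})"
      if "\<theta> \<in> {0..1}" for \<theta>
    proof -
      have 1: "((\<lambda>\<theta>. t0 + \<theta> * (t - t0)) has_vector_derivative (t - t0)) (at \<theta> within {0..1})"
        by (auto intro!: derivative_eq_intros simp: has_real_derivative_iff_has_vector_derivative[symmetric])
      have 2: "((\<lambda>t. f t s) has_vector_derivative ft (t0 + \<theta> * (t - t0)) s)
          (at (t0 + \<theta> * (t - t0)) within (\<lambda>\<theta>. t0 + \<theta> * (t - t0)) ` {0..1})"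
        using der[OF mem ts(2), of t \<theta>] ts(1) that mem
        by (auto intro: has_vector_derivative_within_subset)
      show ?thesis using vector_diff_chain_within[OF 1 2] by (simp add: o_def)
    qed
    then have "((\<lambda>\<theta>. (t - t0) *\<^sub>R ft (t0 + \<theta> * (t - t0)) s) has_integral (f (t0 + 1 * (t - t0)) s - f (t0 + 0 * (t - t0)) s)) {0..1}"
      by (intro fundamental_theorem_of_calculus) auto
    then have "integral {0..1} (\<lambda>\<theta>. (t - t0) *\<^sub>R ft (t0 + \<theta> * (t - t0)) s) = f t s - f t0 s"
      by (simp add: has_integral_integrable_integral)
    then show "f t s - f t0 s = (t - t0) *\<^sub>R q t s" by (simp add: q_def)
  next
    fix s assume "s \<in> S"
    show "q t0 s = ft t0 s" by (simp add: q_def)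
  qed
qed

lemma has_real_derivative_from_quotient:
  fixes F K :: "real \<Rightarrow> real"
  assumes eq: "\<And>t. t \<in> S \<Longrightarrow> F t - F t0 = (t - t0) * K t" and K: "continuous_on S K" and t0: "t0 \<in> S"
  shows "(F has_real_derivative K t0) (at t0 within S)"
  unfolding has_field_derivative_iff
proof (rule Lim_transform_eventually)
  show "(K \<longlongrightarrow> K t0) (at t0 within S)" using K t0 by (auto simp: continuous_on_def)
  show "\<forall>\<^sub>F t in at t0 within S. K t = (F t - F t0) / (t - t0)"
    unfolding eventually_at_filter using eq by (auto intro!: always_eventually)
qed

lemma integral_parts_periodic:
  fixes f g f' g' :: "real \<Rightarrow> 'a::euclidean_space"
  assumes "\<And>s. s \<in> {0..1} \<Longrightarrow> (f has_vector_derivative f' s) (at s within {0..1})"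
    and "\<And>s. s \<in> {0..1} \<Longrightarrow> (g has_vector_derivative g' s) (at s within {0..1})"
    and c: "continuous_on {0..1} f'" "continuous_on {0..1} g'"
    and "f 1 = f 0" "g 1 = g 0"
  shows "integral {0..1} (\<lambda>s. f' s \<bullet> g s) = - integral {0..1} (\<lambda>s. f s \<bullet> g' s)"
proof -
  have cf: "continuous_on {0..1} f" "continuous_on {0..1} g"
    by (rule continuous_on_vector_derivative[OF assms(1)] continuous_on_vector_derivative[OF assms(2)], simp)+
  have "((\<lambda>s. f s \<bullet> g' s + f' s \<bullet> g s) has_integral (f 1 \<bullet> g 1 - f 0 \<bullet> g 0)) {0..1}"
    by (rule fundamental_theorem_of_calculus)
      (use assms in \<open>auto intro!: bounded_bilinear.has_vector_derivative[OF bounded_bilinear_inner]\<close>)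
  then have "integral {0..1} (\<lambda>s. f s \<bullet> g' s + f' s \<bullet> g s) = 0"
    using assms by (simp add: has_integral_integrable_integral)
  also have "integral {0..1} (\<lambda>s. f s \<bullet> g' s + f' s \<bullet> g s)
     = integral {0..1} (\<lambda>s. f s \<bullet> g' s) + integral {0..1} (\<lambda>s. f' s \<bullet> g s)"
    using cf c by (intro Henstock_Kurzweil_Integration.integral_add integrable_continuous_real continuous_intros)
  finally show ?thesis by simp
qed

text \<open>No derivative \<open>\<partial>\<^sub>t \<partial>\<^sub>s u\<close> is assumed: in the difference quotient in time the increment of
  \<open>\<partial>\<^sub>s u\<close> is first integrated by parts.\<close>

lemma loop_energy_has_derivative:
  fixes u us uss w ws wt :: "real \<Rightarrow> real \<Rightarrow> 'a::euclidean_space"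
  assumes cont: "continuous_on ({a..b} \<times> {0..1}) (\<lambda>(t, s). us t s)"
      "continuous_on ({a..b} \<times> {0..1}) (\<lambda>(t, s). uss t s)"
      "continuous_on ({a..b} \<times> {0..1}) (\<lambda>(t, s). w t s)"
      "continuous_on ({a..b} \<times> {0..1}) (\<lambda>(t, s). ws t s)"
      "continuous_on ({a..b} \<times> {0..1}) (\<lambda>(t, s). wt t s)"
    and u: "\<And>t s. t \<in> {a..b} \<Longrightarrow> s \<in> {0..1} \<Longrightarrow> ((\<lambda>s. u t s) has_vector_derivative us t s) (at s within {0..1})"
      "\<And>t s. t \<in> {a..b} \<Longrightarrow> s \<in> {0..1} \<Longrightarrow> ((\<lambda>s. us t s) has_vector_derivative uss t s) (at s within {0..1})"
      "\<And>t s. t \<in> {a..b} \<Longrightarrow> s \<in> {0..1} \<Longrightarrow> ((\<lambda>t. u t s) has_vector_derivative uss t s) (at t within {a..b})"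
    and w: "\<And>t s. t \<in> {a..b} \<Longrightarrow> s \<in> {0..1} \<Longrightarrow> ((\<lambda>s. w t s) has_vector_derivative ws t s) (at s within {0..1})"
      "\<And>t s. t \<in> {a..b} \<Longrightarrow> s \<in> {0..1} \<Longrightarrow> ((\<lambda>t. w t s) has_vector_derivative wt t s) (at t within {a..b})"
    and per: "\<And>t. t \<in> {a..b} \<Longrightarrow> u t 1 = u t 0 + N" "\<And>t. t \<in> {a..b} \<Longrightarrow> us t 1 = us t 0"
      "\<And>t. t \<in> {a..b} \<Longrightarrow> w t 1 = w t 0"
    and t0: "t0 \<in> {a..b}"
  shows "((\<lambda>t. integral {0..1} (\<lambda>s. (norm (us t s - w t s))\<^sup>2 / 2)) has_real_derivative
     integral {0..1} (\<lambda>s. - (norm (uss t0 s))\<^sup>2 + uss t0 s \<bullet> ws t0 s - us t0 s \<bullet> wt t0 s + w t0 s \<bullet> wt t0 s))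
     (at t0 within {a..b})"
proof -
  have sec: "continuous_on {0..1} (f t)" if "continuous_on ({a..b} \<times> {0..1}) (\<lambda>(t, s). f t s)" "t \<in> {a..b}"
    for f :: "real \<Rightarrow> real \<Rightarrow> 'a" and t
  proof -
    have "continuous_on {0..1} (\<lambda>s. (\<lambda>(t, s). f t s) (t, s))"
      by (rule continuous_on_compose2[OF that(1)]) (use that(2) in \<open>auto intro!: continuous_intros\<close>)
    then show ?thesis by simp
  qed
  have base: "continuous_on ({a..b} \<times> {0..1}) (\<lambda>(t, s). f t0 s)" if "continuous_on ({a..b} \<times> {0..1}) (\<lambda>(t, s). f t s)"
    for f :: "real \<Rightarrow> real \<Rightarrow> 'a"
  proof -
    have "continuous_on ({a..b} \<times> {0..1}) (\<lambda>z. f t0 (snd z))"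
      by (rule continuous_on_compose2[OF sec[OF that t0]]) (auto intro!: continuous_intros)
    then show ?thesis by (simp add: case_prod_beta)
  qed
  obtain q where q: "continuous_on ({a..b} \<times> {0..1}) (\<lambda>(t, s). q t s)"
    "\<And>t s. t \<in> {a..b} \<Longrightarrow> s \<in> {0..1} \<Longrightarrow> u t s - u t0 s = (t - t0) *\<^sub>R q t s"
    "\<And>s. s \<in> {0..1} \<Longrightarrow> q t0 s = uss t0 s"
    by (rule Hadamard_quotient[OF cont(2) u(3) t0]) auto
  obtain p where p: "continuous_on ({a..b} \<times> {0..1}) (\<lambda>(t, s). p t s)"
    "\<And>t s. t \<in> {a..b} \<Longrightarrow> s \<in> {0..1} \<Longrightarrow> w t s - w t0 s = (t - t0) *\<^sub>R p t s"
    "\<And>s. s \<in> {0..1} \<Longrightarrow> p t0 s = wt t0 s"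
    by (rule Hadamard_quotient[OF cont(5) w(2) t0]) auto
  \<comment> \<open>\<open>k\<close> is the integrand that remains after the integration by parts
    below, with the increments of \<open>u\<close> and \<open>w\<close> already divided by
    \<open>t - t0\<close>.\<close>
  define k where "k t s = - (q t s \<bullet> ((1/2) *\<^sub>R (uss t s + uss t0 s) - ws t s))
     - us t0 s \<bullet> p t s + (1/2) * (p t s \<bullet> (w t s + w t0 s))" for t s
  define K where "K t = integral {0..1} (k t)" for t
  have kc: "continuous_on ({a..b} \<times> {0..1}) (\<lambda>(t, s). k t s)"
    using cont q(1) p(1) base[OF cont(1)] base[OF cont(2)] base[OF cont(3)]
    unfolding k_def case_prod_beta by (intro continuous_intros)
  have Kc: "continuous_on {a..b} K"
    using integral_continuous_on_param[of "{a..b}" 0 1 k] kc unfolding K_def cbox_interval by blast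
  let ?F = "\<lambda>t. integral {0..1} (\<lambda>s. (norm (us t s - w t s))\<^sup>2 / 2)"
  have Feq: "?F t - ?F t0 = (t - t0) * K t" if t: "t \<in> {a..b}" for t
  proof -
    note c = sec[OF cont(1) t] sec[OF cont(1) t0] sec[OF cont(2) t] sec[OF cont(2) t0] sec[OF cont(3) t]
      sec[OF cont(3) t0] sec[OF cont(4) t] sec[OF cont(4) t0] sec[OF q(1) t] sec[OF p(1) t]
    have cu: "continuous_on {0..1} (u t)" "continuous_on {0..1} (u t0)"
      by (rule continuous_on_vector_derivative[OF u(1)[OF t]] continuous_on_vector_derivative[OF u(1)[OF t0]], simp)+
    let ?g = "\<lambda>s. (1/2) *\<^sub>R (us t s + us t0 s) - w t s"
    let ?g' = "\<lambda>s. (1/2) *\<^sub>R (uss t s + uss t0 s) - ws t s"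
    have "?F t - ?F t0 = integral {0..1} (\<lambda>s. (norm (us t s - w t s))\<^sup>2 / 2 - (norm (us t0 s - w t0 s))\<^sup>2 / 2)"
      using c by (intro integral_diff[symmetric] integrable_continuous_real continuous_intros) auto
    \<comment> \<open>This splitting confines \<open>us t - us t0\<close> to the first term, paired
      with the mean \<open>?g\<close>; the other terms contain the increment of \<open>w\<close>,
      whose time derivative is available.\<close>
    also have "\<dots> = integral {0..1} (\<lambda>s. (us t s - us t0 s) \<bullet> ?g s
        + (- (us t0 s \<bullet> (w t s - w t0 s)) + (1/2) * ((w t s - w t0 s) \<bullet> (w t s + w t0 s))))"
      by (intro integral_cong) (simp add: power2_norm_eq_inner inner_simps inner_commute field_simps)
    also have "\<dots> = integral {0..1} (\<lambda>s. (us t s - us t0 s) \<bullet> ?g s)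
        + integral {0..1} (\<lambda>s. - (us t0 s \<bullet> (w t s - w t0 s)) + (1/2) * ((w t s - w t0 s) \<bullet> (w t s + w t0 s)))"
      using c by (intro Henstock_Kurzweil_Integration.integral_add integrable_continuous_real continuous_intros) auto
    \<comment> \<open>The shift \<open>N\<close> cancels in \<open>u t - u t0\<close>, which is
      therefore periodic, and \<open>?g\<close> is periodic too: no boundary terms appear.\<close>
    also have "integral {0..1} (\<lambda>s. (us t s - us t0 s) \<bullet> ?g s) = - integral {0..1} (\<lambda>s. (u t s - u t0 s) \<bullet> ?g' s)"
    proof (rule integral_parts_periodic)
      show "((\<lambda>s. u t s - u t0 s) has_vector_derivative us t s - us t0 s) (at s within {0..1})" if "s \<in> {0..1}" for s
        using u(1) t t0 that by (intro derivative_intros) auto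
      show "(?g has_vector_derivative ?g' s) (at s within {0..1})" if "s \<in> {0..1}" for s
        using u(2) w(1) t t0 that by (auto intro!: derivative_eq_intros)
    qed (use per t t0 c in \<open>auto intro!: continuous_intros\<close>)
    also have "- integral {0..1} (\<lambda>s. (u t s - u t0 s) \<bullet> ?g' s) = integral {0..1} (\<lambda>s. - ((u t s - u t0 s) \<bullet> ?g' s))"
      by simp
    also have "integral {0..1} (\<lambda>s. - ((u t s - u t0 s) \<bullet> ?g' s))
      + integral {0..1} (\<lambda>s. - (us t0 s \<bullet> (w t s - w t0 s)) + (1/2) * ((w t s - w t0 s) \<bullet> (w t s + w t0 s)))
      = integral {0..1} (\<lambda>s. - ((u t s - u t0 s) \<bullet> ?g' s)
        + (- (us t0 s \<bullet> (w t s - w t0 s)) + (1/2) * ((w t s - w t0 s) \<bullet> (w t s + w t0 s))))"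
      using c cu by (intro Henstock_Kurzweil_Integration.integral_add[symmetric] integrable_continuous_real continuous_intros) auto
    also have "\<dots> = integral {0..1} (\<lambda>s. (t - t0) * k t s)"
    proof (intro integral_cong)
      fix s :: real assume s: "s \<in> {0..1}"
      show "- ((u t s - u t0 s) \<bullet> ?g' s) + (- (us t0 s \<bullet> (w t s - w t0 s)) + (1/2) * ((w t s - w t0 s) \<bullet> (w t s + w t0 s)))
          = (t - t0) * k t s"
        unfolding q(2)[OF t s] p(2)[OF t s] k_def by (simp add: algebra_simps diff_divide_distrib)
    qed
    finally show ?thesis by (simp add: K_def)
  qed
  have "K t0 = integral {0..1} (\<lambda>s. - (norm (uss t0 s))\<^sup>2 + uss t0 s \<bullet> ws t0 s - us t0 s \<bullet> wt t0 s + w t0 s \<bullet> wt t0 s)"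
    unfolding K_def k_def using q(3) p(3)
    by (intro integral_cong) (simp add: power2_norm_eq_inner inner_simps inner_commute scaleR_2[symmetric])
  then show ?thesis
    using has_real_derivative_from_quotient[OF Feq Kc t0] by simp
qed

text \<open>Agrees with the derivative where that exists, and, as a limit of a sequence of difference
  quotients, inherits measurability in all parameters everywhere.\<close>

definition fwd_deriv :: "(real \<Rightarrow> 'a::real_normed_vector) \<Rightarrow> real \<Rightarrow> 'a" where
  "fwd_deriv f s = lim (\<lambda>n. real (Suc n) *\<^sub>R (f (s + 1 / real (Suc n)) - f s))"

lemma fwd_diff_tendsto:
  assumes "(f has_vector_derivative D) (at s)"
  shows "(\<lambda>n. real (Suc n) *\<^sub>R (f (s + 1 / real (Suc n)) - f s)) \<longlonglongrightarrow> D"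
proof -
  have "((\<lambda>h. (1 / h) *\<^sub>R (f (s + h) - f s)) \<longlongrightarrow> D) (at 0)"
  proof -
    have "((\<lambda>y. (1 / norm (y - s)) *\<^sub>R (f y - (f s + (y - s) *\<^sub>R D))) \<longlongrightarrow> 0) (at s)"
      using assms unfolding has_vector_derivative_def has_derivative_within by auto
    then have "((\<lambda>h. (1 / norm h) *\<^sub>R (f (s + h) - (f s + h *\<^sub>R D))) \<longlongrightarrow> 0) (at 0)"
      by (subst (asm) LIM_offset_zero_iff) auto
    then have "((\<lambda>h. norm ((1 / norm h) *\<^sub>R (f (s + h) - (f s + h *\<^sub>R D)))) \<longlongrightarrow> 0) (at 0)"
      by (rule tendsto_norm_zero)
    then have "((\<lambda>h. norm ((1 / h) *\<^sub>R (f (s + h) - f s) - D)) \<longlongrightarrow> 0) (at 0)"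
    proof (rule Lim_transform_eventually)
      show "\<forall>\<^sub>F h in at 0. norm ((1 / norm h) *\<^sub>R (f (s + h) - (f s + h *\<^sub>R D))) = norm ((1 / h) *\<^sub>R (f (s + h) - f s) - D)"
        unfolding eventually_at_filter
      proof (intro always_eventually allI impI)
        fix h :: real assume "h \<noteq> 0"
        then have "(1 / h) *\<^sub>R (f (s + h) - f s) - D = (1 / h) *\<^sub>R (f (s + h) - (f s + h *\<^sub>R D))"
          by (simp add: scaleR_diff_right scaleR_add_right)
        then show "norm ((1 / norm h) *\<^sub>R (f (s + h) - (f s + h *\<^sub>R D))) = norm ((1 / h) *\<^sub>R (f (s + h) - f s) - D)"
          by simp
      qed
    qed
    then show ?thesis by (simp only: tendsto_norm_zero_iff LIM_zero_iff)
  qed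
  moreover have "filterlim (\<lambda>n. 1 / real (Suc n)) (at 0) sequentially"
    unfolding filterlim_at using LIMSEQ_inverse_real_of_nat by (auto simp: inverse_eq_divide)
  ultimately show ?thesis
    using filterlim_compose[of "\<lambda>h. (1 / h) *\<^sub>R (f (s + h) - f s)" "nhds D" "at 0" "\<lambda>n. 1 / real (Suc n)" sequentially]
    by (simp add: o_def)
qed

lemma fwd_deriv_eq: "(f has_vector_derivative D) (at s) \<Longrightarrow> fwd_deriv f s = D"
  unfolding fwd_deriv_def by (rule limI[OF fwd_diff_tendsto])

section \<open>Lebesgue measure on a compact interval\<close>

abbreviation interval_lborel :: "real \<Rightarrow> real \<Rightarrow> real measure" where
  "interval_lborel a b \<equiv> restrict_space lborel {a..b}"

abbreviation unit_lborel :: "real measure" where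
  "unit_lborel \<equiv> interval_lborel 0 1"

lemma space_interval_lborel: "space (interval_lborel a b) = {a..b}"
  by (simp add: space_restrict_space)

lemma finite_measure_interval_lborel: "finite_measure (interval_lborel a b)"
  by (rule finite_measureI) (simp add: space_interval_lborel emeasure_restrict_space emeasure_lborel_Icc_eq)

lemma prob_space_unit_lborel: "prob_space unit_lborel"
  by (rule prob_spaceI) (simp add: space_interval_lborel emeasure_restrict_space)

lemma integrable_interval_lborel_iff:
  fixes f :: "real \<Rightarrow> 'b::{banach, second_countable_topology}"
  shows "integrable (interval_lborel a b) f \<longleftrightarrow> set_integrable lborel {a..b} f"
  by (simp add: integrable_restrict_space set_integrable_def)

lemma lebesgue_integral_interval_lborel:
  fixes f :: "real \<Rightarrow> 'b::{banach, second_countable_topology}"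
  shows "integral\<^sup>L (interval_lborel a b) f = (LINT s:{a..b}|lborel. f s)"
  by (simp add: integral_restrict_space set_lebesgue_integral_def)

lemma integral_interval_lborel_eq_integral:
  fixes f :: "real \<Rightarrow> 'b::euclidean_space"
  assumes "integrable (interval_lborel a b) f"
  shows "integral\<^sup>L (interval_lborel a b) f = integral {a..b} f"
  using assms unfolding integrable_interval_lborel_iff lebesgue_integral_interval_lborel
  by (rule set_borel_integral_eq_integral)

lemma integrable_interval_continuous:
  fixes f :: "real \<Rightarrow> 'b::euclidean_space"
  assumes "continuous_on {a..b} f"
  shows "integrable (interval_lborel a b) f"
  unfolding integrable_interval_lborel_iff
  using assms by (intro borel_integrable_compact[unfolded set_integrable_def[symmetric]] compact_Icc)

lemma integral_interval_continuous:
  fixes f :: "real \<Rightarrow> 'b::euclidean_space"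
  assumes "continuous_on {a..b} f"
  shows "integral\<^sup>L (interval_lborel a b) f = integral {a..b} f"
  by (intro integral_interval_lborel_eq_integral integrable_interval_continuous assms)

lemma AE_interval_lborel: "(AE s in interval_lborel a b. P s) \<longleftrightarrow> (AE s in lborel. s \<in> {a..b} \<longrightarrow> P s)"
  by (rule AE_restrict_space_iff) auto

lemma measurable_interval_lborel: "f \<in> borel_measurable borel \<Longrightarrow> f \<in> borel_measurable (interval_lborel a b)"
  by (rule measurable_restrict_space1) simp

lemma borel_measurable_fwd_deriv:
  fixes f :: "real \<Rightarrow> 'a::euclidean_space"
  assumes "f \<in> borel_measurable borel"
  shows "fwd_deriv f \<in> borel_measurable borel"
  unfolding fwd_deriv_def using assms by measurable

lemma continuous_on_section:
  assumes "continuous_on (I \<times> J) (\<lambda>(t, s). f t s)" "t \<in> I"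
  shows "continuous_on J (f t)"
proof -
  have "continuous_on J (\<lambda>s. (\<lambda>(t, s). f t s) (t, s))"
    by (rule continuous_on_compose2[OF assms(1)]) (use assms(2) in \<open>auto intro!: continuous_intros\<close>)
  then show ?thesis by simp
qed

lemma continuous_on_integral_interval:
  fixes f :: "real \<Rightarrow> real \<Rightarrow> real"
  assumes "continuous_on (I \<times> {a..b}) (\<lambda>(t, s). f t s)"
  shows "continuous_on I (\<lambda>t. LINT s|interval_lborel a b. f t s)"
proof -
  have "continuous_on I (\<lambda>t. integral {a..b} (f t))"
    using integral_continuous_on_param[of I a b f] assms by simp
  then show ?thesis
    by (rule continuous_on_eq) (simp add: integral_interval_continuous continuous_on_section[OF assms])
qed

lemma has_vector_derivative_shifted:
  assumes "(f has_vector_derivative D) (at (s + h))"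
  shows "((\<lambda>x. f (x + h)) has_vector_derivative D) (at s)"
proof -
  have "((\<lambda>x. x + h) has_vector_derivative 1) (at s)"
    by (auto simp: has_real_derivative_iff_has_vector_derivative[symmetric] intro!: derivative_eq_intros)
  from vector_diff_chain_at[OF this assms] show ?thesis by (simp add: o_def)
qed

lemma lipschitz_on_Icc_of_continuous_derivative:
  fixes f f' :: "real \<Rightarrow> 'a::real_normed_vector"
  assumes "\<And>s. s \<in> {a..b} \<Longrightarrow> (f has_vector_derivative f' s) (at s within {a..b})"
    and c: "continuous_on {a..b} f'"
  obtains B where "B-lipschitz_on {a..b} f"
proof -
  obtain B where B: "B > 0" "\<forall>x\<in>f' ` {a..b}. norm x \<le> B"
    using compact_imp_bounded[OF compact_continuous_image[OF c compact_Icc]] bounded_pos by metis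
  have "B-lipschitz_on {a..b} f"
  proof (rule bounded_derivative_imp_lipschitz)
    show "(f has_derivative (\<lambda>h. h *\<^sub>R f' s)) (at s within {a..b})" if "s \<in> {a..b}" for s
      using assms(1)[OF that] unfolding has_vector_derivative_def .
    show "onorm (\<lambda>h. h *\<^sub>R f' s) \<le> B" if "s \<in> {a..b}" for s
      using B(2) that onorm_scaleR_left[OF bounded_linear_ident, of "f' s"] by (simp add: onorm_id)
  qed (use B in auto)
  then show thesis by (rule that)
qed

section \<open>A single loop under the heat flow: decay of the energy of its tangent\<close>

locale heat_loop =
  fixes Y0 :: "real \<Rightarrow> real ^ 'n::finite" and Y
  assumes loop: "is_loop Y0" and heat: "heat_solution Y0 Y"
begin

text \<open>For t > 0 these are the classical derivatives, and \<open>Dt\<close> is by the heat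
  equation also the second derivative in \<open>s\<close>. At t = 0, \<open>Ds\<close> is the
  derivative only for almost every \<open>s\<close>.\<close>

abbreviation "Ds t \<equiv> fwd_deriv (Y t)"
abbreviation "Dt t s \<equiv> fwd_deriv (\<lambda>\<tau>. Y \<tau> s) t"

lemma Y_0: "Y 0 = Y0" using heat unfolding heat_solution_def by auto

lemma Y_continuous: "continuous_on ({0..} \<times> UNIV) (\<lambda>(t, s). Y t s)"
  using heat unfolding heat_solution_def by blast

lemma Y_period: obtains N where "\<And>i. N $ i \<in> \<int>" "\<And>t s. t \<ge> 0 \<Longrightarrow> Y t (s + 1) = Y t s + N"
  using heat unfolding heat_solution_def by blast

lemma Y_derivatives:
  shows Ds: "t > 0 \<Longrightarrow> (Y t has_vector_derivative Ds t s) (at s)"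
    and Dss: "t > 0 \<Longrightarrow> (Ds t has_vector_derivative Dt t s) (at s)"
    and Dt: "t > 0 \<Longrightarrow> ((\<lambda>\<tau>. Y \<tau> s) has_vector_derivative Dt t s) (at t)"
    and Ds_continuous: "continuous_on ({0<..} \<times> UNIV) (\<lambda>(t, s). Ds t s)"
    and Dt_continuous: "continuous_on ({0<..} \<times> UNIV) (\<lambda>(t, s). Dt t s)"
proof -
  obtain Ys Yss where c: "continuous_on ({0<..} \<times> UNIV) (\<lambda>(t, s). Ys t s)"
        "continuous_on ({0<..} \<times> UNIV) (\<lambda>(t, s). Yss t s)"
    and d: "\<And>t s. t > 0 \<Longrightarrow> ((\<lambda>\<sigma>. Y t \<sigma>) has_vector_derivative Ys t s) (at s)"
           "\<And>t s. t > 0 \<Longrightarrow> ((\<lambda>\<sigma>. Ys t \<sigma>) has_vector_derivative Yss t s) (at s)"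
           "\<And>t s. t > 0 \<Longrightarrow> ((\<lambda>\<tau>. Y \<tau> s) has_vector_derivative Yss t s) (at t)"
    using heat unfolding heat_solution_def by blast
  have e: "Ds t = Ys t" "Dt t s = Yss t s" if "t > 0" for t s
    using d(1,3)[OF that] by (auto intro!: fwd_deriv_eq)
  show "t > 0 \<Longrightarrow> (Y t has_vector_derivative Ds t s) (at s)"
    "t > 0 \<Longrightarrow> (Ds t has_vector_derivative Dt t s) (at s)"
    "t > 0 \<Longrightarrow> ((\<lambda>\<tau>. Y \<tau> s) has_vector_derivative Dt t s) (at t)"
    using d by (simp_all add: e)
  show "continuous_on ({0<..} \<times> UNIV) (\<lambda>(t, s). Ds t s)"
    by (rule continuous_on_eq[OF c(1)]) (auto simp: e)
  show "continuous_on ({0<..} \<times> UNIV) (\<lambda>(t, s). Dt t s)"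
    by (rule continuous_on_eq[OF c(2)]) (auto simp: e)
qed

lemma fwd_deriv_shift:
  assumes "\<And>s. f (s + 1) = f s + N"
  shows "fwd_deriv f (s + 1) = fwd_deriv f s"
proof -
  have "f (s + 1 + h) - f (s + 1) = f (s + h) - f s" for h
    using assms[of "s + h"] assms[of s] by (simp add: ac_simps)
  then show ?thesis unfolding fwd_deriv_def by simp
qed

lemma Ds_period: "t \<ge> 0 \<Longrightarrow> Ds t (s + 1) = Ds t s"
  by (rule Y_period) (rule fwd_deriv_shift, blast)

lemma abs_torus_Y_period: "t \<ge> 0 \<Longrightarrow> abs_torus (Y t (s + 1)) = abs_torus (Y t s)"
  by (rule Y_period) (simp add: abs_torus_add_integer)

lemma Y_section: "t \<ge> 0 \<Longrightarrow> continuous_on S (Y t)"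
  using continuous_on_section[OF Y_continuous, of t] by (auto intro: continuous_on_subset)

lemma Ds_section: "t > 0 \<Longrightarrow> continuous_on S (Ds t)"
  using continuous_on_section[OF Ds_continuous, of t] by (auto intro: continuous_on_subset)

lemma Dt_section: "t > 0 \<Longrightarrow> continuous_on S (Dt t)"
  using continuous_on_section[OF Dt_continuous, of t] by (auto intro: continuous_on_subset)

lemma Ds_measurable: "t \<ge> 0 \<Longrightarrow> Ds t \<in> borel_measurable borel"
  by (intro borel_measurable_fwd_deriv borel_measurable_continuous_onI Y_section)

text \<open>Rademacher's theorem for the initial loop; limits of difference quotients inherit the
  Lipschitz constant as a bound.\<close>

lemma Ds_0:
  obtains C where "C-lipschitz_on UNIV (Y 0)"
    "AE s in lborel. (Y 0 has_vector_derivative Ds 0 s) (at s)" "AE s in lborel. norm (Ds 0 s) \<le> C"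
proof -
  obtain C where C: "C-lipschitz_on UNIV (Y 0)" using loop unfolding is_loop_def Y_0 by blast
  have d: "AE s in lborel. (Y 0 has_vector_derivative Ds 0 s) (at s)"
    using lipschitz_AE_differentiable[OF C]
    by eventually_elim (metis fwd_deriv_eq vector_derivative_works)
  have "AE s in lborel. norm (Ds 0 s) \<le> C"
    using d
  proof eventually_elim
    case (elim s)
    have "(\<lambda>n. norm (real (Suc n) *\<^sub>R (Y 0 (s + 1 / real (Suc n)) - Y 0 s))) \<longlonglongrightarrow> norm (Ds 0 s)"
      by (intro tendsto_norm fwd_diff_tendsto elim)
    then show ?case
    proof (rule LIMSEQ_le_const2, intro exI allI impI)
      fix n
      have "norm (Y 0 (s + 1 / real (Suc n)) - Y 0 s) \<le> C * (1 / real (Suc n))"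
        using lipschitz_onD[OF C, of "s + 1 / real (Suc n)" s] by (simp add: dist_norm)
      then have "real (Suc n) * norm (Y 0 (s + 1 / real (Suc n)) - Y 0 s) \<le> real (Suc n) * (C * (1 / real (Suc n)))"
        by (intro mult_left_mono) auto
      then show "norm (real (Suc n) *\<^sub>R (Y 0 (s + 1 / real (Suc n)) - Y 0 s)) \<le> C" by simp
    qed
  qed
  with C d show thesis by (rule that)
qed

lemma AE_Ds: "t \<ge> 0 \<Longrightarrow> AE s in lborel. (Y t has_vector_derivative Ds t s) (at s)"
proof (cases "t = 0")
  case True
  show ?thesis unfolding True by (rule Ds_0)
qed (simp add: Ds)

lemma Y_lipschitz:
  assumes "t \<ge> 0"
  obtains B where "B-lipschitz_on {a..b} (Y t)"
proof (cases "t = 0")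
  case True
  obtain C where "C-lipschitz_on UNIV (Y 0)" by (rule Ds_0)
  then show thesis by (intro that[of C]) (auto simp: True intro: lipschitz_on_subset)
next
  case False
  then show thesis using assms
    by (intro lipschitz_on_Icc_of_continuous_derivative[of a b "Y t" "Ds t", OF _ _ that])
      (auto intro!: has_vector_derivative_at_within Ds Ds_section)
qed

lemma Ds_integrable_sq:
  assumes "t \<ge> 0"
  shows "integrable unit_lborel (\<lambda>s. (norm (Ds t s))\<^sup>2)" "integrable unit_lborel (Ds t)"
proof -
  interpret prob_space unit_lborel by (rule prob_space_unit_lborel)
  obtain B where B: "AE s in unit_lborel. norm (Ds t s) \<le> B"
  proof (cases "t = 0")
    case True
    obtain C where "AE s in lborel. norm (Ds 0 s) \<le> C" by (rule Ds_0)
    then show thesis by (intro that[of C]) (auto simp: True AE_interval_lborel elim: eventually_mono)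
  next
    case False
    then have "compact (Ds t ` {0..1})" using assms by (intro compact_continuous_image Ds_section) auto
    then obtain B where "\<forall>x\<in>Ds t ` {0..1}. norm x \<le> B"
      using compact_imp_bounded bounded_iff by metis
    then show thesis by (intro that[of B] AE_I2) (auto simp: space_interval_lborel)
  qed
  have m: "Ds t \<in> borel_measurable unit_lborel" by (intro measurable_interval_lborel Ds_measurable assms)
  then show "integrable unit_lborel (Ds t)" using B by (intro integrable_const_bound)
  have "AE s in unit_lborel. norm ((norm (Ds t s))\<^sup>2) \<le> B\<^sup>2"
    using B by eventually_elim (simp add: power_mono)
  then show "integrable unit_lborel (\<lambda>s. (norm (Ds t s))\<^sup>2)" using m by (intro integrable_const_bound[of _ "B\<^sup>2"]) auto
qed

text \<open>The increment in \<open>s\<close> solves the heat equation and is periodic, because the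
  integer shift cancels. Its norm therefore decays, and in contrast to the derivative it is
  continuous up to t = 0, so the initial time is included.\<close>

lemma difference_energy_le:
  assumes t: "t > 0"
  shows "integral {0..1} (\<lambda>s. (norm (Y t (s + h) - Y t s))\<^sup>2 / 2) \<le> integral {0..1} (\<lambda>s. (norm (Y 0 (s + h) - Y 0 s))\<^sup>2 / 2)"
proof -
  define V where "V t s = Y t (s + h) - Y t s" for t s
  define Vs where "Vs t s = Ds t (s + h) - Ds t s" for t s
  define Vt where "Vt t s = Dt t (s + h) - Dt t s" for t s
  let ?F = "\<lambda>t. integral {0..1} (\<lambda>s. (norm (V t s))\<^sup>2 / 2)"
  have shift: "continuous_on (I \<times> UNIV) (\<lambda>(t, s). f t (s + h) - f t s)"
    if "continuous_on (I \<times> UNIV) (\<lambda>(t, s). f t s)" for f :: "real \<Rightarrow> real \<Rightarrow> real ^ 'n" and I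
  proof -
    have "continuous_on (I \<times> UNIV) (\<lambda>z. (\<lambda>(t, s). f t s) (fst z, snd z + h))"
      by (rule continuous_on_compose2[OF that]) (auto intro!: continuous_intros)
    then have "continuous_on (I \<times> UNIV) (\<lambda>z. (\<lambda>(t, s). f t s) (fst z, snd z + h) - (\<lambda>(t, s). f t s) z)"
      using that by (rule continuous_on_diff)
    then show ?thesis by (simp add: case_prod_beta)
  qed
  have Vc: "continuous_on ({0..} \<times> UNIV) (\<lambda>(t, s). V t s)"
    unfolding V_def by (rule shift[OF Y_continuous])
  have Vsc: "continuous_on ({0<..} \<times> UNIV) (\<lambda>(t, s). Vs t s)"
    unfolding Vs_def by (rule shift[OF Ds_continuous])
  have Vtc: "continuous_on ({0<..} \<times> UNIV) (\<lambda>(t, s). Vt t s)"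
    unfolding Vt_def by (rule shift[OF Dt_continuous])
  have Vsd: "(V t has_vector_derivative Vs t s) (at s)" if "t > 0" for t s
    using Ds[OF that] unfolding V_def Vs_def
    by (intro derivative_intros has_vector_derivative_shifted)
  have Vssd: "(Vs t has_vector_derivative Vt t s) (at s)" if "t > 0" for t s
    using Dss[OF that] unfolding Vs_def Vt_def
    by (intro derivative_intros has_vector_derivative_shifted)
  have Vtd: "((\<lambda>t. V t s) has_vector_derivative Vt t s) (at t)" if "t > 0" for t s
    using Dt[OF that] unfolding V_def Vt_def by (intro derivative_intros)
  obtain N where N: "\<And>t s. t \<ge> 0 \<Longrightarrow> Y t (s + 1) = Y t s + N" by (rule Y_period) blast
  have per: "V t 1 = V t 0" "Vs t 1 = Vs t 0" if "t > 0" for t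
    using N[of t h] N[of t 0] Ds_period[of t h] Ds_period[of t 0] that
    by (auto simp: V_def Vs_def add.commute)
  have der: "\<exists>y. DERIV ?F t0 :> y \<and> y \<le> 0" if t0: "t0 > 0" for t0
  proof -
    let ?I = "{t0 / 2 .. t0 + 1}"
    have sub: "?I \<times> {0..1} \<subseteq> {0..} \<times> UNIV" "?I \<times> {0..1} \<subseteq> {0<..} \<times> UNIV" using t0 by auto
    have pos: "t > 0" if "t \<in> ?I" for t using that t0 by auto
    \<comment> \<open>Only the \<open>w\<close> slot of the general formula is filled:
      \<open>u = 0\<close> and \<open>w = V\<close> give the integral of
      \<open>V \<bullet> Vt\<close>, which another integration by parts turns into minus the
      integral of |Vs|^2.\<close>
    have "((\<lambda>t. integral {0..1} (\<lambda>s. (norm (0 - V t s))\<^sup>2 / 2)) has_real_derivative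
     integral {0..1} (\<lambda>s. - (norm (0::real^'n))\<^sup>2 + 0 \<bullet> Vs t0 s - 0 \<bullet> Vt t0 s + V t0 s \<bullet> Vt t0 s))
     (at t0 within ?I)"
      using t0 per pos continuous_on_subset[OF Vc sub(1)] continuous_on_subset[OF Vsc sub(2)] continuous_on_subset[OF Vtc sub(2)]
      by (intro loop_energy_has_derivative[where u = "\<lambda>t s. 0" and N = 0])
        (auto intro!: has_vector_derivative_at_within Vsd Vtd)
    then have "DERIV ?F t0 :> integral {0..1} (\<lambda>s. V t0 s \<bullet> Vt t0 s)"
      using t0 by (simp add: at_within_Icc_at)
    moreover have "integral {0..1} (\<lambda>s. V t0 s \<bullet> Vt t0 s) \<le> 0"
    proof -
      have c: "continuous_on {0..1} (Vs t0)" "continuous_on {0..1} (Vt t0)"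
        using continuous_on_section[OF Vsc, of t0] continuous_on_section[OF Vtc, of t0] t0
        by (auto intro: continuous_on_subset)
      have "integral {0..1} (\<lambda>s. Vs t0 s \<bullet> Vs t0 s) = - integral {0..1} (\<lambda>s. V t0 s \<bullet> Vt t0 s)"
        using t0 per c by (intro integral_parts_periodic) (auto intro!: has_vector_derivative_at_within Vsd Vssd)
      moreover have "0 \<le> integral {0..1} (\<lambda>s. Vs t0 s \<bullet> Vs t0 s)"
        using c by (intro integral_nonneg integrable_continuous_real continuous_intros) auto
      ultimately show ?thesis by simp
    qed
    ultimately show ?thesis by blast
  qed
  have "continuous_on {0..t} ?F"
  proof -
    have "continuous_on ({0..t} \<times> cbox 0 1) (\<lambda>(t, s). (norm (V t s))\<^sup>2 / 2)"
    proof -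
      have "continuous_on ({0..t} \<times> cbox 0 1) (\<lambda>(t, s). V t s)" by (rule continuous_on_subset[OF Vc]) auto
      then show ?thesis unfolding case_prod_beta by (intro continuous_intros) auto
    qed
    from integral_continuous_on_param[OF this] show ?thesis by simp
  qed
  then have "?F 0 \<ge> ?F t"
    using t der by (intro DERIV_nonpos_imp_decreasing_open[of 0 t ?F]) auto
  then show ?thesis by (simp add: V_def)
qed

text \<open>Decay holds for increments of step \<open>1 / (n + 1)\<close>; after rescaling,
  dominated convergence passes to the limit on both sides. At time zero the quotients converge only
  almost everywhere, which suffices.\<close>

lemma Ds_energy_le:
  assumes t: "t \<ge> 0"
  shows "(LINT s|unit_lborel. (norm (Ds t s))\<^sup>2) \<le> (LINT s|unit_lborel. (norm (Ds 0 s))\<^sup>2)"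
proof (cases "t = 0")
  case False
  then have t: "t > 0" using assms by simp
  interpret prob_space unit_lborel by (rule prob_space_unit_lborel)
  define q where "q t n s = (norm (real (Suc n) *\<^sub>R (Y t (s + 1 / real (Suc n)) - Y t s)))\<^sup>2" for t n s
  have qc: "continuous_on {0..1} (q t n)" if "t \<ge> 0" for t n
    unfolding q_def by (intro continuous_intros continuous_on_compose2[OF Y_section[OF that, of UNIV]] Y_section that) auto
  have lim: "(\<lambda>n. LINT s|unit_lborel. q t n s) \<longlonglongrightarrow> (LINT s|unit_lborel. (norm (Ds t s))\<^sup>2)"
    if t: "t \<ge> 0" and B: "B-lipschitz_on {0..2} (Y t)"
      and AE: "AE s in unit_lborel. (Y t has_vector_derivative Ds t s) (at s)" for t B
  proof (rule integral_dominated_convergence[where w = "\<lambda>_. B\<^sup>2"])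
    show "(\<lambda>s. (norm (Ds t s))\<^sup>2) \<in> borel_measurable unit_lborel"
      using Ds_integrable_sq(1)[OF t] by auto
    show "q t n \<in> borel_measurable unit_lborel" for n
      using integrable_interval_continuous[OF qc[OF t]] by auto
    show "AE s in unit_lborel. (\<lambda>n. q t n s) \<longlonglongrightarrow> (norm (Ds t s))\<^sup>2"
      using AE unfolding q_def by eventually_elim (intro tendsto_intros fwd_diff_tendsto)
    show "AE s in unit_lborel. norm (q t n s) \<le> B\<^sup>2" for n
    proof (rule AE_I2)
      fix s assume "s \<in> space unit_lborel"
      moreover have "1 / real (Suc n) \<le> 1" "1 / real (Suc n) \<ge> 0" by auto
      ultimately have s: "s \<in> {0..2}" "s + 1 / real (Suc n) \<in> {0..2}"
        unfolding space_interval_lborel atLeastAtMost_iff by linarith+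
      have "norm (Y t (s + 1 / real (Suc n)) - Y t s) \<le> B * (1 / real (Suc n))"
        using lipschitz_onD[OF B s(2) s(1)] by (simp add: dist_norm)
      then have "norm (real (Suc n) *\<^sub>R (Y t (s + 1 / real (Suc n)) - Y t s)) \<le> B"
        by (simp only: norm_scaleR abs_of_nat) (simp add: pos_le_divide_eq mult.commute del: of_nat_Suc)
      then show "norm (q t n s) \<le> B\<^sup>2" unfolding q_def by (simp add: power_mono del: norm_scaleR)
    qed
  qed simp
  have le: "(LINT s|unit_lborel. q t n s) \<le> (LINT s|unit_lborel. q 0 n s)" for n
  proof -
    have "integral {0..1} (q r n) = (2 * (real (Suc n))\<^sup>2) * integral {0..1} (\<lambda>s. (norm (Y r (s + 1 / real (Suc n)) - Y r s))\<^sup>2 / 2)" for r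
      unfolding integral_mult_right[symmetric] q_def by (intro integral_cong) (simp add: power_mult_distrib)
    then show ?thesis using difference_energy_le[OF t, of "1 / real (Suc n)"] t
      by (simp only: integral_interval_continuous qc order_refl less_imp_le) (rule mult_left_mono, auto)
  qed
  \<comment> \<open>The interval \<open>{0..2}\<close> contains \<open>s\<close> and
    \<open>s + 1 / (n + 1)\<close> for every \<open>s\<close> in the unit interval, and the
    Lipschitz constant there dominates the quotients.\<close>
  obtain B where B: "B-lipschitz_on {0..2} (Y t)" using t by (rule Y_lipschitz[OF less_imp_le])
  obtain C where C: "C-lipschitz_on {0..2} (Y 0)" by (rule Y_lipschitz[of 0]) auto
  show ?thesis
  proof (rule LIMSEQ_le[OF lim[OF _ B] lim[OF _ C]])
    show "AE s in unit_lborel. (Y 0 has_vector_derivative Ds 0 s) (at s)"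
      using AE_Ds[of 0] by (auto simp: AE_interval_lborel elim: eventually_mono)
    show "\<exists>N. \<forall>n\<ge>N. (LINT s|unit_lborel. q t n s) \<le> (LINT s|unit_lborel. q 0 n s)" using le by blast
  qed (use t Ds in auto)
qed simp

end

lemma lipschitz_on_inner_Icc:
  fixes f g :: "real \<Rightarrow> 'a::real_inner"
  assumes f: "B-lipschitz_on {a..b} f" and g: "C-lipschitz_on {a..b} g"
  obtains D where "D-lipschitz_on {a..b} (\<lambda>s. f s \<bullet> g s)"
proof -
  obtain F where "F > 0" "\<forall>y\<in>f ` {a..b}. norm y \<le> F"
    using compact_imp_bounded[OF compact_continuous_image[OF lipschitz_on_continuous_on[OF f] compact_Icc]]
    unfolding bounded_pos by blast
  then have F: "F > 0" "\<And>x. x \<in> {a..b} \<Longrightarrow> norm (f x) \<le> F" by blast+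
  obtain G where "G > 0" "\<forall>y\<in>g ` {a..b}. norm y \<le> G"
    using compact_imp_bounded[OF compact_continuous_image[OF lipschitz_on_continuous_on[OF g] compact_Icc]]
    unfolding bounded_pos by blast
  then have G: "G > 0" "\<And>x. x \<in> {a..b} \<Longrightarrow> norm (g x) \<le> G" by blast+
  have "(B * G + F * C)-lipschitz_on {a..b} (\<lambda>s. f s \<bullet> g s)"
  proof (rule lipschitz_onI)
    fix x y assume xy: "x \<in> {a..b}" "y \<in> {a..b}"
    have "dist (f x \<bullet> g x) (f y \<bullet> g y) = \<bar>(f x - f y) \<bullet> g x + f y \<bullet> (g x - g y)\<bar>"
      by (simp add: dist_real_def inner_simps)
    also have "\<dots> \<le> \<bar>(f x - f y) \<bullet> g x\<bar> + \<bar>f y \<bullet> (g x - g y)\<bar>" by simp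
    also have "\<dots> \<le> norm (f x - f y) * norm (g x) + norm (f y) * norm (g x - g y)"
      by (intro add_mono Cauchy_Schwarz_ineq2)
    also have "\<dots> \<le> (B * dist x y) * G + F * (C * dist x y)"
      using lipschitz_onD[OF f xy] lipschitz_onD[OF g xy] F(2)[OF xy(2)] G(2)[OF xy(1)]
        lipschitz_on_nonneg[OF f] F(1) by (intro add_mono mult_mono) (auto simp: dist_norm)
    finally show "dist (f x \<bullet> g x) (f y \<bullet> g y) \<le> (B * G + F * C) * dist x y" by (simp add: algebra_simps)
  qed (use lipschitz_on_nonneg[OF f] lipschitz_on_nonneg[OF g] F G in auto)
  then show thesis by (rule that)
qed

section \<open>Weak continuity of the tangent in time, down to time zero\<close>

context heat_loop
begin

text \<open>From x \<le> (1 + x^2) / 2 on a space of mass one, followed by energy decay. The bound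
  is uniform in time and affine in the initial energy, hence integrable over an ensemble of finite
  energy.\<close>

lemma Ds_norm_le: "t \<ge> 0 \<Longrightarrow> (LINT s|unit_lborel. norm (Ds t s)) \<le> (1 + (LINT s|unit_lborel. (norm (Ds 0 s))\<^sup>2)) / 2"
proof -
  assume t: "t \<ge> 0"
  interpret prob_space unit_lborel by (rule prob_space_unit_lborel)
  have "(LINT s|unit_lborel. norm (Ds t s)) \<le> (LINT s|unit_lborel. 1 / 2 + (norm (Ds t s))\<^sup>2 / 2)"
  proof (rule integral_mono)
    show "norm (Ds t s) \<le> 1 / 2 + (norm (Ds t s))\<^sup>2 / 2" for s
      using sum_squares_bound[of "norm (Ds t s)" 1] by simp
  qed (use Ds_integrable_sq[OF t] in auto)
  also have "\<dots> = 1 / 2 + (LINT s|unit_lborel. (norm (Ds t s))\<^sup>2) / 2"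
    using Ds_integrable_sq[OF t] by (simp add: prob_space[unfolded space_interval_lborel])
  also have "\<dots> \<le> 1 / 2 + (LINT s|unit_lborel. (norm (Ds 0 s))\<^sup>2) / 2" using Ds_energy_le[OF t] by simp
  finally show ?thesis by simp
qed

lemma inner_Ds_integrable:
  assumes \<phi>: "continuous_on {0..1} \<phi>" and t: "t \<ge> 0"
  shows "integrable unit_lborel (\<lambda>s. \<phi> s \<bullet> Ds t s)"
proof -
  obtain K where "\<forall>x\<in>\<phi> ` {0..1}. norm x \<le> K"
    using compact_imp_bounded[OF compact_continuous_image[OF \<phi> compact_Icc]] unfolding bounded_iff by blast
  then have K: "\<And>s. s \<in> {0..1} \<Longrightarrow> norm (\<phi> s) \<le> K" by blast
  show ?thesis
  proof (rule Bochner_Integration.integrable_bound)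
    show "integrable unit_lborel (\<lambda>s. K * norm (Ds t s))" using Ds_integrable_sq[OF t] by auto
    show "(\<lambda>s. \<phi> s \<bullet> Ds t s) \<in> borel_measurable unit_lborel"
      using integrable_interval_continuous[OF \<phi>] Ds_integrable_sq(2)[OF t] by (intro borel_measurable_inner) auto
    have "norm (\<phi> s \<bullet> Ds t s) \<le> norm (K * norm (Ds t s))" if "s \<in> {0..1}" for s
    proof -
      have "\<bar>\<phi> s \<bullet> Ds t s\<bar> \<le> norm (\<phi> s) * norm (Ds t s)" by (rule Cauchy_Schwarz_ineq2)
      also have "\<dots> \<le> K * norm (Ds t s)" using K[OF that] by (intro mult_right_mono) auto
      finally show ?thesis by (smt (verit) real_norm_def)
    qed
    then show "AE s in unit_lborel. norm (\<phi> s \<bullet> Ds t s) \<le> norm (K * norm (Ds t s))"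
      by (intro AE_I2) (auto simp: space_interval_lborel)
  qed
qed

lemma inner_Ds_bound:
  assumes \<phi>: "continuous_on {0..1} \<phi>" and K: "\<And>s. s \<in> {0..1} \<Longrightarrow> norm (\<phi> s) \<le> K" and t: "t \<ge> 0"
  shows "\<bar>LINT s|unit_lborel. \<phi> s \<bullet> Ds t s\<bar> \<le> K * ((1 + (LINT s|unit_lborel. (norm (Ds 0 s))\<^sup>2)) / 2)"
proof -
  have K0: "K \<ge> 0" using order_trans[OF norm_ge_zero K[of 0]] by simp
  have "\<bar>LINT s|unit_lborel. \<phi> s \<bullet> Ds t s\<bar> \<le> (LINT s|unit_lborel. \<bar>\<phi> s \<bullet> Ds t s\<bar>)"
    using integral_norm_bound[of unit_lborel "\<lambda>s. \<phi> s \<bullet> Ds t s"] by simp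
  also have "\<dots> \<le> (LINT s|unit_lborel. K * norm (Ds t s))"
  proof (rule integral_mono)
    show "\<bar>\<phi> s \<bullet> Ds t s\<bar> \<le> K * norm (Ds t s)" if "s \<in> space unit_lborel" for s
      using Cauchy_Schwarz_ineq2[of "\<phi> s" "Ds t s"] mult_right_mono[OF K, of s "norm (Ds t s)"] that
      by (auto simp: space_interval_lborel)
  qed (use inner_Ds_integrable[OF \<phi> t] Ds_integrable_sq(2)[OF t] in auto)
  also have "\<dots> \<le> K * ((1 + (LINT s|unit_lborel. (norm (Ds 0 s))\<^sup>2)) / 2)"
    using mult_left_mono[OF Ds_norm_le[OF t] K0] by (simp only: integral_mult_right_zero)
  finally show ?thesis .
qed

text \<open>The right side involves only \<open>Y\<close>, which is continuous in time down to zero.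
  The product \<open>p \<bullet> Y\<close> is Lipschitz at every time, so its almost everywhere
  derivative can be integrated; the boundary terms remain because neither factor need be
  periodic.\<close>

lemma Ds_parts:
  assumes p: "\<And>s. s \<in> {0..1} \<Longrightarrow> (p has_vector_derivative p' s) (at s)" and p': "continuous_on {0..1} p'"
    and t: "t \<ge> 0"
  shows "(LINT s|unit_lborel. p s \<bullet> Ds t s) = p 1 \<bullet> Y t 1 - p 0 \<bullet> Y t 0 - (LINT s|unit_lborel. p' s \<bullet> Y t s)"
proof -
  have pc: "continuous_on {0..1} p"
    by (rule continuous_on_vector_derivative[OF has_vector_derivative_at_within[OF p]])
  obtain P where P: "P-lipschitz_on {0..1} p"
    by (rule lipschitz_on_Icc_of_continuous_derivative[OF has_vector_derivative_at_within[OF p] p'])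
  obtain B where B: "B-lipschitz_on {0..1} (Y t)" using t by (rule Y_lipschitz)
  obtain D where D: "D-lipschitz_on {0..1} (\<lambda>s. p s \<bullet> Y t s)" by (rule lipschitz_on_inner_Icc[OF P B])
  have 1: "((\<lambda>s. p s \<bullet> Ds t s + p' s \<bullet> Y t s) has_integral p 1 \<bullet> Y t 1 - p 0 \<bullet> Y t 0) {0..1}"
  proof (rule lipschitz_on_has_integral_derivative[OF D])
    show "AE s in lborel. s \<in> {0<..<1} \<longrightarrow> ((\<lambda>s. p s \<bullet> Y t s) has_vector_derivative p s \<bullet> Ds t s + p' s \<bullet> Y t s) (at s)"
      using AE_Ds[OF t]
      by eventually_elim (auto intro!: bounded_bilinear.has_vector_derivative[OF bounded_bilinear_inner] p)
  qed simp
  have 2: "((\<lambda>s. p' s \<bullet> Y t s) has_integral integral {0..1} (\<lambda>s. p' s \<bullet> Y t s)) {0..1}"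
    using p' Y_section[OF t] by (intro integrable_integral integrable_continuous_real continuous_intros)
  have "((\<lambda>s. p s \<bullet> Ds t s) has_integral (p 1 \<bullet> Y t 1 - p 0 \<bullet> Y t 0) - integral {0..1} (\<lambda>s. p' s \<bullet> Y t s)) {0..1}"
    using has_integral_diff[OF 1 2] by simp
  then have "integral {0..1} (\<lambda>s. p s \<bullet> Ds t s) = p 1 \<bullet> Y t 1 - p 0 \<bullet> Y t 0 - integral {0..1} (\<lambda>s. p' s \<bullet> Y t s)"
    by (simp add: has_integral_iff)
  moreover have "(LINT s|unit_lborel. p s \<bullet> Ds t s) = integral {0..1} (\<lambda>s. p s \<bullet> Ds t s)"
    by (intro integral_interval_lborel_eq_integral inner_Ds_integrable pc t)
  moreover have "(LINT s|unit_lborel. p' s \<bullet> Y t s) = integral {0..1} (\<lambda>s. p' s \<bullet> Y t s)"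
    using p' Y_section[OF t] by (intro integral_interval_continuous continuous_intros)
  ultimately show ?thesis by simp
qed

lemma test_field_continuous:
  fixes \<phi> :: "real \<times> 'n torus \<Rightarrow> 'b::topological_space"
  assumes "continuous_on ({a..b} \<times> UNIV) \<phi>" "a \<ge> 0"
  shows "continuous_on ({a..b} \<times> S) (\<lambda>(t, s). \<phi> (t, abs_torus (Y t s)))"
proof -
  have Yc: "continuous_on ({a..b} \<times> S) (\<lambda>z. Y (fst z) (snd z))"
    using assms(2) by (intro continuous_on_subset[OF Y_continuous[unfolded case_prod_beta]]) auto
  have "continuous_on ({a..b} \<times> S) (\<lambda>z. (\<lambda>(t, y). \<phi> (t, abs_torus y)) (fst z, Y (fst z) (snd z)))"
    by (rule continuous_on_compose2[OF assms(1)[unfolded continuous_on_time_torus]])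
      (auto intro!: continuous_intros Yc)
  then show ?thesis by (simp add: case_prod_beta)
qed

text \<open>At \<open>t = 0\<close> the derivative \<open>\<partial>\<^sub>s Y\<close> converges only weakly; the test field along the loop is replaced
  by a polynomial, against which \<open>\<partial>\<^sub>s Y\<close> is integrated by parts.\<close>

lemma loop_B_continuous_aux:
  fixes \<phi> :: "real \<times> 'n torus \<Rightarrow> real ^ 'n"
  assumes \<phi>: "continuous_on ({0..T} \<times> UNIV) \<phi>" and T: "T > 0"
  shows "((\<lambda>t. LINT s|unit_lborel. \<phi> (t, abs_torus (Y t s)) \<bullet> Ds t s) \<longlongrightarrow>
      (LINT s|unit_lborel. \<phi> (0, abs_torus (Y 0 s)) \<bullet> Ds 0 s)) (at 0 within {0..T})"
proof (rule tendstoI)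
  fix e :: real assume e: "e > 0"
  define A where "A = (1 + (LINT s|unit_lborel. (norm (Ds 0 s))\<^sup>2)) / 2"
  have A: "A \<ge> 0" unfolding A_def by (simp add: add_nonneg_nonneg)
  \<comment> \<open>Three replacement errors of at most \<open>d * A\<close> and one below
    \<open>d\<close> stay under \<open>d * (3 * A + 1)\<close>, which is less than
    \<open>e\<close>.\<close>
  define d where "d = e / (3 * A + 2)"
  have d: "d > 0" using e A by (simp add: d_def add_nonneg_pos)
  have dA: "d * (3 * A + 1) < e"
  proof -
    have "d * (3 * A + 1) < d * (3 * A + 2)" using d by simp
    also have "\<dots> = e" using A by (simp add: d_def)
    finally show ?thesis .
  qed
  let ?\<kappa> = "\<lambda>t s. \<phi> (t, abs_torus (Y t s))"
  have kc: "continuous_on ({0..T} \<times> {0..1}) (\<lambda>(t, s). ?\<kappa> t s)" by (rule test_field_continuous[OF \<phi>]) simp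
  have ks: "continuous_on {0..1} (?\<kappa> t)" if "t \<in> {0..T}" for t by (rule continuous_on_section[OF kc that])
  have 0: "0 \<in> {0..T}" using T by simp
  obtain p where p: "polynomial_function p" "\<And>s. s \<in> {0..1} \<Longrightarrow> norm (?\<kappa> 0 s - p s) < d"
    using Stone_Weierstrass_polynomial_function[OF compact_Icc ks[OF 0] d] by metis
  obtain p' where p': "polynomial_function p'" "\<And>s. (p has_vector_derivative p' s) (at s)"
    using has_vector_derivative_polynomial_function[OF p(1)] by metis
  have pc: "continuous_on S p" "continuous_on S p'" for S
    using p(1) p'(1) by (auto intro: continuous_on_polymonial_function)
  define G where "G t = (LINT s|unit_lborel. p s \<bullet> Ds t s)" for t
  have "continuous_on {0..T} G"
  proof (rule continuous_on_eq)
    have Yc: "continuous_on ({0..T} \<times> {0..1}) (\<lambda>z. Y (fst z) (snd z))"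
      by (rule continuous_on_subset[OF Y_continuous[unfolded case_prod_beta]]) auto
    have Ys: "continuous_on {0..T} (\<lambda>t. Y t s)" for s
    proof -
      have "continuous_on {0..T} (\<lambda>t. (\<lambda>(t, s). Y t s) (t, s))"
        by (rule continuous_on_compose2[OF Y_continuous]) (auto intro!: continuous_intros)
      then show ?thesis by simp
    qed
    have "continuous_on ({0..T} \<times> {0..1}) (\<lambda>(t, s). p' s \<bullet> Y t s)"
      unfolding case_prod_beta by (intro continuous_intros Yc continuous_on_compose2[OF pc(2)[of UNIV]]) auto
    from continuous_on_integral_interval[OF this]
    show "continuous_on {0..T} (\<lambda>t. p 1 \<bullet> Y t 1 - p 0 \<bullet> Y t 0 - (LINT s|unit_lborel. p' s \<bullet> Y t s))"
      by (intro continuous_intros Ys)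
    show "p 1 \<bullet> Y t 1 - p 0 \<bullet> Y t 0 - (LINT s|unit_lborel. p' s \<bullet> Y t s) = G t" if "t \<in> {0..T}" for t
      unfolding G_def using that by (subst Ds_parts[OF p'(2) pc(2)]) auto
  qed
  then have "(G \<longlongrightarrow> G 0) (at 0 within {0..T})" using T by (auto simp: continuous_on_def)
  from tendstoD[OF this d] have ev1: "\<forall>\<^sub>F t in at 0 within {0..T}. dist (G t) (G 0) < d" .
  have "uniformly_continuous_on ({0..T} \<times> {0..1}) (\<lambda>(t, s). ?\<kappa> t s)"
    by (rule compact_uniformly_continuous[OF kc]) (intro compact_Times compact_Icc)
  then obtain r where r: "r > 0" "\<And>x x'. x \<in> {0..T} \<times> {0..1} \<Longrightarrow> x' \<in> {0..T} \<times> {0..1} \<Longrightarrow> dist x' x < r \<Longrightarrow>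
      dist ((\<lambda>(t, s). ?\<kappa> t s) x') ((\<lambda>(t, s). ?\<kappa> t s) x) < d"
    using d unfolding uniformly_continuous_on_def by blast
  have close: "norm (?\<kappa> t s - ?\<kappa> 0 s) \<le> d" if "t \<in> {0..T}" "t < r" "s \<in> {0..1}" for t s
    using r(2)[of "(0, s)" "(t, s)"] that T by (auto simp: dist_Pair_Pair dist_norm)
  have ev2: "\<forall>\<^sub>F t in at 0 within {0..T}. t \<in> {0..T} \<and> t < r"
    using r(1) by (auto simp: eventually_at intro!: exI[of _ r])
  show "\<forall>\<^sub>F t in at 0 within {0..T}. dist (LINT s|unit_lborel. ?\<kappa> t s \<bullet> Ds t s) (LINT s|unit_lborel. ?\<kappa> 0 s \<bullet> Ds 0 s) < e"
    using ev1 ev2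
  proof eventually_elim
    case (elim t)
    then have t: "t \<in> {0..T}" "t \<ge> 0" "t < r" by auto
    note c = ks[OF t(1)] ks[OF 0] pc(1)[of "{0..1}"]
    note i = inner_Ds_integrable[OF c(1) t(2)] inner_Ds_integrable[OF c(2) t(2)] inner_Ds_integrable[OF c(3) t(2)]
      inner_Ds_integrable[OF c(1) order_refl] inner_Ds_integrable[OF c(2) order_refl] inner_Ds_integrable[OF c(3) order_refl]
    \<comment> \<open>Successive replacements: the field on the moving loop by the field on the
      initial loop, then by the polynomial \<open>p\<close>, whose pairing \<open>G\<close> is
      continuous in time, and back at time zero.\<close>
    have "(LINT s|unit_lborel. ?\<kappa> t s \<bullet> Ds t s) - (LINT s|unit_lborel. ?\<kappa> 0 s \<bullet> Ds 0 s)
      = (LINT s|unit_lborel. (?\<kappa> t s - ?\<kappa> 0 s) \<bullet> Ds t s) + (LINT s|unit_lborel. (?\<kappa> 0 s - p s) \<bullet> Ds t s)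
        + (G t - G 0) - (LINT s|unit_lborel. (?\<kappa> 0 s - p s) \<bullet> Ds 0 s)"
      using i by (simp add: inner_diff_left G_def)
    moreover have "\<bar>LINT s|unit_lborel. (?\<kappa> t s - ?\<kappa> 0 s) \<bullet> Ds t s\<bar> \<le> d * A"
      unfolding A_def using close t c by (intro inner_Ds_bound continuous_intros) auto
    moreover have "\<bar>LINT s|unit_lborel. (?\<kappa> 0 s - p s) \<bullet> Ds t s\<bar> \<le> d * A"
      unfolding A_def using p(2) t c by (intro inner_Ds_bound continuous_intros) (auto intro: less_imp_le)
    moreover have "\<bar>LINT s|unit_lborel. (?\<kappa> 0 s - p s) \<bullet> Ds 0 s\<bar> \<le> d * A"
      unfolding A_def using p(2) t c by (intro inner_Ds_bound continuous_intros) (auto intro: less_imp_le)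
    moreover have "\<bar>G t - G 0\<bar> < d" using elim(1) by (simp add: dist_real_def)
    ultimately have "\<bar>(LINT s|unit_lborel. ?\<kappa> t s \<bullet> Ds t s) - (LINT s|unit_lborel. ?\<kappa> 0 s \<bullet> Ds 0 s)\<bar> < 3 * (d * A) + d"
      by linarith
    also have "\<dots> < e" using dA by (simp add: algebra_simps)
    finally show ?case by (simp add: dist_real_def)
  qed
qed

lemma loop_B_continuous:
  fixes \<phi> :: "real \<times> 'n torus \<Rightarrow> real ^ 'n"
  assumes \<phi>: "continuous_on ({0..T} \<times> UNIV) \<phi>" and T: "T > 0"
  shows "continuous_on {0..T} (\<lambda>t. LINT s|unit_lborel. \<phi> (t, abs_torus (Y t s)) \<bullet> Ds t s)"
    (is "continuous_on _ ?k")
  unfolding continuous_on_def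
proof
  fix t0 assume t0: "t0 \<in> {0..T}"
  show "(?k \<longlongrightarrow> ?k t0) (at t0 within {0..T})"
  proof (cases "t0 = 0")
    case True
    then show ?thesis using loop_B_continuous_aux[OF assms] by simp
  next
    case False
    then have pos: "t0 > 0" using t0 by simp
    let ?I = "{t0 / 2..T}"
    have "continuous_on (?I \<times> {0..1}) (\<lambda>(t, s). \<phi> (t, abs_torus (Y t s)))"
      using pos by (intro test_field_continuous continuous_on_subset[OF \<phi>]) auto
    moreover have "continuous_on (?I \<times> {0..1}) (\<lambda>(t, s). Ds t s)"
      using pos by (intro continuous_on_subset[OF Ds_continuous]) auto
    ultimately have "continuous_on (?I \<times> {0..1}) (\<lambda>(t, s). \<phi> (t, abs_torus (Y t s)) \<bullet> Ds t s)"
      unfolding case_prod_beta by (rule continuous_on_inner)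
    from continuous_on_integral_interval[OF this] have "(?k \<longlongrightarrow> ?k t0) (at t0 within ?I)"
      using t0 pos by (auto simp: continuous_on_def)
    moreover have "at t0 within {0..T} = at t0 within ?I"
    proof (rule at_within_nhd[of _ "{t0 / 2<..}"])
      show "{0..T} \<inter> {t0 / 2<..} - {t0} = ?I \<inter> {t0 / 2<..} - {t0}" using pos by auto
    qed (use pos in auto)
    ultimately show ?thesis by simp
  qed
qed

end

section \<open>The dissipation identity\<close>

definition pair_vec :: "real ^ 'n \<Rightarrow> real ^ 'n \<Rightarrow> real ^ ('n::finite + 'n)" where
  "pair_vec p q = (\<chi> I. case I of Inl i \<Rightarrow> p $ i | Inr i \<Rightarrow> q $ i)"

lemma pair_vec_nth [simp]: "pair_vec p q $ Inl i = p $ i" "pair_vec p q $ Inr i = q $ i"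
  by (simp_all add: pair_vec_def)

lemma sum_UNIV_Plus: "(\<Sum>I\<in>UNIV. f I) = (\<Sum>i\<in>UNIV. f (Inl i)) + (\<Sum>i\<in>UNIV. f (Inr i))"
  for f :: "'a::finite + 'b::finite \<Rightarrow> 'c::comm_monoid_add"
  unfolding UNIV_Plus_UNIV[symmetric] by (subst sum.Plus) (auto simp: o_def)

lemma inner_pair_vec: "U \<bullet> pair_vec p q = (\<chi> i. U $ Inl i) \<bullet> p + (\<chi> i. U $ Inr i) \<bullet> q"
  by (simp add: inner_vec_def sum_UNIV_Plus)

lemma inner_pair_vec_pair_vec: "pair_vec a b \<bullet> pair_vec p q = a \<bullet> p + b \<bullet> q"
  by (simp add: inner_vec_def sum_UNIV_Plus)

lemma inner_transpose_mult: "x \<bullet> (transpose A *v y) = (A *v x) \<bullet> y" for x y :: "real ^ 'n::finite"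
  by (simp add: dot_lmul_matrix[symmetric] transpose_matrix_vector inner_commute)

lemma Q_matrix_mult_pair_vec:
  "Q_matrix r b v z *v pair_vec p q =
     pair_vec (r *\<^sub>R p - space_jacobian v z *v p - transpose (space_jacobian v z) *v p
        + space_jacobian b z *v q - transpose (space_jacobian b z) *v q)
       (transpose (space_jacobian b z) *v p - space_jacobian b z *v p + 2 *\<^sub>R q)"
proof (subst vec_eq_iff, intro allI)
  fix I
  have id: "(\<Sum>j\<in>UNIV. (c * (if i = j then 1 else 0) * x $ j)) = c * x $ i" for i :: 'a and x :: "real ^ 'a" and c :: real
    by (simp add: if_distrib if_distribR cong: if_cong)
  show "(Q_matrix r b v z *v pair_vec p q) $ I =
     pair_vec (r *\<^sub>R p - space_jacobian v z *v p - transpose (space_jacobian v z) *v p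
        + space_jacobian b z *v q - transpose (space_jacobian b z) *v q)
       (transpose (space_jacobian b z) *v p - space_jacobian b z *v p + 2 *\<^sub>R q) $ I"
    by (cases I) (simp_all add: Q_matrix_def Let_def matrix_vector_mult_def sum_UNIV_Plus mat_def
        left_diff_distrib distrib_right sum.distrib sum_subtractf sum_negf id)
qed

text \<open>Moving transposes across the inner product leaves only Jacobians applied to vectors,
  that is, directional derivatives. The off-diagonal blocks are transposes of each other, so each
  mixed term appears twice.\<close>

lemma inner_Q_matrix_pair_vec:
  "pair_vec p q \<bullet> (Q_matrix r b v z *v pair_vec p q) =
     r * (p \<bullet> p) - 2 * (p \<bullet> (space_jacobian v z *v p)) + 2 * (p \<bullet> (space_jacobian b z *v q))
       - 2 * (q \<bullet> (space_jacobian b z *v p)) + 2 * (q \<bullet> q)"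
  by (simp add: Q_matrix_mult_pair_vec inner_pair_vec_pair_vec inner_simps inner_transpose_mult
      inner_commute[of "_ *v _"] del: transpose_matrix_vector)

lemma pair_vec_components: "U = pair_vec (\<chi> i. U $ Inl i) (\<chi> i. U $ Inr i)"
proof (subst vec_eq_iff, intro allI)
  fix I show "U $ I = pair_vec (\<chi> i. U $ Inl i) (\<chi> i. U $ Inr i) $ I" by (cases I) simp_all
qed

text \<open>Fixing one witness \<open>D\<close> of continuous differentiability turns each
  differential operator of the definitions into a value of the linear map \<open>D z\<close> at an
  increment (time, space); the later identities become linear algebra.\<close>

locale C1_derivative =
  fixes T :: real and w :: "real \<times> 'n::finite torus \<Rightarrow> real ^ 'n"
    and D :: "real \<times> 'n torus \<Rightarrow> ((real \<times> (real ^ 'n)) \<Rightarrow>\<^sub>L (real ^ 'n))"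
  assumes T_pos: "T > 0" and D_continuous: "continuous_on ({0..T} \<times> UNIV) D"
    and D: "\<And>t x. t \<in> {0..T} \<Longrightarrow>
      ((\<lambda>(\<tau>, y). w (\<tau>, abs_torus y)) has_derivative blinfun_apply (D (t, abs_torus x))) (at (t, x) within {0..T} \<times> UNIV)"
begin

lemma D_pair: "blinfun_apply (D z) (c, h) = c *\<^sub>R blinfun_apply (D z) (1, 0) + blinfun_apply (D z) (0, h)"
  unfolding blinfun.scaleR_right[symmetric] blinfun.add_right[symmetric] by simp

lemma D_space_diff: "blinfun_apply (D z) (0, h - k) = blinfun_apply (D z) (0, h) - blinfun_apply (D z) (0, k)"
  unfolding blinfun.diff_right[symmetric] by simp

lemma D_at:
  assumes "z \<in> {0..T} \<times> UNIV"
  shows "((\<lambda>(\<tau>, y). w (\<tau>, abs_torus y)) has_derivative blinfun_apply ((\<lambda>(t, x). D (t, abs_torus x)) z))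
    (at z within {0..T} \<times> UNIV)"
  using assms D by (cases z) auto

lemma field_continuous: "continuous_on ({0..T} \<times> UNIV) w"
  unfolding continuous_on_time_torus
  by (rule has_derivative_continuous_on[OF D_at])

lemma chain:
  assumes "(f has_vector_derivative (c, h)) (at x within S)" "f ` S \<subseteq> {0..T} \<times> UNIV" "x \<in> S"
  shows "((\<lambda>x. w (fst (f x), abs_torus (snd (f x)))) has_vector_derivative
      blinfun_apply (D (fst (f x), abs_torus (snd (f x)))) (c, h)) (at x within S)"
proof -
  have "((\<lambda>x. (\<lambda>(\<tau>, y). w (\<tau>, abs_torus y)) (f x)) has_derivative
     (\<lambda>k. blinfun_apply ((\<lambda>(t, x). D (t, abs_torus x)) (f x)) (k *\<^sub>R (c, h)))) (at x within S)"
    by (rule has_derivative_in_compose2[OF D_at assms(2,3) assms(1)[unfolded has_vector_derivative_def]])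
  then show ?thesis
    unfolding has_vector_derivative_def by (simp add: case_prod_beta blinfun.scaleR_right[symmetric])
qed

lemma space_derivative:
  assumes "t \<in> {0..T}"
  shows "((\<lambda>y. w (t, abs_torus y)) has_derivative (\<lambda>h. blinfun_apply (D (t, abs_torus x)) (0, h))) (at x)"
proof -
  have "((\<lambda>y. (\<lambda>(\<tau>, y). w (\<tau>, abs_torus y)) (t, y)) has_derivative
     (\<lambda>h. blinfun_apply ((\<lambda>(t, x). D (t, abs_torus x)) (t, x)) (0, h))) (at x within UNIV)"
    by (rule has_derivative_in_compose2[OF D_at])
      (use assms in \<open>auto intro!: derivative_eq_intros\<close>)
  then show ?thesis by simp
qed

lemma dir_deriv_eq:
  assumes "fst z \<in> {0..T}"
  shows "dir_deriv h w z = blinfun_apply (D z) (0, h z)"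
  using frechet_derivative_at[OF space_derivative[OF assms, of "rep_torus (snd z)"], symmetric]
  by (simp add: dir_deriv_def)

lemma space_jacobian_mult:
  assumes "fst z \<in> {0..T}"
  shows "space_jacobian w z *v \<xi> = blinfun_apply (D z) (0, \<xi>)"
proof -
  have d: "((\<lambda>y. w (fst z, abs_torus y)) has_derivative (\<lambda>h. blinfun_apply (D z) (0, h))) (at (rep_torus (snd z)))"
    using space_derivative[OF assms, of "rep_torus (snd z)"] by simp
  show ?thesis unfolding space_jacobian_def jacobian_def frechet_derivative_at[OF d, symmetric]
    using has_derivative_linear[OF d] by (simp add: matrix_works)
qed

lemma time_deriv_eq:
  assumes "fst z \<in> {0..T}"
  shows "time_deriv {0..T} w z = blinfun_apply (D z) (1, 0)"
proof -
  have "((\<lambda>t. (t, rep_torus (snd z))) has_vector_derivative (1, 0)) (at (fst z) within {0..T})"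
    by (auto simp: has_vector_derivative_def intro!: derivative_eq_intros)
  from chain[OF this] assms
  have "((\<lambda>t. w (t, snd z)) has_vector_derivative blinfun_apply (D z) (1, 0)) (at (fst z) within {0..T})"
    by (auto simp: image_subset_iff)
  then show ?thesis unfolding time_deriv_def
    using T_pos assms by (auto intro!: vector_derivative_within_cbox[of 0 T, unfolded cbox_interval])
qed

lemma space_jacobian_continuous: "continuous_on ({0..T} \<times> UNIV) (space_jacobian w)"
proof (rule continuous_on_eq)
  show "continuous_on ({0..T} \<times> UNIV) (\<lambda>z. \<chi> i j. blinfun_apply (D z) (0, axis j 1) $ i)"
    by (intro continuous_intros D_continuous)
  show "(\<chi> i j. blinfun_apply (D z) (0, axis j 1) $ i) = space_jacobian w z" if "z \<in> {0..T} \<times> UNIV" for z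
    using that by (subst vec_eq_iff, subst vec_eq_iff)
      (auto simp: space_jacobian_mult[symmetric] matrix_vector_mult_basis column_def)
qed

end

lemma C1_field_obtain:
  assumes "C1_field T w" "T > 0"
  obtains D where "C1_derivative T w D"
  using assms unfolding C1_field_def C1_derivative_def by blast

locale C1_fields = b: C1_derivative T b Db + v: C1_derivative T v Dv
  for T and b :: "real \<times> 'n::finite torus \<Rightarrow> real ^ 'n" and Db
    and v :: "real \<times> 'n torus \<Rightarrow> real ^ 'n" and Dv
begin

text \<open>\<open>Db z (1, v z)\<close> is the derivative of \<open>b\<close> along the flow of
  \<open>v\<close>; the product rule for |b|^2 / 2 and for \<open>b \<bullet> v\<close> does the
  rest.\<close>

lemma L1_eq:
  assumes z: "fst z \<in> {0..T}"
  shows "L1 T b v z = (norm (v z))\<^sup>2 + b z \<bullet> Db z (1, v z) - (Db z (0, b z) \<bullet> v z + b z \<bullet> Dv z (0, b z))"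
proof -
  obtain t x where tx: "z = (t, x)" by (cases z)
  let ?y = "rep_torus x"
  have t: "t \<in> {0..T}" using z tx by simp
  have sb: "((\<lambda>y. b (t, abs_torus y)) has_derivative (\<lambda>h. Db z (0, h))) (at ?y)"
    using b.space_derivative[OF t, of ?y] by (simp add: tx)
  have sv: "((\<lambda>y. v (t, abs_torus y)) has_derivative (\<lambda>h. Dv z (0, h))) (at ?y)"
    using v.space_derivative[OF t, of ?y] by (simp add: tx)
  have "((\<lambda>y. b (t, abs_torus y) \<bullet> v (t, abs_torus y)) has_derivative
      (\<lambda>h. b z \<bullet> Dv z (0, h) + Db z (0, h) \<bullet> v z)) (at ?y)"
    using has_derivative_inner[OF sb sv] by (simp add: tx)
  from frechet_derivative_at[OF this, symmetric]
  have 1: "dir_deriv b (\<lambda>y. b y \<bullet> v y) z = b z \<bullet> Dv z (0, b z) + Db z (0, b z) \<bullet> v z"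
    by (simp add: dir_deriv_def tx)
  have "((\<lambda>y. (norm (b (t, abs_torus y)))\<^sup>2 / 2) has_derivative (\<lambda>h. b z \<bullet> Db z (0, h))) (at ?y)"
    unfolding power2_norm_eq_inner
    by (rule has_derivative_eq_rhs[OF has_derivative_divide[OF has_derivative_inner[OF sb sb] has_derivative_const]])
      (auto simp: tx fun_eq_iff inner_commute)
  from frechet_derivative_at[OF this, symmetric]
  have 2: "dir_deriv v (\<lambda>y. (norm (b y))\<^sup>2 / 2) z = b z \<bullet> Db z (0, v z)"
    by (simp add: dir_deriv_def tx)
  have "((\<lambda>t. (t, ?y)) has_vector_derivative (1, 0)) (at t within {0..T})"
    by (auto simp: has_vector_derivative_def intro!: derivative_eq_intros)
  from b.chain[OF this] t
  have tb: "((\<lambda>t. b (t, x)) has_vector_derivative Db z (1, 0)) (at t within {0..T})"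
    by (auto simp: image_subset_iff tx)
  have "((\<lambda>t. (norm (b (t, x)))\<^sup>2 / 2) has_vector_derivative b z \<bullet> Db z (1, 0)) (at t within {0..T})"
    using bounded_linear.has_vector_derivative[OF bounded_linear_divide bounded_bilinear.has_vector_derivative[OF bounded_bilinear_inner tb tb], of 2]
    by (simp add: power2_norm_eq_inner tx inner_commute)
  then have 3: "time_deriv {0..T} (\<lambda>y. (norm (b y))\<^sup>2 / 2) z = b z \<bullet> Db z (1, 0)"
    unfolding time_deriv_def
    using b.T_pos t by (auto simp: tx intro!: vector_derivative_within_cbox[of 0 T, unfolded cbox_interval])
  show ?thesis
    unfolding L1_def D_star_def 1 2 3 b.D_pair[of z 1 "v z"] by (simp add: inner_simps)
qed

lemma L2_eq:
  assumes z: "fst z \<in> {0..T}"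
  shows "L2 T b v z = - Db z (1, v z) + Dv z (0, b z)"
  unfolding L2_def D_star_def b.time_deriv_eq[OF z] b.dir_deriv_eq[OF z] v.dir_deriv_eq[OF z] b.D_pair[of z 1 "v z"]
  by simp

lemma L3_eq:
  assumes z: "fst z \<in> {0..T}"
  shows "L3 b v z = - v z + Db z (0, b z)"
  unfolding L3_def b.dir_deriv_eq[OF z] by simp

lemma Q_eq:
  assumes z: "fst z \<in> {0..T}"
  shows "pair_vec p q \<bullet> (Q_matrix r b v z *v pair_vec p q) =
     r * (p \<bullet> p) - 2 * (p \<bullet> Dv z (0, p)) + 2 * (p \<bullet> Db z (0, q)) - 2 * (q \<bullet> Db z (0, p)) + 2 * (q \<bullet> q)"
  unfolding inner_Q_matrix_pair_vec b.space_jacobian_mult[OF z] v.space_jacobian_mult[OF z] ..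

lemma L_continuous:
  shows "continuous_on ({0..T} \<times> UNIV) (L1 T b v)"
    and "continuous_on ({0..T} \<times> UNIV) (L2 T b v)"
    and "continuous_on ({0..T} \<times> UNIV) (L3 b v)"
proof -
  note c = b.D_continuous v.D_continuous b.field_continuous v.field_continuous
  have "continuous_on ({0..T} \<times> UNIV) (\<lambda>z. (norm (v z))\<^sup>2 + b z \<bullet> Db z (1, v z) - (Db z (0, b z) \<bullet> v z + b z \<bullet> Dv z (0, b z)))"
    by (intro continuous_intros c)
  then show "continuous_on ({0..T} \<times> UNIV) (L1 T b v)" by (rule continuous_on_eq) (auto simp: L1_eq)
  have "continuous_on ({0..T} \<times> UNIV) (\<lambda>z. - Db z (1, v z) + Dv z (0, b z))"
    by (intro continuous_intros c)
  then show "continuous_on ({0..T} \<times> UNIV) (L2 T b v)" by (rule continuous_on_eq) (auto simp: L2_eq)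
  have "continuous_on ({0..T} \<times> UNIV) (\<lambda>z. - v z + Db z (0, b z))"
    by (intro continuous_intros c)
  then show "continuous_on ({0..T} \<times> UNIV) (L3 b v)" by (rule continuous_on_eq) (auto simp: L3_eq)
qed

text \<open>Here \<open>p\<close> and \<open>q\<close> stand for the s- and t-derivative of one loop
  at the position \<open>z\<close>, before any averaging over the loop points at that position. Up
  to the factor exp (- r t) this is the loop version of the integrand on the left of the dissipation
  inequality.\<close>

definition dissipation :: "real \<Rightarrow> real \<times> 'n torus \<Rightarrow> real ^ 'n \<Rightarrow> real ^ 'n \<Rightarrow> real" where
  "dissipation r z p q =
     pair_vec (p - b z) (q - v z) \<bullet> (Q_matrix r b v z *v pair_vec (p - b z) (q - v z)) / 2
       - (L1 T b v z + p \<bullet> L2 T b v z + q \<bullet> L3 b v z)"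

text \<open>The summand \<open>v \<bullet> (q - Db(0,p)) + Dv(0,p) \<bullet> (p - b)\<close> is the derivative of \<open>v \<bullet> (\<partial>\<^sub>s X - b)\<close>
  along a loop \<open>X\<close> with \<open>p = \<partial>\<^sub>s X\<close> and \<open>q = \<partial>\<^sub>s\<^sub>s X = \<partial>\<^sub>t X\<close>, hence integrates to zero.\<close>

lemma dissipation_identity:
  assumes z: "fst z \<in> {0..T}"
  shows "- (norm q)\<^sup>2 + q \<bullet> Db z (0, p) - p \<bullet> Db z (1, q) + b z \<bullet> Db z (1, q) - r * ((norm (p - b z))\<^sup>2 / 2)
     = - dissipation r z p q - (v z \<bullet> (q - Db z (0, p)) + Dv z (0, p) \<bullet> (p - b z))"
  \<comment> \<open>Once the increments are split into time and space parts, an identity between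
    inner products remains; the term with \<open>r\<close> is the \<open>r\<close> block of the
    quadratic form.\<close>
  unfolding dissipation_def Q_eq[OF z] L1_eq[OF z] L2_eq[OF z] L3_eq[OF z] power2_norm_eq_inner
    b.D_pair[of z 1 "v z"] b.D_pair[of z 1 q]
  by (simp add: inner_simps b.D_space_diff v.D_space_diff algebra_simps inner_commute add_divide_distrib diff_divide_distrib)

end

section \<open>Smooth test functions, and energy identities along one loop\<close>

lemma smooth_fun_derivative:
  assumes "smooth_fun f"
  shows "(f has_derivative frechet_derivative f (at x)) (at x)"
    and "continuous_on UNIV (\<lambda>x. frechet_derivative f (at x) h)"
proof -
  have d: "\<And>x. f differentiable (at x)" "\<And>h. smooth_fun (\<lambda>x. frechet_derivative f (at x) h)"
    using assms by (auto elim: smooth_fun.cases)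
  show "(f has_derivative frechet_derivative f (at x)) (at x)"
    using d(1) frechet_derivative_works by blast
  have "(\<lambda>x. frechet_derivative f (at x) h) differentiable (at x)" for x
    using d(2)[of h] by (auto elim: smooth_fun.cases)
  then show "continuous_on UNIV (\<lambda>x. frechet_derivative f (at x) h)"
    by (auto intro!: differentiable_imp_continuous_on simp: differentiable_on_def)
qed

lemma linear_inner_axis:
  fixes L :: "real ^ 'n \<Rightarrow> real"
  assumes "linear L"
  shows "(\<chi> j. L (axis j 1)) \<bullet> h = L h"
proof -
  have "L h = L (\<Sum>j\<in>UNIV. (h $ j) *\<^sub>R axis j 1)"
    using basis_expansion[of h] by (simp add: scalar_mult_eq_scaleR)
  also have "\<dots> = (\<Sum>j\<in>UNIV. (h $ j) * L (axis j 1))"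
    using assms by (simp add: linear_sum linear_cmul)
  finally show ?thesis by (simp add: inner_vec_def mult.commute)
qed

lemma torus_grad_inner:
  assumes "smooth_fun (\<lambda>y. \<phi> (abs_torus y))"
  shows "torus_grad \<phi> (abs_torus y) \<bullet> h = frechet_derivative (\<lambda>y. \<phi> (abs_torus y)) (at y) h"
  unfolding torus_grad_abs_torus
  by (rule linear_inner_axis[OF has_derivative_linear[OF smooth_fun_derivative(1)[OF assms]]])

lemma torus_grad_continuous:
  assumes "smooth_fun (\<lambda>y. \<phi> (abs_torus y))"
  shows "continuous_on UNIV (torus_grad \<phi>)"
  unfolding continuous_on_torus torus_grad_abs_torus
  by (intro continuous_intros smooth_fun_derivative(2)[OF assms])

lemma time_torus_derivatives:
  assumes \<phi>: "smooth_fun (\<lambda>(t, y). \<phi> (t, abs_torus y))"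
  shows "time_deriv UNIV \<phi> (t, abs_torus y) = frechet_derivative (\<lambda>(t, y). \<phi> (t, abs_torus y)) (at (t, y)) (1, 0)"
    and "torus_grad (\<lambda>q. \<phi> (t, q)) (abs_torus y) \<bullet> h = frechet_derivative (\<lambda>(t, y). \<phi> (t, abs_torus y)) (at (t, y)) (0, h)"
    and "continuous_on S (time_deriv UNIV \<phi>)"
    and "continuous_on S (\<lambda>(t, p). torus_grad (\<lambda>q. \<phi> (t, q)) p)"
proof -
  let ?f = "\<lambda>(t, y). \<phi> (t, abs_torus y)"
  note d = smooth_fun_derivative[OF \<phi>]
  have time: "time_deriv UNIV \<phi> (t, abs_torus y) = frechet_derivative ?f (at (t, y)) (1, 0)" for t y
  proof -
    have "((\<lambda>\<tau>. ?f (\<tau>, y)) has_derivative (\<lambda>k. frechet_derivative ?f (at (t, y)) (k, 0))) (at t)"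
      by (rule has_derivative_compose[OF _ d(1)]) (auto intro!: derivative_eq_intros)
    moreover have eq: "(\<lambda>k. k *\<^sub>R frechet_derivative ?f (at (t, y)) (1, 0)) = (\<lambda>k. frechet_derivative ?f (at (t, y)) (k, 0))"
      by (subst linear_cmul[OF has_derivative_linear[OF d(1)], symmetric]) simp
    ultimately have "((\<lambda>\<tau>. \<phi> (\<tau>, abs_torus y)) has_vector_derivative frechet_derivative ?f (at (t, y)) (1, 0)) (at t)"
      unfolding has_vector_derivative_def eq by (simp only: prod.case)
    then show ?thesis by (simp add: time_deriv_def vector_derivative_at)
  qed
  then show "time_deriv UNIV \<phi> (t, abs_torus y) = frechet_derivative ?f (at (t, y)) (1, 0)" .
  have space: "((\<lambda>y. \<phi> (t, abs_torus y)) has_derivative (\<lambda>h. frechet_derivative ?f (at (t, y)) (0, h))) (at y)" for t y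
  proof -
    have "((\<lambda>y. ?f (t, y)) has_derivative (\<lambda>h. frechet_derivative ?f (at (t, y)) (0, h))) (at y)"
      by (rule has_derivative_compose[OF _ d(1)]) (auto intro!: derivative_eq_intros)
    then show ?thesis by simp
  qed
  have grad: "torus_grad (\<lambda>q. \<phi> (t, q)) (abs_torus y) = (\<chi> j. frechet_derivative ?f (at (t, y)) (0, axis j 1))" for t y
    unfolding torus_grad_abs_torus using frechet_derivative_at[OF space[of t y]] by metis
  show "torus_grad (\<lambda>q. \<phi> (t, q)) (abs_torus y) \<bullet> h = frechet_derivative ?f (at (t, y)) (0, h)"
    unfolding grad by (rule linear_inner_axis[OF has_derivative_linear[OF space]])
  have "continuous_on (UNIV \<times> UNIV) (time_deriv UNIV \<phi>)"
    unfolding continuous_on_time_torus time using d(2)[of "(1, 0)"] by (simp add: case_prod_beta)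
  then show "continuous_on S (time_deriv UNIV \<phi>)" by (rule continuous_on_subset) simp
  have "continuous_on UNIV (\<lambda>z. \<chi> j. frechet_derivative ?f (at z) (0, axis j 1))"
    by (intro continuous_intros d(2))
  then have "continuous_on (UNIV \<times> UNIV) (\<lambda>(t, p). torus_grad (\<lambda>q. \<phi> (t, q)) p)"
    unfolding continuous_on_time_torus by (simp add: grad case_prod_beta)
  then show "continuous_on S (\<lambda>(t, p). torus_grad (\<lambda>q. \<phi> (t, q)) p)" by (rule continuous_on_subset) simp
qed

context heat_loop
begin

text \<open>The integrand is the derivative in \<open>s\<close> of the test function along the loop,
  and the loop closes up on the torus.\<close>

lemma grad_integral_zero:
  assumes \<phi>: "smooth_fun (\<lambda>y. \<phi> (abs_torus y))" and t: "t > 0"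
  shows "(LINT s|unit_lborel. torus_grad \<phi> (abs_torus (Y t s)) \<bullet> Ds t s) = 0"
proof -
  let ?f = "\<lambda>y. \<phi> (abs_torus y)"
  have c: "continuous_on {0..1} (\<lambda>s. torus_grad \<phi> (abs_torus (Y t s)) \<bullet> Ds t s)"
  proof (rule continuous_on_inner[OF _ Ds_section[OF t]])
    show "continuous_on {0..1} (\<lambda>s. torus_grad \<phi> (abs_torus (Y t s)))"
      by (rule continuous_on_compose2[OF torus_grad_continuous[OF \<phi>, unfolded continuous_on_torus] Y_section])
        (use t in auto)
  qed
  have "((\<lambda>s. torus_grad \<phi> (abs_torus (Y t s)) \<bullet> Ds t s) has_integral ?f (Y t 1) - ?f (Y t 0)) {0..1}"
  proof (rule fundamental_theorem_of_calculus)
    fix s :: real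
    have "((\<lambda>s. ?f (Y t s)) has_derivative (\<lambda>k. frechet_derivative ?f (at (Y t s)) (k *\<^sub>R Ds t s))) (at s)"
      using Ds[OF t, of s] unfolding has_vector_derivative_def
      by (rule has_derivative_compose[OF _ smooth_fun_derivative(1)[OF \<phi>]])
    then have "((\<lambda>s. ?f (Y t s)) has_vector_derivative torus_grad \<phi> (abs_torus (Y t s)) \<bullet> Ds t s) (at s)"
      unfolding has_vector_derivative_def torus_grad_inner[OF \<phi>]
      by (simp only: linear_cmul[OF has_derivative_linear[OF smooth_fun_derivative(1)[OF \<phi>]]])
    then show "((\<lambda>s. ?f (Y t s)) has_vector_derivative torus_grad \<phi> (abs_torus (Y t s)) \<bullet> Ds t s) (at s within {0..1})"
      by (rule has_vector_derivative_at_within)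
  qed simp
  moreover have "?f (Y t 1) = ?f (Y t 0)" using abs_torus_Y_period[of t 0] t by simp
  ultimately show ?thesis using c by (simp add: integral_interval_continuous has_integral_iff)
qed

text \<open>For a fixed label \<open>s\<close> the integrand is the time derivative of
  \<open>\<phi> (t, abs_torus (Y t s))\<close>, and the support of the test function avoids both
  ends of the time interval.\<close>

lemma transport_integral_zero:
  assumes \<phi>: "smooth_fun (\<lambda>(t, y). \<phi> (t, abs_torus y))" and \<alpha>: "0 < \<alpha>" "\<beta> < T" "T > 0"
    and supp: "\<And>t p. t \<notin> {\<alpha>..\<beta>} \<Longrightarrow> \<phi> (t, p) = 0"
  shows "(LINT t|interval_lborel 0 T. time_deriv UNIV \<phi> (t, abs_torus (Y t s))
      + torus_grad (\<lambda>q. \<phi> (t, q)) (abs_torus (Y t s)) \<bullet> Dt t s) = 0"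
proof -
  let ?f = "\<lambda>(t, y). \<phi> (t, abs_torus y)"
  let ?g = "\<lambda>t. time_deriv UNIV \<phi> (t, abs_torus (Y t s)) + torus_grad (\<lambda>q. \<phi> (t, q)) (abs_torus (Y t s)) \<bullet> Dt t s"
  note d = smooth_fun_derivative[OF \<phi>]
  note lin = has_derivative_linear[OF d(1)]
  have g: "?g t = frechet_derivative ?f (at (t, Y t s)) (1, Dt t s)" for t
    unfolding time_torus_derivatives[OF \<phi>] by (subst linear_add[OF lin, symmetric]) simp
  \<comment> \<open>\<open>a\<close> lies before the support and away from time zero, where
    \<open>Dt\<close> need not be a derivative; the bound \<open>T / 2\<close> keeps it below
    \<open>T\<close> even if \<alpha> is larger.\<close>
  define a where "a = min (\<alpha> / 2) (T / 2)"
  have a: "0 < a" "a < \<alpha>" "a < T" using \<alpha> by (auto simp: a_def)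
  \<comment> \<open>The test function vanishes on an open set of earlier times, so its full
    derivative is zero there. The times before \<open>a\<close> thus contribute nothing, whatever
    the value of \<open>Dt\<close> at time zero.\<close>
  have zero: "?g t = 0" if "t < \<alpha>" for t
  proof -
    have "((\<lambda>_. 0) has_derivative frechet_derivative ?f (at (t, Y t s))) (at (t, Y t s))"
    proof (rule has_derivative_transform_within_open[OF d(1)])
      show "open ({..<\<alpha>} \<times> (UNIV :: (real^'n) set))" by (intro open_Times) auto
    qed (use that supp in auto)
    from has_derivative_unique[OF this has_derivative_const] show ?thesis unfolding g by simp
  qed
  have c: "continuous_on {a..T} ?g"
  proof -
    have Yc: "continuous_on {a..T} (\<lambda>t. (t, Y t s))"
    proof -
      have "continuous_on {a..T} (\<lambda>t. (\<lambda>(t, s). Y t s) (t, s))"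
        by (rule continuous_on_compose2[OF Y_continuous]) (use a in \<open>auto intro!: continuous_intros\<close>)
      then show ?thesis by (auto intro!: continuous_intros)
    qed
    have Dc: "continuous_on {a..T} (\<lambda>t. Dt t s)"
    proof -
      have "continuous_on {a..T} (\<lambda>t. (\<lambda>(t, s). Dt t s) (t, s))"
        by (rule continuous_on_compose2[OF Dt_continuous]) (use a in \<open>auto intro!: continuous_intros\<close>)
      then show ?thesis by simp
    qed
    have "continuous_on UNIV (\<lambda>(t, y). time_deriv UNIV \<phi> (t, abs_torus y))"
      using time_torus_derivatives(3)[OF \<phi>, of "UNIV \<times> UNIV"] unfolding continuous_on_time_torus by simp
    from continuous_on_compose2[OF this Yc]
    have 1: "continuous_on {a..T} (\<lambda>t. time_deriv UNIV \<phi> (t, abs_torus (Y t s)))" by simp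
    have "continuous_on UNIV (\<lambda>(t, y). torus_grad (\<lambda>q. \<phi> (t, q)) (abs_torus y))"
      using time_torus_derivatives(4)[OF \<phi>, of "UNIV \<times> UNIV"] unfolding continuous_on_time_torus by simp
    from continuous_on_compose2[OF this Yc]
    have 2: "continuous_on {a..T} (\<lambda>t. torus_grad (\<lambda>q. \<phi> (t, q)) (abs_torus (Y t s)))" by simp
    show ?thesis by (intro continuous_intros 1 2 Dc)
  qed
  have "(?g has_integral ?f (T, Y T s) - ?f (a, Y a s)) {a..T}"
  proof (rule fundamental_theorem_of_calculus)
    fix t assume t: "t \<in> {a..T}"
    then have "t > 0" using a by simp
    have "((\<lambda>t. (t, Y t s)) has_derivative (\<lambda>k. (k, k *\<^sub>R Dt t s))) (at t)"
      using Dt[OF \<open>t > 0\<close>, of s] unfolding has_vector_derivative_def by (auto intro!: derivative_eq_intros)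
    from has_derivative_compose[OF this d(1)]
    have "((\<lambda>t. ?f (t, Y t s)) has_derivative (\<lambda>k. frechet_derivative ?f (at (t, Y t s)) (k *\<^sub>R (1, Dt t s)))) (at t)"
      by simp
    then have "((\<lambda>t. ?f (t, Y t s)) has_vector_derivative ?g t) (at t)"
      unfolding has_vector_derivative_def g by (simp only: linear_cmul[OF lin])
    then show "((\<lambda>t. ?f (t, Y t s)) has_vector_derivative ?g t) (at t within {a..T})"
      by (rule has_vector_derivative_at_within)
  qed (use a in simp)
  moreover have "?f (T, Y T s) = 0" "?f (a, Y a s) = 0" using supp a \<alpha> by auto
  ultimately have 1: "integral {a..T} ?g = 0" by (simp add: has_integral_iff)
  have "(LINT t|interval_lborel 0 T. ?g t) = (LINT t|lborel. indicator {0..T} t *\<^sub>R ?g t)"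
    by (simp add: lebesgue_integral_interval_lborel set_lebesgue_integral_def)
  also have "\<dots> = (LINT t|lborel. indicator {a..T} t *\<^sub>R ?g t)"
    using a zero by (intro Bochner_Integration.integral_cong) (auto split: split_indicator)
  also have "\<dots> = (LINT t|interval_lborel a T. ?g t)"
    by (simp add: lebesgue_integral_interval_lborel set_lebesgue_integral_def)
  also have "\<dots> = 0" using 1 integral_interval_continuous[OF c] by simp
  finally show ?thesis .
qed

text \<open>With zero field, half the energy of the tangent decreases at the rate of the integral of
  |Dt|^2. The total is at most half the energy at \<open>a\<close>, which decay bounds by its
  initial value.\<close>

lemma Dt_energy_le:
  assumes a: "0 < a" "a \<le> c"
  shows "(LINT t|interval_lborel a c. LINT s|unit_lborel. (norm (Dt t s))\<^sup>2) \<le> (LINT s|unit_lborel. (norm (Ds 0 s))\<^sup>2) / 2"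
proof -
  let ?F = "\<lambda>t. integral {0..1} (\<lambda>s. (norm (Ds t s))\<^sup>2 / 2)"
  have sub: "{a..c} \<times> {0..1} \<subseteq> {0<..} \<times> UNIV" using a by auto
  have Dc: "continuous_on ({a..c} \<times> {0..1}) (\<lambda>(t, s). (norm (Dt t s))\<^sup>2)"
    using continuous_on_subset[OF Dt_continuous sub] unfolding case_prod_beta by (intro continuous_intros)
  obtain N where N: "\<And>t s. t \<ge> 0 \<Longrightarrow> Y t (s + 1) = Y t s + N" by (rule Y_period) blast
  have "(?F has_real_derivative integral {0..1} (\<lambda>s. - (norm (Dt t s))\<^sup>2)) (at t within {a..c})" if t: "t \<in> {a..c}" for t
  proof -
    have "((\<lambda>t. integral {0..1} (\<lambda>s. (norm (Ds t s - 0))\<^sup>2 / 2)) has_real_derivative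
     integral {0..1} (\<lambda>s. - (norm (Dt t s))\<^sup>2 + Dt t s \<bullet> 0 - Ds t s \<bullet> 0 + 0 \<bullet> (0::real^'n)))
     (at t within {a..c})"
    proof (rule loop_energy_has_derivative[where u = Y and N = N])
      show "Y t 1 = Y t 0 + N" "Ds t 1 = Ds t 0" if "t \<in> {a..c}" for t
        using N[of t 0] Ds_period[of t 0] that a by auto
    qed (use a t in \<open>auto intro!: has_vector_derivative_at_within Ds Dss Dt
      continuous_on_subset[OF Ds_continuous sub] continuous_on_subset[OF Dt_continuous sub]\<close>)
    then show ?thesis by simp
  qed
  then have "((\<lambda>t. integral {0..1} (\<lambda>s. - (norm (Dt t s))\<^sup>2)) has_integral ?F c - ?F a) {a..c}"
    using a by (intro fundamental_theorem_of_calculus) (auto simp: has_real_derivative_iff_has_vector_derivative)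
  from has_integral_neg[OF this]
  have "((\<lambda>t. integral {0..1} (\<lambda>s. (norm (Dt t s))\<^sup>2)) has_integral ?F a - ?F c) {a..c}" by simp
  moreover have "(LINT t|interval_lborel a c. LINT s|unit_lborel. (norm (Dt t s))\<^sup>2) = integral {a..c} (\<lambda>t. LINT s|unit_lborel. (norm (Dt t s))\<^sup>2)"
    by (intro integral_interval_continuous continuous_on_integral_interval Dc)
  moreover have "\<dots> = integral {a..c} (\<lambda>t. integral {0..1} (\<lambda>s. (norm (Dt t s))\<^sup>2))"
    using a by (intro integral_cong integral_interval_continuous) (auto intro!: continuous_intros Dt_section)
  ultimately have "(LINT t|interval_lborel a c. LINT s|unit_lborel. (norm (Dt t s))\<^sup>2) = ?F a - ?F c"
    by (simp add: has_integral_iff)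
  moreover have "0 \<le> ?F c"
    using a by (intro integral_nonneg integrable_continuous_real) (auto intro!: continuous_intros Ds_section)
  moreover have "?F a = (LINT s|unit_lborel. (norm (Ds a s))\<^sup>2) / 2"
  proof -
    have "?F a = (LINT s|unit_lborel. (norm (Ds a s))\<^sup>2 / 2)"
      using a by (intro integral_interval_continuous[symmetric]) (auto intro!: continuous_intros Ds_section)
    then show ?thesis by simp
  qed
  ultimately show ?thesis using Ds_energy_le[of a] a by simp
qed

text \<open>The bound is independent of the lower endpoint, so monotone convergence along
  \<open>T / (n + 1)\<close> reaches time zero, although \<open>Dt\<close> itself may blow up
  there.\<close>

lemma nn_Dt_energy_le:
  assumes T: "T > 0"
  shows "(\<integral>\<^sup>+t. \<integral>\<^sup>+s. ennreal ((norm (Dt t s))\<^sup>2) \<partial>unit_lborel \<partial>interval_lborel 0 T)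
    \<le> ennreal ((LINT s|unit_lborel. (norm (Ds 0 s))\<^sup>2) / 2)" (is "?L \<le> ennreal ?R")
proof -
  let ?g = "\<lambda>t. LINT s|unit_lborel. (norm (Dt t s))\<^sup>2"
  define a where "a n = T / real (Suc n)" for n
  have a: "0 < a n" "a n \<le> T" for n using T by (auto simp: a_def divide_le_eq_1 field_simps)
  have a_dec: "a (Suc n) \<le> a n" for n using T by (auto simp: a_def intro!: divide_left_mono)
  have gs: "(\<integral>\<^sup>+s. ennreal ((norm (Dt t s))\<^sup>2) \<partial>unit_lborel) = ennreal (?g t)" if "t > 0" for t
    using that by (intro nn_integral_eq_integral integrable_interval_continuous) (auto intro!: continuous_intros Dt_section)
  have gc: "continuous_on {a n..c} ?g" for n c
  proof (rule continuous_on_integral_interval)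
    show "continuous_on ({a n..c} \<times> {0..1}) (\<lambda>(t, s). (norm (Dt t s))\<^sup>2)"
      using a[of n] unfolding case_prod_beta
      by (intro continuous_intros continuous_on_subset[OF Dt_continuous[unfolded case_prod_beta]]) auto
  qed
  have gn: "?g t \<ge> 0" for t by simp
  have "?L = (\<integral>\<^sup>+t. (\<integral>\<^sup>+s. ennreal ((norm (Dt t s))\<^sup>2) \<partial>unit_lborel) * indicator {0..T} t \<partial>lborel)"
    by (subst nn_integral_restrict_space) auto
  also have "\<dots> = (\<integral>\<^sup>+t. (SUP n. ennreal (?g t * indicator {a n..T} t)) \<partial>lborel)"
  proof (rule nn_integral_cong_AE)
    have "AE t in lborel. t \<noteq> (0::real)" by (rule AE_lborel_singleton)
    then show "AE t in lborel. (\<integral>\<^sup>+s. ennreal ((norm (Dt t s))\<^sup>2) \<partial>unit_lborel) * indicator {0..T} t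
      = (SUP n. ennreal (?g t * indicator {a n..T} t))"
    proof eventually_elim
      case (elim t)
      show ?case
      proof (cases "0 < t \<and> t \<le> T")
        case True
        obtain n where "T / t < real n" using reals_Archimedean2[of "T / t"] by blast
        then have "T / t < real (Suc n)" by simp
        then have n: "a n \<le> t" using True by (simp add: a_def field_simps)
        have "(SUP n. ennreal (?g t * indicator {a n..T} t)) = ennreal (?g t)"
        proof (rule antisym)
          show "(SUP n. ennreal (?g t * indicator {a n..T} t)) \<le> ennreal (?g t)"
            by (intro SUP_least ennreal_leI) (simp split: split_indicator)
          have "ennreal (?g t) = ennreal (?g t * indicator {a n..T} t)" using n True by simp
          also have "\<dots> \<le> (SUP n. ennreal (?g t * indicator {a n..T} t))" by (rule SUP_upper) simp
          finally show "ennreal (?g t) \<le> (SUP n. ennreal (?g t * indicator {a n..T} t))" .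
        qed
        then show ?thesis using True gs by simp
      next
        case False
        then have "t < 0 \<or> T < t" using elim by auto
        then have "t \<notin> {0..T}" "t \<notin> {a n..T}" for n using a(1)[of n] by auto
        then show ?thesis by simp
      qed
    qed
  qed
  also have "\<dots> = (SUP n. \<integral>\<^sup>+t. ennreal (?g t * indicator {a n..T} t) \<partial>lborel)"
  proof (rule nn_integral_monotone_convergence_SUP)
    show "incseq (\<lambda>n t. ennreal (?g t * indicator {a n..T} t))"
    proof (intro incseq_SucI le_funI ennreal_leI mult_left_mono gn)
      show "indicator {a n..T} t \<le> (indicator {a (Suc n)..T} t :: real)" for n t
        using a_dec[of n] by (simp split: split_indicator)
    qed
    show "(\<lambda>t. ennreal (?g t * indicator {a n..T} t)) \<in> borel_measurable lborel" for n
      using borel_measurable_continuous_on_indicator[OF _ gc[of n T]] by (auto simp: mult.commute)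
  qed
  also have "\<dots> \<le> ennreal ?R"
  proof (rule SUP_least)
    fix n
    have "(\<integral>\<^sup>+t. ennreal (?g t * indicator {a n..T} t) \<partial>lborel) = (\<integral>\<^sup>+t. ennreal (?g t) \<partial>interval_lborel (a n) T)"
      by (subst nn_integral_restrict_space) (auto intro!: nn_integral_cong split: split_indicator)
    also have "\<dots> = ennreal (LINT t|interval_lborel (a n) T. ?g t)"
      using gn by (intro nn_integral_eq_integral integrable_interval_continuous gc) auto
    also have "\<dots> \<le> ennreal ?R" by (intro ennreal_leI Dt_energy_le a)
    finally show "(\<integral>\<^sup>+t. ennreal (?g t * indicator {a n..T} t) \<partial>lborel) \<le> ennreal ?R" .
  qed
  finally show ?thesis .
qed

lemma field_derivatives:
  assumes "C1_derivative T w D"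
  shows "0 < t \<Longrightarrow> t \<le> T \<Longrightarrow> ((\<lambda>s. w (t, abs_torus (Y t s))) has_vector_derivative
      blinfun_apply (D (t, abs_torus (Y t s))) (0, Ds t s)) (at s within S)"
    and "0 < a \<Longrightarrow> c \<le> T \<Longrightarrow> t \<in> {a..c} \<Longrightarrow> ((\<lambda>t. w (t, abs_torus (Y t s))) has_vector_derivative
      blinfun_apply (D (t, abs_torus (Y t s))) (1, Dt t s)) (at t within {a..c})"
proof -
  interpret C1_derivative T w D by fact
  show "((\<lambda>s. w (t, abs_torus (Y t s))) has_vector_derivative
      blinfun_apply (D (t, abs_torus (Y t s))) (0, Ds t s)) (at s within S)" if t: "0 < t" "t \<le> T"
  proof (rule has_vector_derivative_at_within)
    have "((\<lambda>s. (t, Y t s)) has_vector_derivative (0, Ds t s)) (at s)"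
      using Ds[OF t(1), of s] unfolding has_vector_derivative_def by (auto intro!: derivative_eq_intros)
    from chain[OF this] t show "((\<lambda>s. w (t, abs_torus (Y t s))) has_vector_derivative
      blinfun_apply (D (t, abs_torus (Y t s))) (0, Ds t s)) (at s)" by (simp add: image_subset_iff)
  qed
  show "((\<lambda>t. w (t, abs_torus (Y t s))) has_vector_derivative
      blinfun_apply (D (t, abs_torus (Y t s))) (1, Dt t s)) (at t within {a..c})"
    if a: "0 < a" "c \<le> T" "t \<in> {a..c}"
  proof -
    have "((\<lambda>t. (t, Y t s)) has_vector_derivative (1, Dt t s)) (at t within {a..c})"
      using has_vector_derivative_at_within[OF Dt[of t s]] a unfolding has_vector_derivative_def
      by (auto intro!: derivative_eq_intros)
    from chain[OF this] a show ?thesis by (simp add: image_subset_iff)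
  qed
qed

text \<open>\<open>loop_energy_has_derivative\<close> is applied with \<open>b\<close> along the
  loop as the field \<open>w\<close>; the dissipation identity rewrites the result, and the
  exponential weight accounts for the term with \<open>r\<close>. Starting at \<open>a > 0\<close>
  keeps all derivatives classical.\<close>

lemma dissipation_balance:
  fixes r :: real
  assumes "C1_fields T b Db v Dv" and a: "0 < a" "a \<le> c" "c \<le> T"
  defines "E \<equiv> \<lambda>t. LINT s|unit_lborel. (norm (Ds t s - b (t, abs_torus (Y t s))))\<^sup>2 / 2"
    and "d \<equiv> \<lambda>t s. exp (- r * t) * C1_fields.dissipation T b v r (t, abs_torus (Y t s)) (Ds t s) (Dt t s)"
  shows "continuous_on ({a..c} \<times> {0..1}) (\<lambda>(t, s). d t s)"
    and "exp (- r * c) * E c + (LINT t|interval_lborel a c. LINT s|unit_lborel. d t s) = exp (- r * a) * E a"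
proof -
  interpret C1_fields T b Db v Dv by fact
  let ?z = "\<lambda>t s. (t, abs_torus (Y t s))"
  have z: "fst (?z t s) \<in> {0..T}" if "t \<in> {a..c}" for t s using that a by auto
  have sub: "{a..c} \<times> {0..1} \<subseteq> {0<..} \<times> UNIV" using a by auto
  have sub': "{a..c} \<times> UNIV \<subseteq> {0..T} \<times> UNIV" using a by auto
  note Dsc = continuous_on_subset[OF Ds_continuous sub, unfolded case_prod_beta]
  note Dtc = continuous_on_subset[OF Dt_continuous sub, unfolded case_prod_beta]
  note fc = test_field_continuous[OF continuous_on_subset[OF _ sub'] less_imp_le[OF a(1)], unfolded case_prod_beta]
  note bc = fc[OF b.field_continuous] and vc = fc[OF v.field_continuous]
    and Dbc = fc[OF b.D_continuous] and Dvc = fc[OF v.D_continuous]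
  note cs = Dsc Dtc bc vc Dbc Dvc
  show dc: "continuous_on ({a..c} \<times> {0..1}) (\<lambda>(t, s). d t s)"
    unfolding case_prod_beta
  \<comment> \<open>Continuity of \<open>d\<close> is read off the dissipation identity, whose other
    terms contain only the fields, their derivatives and the derivatives of the loop.\<close>
  proof (rule continuous_on_eq)
    let ?p = "\<lambda>x. Ds (fst x) (snd x)" and ?q = "\<lambda>x. Dt (fst x) (snd x)" and ?y = "\<lambda>x. ?z (fst x) (snd x)"
    let ?m = "\<lambda>x. - (norm (?q x))\<^sup>2 + ?q x \<bullet> Db (?y x) (0, ?p x) - ?p x \<bullet> Db (?y x) (1, ?q x) + b (?y x) \<bullet> Db (?y x) (1, ?q x)
       - r * ((norm (?p x - b (?y x)))\<^sup>2 / 2)"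
    let ?n = "\<lambda>x. v (?y x) \<bullet> (?q x - Db (?y x) (0, ?p x)) + Dv (?y x) (0, ?p x) \<bullet> (?p x - b (?y x))"
    show "continuous_on ({a..c} \<times> {0..1}) (\<lambda>x. exp (- r * fst x) * (- (?m x) - ?n x))"
      by (intro continuous_intros cs) auto
    show "exp (- r * fst x) * (- (?m x) - ?n x) = d (fst x) (snd x)" if "x \<in> {a..c} \<times> {0..1}" for x
    proof -
      have "fst (?y x) \<in> {0..T}" using that z by (auto simp: mem_Times_iff)
      from dissipation_identity[OF this, of "?q x" "?p x" r]
      have "dissipation r (?y x) (?p x) (?q x) = - ?m x - ?n x" by linarith
      then show ?thesis by (simp only: d_def)
    qed
  qed
  define F where "F t = integral {0..1} (\<lambda>s. (norm (Ds t s - b (?z t s)))\<^sup>2 / 2)" for t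
  define k where "k t = integral {0..1} (d t)" for t
  obtain N where N: "\<And>t s. t \<ge> 0 \<Longrightarrow> Y t (s + 1) = Y t s + N" by (rule Y_period) blast
  have per: "abs_torus (Y t 1) = abs_torus (Y t 0)" "Ds t 1 = Ds t 0" "Y t 1 = Y t 0 + N" if "t \<in> {a..c}" for t
    using abs_torus_Y_period[of t 0] Ds_period[of t 0] N[of t 0] that a by auto
  have der: "((\<lambda>t. exp (- r * t) * F t) has_real_derivative - k t) (at t within {a..c})" if t: "t \<in> {a..c}" for t
  proof -
    have sec: "continuous_on {0..1} (f t)" if "continuous_on ({a..c} \<times> {0..1}) (\<lambda>x. f (fst x) (snd x))" for f :: "real \<Rightarrow> real \<Rightarrow> 'd::topological_space"
      using continuous_on_section[of "{a..c}" "{0..1}" f t] that t by (simp add: case_prod_beta)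
    note ss = sec[OF Dsc] sec[OF Dtc] sec[OF bc] sec[OF vc] sec[OF Dbc] sec[OF Dvc]
    let ?g = "\<lambda>s. - (norm (Dt t s))\<^sup>2 + Dt t s \<bullet> Db (?z t s) (0, Ds t s) - Ds t s \<bullet> Db (?z t s) (1, Dt t s) + b (?z t s) \<bullet> Db (?z t s) (1, Dt t s)"
    let ?e = "\<lambda>s. (norm (Ds t s - b (?z t s)))\<^sup>2 / 2"
    let ?n = "\<lambda>s. v (?z t s) \<bullet> (Dt t s - Db (?z t s) (0, Ds t s)) + Dv (?z t s) (0, Ds t s) \<bullet> (Ds t s - b (?z t s))"
    have "(F has_real_derivative integral {0..1} ?g) (at t within {a..c})"
      unfolding F_def
    proof (rule loop_energy_has_derivative[where u = Y and N = N])
      fix t s :: real assume ts: "t \<in> {a..c}" "s \<in> {0..1}"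
      then have t: "t > 0" "t \<le> T" using a by auto
      show "(Y t has_vector_derivative Ds t s) (at s within {0..1})" "(Ds t has_vector_derivative Dt t s) (at s within {0..1})"
         "((\<lambda>t. Y t s) has_vector_derivative Dt t s) (at t within {a..c})"
        using t by (auto intro!: has_vector_derivative_at_within Ds Dss Dt)
      show "((\<lambda>s. b (?z t s)) has_vector_derivative Db (?z t s) (0, Ds t s)) (at s within {0..1})"
        by (rule field_derivatives(1)[OF b.C1_derivative_axioms t])
      show "((\<lambda>t. b (?z t s)) has_vector_derivative Db (?z t s) (1, Dt t s)) (at t within {a..c})"
        by (rule field_derivatives(2)[OF b.C1_derivative_axioms a(1,3) ts(1)])
    next
      show "continuous_on ({a..c} \<times> {0..1}) (\<lambda>(t, s). Ds t s)" "continuous_on ({a..c} \<times> {0..1}) (\<lambda>(t, s). Dt t s)"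
        "continuous_on ({a..c} \<times> {0..1}) (\<lambda>(t, s). b (?z t s))"
        "continuous_on ({a..c} \<times> {0..1}) (\<lambda>(t, s). Db (?z t s) (0, Ds t s))"
        "continuous_on ({a..c} \<times> {0..1}) (\<lambda>(t, s). Db (?z t s) (1, Dt t s))"
        unfolding case_prod_beta by (intro continuous_intros cs)+
      show "Y t 1 = Y t 0 + N" "Ds t 1 = Ds t 0" "b (?z t 1) = b (?z t 0)" if "t \<in> {a..c}" for t
        using per[OF that] by simp_all
    qed (rule t)
    then have 1: "((\<lambda>t. exp (- r * t) * F t) has_real_derivative exp (- r * t) * (integral {0..1} ?g - r * F t)) (at t within {a..c})"
      by (auto intro!: derivative_eq_intros simp: algebra_simps)
    \<comment> \<open>The remainder of the identity is exact: its antiderivative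
      \<open>v \<bullet> (Ds - b)\<close> along the loop is periodic in \<open>s\<close>.\<close>
    have n0: "integral {0..1} ?n = 0"
    proof -
      have "(?n has_integral v (?z t 1) \<bullet> (Ds t 1 - b (?z t 1)) - v (?z t 0) \<bullet> (Ds t 0 - b (?z t 0))) {0..1}"
      proof (rule fundamental_theorem_of_calculus)
        fix s :: real assume s: "s \<in> {0..1}"
        have tt: "0 < t" "t \<le> T" using t a by auto
        show "((\<lambda>s. v (?z t s) \<bullet> (Ds t s - b (?z t s))) has_vector_derivative ?n s) (at s within {0..1})"
          using tt by (intro bounded_bilinear.has_vector_derivative[OF bounded_bilinear_inner] derivative_intros
              field_derivatives(1)[OF v.C1_derivative_axioms] field_derivatives(1)[OF b.C1_derivative_axioms]
              has_vector_derivative_at_within[OF Dss]) auto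
      qed simp
      then show ?thesis using per[OF t] by (simp add: has_integral_iff)
    qed
    have nc: "continuous_on {0..1} ?n" by (intro continuous_intros ss)
    have gc: "continuous_on {0..1} ?g" by (intro continuous_intros ss)
    have ec: "continuous_on {0..1} ?e" by (intro continuous_intros ss) auto
    have "integral {0..1} ?g - r * F t = integral {0..1} ?g - integral {0..1} (\<lambda>s. r * ?e s)"
      by (simp add: F_def)
    also have "\<dots> = integral {0..1} (\<lambda>s. ?g s - r * ?e s)"
      by (intro integral_diff[symmetric] integrable_continuous_real gc continuous_on_mult continuous_on_const ec)
    also have "\<dots> = integral {0..1} (\<lambda>s. - dissipation r (?z t s) (Ds t s) (Dt t s) - ?n s)"
      by (intro integral_cong) (rule dissipation_identity[OF z[OF t]])
    also have "\<dots> = integral {0..1} (\<lambda>s. - dissipation r (?z t s) (Ds t s) (Dt t s)) - integral {0..1} ?n"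
    proof (rule integral_diff)
      have "continuous_on {0..1} (d t)" using sec[of d] dc by (simp add: case_prod_beta)
      then have "continuous_on {0..1} (\<lambda>s. - (exp (r * t) * d t s))" by (intro continuous_intros)
      then have "continuous_on {0..1} (\<lambda>s. - dissipation r (?z t s) (Ds t s) (Dt t s))"
        by (simp add: d_def mult.assoc[symmetric] exp_add[symmetric])
      then show "(\<lambda>s. - dissipation r (?z t s) (Ds t s) (Dt t s)) integrable_on {0..1}" by (rule integrable_continuous_real)
      show "?n integrable_on {0..1}" using nc by (rule integrable_continuous_real)
    qed
    finally have "exp (- r * t) * (integral {0..1} ?g - r * F t) = - k t"
      using n0 by (simp add: k_def d_def)
    with 1 show ?thesis by simp
  qed
  have "((\<lambda>t. - k t) has_integral exp (- r * c) * F c - exp (- r * a) * F a) {a..c}"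
    using a der by (intro fundamental_theorem_of_calculus) (auto simp: has_real_derivative_iff_has_vector_derivative)
  from has_integral_neg[OF this]
  have 1: "integral {a..c} k = exp (- r * a) * F a - exp (- r * c) * F c" by (simp add: has_integral_iff)
  have "(LINT t|interval_lborel a c. LINT s|unit_lborel. d t s) = integral {a..c} (\<lambda>t. LINT s|unit_lborel. d t s)"
    by (intro integral_interval_continuous continuous_on_integral_interval dc)
  also have "\<dots> = integral {a..c} k"
    unfolding k_def by (intro integral_cong integral_interval_continuous continuous_on_section[OF dc])
  also note 1
  finally have 2: "(LINT t|interval_lborel a c. LINT s|unit_lborel. d t s) = exp (- r * a) * F a - exp (- r * c) * F c" .
  have FE: "E t = F t" if "t \<in> {a..c}" for t
  proof -
    have "continuous_on {0..1} (Ds t)" "continuous_on {0..1} (\<lambda>s. b (?z t s))"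
      using that Dsc bc continuous_on_section[of "{a..c}" "{0..1}" "\<lambda>t. Ds t" t]
        continuous_on_section[of "{a..c}" "{0..1}" "\<lambda>t s. b (?z t s)" t] by (auto simp: case_prod_beta)
    then show ?thesis unfolding E_def F_def by (intro integral_interval_continuous continuous_intros) auto
  qed
  show "exp (- r * c) * E c + (LINT t|interval_lborel a c. LINT s|unit_lborel. d t s) = exp (- r * a) * E a"
    unfolding 2 using a by (simp add: FE)
qed

end

section \<open>Conditional expectation and the quadratic energy\<close>

lemma integrable_mult_L2:
  fixes f g :: "'a \<Rightarrow> real"
  assumes [measurable]: "f \<in> borel_measurable M" "g \<in> borel_measurable M"
    and "integrable M (\<lambda>x. (f x)\<^sup>2)" "integrable M (\<lambda>x. (g x)\<^sup>2)"
  shows "integrable M (\<lambda>x. f x * g x)"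
proof (rule Bochner_Integration.integrable_bound)
  show "integrable M (\<lambda>x. (f x)\<^sup>2 + (g x)\<^sup>2)" using assms by simp
  show "AE x in M. norm (f x * g x) \<le> norm ((f x)\<^sup>2 + (g x)\<^sup>2)"
  proof (rule AE_I2)
    fix x
    have "\<bar>f x * g x\<bar> = \<bar>f x\<bar> * \<bar>g x\<bar>" by (simp add: abs_mult)
    also have "\<dots> \<le> (f x)\<^sup>2 + (g x)\<^sup>2"
      using sum_squares_bound[of "\<bar>f x\<bar>" "\<bar>g x\<bar>"] mult_nonneg_nonneg[OF abs_ge_zero abs_ge_zero, of "f x" "g x"]
      unfolding mult.assoc power2_abs by linarith
    finally show "norm (f x * g x) \<le> norm ((f x)\<^sup>2 + (g x)\<^sup>2)" by simp
  qed
qed simp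

text \<open>The conditional expectation of \<open>f\<close> given \<open>Z\<close>, as a function of the value of \<open>Z\<close>.\<close>

lemma (in finite_measure) pushforward_density_nonneg:
  fixes f :: "'a \<Rightarrow> real"
  assumes Z [measurable]: "Z \<in> M \<rightarrow>\<^sub>M N" and f [measurable]: "f \<in> borel_measurable M" and f0: "\<And>x. 0 \<le> f x"
    and f2: "integrable M (\<lambda>x. (f x)\<^sup>2)"
  obtains u where "u \<in> borel_measurable N" "integrable (distr M N Z) (\<lambda>x. (u x)\<^sup>2)"
    "\<And>\<phi>. \<phi> \<in> borel_measurable N \<Longrightarrow> (LINT x|M. \<phi> (Z x) * f x) = (LINT y|distr M N Z. \<phi> y * u y)"
proof -
  let ?D = "distr M N Z" and ?\<nu> = "distr (density M f) N Z"
  interpret D: finite_measure ?D by (rule finite_measure_distr) simp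
  have fi: "integrable M f"
    using integrable_mult_L2[of "\<lambda>_. 1" M f] f2 by simp
  have "absolutely_continuous ?D ?\<nu>"
    unfolding absolutely_continuous_def
  proof
    fix A assume A: "A \<in> null_sets ?D"
    then have [measurable]: "A \<in> sets N" and "Z -` A \<inter> space M \<in> null_sets M"
      by (auto simp: null_sets_distr_iff)
    then have "Z -` A \<inter> space M \<in> null_sets (density M f)"
      using absolutely_continuousI_density[of f M] by (auto simp: absolutely_continuous_def)
    then show "A \<in> null_sets ?\<nu>" by (subst null_sets_distr_iff) auto
  qed
  then obtain g where g: "g \<in> borel_measurable ?D" "density ?D g = ?\<nu>"
    using D.Radon_Nikodym[of ?\<nu>] by auto
  have gm [measurable]: "g \<in> borel_measurable N" using g(1) by simp
  have "(\<integral>\<^sup>+y. g y \<partial>?D) = emeasure (density ?D g) (space N)"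
    by (subst emeasure_density) (auto intro!: nn_integral_cong simp: space_distr)
  also have "\<dots> = (\<integral>\<^sup>+x. f x \<partial>M)"
    unfolding g(2) by (subst emeasure_distr) (auto simp: emeasure_density intro!: nn_integral_cong split: split_indicator dest: measurable_space[OF Z])
  also have "\<dots> < \<infinity>" using fi f0 by (subst nn_integral_eq_integral) auto
  finally have gfin: "(\<integral>\<^sup>+y. g y \<partial>?D) < \<infinity>" .
  then have AEg: "AE y in ?D. g y \<noteq> \<infinity>" by (intro nn_integral_noteq_infinite) auto
  define u where "u y = enn2real (g y)" for y
  have um [measurable]: "u \<in> borel_measurable N" unfolding u_def by simp
  have u0: "0 \<le> u y" for y by (simp add: u_def)
  have gu: "AE y in ?D. g y = ennreal (u y)"
    using AEg by eventually_elim (simp add: u_def less_top)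
  have dens: "density ?D (\<lambda>y. ennreal (u y)) = ?\<nu>"
    unfolding g(2)[symmetric] using gu by (intro density_cong) (auto elim: eventually_mono)
  have id: "(LINT x|M. \<phi> (Z x) * f x) = (LINT y|?D. \<phi> y * u y)" if [measurable]: "\<phi> \<in> borel_measurable N" for \<phi> :: "'b \<Rightarrow> real"
  proof -
    have "(LINT y|?D. \<phi> y * u y) = (LINT y|density ?D (\<lambda>y. ennreal (u y)). \<phi> y)"
      using u0 by (subst integral_density) (auto simp: mult.commute)
    also have "\<dots> = (LINT x|density M f. \<phi> (Z x))"
      unfolding dens by (rule integral_distr) auto
    also have "\<dots> = (LINT x|M. \<phi> (Z x) * f x)"
      using f0 by (subst integral_density) (auto simp: mult.commute)
    finally show ?thesis by simp
  qed
  have ui: "integrable ?D u"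
  proof (rule integrableI_nonneg)
    have "(\<integral>\<^sup>+y. ennreal (u y) \<partial>?D) = (\<integral>\<^sup>+y. g y \<partial>?D)" using gu by (intro nn_integral_cong_AE) auto
    then show "(\<integral>\<^sup>+y. ennreal (u y) \<partial>?D) < \<infinity>" using gfin by simp
  qed (use u0 in auto)
  \<comment> \<open>Square integrability of \<open>u\<close> is still open, so \<open>u\<close> is
    truncated. Testing with v = min u n, the integral of v^2 is at most that of v u, which equals
    that of v(Z) f and is at most half the sum of the integrals of v^2 and f^2. Absorbing v^2 leaves
    a bound free of \<open>n\<close>, and Fatou's lemma removes the truncation.\<close>
  have trunc: "(\<integral>\<^sup>+y. ennreal ((min (u y) (real n))\<^sup>2) \<partial>?D) \<le> ennreal (LINT x|M. (f x)\<^sup>2)" for n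
  proof -
    let ?v = "\<lambda>y. min (u y) (real n)"
    have v: "0 \<le> ?v y" "?v y \<le> real n" "?v y \<le> u y" for y using u0[of y] by auto
    have vi: "integrable ?D (\<lambda>y. (?v y)\<^sup>2)"
    proof (rule D.integrable_const_bound)
      show "AE y in ?D. norm ((?v y)\<^sup>2) \<le> (real n)\<^sup>2"
        using power_mono[OF v(2) v(1), of _ 2] by (intro AE_I2) simp
    qed simp
    have vZ: "integrable M (\<lambda>x. (?v (Z x))\<^sup>2)" and vZe: "(LINT x|M. (?v (Z x))\<^sup>2) = (LINT y|?D. (?v y)\<^sup>2)"
      using vi integrable_distr_eq[OF Z, of "\<lambda>y. (?v y)\<^sup>2"] integral_distr[OF Z, of "\<lambda>y. (?v y)\<^sup>2"] by auto
    have vui: "integrable ?D (\<lambda>y. ?v y * u y)"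
    proof (rule Bochner_Integration.integrable_bound)
      show "integrable ?D (\<lambda>y. real n * u y)" using ui by simp
      show "AE y in ?D. norm (?v y * u y) \<le> norm (real n * u y)"
        using mult_right_mono[OF v(2) u0] v(1) u0 by (intro AE_I2) (simp add: abs_mult)
    qed simp
    have "(LINT y|?D. (?v y)\<^sup>2) \<le> (LINT y|?D. ?v y * u y)"
    proof (rule integral_mono[OF vi vui])
      show "(?v y)\<^sup>2 \<le> ?v y * u y" for y using mult_left_mono[OF v(3) v(1)] by (simp add: power2_eq_square)
    qed
    also have "\<dots> = (LINT x|M. ?v (Z x) * f x)" by (rule id[symmetric]) simp
    also have "\<dots> \<le> (LINT x|M. (?v (Z x))\<^sup>2 / 2 + (f x)\<^sup>2 / 2)"
      using vZ f2
    proof (intro integral_mono integrable_mult_L2)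
      show "?v (Z x) * f x \<le> (?v (Z x))\<^sup>2 / 2 + (f x)\<^sup>2 / 2" for x
        using sum_squares_bound[of "?v (Z x)" "f x"] by simp
    qed auto
    also have "\<dots> = (LINT y|?D. (?v y)\<^sup>2) / 2 + (LINT x|M. (f x)\<^sup>2) / 2" using vZ f2 by (simp add: vZe)
    finally have "(LINT y|?D. (?v y)\<^sup>2) \<le> (LINT x|M. (f x)\<^sup>2)" by simp
    then show ?thesis using vi by (subst nn_integral_eq_integral) (auto intro: ennreal_leI)
  qed
  have "(\<integral>\<^sup>+y. ennreal ((u y)\<^sup>2) \<partial>?D) \<le> ennreal (LINT x|M. (f x)\<^sup>2)"
  proof -
    have "(\<integral>\<^sup>+y. ennreal ((u y)\<^sup>2) \<partial>?D) \<le> (\<integral>\<^sup>+y. liminf (\<lambda>n. ennreal ((min (u y) (real n))\<^sup>2)) \<partial>?D)"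
    proof (rule nn_integral_mono)
      fix y
      obtain k where "u y < real k" using reals_Archimedean2 by blast
      then have "\<forall>\<^sub>F n in sequentially. ennreal ((u y)\<^sup>2) = ennreal ((min (u y) (real n))\<^sup>2)"
        unfolding eventually_sequentially by (intro exI[of _ k] allI impI) (simp add: min_absorb1)
      then have "(\<lambda>n. ennreal ((min (u y) (real n))\<^sup>2)) \<longlonglongrightarrow> ennreal ((u y)\<^sup>2)"
        by (rule Lim_transform_eventually[OF tendsto_const])
      then show "ennreal ((u y)\<^sup>2) \<le> liminf (\<lambda>n. ennreal ((min (u y) (real n))\<^sup>2))"
        by (subst lim_imp_Liminf[of sequentially]) auto
    qed
    also have "\<dots> \<le> liminf (\<lambda>n. \<integral>\<^sup>+y. ennreal ((min (u y) (real n))\<^sup>2) \<partial>?D)"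
      by (rule nn_integral_liminf) auto
    also have "\<dots> \<le> ennreal (LINT x|M. (f x)\<^sup>2)"
      using trunc by (intro Liminf_le) (auto intro: always_eventually)
    finally show ?thesis .
  qed
  then have "integrable ?D (\<lambda>y. (u y)\<^sup>2)"
    by (intro integrableI_nonneg) (auto intro: le_less_trans)
  then show thesis by (intro that[of u] id) auto
qed

text \<open>Positive and negative part of \<open>f\<close> are treated separately; square integrable
  test functions keep both integrals finite, so that they may be subtracted.\<close>

lemma (in finite_measure) pushforward_density:
  fixes f :: "'a \<Rightarrow> real"
  assumes Z [measurable]: "Z \<in> M \<rightarrow>\<^sub>M N" and f [measurable]: "f \<in> borel_measurable M"
    and f2: "integrable M (\<lambda>x. (f x)\<^sup>2)"
  obtains u where "u \<in> borel_measurable N" "integrable (distr M N Z) (\<lambda>x. (u x)\<^sup>2)"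
    "\<And>\<phi>. \<phi> \<in> borel_measurable N \<Longrightarrow> integrable (distr M N Z) (\<lambda>x. (\<phi> x)\<^sup>2) \<Longrightarrow>
      (LINT x|M. \<phi> (Z x) * f x) = (LINT y|distr M N Z. \<phi> y * u y)"
proof -
  let ?D = "distr M N Z"
  have p2: "integrable M (\<lambda>x. (max 0 (f x))\<^sup>2)" "integrable M (\<lambda>x. (max 0 (- f x))\<^sup>2)"
    by (intro Bochner_Integration.integrable_bound[OF f2]; force simp: max_def)+
  obtain u where u [measurable]: "u \<in> borel_measurable N" and u2: "integrable ?D (\<lambda>x. (u x)\<^sup>2)"
    and ui: "\<And>\<phi>. \<phi> \<in> borel_measurable N \<Longrightarrow> (LINT x|M. \<phi> (Z x) * max 0 (f x)) = (LINT y|?D. \<phi> y * u y)"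
    by (rule pushforward_density_nonneg[OF Z _ _ p2(1)]) auto
  obtain v where v [measurable]: "v \<in> borel_measurable N" and v2: "integrable ?D (\<lambda>x. (v x)\<^sup>2)"
    and vi: "\<And>\<phi>. \<phi> \<in> borel_measurable N \<Longrightarrow> (LINT x|M. \<phi> (Z x) * max 0 (- f x)) = (LINT y|?D. \<phi> y * v y)"
    by (rule pushforward_density_nonneg[OF Z _ _ p2(2)]) auto
  show thesis
  proof (rule that[of "\<lambda>y. u y - v y"])
    show "integrable ?D (\<lambda>x. (u x - v x)\<^sup>2)"
      using u2 v2 integrable_mult_L2[of u ?D v] by (simp add: power2_diff mult.assoc)
    fix \<phi> :: "'b \<Rightarrow> real" assume [measurable]: "\<phi> \<in> borel_measurable N" and \<phi>: "integrable ?D (\<lambda>x. (\<phi> x)\<^sup>2)"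
    have \<phi>Z: "integrable M (\<lambda>x. (\<phi> (Z x))\<^sup>2)"
      using \<phi> integrable_distr_eq[OF Z, of "\<lambda>x. (\<phi> x)\<^sup>2"] by simp
    have "(LINT x|M. \<phi> (Z x) * f x) = (LINT x|M. \<phi> (Z x) * max 0 (f x) - \<phi> (Z x) * max 0 (- f x))"
      by (intro Bochner_Integration.integral_cong) (auto simp: max_def)
    also have "\<dots> = (LINT x|M. \<phi> (Z x) * max 0 (f x)) - (LINT x|M. \<phi> (Z x) * max 0 (- f x))"
      using \<phi>Z p2 by (intro Bochner_Integration.integral_diff integrable_mult_L2) auto
    also have "\<dots> = (LINT y|?D. \<phi> y * u y) - (LINT y|?D. \<phi> y * v y)" by (simp add: ui vi)
    also have "\<dots> = (LINT y|?D. \<phi> y * u y - \<phi> y * v y)"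
      using \<phi> u2 v2 by (intro Bochner_Integration.integral_diff[symmetric] integrable_mult_L2) auto
    finally show "(LINT x|M. \<phi> (Z x) * f x) = (LINT y|?D. \<phi> y * (u y - v y))" by (simp add: right_diff_distrib)
  qed simp
qed

lemma inner_matrix_vector_sum:
  "x \<bullet> (A *v y) = (\<Sum>i\<in>UNIV. \<Sum>j\<in>UNIV. A $ i $ j * x $ i * y $ j)" for x :: "real ^ 'm::finite"
  by (simp add: inner_vec_def matrix_vector_mult_def sum_distrib_left mult.assoc mult.left_commute)

lemma borel_measurable_vec_nth [measurable (raw)]:
  fixes f :: "'a \<Rightarrow> real ^ 'm::finite"
  assumes "f \<in> borel_measurable M"
  shows "(\<lambda>x. f x $ i) \<in> borel_measurable M"
proof -
  have "(\<lambda>v :: real ^ 'm. v $ i) \<in> borel_measurable borel"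
    by (intro borel_measurable_continuous_onI continuous_intros)
  from measurable_compose[OF assms this] show ?thesis .
qed

lemma borel_measurable_vec_lambda:
  fixes f :: "'m::finite \<Rightarrow> 'a \<Rightarrow> real"
  assumes "\<And>i. f i \<in> borel_measurable M"
  shows "(\<lambda>x. \<chi> i. f i x) \<in> borel_measurable M"
  by (subst borel_measurable_euclidean_space) (auto simp: Basis_vec_def inner_axis assms)

lemma integrable_component_sq:
  fixes w :: "'a \<Rightarrow> real ^ 'm::finite"
  assumes [measurable]: "w \<in> borel_measurable M" and w: "integrable M (\<lambda>x. (norm (w x))\<^sup>2)"
  shows "integrable M (\<lambda>x. (w x $ i)\<^sup>2)"
proof (rule Bochner_Integration.integrable_bound[OF w])
  show "AE x in M. norm ((w x $ i)\<^sup>2) \<le> norm ((norm (w x))\<^sup>2)"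
    using component_le_norm_cart by (intro AE_I2) (simp add: abs_le_square_iff[symmetric])
qed simp

text \<open>Jensen's inequality for the conditional expectation \<open>u\<close> of \<open>w\<close> given \<open>Z\<close>: the cross terms of the
  nonnegative integral of \<open>(w - u \<circ> Z)\<^sup>T Q (w - u \<circ> Z)\<close> are evaluated by the defining property of \<open>u\<close>.\<close>

lemma quad_energy_le:
  fixes Z :: "'a \<Rightarrow> 'b::topological_space" and w :: "'a \<Rightarrow> real ^ 'm::finite"
  assumes fin: "finite_measure \<Lambda>" and Z [measurable]: "Z \<in> \<Lambda> \<rightarrow>\<^sub>M restrict_space borel S"
    and w [measurable]: "w \<in> borel_measurable \<Lambda>" and w2: "integrable \<Lambda> (\<lambda>x. (norm (w x))\<^sup>2)"
    and S: "compact S" and Q: "continuous_on S Q"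
    and Q0: "\<And>z \<xi>. z \<in> S \<Longrightarrow> 0 \<le> \<xi> \<bullet> (Q z *v \<xi>)"
    and \<rho>: "\<And>\<phi>. continuous_on S \<phi> \<Longrightarrow> \<rho> \<phi> = (LINT x|\<Lambda>. \<phi> (Z x))"
    and U: "\<And>\<Phi>. continuous_on S \<Phi> \<Longrightarrow> U \<Phi> = (LINT x|\<Lambda>. \<Phi> (Z x) \<bullet> w x)"
  shows "quad_energy S Q \<rho> U \<le> ereal (LINT x|\<Lambda>. (w x \<bullet> (Q (Z x) *v w x)) / 2)"
proof -
  interpret finite_measure \<Lambda> by fact
  let ?N = "restrict_space borel S"
  let ?M = "distr \<Lambda> ?N Z"
  interpret D: finite_measure ?M by (rule finite_measure_distr) simp
  have spN: "space ?N = S" by (simp add: space_restrict_space)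
  have ZS: "Z x \<in> S" if "x \<in> space \<Lambda>" for x using measurable_space[OF Z that] by (simp add: spN)
  have wi2: "integrable \<Lambda> (\<lambda>x. (w x $ i)\<^sup>2)" for i by (rule integrable_component_sq[OF w w2])
  define R where "R i u \<longleftrightarrow> u \<in> borel_measurable ?N \<and> integrable ?M (\<lambda>x. (u x)\<^sup>2) \<and>
      (\<forall>\<phi>. \<phi> \<in> borel_measurable ?N \<longrightarrow> integrable ?M (\<lambda>x. (\<phi> x)\<^sup>2) \<longrightarrow>
      (LINT x|\<Lambda>. \<phi> (Z x) * w x $ i) = (LINT y|?M. \<phi> y * u y))" for i and u :: "'b \<Rightarrow> real"
  have "\<exists>u. R i u" for i
    unfolding R_def
  proof (rule pushforward_density[OF Z _ wi2[of i]])
    show "(\<lambda>x. w x $ i) \<in> borel_measurable \<Lambda>" by simp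
  qed blast
  then obtain c where "\<And>i. R i (c i)" by metis
  then have c: "\<And>i. c i \<in> borel_measurable ?N" "\<And>i. integrable ?M (\<lambda>x. (c i x)\<^sup>2)"
    and ci: "\<And>i \<phi>. \<phi> \<in> borel_measurable ?N \<Longrightarrow> integrable ?M (\<lambda>x. (\<phi> x)\<^sup>2) \<Longrightarrow>
      (LINT x|\<Lambda>. \<phi> (Z x) * w x $ i) = (LINT y|?M. \<phi> y * c i y)"
    unfolding R_def by blast+
  note [measurable] = c(1)
  define u where "u y = (\<chi> i. c i y)" for y
  have u [measurable]: "u \<in> borel_measurable ?N"
    unfolding u_def by (rule borel_measurable_vec_lambda) (rule c)
  have u2: "integrable ?M (\<lambda>y. (norm (u y))\<^sup>2)"
    unfolding norm_vec_def L2_set_def u_def using c by (simp add: sum_nonneg)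
  have bounded_L2: "integrable ?M (\<lambda>y. (\<phi> y * \<psi> y)\<^sup>2)"
    if "\<phi> \<in> borel_measurable ?N" "\<And>y. y \<in> S \<Longrightarrow> \<bar>\<phi> y\<bar> \<le> K" "\<psi> \<in> borel_measurable ?N" "integrable ?M (\<lambda>y. (\<psi> y)\<^sup>2)" for \<phi> \<psi> :: "'b \<Rightarrow> real" and K
  proof (rule Bochner_Integration.integrable_bound)
    show "integrable ?M (\<lambda>y. K\<^sup>2 * (\<psi> y)\<^sup>2)" using that by simp
    have "(\<phi> y * \<psi> y)\<^sup>2 \<le> K\<^sup>2 * (\<psi> y)\<^sup>2" if "y \<in> S" for y
      using power_mono[OF \<open>\<And>y. y \<in> S \<Longrightarrow> \<bar>\<phi> y\<bar> \<le> K\<close>[OF that], of 2]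
      unfolding power_mult_distrib by (intro mult_right_mono) auto
    then show "AE y in ?M. norm ((\<phi> y * \<psi> y)\<^sup>2) \<le> norm (K\<^sup>2 * (\<psi> y)\<^sup>2)"
      by (intro AE_I2) (auto simp: spN)
  qed (use that in auto)
  have cont_bd: "\<exists>K. \<forall>y\<in>S. \<bar>\<phi> y\<bar> \<le> K" if "continuous_on S \<phi>" for \<phi> :: "'b \<Rightarrow> real"
    using compact_imp_bounded[OF compact_continuous_image[OF that S]] unfolding bounded_iff by auto
  have cont_meas: "\<phi> \<in> borel_measurable ?N" if "continuous_on S \<phi>" for \<phi> :: "'b \<Rightarrow> real"
    using that by (rule borel_measurable_continuous_on_restrict)
  have Qc: "continuous_on S (\<lambda>z. Q z $ i $ j)" for i j by (intro continuous_intros Q)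
  obtain K where K: "\<And>i j y. y \<in> S \<Longrightarrow> \<bar>Q y $ i $ j\<bar> \<le> K i j" using cont_bd[OF Qc] by metis
  note [measurable] = cont_meas[OF Qc]
  have QwM: "integrable ?M (\<lambda>y. Q y $ i $ j * a y * b y)"
    if "a \<in> borel_measurable ?N" "b \<in> borel_measurable ?N" "integrable ?M (\<lambda>y. (a y)\<^sup>2)" "integrable ?M (\<lambda>y. (b y)\<^sup>2)" for a b i j
    using that K by (intro integrable_mult_L2 bounded_L2[of _ "K i j"]) auto
  have L2Z: "integrable \<Lambda> (\<lambda>x. (\<phi> (Z x))\<^sup>2)" if "\<phi> \<in> borel_measurable ?N" "integrable ?M (\<lambda>y. (\<phi> y)\<^sup>2)" for \<phi> :: "'b \<Rightarrow> real"
    using that integrable_distr_eq[OF Z, of "\<lambda>y. (\<phi> y)\<^sup>2"] by simp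
  have QwL: "integrable \<Lambda> (\<lambda>x. Q (Z x) $ i $ j * a x * b x)"
    if [measurable]: "a \<in> borel_measurable \<Lambda>" "b \<in> borel_measurable \<Lambda>" and i: "integrable \<Lambda> (\<lambda>x. (a x)\<^sup>2)" "integrable \<Lambda> (\<lambda>x. (b x)\<^sup>2)" for a b i j
  proof (rule Bochner_Integration.integrable_bound)
    show "integrable \<Lambda> (\<lambda>x. K i j * (a x * b x))" using i by (intro integrable_mult_right integrable_mult_L2) auto
    show "AE x in \<Lambda>. norm (Q (Z x) $ i $ j * a x * b x) \<le> norm (K i j * (a x * b x))"
    proof (rule AE_I2)
      fix x assume x: "x \<in> space \<Lambda>"
      have "\<bar>Q (Z x) $ i $ j\<bar> \<le> \<bar>K i j\<bar>" using K[OF ZS[OF x], of i j] by simp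
      then show "norm (Q (Z x) $ i $ j * a x * b x) \<le> norm (K i j * (a x * b x))"
        by (simp add: abs_mult mult.assoc mult_right_mono)
    qed
  qed measurable
  have cZ2: "integrable \<Lambda> (\<lambda>x. (c i (Z x))\<^sup>2)" for i by (rule L2Z[OF c(1) c(2)])
  let ?ww = "\<lambda>i j x. Q (Z x) $ i $ j * w x $ i * w x $ j"
  let ?cw = "\<lambda>i j x. Q (Z x) $ i $ j * c i (Z x) * w x $ j"
  let ?wc = "\<lambda>i j x. Q (Z x) $ i $ j * w x $ i * c j (Z x)"
  let ?cc = "\<lambda>i j x. Q (Z x) $ i $ j * c i (Z x) * c j (Z x)"
  let ?I = "\<lambda>i j. LINT y|?M. Q y $ i $ j * c i y * c j y"
  have int: "integrable \<Lambda> (?ww i j)" "integrable \<Lambda> (?cw i j)" "integrable \<Lambda> (?wc i j)" "integrable \<Lambda> (?cc i j)" for i j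
    by (intro QwL wi2 cZ2; measurable)+
  \<comment> \<open>The defining property of \<open>c\<close> is tested with an entry of
    \<open>Q\<close> times a component of \<open>c\<close>, square integrable because
    \<open>Q\<close> is bounded on the compact set \<open>S\<close>. The two mixed terms and the
    last one share the value \<open>?I i j\<close>, so the expansion collapses to a
    difference.\<close>
  have cw: "integral\<^sup>L \<Lambda> (?cw i j) = ?I i j" for i j
    using K by (intro ci[of "\<lambda>y. Q y $ i $ j * c i y"] bounded_L2[of _ "K i j"] c) auto
  have wc: "integral\<^sup>L \<Lambda> (?wc i j) = ?I i j" for i j
  proof -
    have "(LINT x|\<Lambda>. (Q (Z x) $ i $ j * c j (Z x)) * w x $ i) = (LINT y|?M. (Q y $ i $ j * c j y) * c i y)"
      using K by (intro ci[of "\<lambda>y. Q y $ i $ j * c j y"] bounded_L2[of _ "K i j"] c) auto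
    then show ?thesis by (simp add: ac_simps)
  qed
  have cc: "integral\<^sup>L \<Lambda> (?cc i j) = ?I i j" for i j
    by (subst integral_distr[OF Z]) auto
  have "0 \<le> (LINT x|\<Lambda>. (w x - u (Z x)) \<bullet> (Q (Z x) *v (w x - u (Z x))))"
    using Q0 ZS by (intro Bochner_Integration.integral_nonneg) auto
  also have "\<dots> = (LINT x|\<Lambda>. (\<Sum>i\<in>UNIV. \<Sum>j\<in>UNIV. ?ww i j x - ?cw i j x - ?wc i j x + ?cc i j x))"
    unfolding inner_matrix_vector_sum u_def by (simp add: algebra_simps)
  also have "\<dots> = (\<Sum>i\<in>UNIV. \<Sum>j\<in>UNIV. integral\<^sup>L \<Lambda> (?ww i j) - ?I i j)"
    using int by (simp add: Bochner_Integration.integral_sum cw wc cc)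
  also have "\<dots> = (LINT x|\<Lambda>. w x \<bullet> (Q (Z x) *v w x)) - (LINT y|?M. u y \<bullet> (Q y *v u y))"
  proof -
    have "(LINT x|\<Lambda>. w x \<bullet> (Q (Z x) *v w x)) = (\<Sum>i\<in>UNIV. \<Sum>j\<in>UNIV. integral\<^sup>L \<Lambda> (?ww i j))"
      unfolding inner_matrix_vector_sum using int by (simp add: Bochner_Integration.integral_sum)
    moreover have "(LINT y|?M. u y \<bullet> (Q y *v u y)) = (\<Sum>i\<in>UNIV. \<Sum>j\<in>UNIV. ?I i j)"
      unfolding inner_matrix_vector_sum u_def using QwM c by (simp add: Bochner_Integration.integral_sum)
    ultimately show ?thesis by (simp add: sum_subtractf)
  qed
  finally have le: "(LINT y|?M. (u y \<bullet> (Q y *v u y)) / 2) \<le> (LINT x|\<Lambda>. (w x \<bullet> (Q (Z x) *v w x)) / 2)" by simp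
  \<comment> \<open>The image measure together with \<open>u\<close> is an admissible pair in the
    infimum, which is therefore at most the value at this pair.\<close>
  have "quad_energy S Q \<rho> U \<le> ereal (LINT y|?M. (u y \<bullet> (Q y *v u y)) / 2)"
    unfolding quad_energy_def
  proof (rule Inf_lower, rule CollectI, intro exI conjI allI impI)
    show "finite_measure ?M" by unfold_locales
    show "sets ?M = sets ?N" by simp
    show "u \<in> borel_measurable ?M" by simp
    show "integrable ?M (\<lambda>z. (norm (u z))\<^sup>2)" by (rule u2)
    show "\<rho> \<phi> = (LINT z|?M. \<phi> z)" if "continuous_on S \<phi>" for \<phi>
      unfolding \<rho>[OF that] using cont_meas[OF that] by (subst integral_distr[OF Z]) auto
    show "U \<Phi> = (LINT z|?M. \<Phi> z \<bullet> u z)" if \<Phi>: "continuous_on S \<Phi>" for \<Phi>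
    proof -
      have \<Phi>c: "continuous_on S (\<lambda>y. \<Phi> y $ i)" for i by (intro continuous_intros \<Phi>)
      note [measurable] = cont_meas[OF \<Phi>c]
      obtain B where B: "\<And>i y. y \<in> S \<Longrightarrow> \<bar>\<Phi> y $ i\<bar> \<le> B i" using cont_bd[OF \<Phi>c] by metis
      have \<Phi>2: "integrable ?M (\<lambda>y. (\<Phi> y $ i)\<^sup>2)" for i
        using bounded_L2[of "\<lambda>y. \<Phi> y $ i" "B i" "\<lambda>_. 1"] B by simp
      have "U \<Phi> = (LINT x|\<Lambda>. (\<Sum>i\<in>UNIV. \<Phi> (Z x) $ i * w x $ i))" by (simp add: U[OF \<Phi>] inner_vec_def)
      also have "\<dots> = (\<Sum>i\<in>UNIV. LINT x|\<Lambda>. \<Phi> (Z x) $ i * w x $ i)"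
        using wi2 L2Z[OF _ \<Phi>2] by (intro Bochner_Integration.integral_sum integrable_mult_L2) auto
      also have "\<dots> = (\<Sum>i\<in>UNIV. LINT y|?M. \<Phi> y $ i * c i y)" by (intro sum.cong refl ci \<Phi>2) simp
      also have "\<dots> = (LINT y|?M. (\<Sum>i\<in>UNIV. \<Phi> y $ i * c i y))"
        using c \<Phi>2 by (intro Bochner_Integration.integral_sum[symmetric] integrable_mult_L2) auto
      also have "\<dots> = (LINT y|?M. \<Phi> y \<bullet> u y)" by (simp add: inner_vec_def u_def)
      finally show ?thesis .
    qed
  qed simp
  also have "\<dots> \<le> ereal (LINT x|\<Lambda>. (w x \<bullet> (Q (Z x) *v w x)) / 2)" using le by simp
  finally show ?thesis .
qed

section \<open>Ensembles of loops\<close>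

lemma (in complete_measure) borel_measurable_cong_AE_complete:
  assumes f: "f \<in> M \<rightarrow>\<^sub>M N" and ae: "AE x in M. f x = g x" and g: "g \<in> space M \<rightarrow> space N"
  shows "g \<in> M \<rightarrow>\<^sub>M N"
proof (rule measurableI)
  fix A assume A: "A \<in> sets N"
  show "g -` A \<inter> space M \<in> sets M"
  proof (rule in_sets_AE[of "f -` A \<inter> space M"])
    show "AE x in M. (x \<in> f -` A \<inter> space M) = (x \<in> g -` A \<inter> space M)"
      using ae by eventually_elim auto
  qed (use measurable_sets[OF f A] in auto)
qed (use g in auto)

text \<open>Over a complete measure, measurability transfers between functions that agree almost
  everywhere; if both fail to be measurable, both integrals have the default value 0.\<close>

lemma integral_completion_cong_AE:
  fixes f g :: "'a \<Rightarrow> 'b::{banach, second_countable_topology}"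
  assumes ae: "AE x in M. f x = g x"
  shows "integral\<^sup>L (completion M) f = integral\<^sup>L (completion M) g"
proof -
  have ae': "AE x in completion M. f x = g x" using ae by (rule AE_completion)
  then have ae'': "AE x in completion M. g x = f x" by eventually_elim simp
  show ?thesis
  proof (cases "f \<in> borel_measurable (completion M)")
    case True
    then have "g \<in> borel_measurable (completion M)"
      using completion.borel_measurable_cong_AE_complete[OF True ae'] by simp
    then show ?thesis using True ae' by (intro integral_cong_AE)
  next
    case False
    then have "g \<notin> borel_measurable (completion M)"
      using completion.borel_measurable_cong_AE_complete[OF _ ae'', of borel] by auto
    then show ?thesis using False by (metis borel_measurable_integrable not_integrable_integral_eq)
  qed
qed

lemma set_lebesgue_integral_cong_AE_lborel:
  fixes f g :: "real \<Rightarrow> real"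
  assumes g: "g \<in> borel_measurable (interval_lborel a b)" and ae: "AE s in lborel. s \<in> {a..b} \<longrightarrow> f s = g s"
  shows "(LINT s:{a..b}|lebesgue. f s) = (LINT s|interval_lborel a b. g s)"
proof -
  have "(LINT s:{a..b}|lebesgue. f s) = (LINT s|lebesgue. indicator {a..b} s *\<^sub>R g s)"
    unfolding set_lebesgue_integral_def
  proof (rule integral_completion_cong_AE)
    show "AE s in lborel. indicator {a..b} s *\<^sub>R f s = indicator {a..b} s *\<^sub>R g s"
      using ae by eventually_elim (auto split: split_indicator)
  qed
  also have "\<dots> = (LINT s|lborel. indicator {a..b} s *\<^sub>R g s)"
  proof (rule integral_completion)
    show "(\<lambda>s. indicator {a..b} s *\<^sub>R g s) \<in> lborel \<rightarrow>\<^sub>M borel"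
      using g by (subst (asm) borel_measurable_restrict_space_iff) (auto simp: mult.commute)
  qed
  finally show ?thesis by (simp add: lebesgue_integral_interval_lborel set_lebesgue_integral_def)
qed

text \<open>Trades an integrand on completed measures for a jointly measurable representative
  \<open>G\<close> on the original ones. In the applications \<open>G\<close> is built from
  \<open>fwd_deriv\<close> in place of \<open>vector_derivative\<close>.\<close>

lemma loop_integral_eq_iterated:
  assumes m: "(\<lambda>(a, s). G a s) \<in> borel_measurable (\<mu> \<Otimes>\<^sub>M unit_lborel)"
    and ae: "\<And>a. a \<in> space \<mu> \<Longrightarrow> AE s in lborel. s \<in> {0..1} \<longrightarrow> g s a = G a s"
  shows "loop_integral \<mu> g = (LINT a|\<mu>. LINT s|unit_lborel. G a s)"
proof -
  interpret U: prob_space unit_lborel by (rule prob_space_unit_lborel)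
  have "loop_integral \<mu> g = (LINT a|completion \<mu>. LINT s|unit_lborel. G a s)"
    unfolding loop_integral_def
  proof (rule Bochner_Integration.integral_cong)
    fix a assume "a \<in> space (completion \<mu>)"
    then have a: "a \<in> space \<mu>" by simp
    have "G a \<in> borel_measurable unit_lborel" using measurable_Pair2[OF m a] by simp
    then show "(LINT s:{0..1}|lebesgue. g s a) = (LINT s|unit_lborel. G a s)"
      by (rule set_lebesgue_integral_cong_AE_lborel[OF _ ae[OF a]])
  qed simp
  also have "\<dots> = (LINT a|\<mu>. LINT s|unit_lborel. G a s)"
    by (intro integral_completion U.borel_measurable_lebesgue_integral m)
  finally show ?thesis .
qed

lemma continuous_on_integral_dominated:
  fixes f :: "real \<Rightarrow> 'a \<Rightarrow> real"
  assumes c: "\<And>x. x \<in> space M \<Longrightarrow> continuous_on S (\<lambda>t. f t x)"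
    and m: "\<And>t. t \<in> S \<Longrightarrow> f t \<in> borel_measurable M"
    and b: "\<And>t x. t \<in> S \<Longrightarrow> x \<in> space M \<Longrightarrow> \<bar>f t x\<bar> \<le> w x" and w: "integrable M w"
  shows "continuous_on S (\<lambda>t. LINT x|M. f t x)"
  unfolding continuous_on_sequentially
proof (intro allI ballI impI)
  fix u t assume t: "t \<in> S" and u: "(\<forall>n. u n \<in> S) \<and> u \<longlonglongrightarrow> t"
  show "((\<lambda>t. LINT x|M. f t x) \<circ> u) \<longlonglongrightarrow> (LINT x|M. f t x)"
    unfolding o_def
  proof (rule integral_dominated_convergence[where w = w])
    show "AE x in M. (\<lambda>n. f (u n) x) \<longlonglongrightarrow> f t x"
      using c t u by (intro AE_I2) (auto simp: continuous_on_sequentially o_def)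
  qed (use m b w t u in auto)
qed

text \<open>The heat equation is imposed for every \<open>a\<close>, so that arguments on single
  loops hold throughout; the final theorem reaches this by changing the loops on a null set.\<close>

locale loop_ensemble = prob_space \<mu> for \<mu> :: "'a measure" +
  fixes X0 :: "real \<Rightarrow> 'a \<Rightarrow> real ^ 'n::finite" and X :: "real \<Rightarrow> real \<Rightarrow> 'a \<Rightarrow> real ^ 'n"
  assumes X_measurable: "\<And>t. t \<ge> 0 \<Longrightarrow> (\<lambda>(s, a). X t s a) \<in> borel_measurable (borel \<Otimes>\<^sub>M \<mu>)"
    and heat_loop: "\<And>a. a \<in> space \<mu> \<Longrightarrow> heat_loop (\<lambda>s. X0 s a) (\<lambda>t s. X t s a)"
    and energy_finite: "loop_energy \<mu> X0 < \<infinity>"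
begin

text \<open>The arguments follow the order of the factors in \<open>\<Lambda> \<tau>\<close>: time,
  loop, parameter. Forward limits make both functions measurable in all three.\<close>

definition "Xs t a s = fwd_deriv (\<lambda>\<sigma>. X t \<sigma> a) s"
definition "Xt t a s = fwd_deriv (\<lambda>\<tau>. X \<tau> s a) t"

abbreviation "\<Omega> \<equiv> \<mu> \<Otimes>\<^sub>M unit_lborel"
abbreviation "\<Lambda> \<tau> \<equiv> interval_lborel 0 \<tau> \<Otimes>\<^sub>M \<Omega>"

sublocale U: prob_space unit_lborel by (rule prob_space_unit_lborel)
sublocale Pi: pair_prob_space \<mu> unit_lborel ..

lemma X_0: "a \<in> space \<mu> \<Longrightarrow> X 0 s a = X0 s a"
  using heat_loop.Y_0[OF heat_loop] by meson

lemma interval_sigma_finite: "sigma_finite_measure (interval_lborel a b)"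
  using finite_measure_interval_lborel finite_measure.axioms(1) by blast

lemma pair_\<Lambda>: "pair_sigma_finite (interval_lborel 0 \<tau>) \<Omega>"
  by (simp add: pair_sigma_finite_def interval_sigma_finite Pi.sigma_finite_measure_axioms)

lemma pair_\<mu>: "pair_sigma_finite (interval_lborel 0 \<tau>) \<mu>"
  by (simp add: pair_sigma_finite_def interval_sigma_finite sigma_finite_measure_axioms)

lemma finite_\<Lambda>: "finite_measure (\<Lambda> \<tau>)"
  by (intro finite_measure_pair_measure finite_measure_interval_lborel) unfold_locales

lemma space_\<Lambda>: "space (\<Lambda> \<tau>) = {0..\<tau>} \<times> space \<mu> \<times> {0..1}"
  by (simp add: space_pair_measure space_interval_lborel)

lemma space_\<Omega>: "space \<Omega> = space \<mu> \<times> {0..1}"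
  by (simp add: space_pair_measure space_interval_lborel)

lemma borel_imp_\<Lambda>:
  assumes "f \<in> borel_measurable (borel \<Otimes>\<^sub>M (\<mu> \<Otimes>\<^sub>M borel))"
  shows "f \<in> borel_measurable (\<Lambda> \<tau>)"
proof -
  have "(\<lambda>x. x) \<in> interval_lborel a b \<rightarrow>\<^sub>M borel" for a b :: real
    by (rule measurable_restrict_space1) simp
  note [measurable] = measurable_compose[OF measurable_fst this] measurable_compose[OF measurable_snd this]
    measurable_compose[OF measurable_snd[THEN measurable_compose, OF measurable_snd] this]
  have "(\<lambda>x. (fst x, fst (snd x), snd (snd x))) \<in> \<Lambda> \<tau> \<rightarrow>\<^sub>M borel \<Otimes>\<^sub>M (\<mu> \<Otimes>\<^sub>M borel)"
    by measurable
  from measurable_compose[OF this assms] show ?thesis by simp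
qed

lemma borel_imp_\<Omega>:
  assumes "f \<in> borel_measurable (borel \<Otimes>\<^sub>M (\<mu> \<Otimes>\<^sub>M borel))"
  shows "(\<lambda>x. f (t, x)) \<in> borel_measurable \<Omega>"
proof -
  have "(\<lambda>x. x) \<in> interval_lborel a b \<rightarrow>\<^sub>M borel" for a b :: real
    by (rule measurable_restrict_space1) simp
  note [measurable] = measurable_compose[OF measurable_snd this]
  have "(\<lambda>x. (t, fst x, snd x)) \<in> \<Omega> \<rightarrow>\<^sub>M borel \<Otimes>\<^sub>M (\<mu> \<Otimes>\<^sub>M borel)"
    by measurable
  from measurable_compose[OF this assms] show ?thesis by simp
qed

lemma X_time_continuous:
  assumes "a \<in> space \<mu>" shows "continuous_on {0..} (\<lambda>t. X t s a)"
proof -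
  interpret heat_loop "\<lambda>s. X0 s a" "\<lambda>t s. X t s a" using assms by (rule heat_loop)
  have "continuous_on {0..} (\<lambda>t. (\<lambda>(t, s). X t s a) (t, s))"
    by (rule continuous_on_compose2[OF Y_continuous]) (auto intro!: continuous_intros)
  then show ?thesis by simp
qed

text \<open>\<open>X\<close> is measurable at each fixed time and continuous in time, hence the
  limit of the functions obtained by rounding the time down to a multiple of
  \<open>1 / (n + 1)\<close>, each a countable gluing. \<open>max 0 t\<close> covers negative times,
  about which nothing is assumed.\<close>

lemma X_jointly_measurable:
  "(\<lambda>(t, a, s). X (max 0 t) s a) \<in> borel_measurable (borel \<Otimes>\<^sub>M (\<mu> \<Otimes>\<^sub>M borel))"
proof (rule borel_measurable_LIMSEQ_metric)
  fix n :: nat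
  let ?k = "\<lambda>t::real. nat \<lfloor>max 0 t * real (Suc n)\<rfloor>"
  have "(\<lambda>x. X (real (?k (fst x)) / real (Suc n)) (snd (snd x)) (fst (snd x))) \<in> borel_measurable (borel \<Otimes>\<^sub>M (\<mu> \<Otimes>\<^sub>M borel))"
  proof (rule measurable_compose_countable[where f = "\<lambda>i x. X (real i / real (Suc n)) (snd (snd x)) (fst (snd x))" and g = "\<lambda>x. ?k (fst x)"])
    fix i :: nat
    have "(\<lambda>x. (snd (snd x), fst (snd x))) \<in> borel \<Otimes>\<^sub>M (\<mu> \<Otimes>\<^sub>M borel) \<rightarrow>\<^sub>M borel \<Otimes>\<^sub>M \<mu>" by measurable
    from measurable_compose[OF this X_measurable[of "real i / real (Suc n)"]]
    show "(\<lambda>x. X (real i / real (Suc n)) (snd (snd x)) (fst (snd x))) \<in> borel_measurable (borel \<Otimes>\<^sub>M (\<mu> \<Otimes>\<^sub>M borel))"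
      by simp
  qed measurable
  then show "(\<lambda>(t, a, s). X (real (?k t) / real (Suc n)) s a) \<in> borel_measurable (borel \<Otimes>\<^sub>M (\<mu> \<Otimes>\<^sub>M borel))"
    by (simp only: case_prod_beta')
next
  fix x :: "real \<times> 'a \<times> real" assume "x \<in> space (borel \<Otimes>\<^sub>M (\<mu> \<Otimes>\<^sub>M borel))"
  then obtain t :: real and a and s :: real where x: "x = (t, a, s)" "a \<in> space \<mu>" by (auto simp: space_pair_measure)
  let ?r = "\<lambda>n. real (nat \<lfloor>max 0 t * real (Suc n)\<rfloor>) / real (Suc n)"
  have "?r \<longlonglongrightarrow> max 0 t"
  proof (rule tendsto_sandwich)
    have e: "?r n = of_int \<lfloor>max 0 t * real (Suc n)\<rfloor> / real (Suc n)" for n by (simp add: zero_le_floor)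
    show "\<forall>\<^sub>F n in sequentially. max 0 t - 1 / real (Suc n) \<le> ?r n"
    proof (intro always_eventually allI)
      fix n
      have "(max 0 t * real (Suc n) - 1) / real (Suc n) \<le> of_int \<lfloor>max 0 t * real (Suc n)\<rfloor> / real (Suc n)"
        by (intro divide_right_mono) linarith+
      then show "max 0 t - 1 / real (Suc n) \<le> ?r n" unfolding e by (simp add: diff_divide_distrib del: of_nat_Suc)
    qed
    show "\<forall>\<^sub>F n in sequentially. ?r n \<le> max 0 t"
    proof (intro always_eventually allI)
      fix n
      have "of_int \<lfloor>max 0 t * real (Suc n)\<rfloor> / real (Suc n) \<le> (max 0 t * real (Suc n)) / real (Suc n)"
        by (intro divide_right_mono) auto
      then show "?r n \<le> max 0 t" unfolding e by (simp del: of_nat_Suc)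
    qed
    have "(\<lambda>n. max 0 t - 1 / real (Suc n)) \<longlonglongrightarrow> max 0 t - 0"
      by (intro tendsto_diff tendsto_const) (use LIMSEQ_inverse_real_of_nat in \<open>simp add: inverse_eq_divide\<close>)
    then show "(\<lambda>n. max 0 t - 1 / real (Suc n)) \<longlonglongrightarrow> max 0 t" by simp
  qed simp
  then have "(\<lambda>n. X (?r n) s a) \<longlonglongrightarrow> X (max 0 t) s a"
    by (rule continuous_on_tendsto_compose[OF X_time_continuous[OF x(2)]]) auto
  then show "(\<lambda>n. case x of (t, a, s) \<Rightarrow> X (real (nat \<lfloor>max 0 t * real (Suc n)\<rfloor>) / real (Suc n)) s a) \<longlonglongrightarrow> (case x of (t, a, s) \<Rightarrow> X (max 0 t) s a)"
    by (simp add: x)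
qed

lemma X_shifted_measurable:
  "(\<lambda>(t, a, s). X (max 0 (t + h)) (s + k) a) \<in> borel_measurable (borel \<Otimes>\<^sub>M (\<mu> \<Otimes>\<^sub>M borel))"
proof -
  have "(\<lambda>x. (fst x + h, fst (snd x), snd (snd x) + k)) \<in> borel \<Otimes>\<^sub>M (\<mu> \<Otimes>\<^sub>M borel) \<rightarrow>\<^sub>M borel \<Otimes>\<^sub>M (\<mu> \<Otimes>\<^sub>M borel)"
    by measurable
  from measurable_compose[OF this X_jointly_measurable] show ?thesis by (simp add: case_prod_beta')
qed

lemma Xs_jointly_measurable:
  "(\<lambda>(t, a, s). Xs (max 0 t) a s) \<in> borel_measurable (borel \<Otimes>\<^sub>M (\<mu> \<Otimes>\<^sub>M borel))"
proof -
  have "(\<lambda>x. lim (\<lambda>n. real (Suc n) *\<^sub>R ((\<lambda>(t, a, s). X (max 0 (t + 0)) (s + 1 / real (Suc n)) a) x - (\<lambda>(t, a, s). X (max 0 (t + 0)) (s + 0) a) x)))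
     \<in> borel_measurable (borel \<Otimes>\<^sub>M (\<mu> \<Otimes>\<^sub>M borel))"
    by (intro borel_measurable_lim_metric borel_measurable_scaleR borel_measurable_diff borel_measurable_const X_shifted_measurable)
  then show ?thesis by (simp add: case_prod_beta' Xs_def fwd_deriv_def)
qed

lemma Xt_jointly_measurable:
  "(\<lambda>(t, a, s). Xt (max 0 t) a s) \<in> borel_measurable (borel \<Otimes>\<^sub>M (\<mu> \<Otimes>\<^sub>M borel))"
proof -
  let ?S = "borel \<Otimes>\<^sub>M (\<mu> \<Otimes>\<^sub>M borel) :: (real \<times> 'a \<times> real) measure"
  have 1: "(\<lambda>x. lim (\<lambda>n. real (Suc n) *\<^sub>R ((\<lambda>(t, a, s). X (max 0 (t + 1 / real (Suc n))) (s + 0) a) x - (\<lambda>(t, a, s). X (max 0 (t + 0)) (s + 0) a) x)))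
     \<in> borel_measurable ?S" (is "?f \<in> _")
    by (intro borel_measurable_lim_metric borel_measurable_scaleR borel_measurable_diff borel_measurable_const X_shifted_measurable)
  \<comment> \<open>The time is cut off before the increment is added, since
    \<open>max 0 (t + h)\<close> differs from \<open>max 0 t + h\<close> for negative
    \<open>t\<close>.\<close>
  have "(\<lambda>x. (max 0 (fst x), snd x)) \<in> ?S \<rightarrow>\<^sub>M ?S" by measurable
  from measurable_compose[OF this 1]
  have "(\<lambda>x. ?f (max 0 (fst x), snd x)) \<in> borel_measurable ?S" .
  moreover have "?f (max 0 (fst x), snd x) = (\<lambda>(t, a, s). Xt (max 0 t) a s) x" for x
  proof -
    have "max 0 (max 0 (fst x) + 1 / real (Suc n)) = max 0 (fst x) + 1 / real (Suc n)" for n :: nat by simp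
    then show ?thesis by (simp add: case_prod_beta Xt_def fwd_deriv_def del: of_nat_Suc)
  qed
  ultimately show ?thesis by simp
qed

lemma \<Lambda>_measurable:
  shows X_\<Lambda>: "(\<lambda>(t, a, s). X t s a) \<in> borel_measurable (\<Lambda> \<tau>)"
    and Xs_\<Lambda>: "(\<lambda>(t, a, s). Xs t a s) \<in> borel_measurable (\<Lambda> \<tau>)"
    and Xt_\<Lambda>: "(\<lambda>(t, a, s). Xt t a s) \<in> borel_measurable (\<Lambda> \<tau>)"
proof -
  have *: "f \<in> borel_measurable (\<Lambda> \<tau>)" if "g \<in> borel_measurable (borel \<Otimes>\<^sub>M (\<mu> \<Otimes>\<^sub>M borel))" "\<And>t a s. t \<ge> 0 \<Longrightarrow> f (t, a, s) = g (t, a, s)"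
    for f g :: "real \<times> 'a \<times> real \<Rightarrow> real ^ 'n"
    using borel_imp_\<Lambda>[OF that(1), of \<tau>] that(2)
    by (subst measurable_cong[of _ f g]) (auto simp: space_\<Lambda>)
  show "(\<lambda>(t, a, s). X t s a) \<in> borel_measurable (\<Lambda> \<tau>)" by (rule *[OF X_jointly_measurable]) auto
  show "(\<lambda>(t, a, s). Xs t a s) \<in> borel_measurable (\<Lambda> \<tau>)" by (rule *[OF Xs_jointly_measurable]) auto
  show "(\<lambda>(t, a, s). Xt t a s) \<in> borel_measurable (\<Lambda> \<tau>)" by (rule *[OF Xt_jointly_measurable]) auto
qed

lemma \<Omega>_measurable:
  assumes "t \<ge> 0"
  shows X_\<Omega>: "(\<lambda>(a, s). X t s a) \<in> borel_measurable \<Omega>"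
    and Xs_\<Omega>: "(\<lambda>(a, s). Xs t a s) \<in> borel_measurable \<Omega>"
  using borel_imp_\<Omega>[OF X_jointly_measurable, of t] borel_imp_\<Omega>[OF Xs_jointly_measurable, of t] assms by (simp_all add: case_prod_beta' max_def)

text \<open>The position of a loop point in space-time. Averaging over loop points with equal
  \<open>Z\<close> turns loop quantities into densities of measures on space-time.\<close>

definition "Z = (\<lambda>(t, a, s). (t, abs_torus (X t s a)))"

lemma Z_measurable: "Z \<in> \<Lambda> \<tau> \<rightarrow>\<^sub>M restrict_space borel ({0..\<tau>} \<times> UNIV)"
proof (rule measurable_restrict_space2)
  show "Z \<in> space (\<Lambda> \<tau>) \<rightarrow> {0..\<tau>} \<times> UNIV" by (auto simp: space_\<Lambda> Z_def)
  have c: "continuous_on UNIV (\<lambda>z :: real \<times> (real ^ 'n). (fst z, abs_torus (snd z)))"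
    by (auto intro!: continuous_intros continuous_on_compose2[OF continuous_on_abs_torus[of UNIV]])
  have "(\<lambda>x. fst x) \<in> borel_measurable (\<Lambda> \<tau>)"
    by (rule measurable_compose[OF measurable_fst]) (rule measurable_restrict_space1, simp)
  from measurable_compose[OF borel_measurable_Pair[OF this X_\<Lambda>] borel_measurable_continuous_onI[OF c]]
  show "Z \<in> \<Lambda> \<tau> \<rightarrow>\<^sub>M borel" by (simp add: Z_def case_prod_beta')
qed

lemma field_\<Lambda>:
  fixes \<phi> :: "real \<times> 'n torus \<Rightarrow> 'b::topological_space"
  assumes "continuous_on ({0..\<tau>} \<times> UNIV) \<phi>"
  shows "(\<lambda>x. \<phi> (Z x)) \<in> borel_measurable (\<Lambda> \<tau>)"
  by (rule measurable_compose[OF Z_measurable borel_measurable_continuous_on_restrict[OF assms]])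

lemma field_\<Omega>:
  fixes \<phi> :: "'n torus \<Rightarrow> 'b::topological_space"
  assumes "continuous_on UNIV \<phi>" "t \<ge> 0"
  shows "(\<lambda>(a, s). \<phi> (abs_torus (X t s a))) \<in> borel_measurable \<Omega>"
  using measurable_compose[OF X_\<Omega>[OF assms(2)] borel_measurable_continuous_onI[OF assms(1)[unfolded continuous_on_torus]]]
  by (simp add: case_prod_beta')

definition "XS x = Xs (fst x) (fst (snd x)) (snd (snd x))"
definition "XT x = Xt (fst x) (fst (snd x)) (snd (snd x))"

lemma XS_measurable: "XS \<in> borel_measurable (\<Lambda> \<tau>)"
  using Xs_\<Lambda> by (simp add: XS_def[abs_def] case_prod_beta')

lemma XT_measurable: "XT \<in> borel_measurable (\<Lambda> \<tau>)"
  using Xt_\<Lambda> by (simp add: XT_def[abs_def] case_prod_beta')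

lemma integral_\<Lambda>:
  fixes f :: "real \<times> 'a \<times> real \<Rightarrow> real"
  assumes "integrable (\<Lambda> \<tau>) f"
  shows "integral\<^sup>L (\<Lambda> \<tau>) f = (LINT t|interval_lborel 0 \<tau>. LINT x|\<Omega>. f (t, x))"
proof -
  interpret L: pair_sigma_finite "interval_lborel 0 \<tau>" \<Omega> by (rule pair_\<Lambda>)
  show ?thesis using L.integral_fst'[OF assms] by simp
qed

lemma AE_integrable_\<Lambda>:
  fixes f :: "real \<times> 'a \<times> real \<Rightarrow> real"
  assumes "integrable (\<Lambda> \<tau>) f"
  shows "AE t in interval_lborel 0 \<tau>. integrable \<Omega> (\<lambda>x. f (t, x))"
proof -
  interpret L: pair_sigma_finite "interval_lborel 0 \<tau>" \<Omega> by (rule pair_\<Lambda>)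
  show ?thesis by (rule L.AE_integrable_fst'[OF assms])
qed

lemma integral_\<Omega>:
  fixes f :: "'a \<times> real \<Rightarrow> real"
  assumes "integrable \<Omega> f"
  shows "integral\<^sup>L \<Omega> f = (LINT a|\<mu>. LINT s|unit_lborel. f (a, s))"
  using Pi.integral_fst'[OF assms] by simp

lemma iterated_integral_measurable:
  fixes f :: "real \<times> 'a \<times> real \<Rightarrow> real"
  assumes [measurable]: "f \<in> borel_measurable (\<Lambda> \<tau>)"
  shows "(\<lambda>t. LINT a|\<mu>. LINT s|unit_lborel. f (t, a, s)) \<in> borel_measurable (interval_lborel 0 \<tau>)"
proof -
  have "(\<lambda>y. f (fst (fst y), snd (fst y), snd y)) \<in> borel_measurable ((interval_lborel 0 \<tau> \<Otimes>\<^sub>M \<mu>) \<Otimes>\<^sub>M unit_lborel)"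
    by measurable
  then have "(\<lambda>(y, s). f (fst y, snd y, s)) \<in> borel_measurable ((interval_lborel 0 \<tau> \<Otimes>\<^sub>M \<mu>) \<Otimes>\<^sub>M unit_lborel)"
    by (simp add: case_prod_beta')
  from U.borel_measurable_lebesgue_integral[OF this]
  have "(\<lambda>y. LINT s|unit_lborel. f (fst y, snd y, s)) \<in> borel_measurable (interval_lborel 0 \<tau> \<Otimes>\<^sub>M \<mu>)" .
  then have "(\<lambda>(t, a). LINT s|unit_lborel. f (t, a, s)) \<in> borel_measurable (interval_lborel 0 \<tau> \<Otimes>\<^sub>M \<mu>)"
    by (simp add: case_prod_beta')
  from borel_measurable_lebesgue_integral[OF this] show ?thesis .
qed

lemma integral_\<Lambda>_iterated:
  fixes f :: "real \<times> 'a \<times> real \<Rightarrow> real"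
  assumes "integrable (\<Lambda> \<tau>) f"
  shows "integral\<^sup>L (\<Lambda> \<tau>) f = (LINT t|interval_lborel 0 \<tau>. LINT a|\<mu>. LINT s|unit_lborel. f (t, a, s))"
  unfolding integral_\<Lambda>[OF assms]
proof (rule integral_cong_AE)
  interpret L: pair_sigma_finite "interval_lborel 0 \<tau>" \<Omega> by (rule pair_\<Lambda>)
  have [measurable]: "f \<in> borel_measurable (\<Lambda> \<tau>)" using assms by simp
  show "(\<lambda>t. LINT x|\<Omega>. f (t, x)) \<in> borel_measurable (interval_lborel 0 \<tau>)" by measurable
  show "(\<lambda>t. LINT a|\<mu>. LINT s|unit_lborel. f (t, a, s)) \<in> borel_measurable (interval_lborel 0 \<tau>)"
    by (rule iterated_integral_measurable) simp
  show "AE t in interval_lborel 0 \<tau>. (LINT x|\<Omega>. f (t, x)) = (LINT a|\<mu>. LINT s|unit_lborel. f (t, a, s))"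
    using AE_integrable_\<Lambda>[OF assms] by eventually_elim (rule integral_\<Omega>)
qed

text \<open>Puts the loop variable outermost, so that an identity for a single loop, which is an
  integral over \<open>t\<close> and \<open>s\<close>, can be inserted.\<close>

lemma integral_\<Lambda>_swap:
  fixes f :: "real \<times> 'a \<times> real \<Rightarrow> real"
  assumes f: "integrable (\<Lambda> \<tau>) f"
  shows "integral\<^sup>L (\<Lambda> \<tau>) f = (LINT a|\<mu>. LINT t|interval_lborel 0 \<tau>. LINT s|unit_lborel. f (t, a, s))"
proof -
  interpret L: pair_sigma_finite "interval_lborel 0 \<tau>" \<Omega> by (rule pair_\<Lambda>)
  interpret M: pair_sigma_finite "interval_lborel 0 \<tau>" \<mu> by (rule pair_\<mu>)
  let ?T = "interval_lborel 0 \<tau>"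
  have [measurable]: "f \<in> borel_measurable (\<Lambda> \<tau>)" using f by simp
  let ?g = "\<lambda>y. LINT s|unit_lborel. f (fst y, snd y, s)"
  have "(\<lambda>y. f (fst (fst y), snd (fst y), snd y)) \<in> borel_measurable ((?T \<Otimes>\<^sub>M \<mu>) \<Otimes>\<^sub>M unit_lborel)"
    by measurable
  then have fm: "(\<lambda>(y, s). f (fst y, snd y, s)) \<in> borel_measurable ((?T \<Otimes>\<^sub>M \<mu>) \<Otimes>\<^sub>M unit_lborel)"
    by (simp add: case_prod_beta')
  have gm: "?g \<in> borel_measurable (?T \<Otimes>\<^sub>M \<mu>)" by (rule U.borel_measurable_lebesgue_integral[OF fm])
  have nm: "(\<lambda>(y, s). ennreal (norm (f (fst y, snd y, s)))) \<in> borel_measurable ((?T \<Otimes>\<^sub>M \<mu>) \<Otimes>\<^sub>M unit_lborel)"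
    using fm by (simp add: case_prod_beta')
  \<comment> \<open>The inner integral is bounded by the integral of the absolute value, and
    Tonelli's theorem reduces the claim to the integrability of \<open>f\<close>.\<close>
  have "integrable (?T \<Otimes>\<^sub>M \<mu>) ?g"
  proof (rule integrableI_bounded[OF gm])
    have "(\<integral>\<^sup>+y. ennreal (norm (?g y)) \<partial>(?T \<Otimes>\<^sub>M \<mu>)) \<le> (\<integral>\<^sup>+y. \<integral>\<^sup>+s. ennreal (norm (f (fst y, snd y, s))) \<partial>unit_lborel \<partial>(?T \<Otimes>\<^sub>M \<mu>))"
    proof (rule nn_integral_mono)
      fix y
      show "ennreal (norm (?g y)) \<le> (\<integral>\<^sup>+s. ennreal (norm (f (fst y, snd y, s))) \<partial>unit_lborel)"
        using integral_norm_bound_ennreal[of unit_lborel "\<lambda>s. f (fst y, snd y, s)"]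
        by (cases "integrable unit_lborel (\<lambda>s. f (fst y, snd y, s))") (simp_all add: not_integrable_integral_eq)
    qed
    also have "\<dots> = (\<integral>\<^sup>+t. \<integral>\<^sup>+a. \<integral>\<^sup>+s. ennreal (norm (f (t, a, s))) \<partial>unit_lborel \<partial>\<mu> \<partial>?T)"
      using nn_integral_fst[OF U.borel_measurable_nn_integral_fst[OF nm]] by simp
    also have "\<dots> = (\<integral>\<^sup>+t. \<integral>\<^sup>+x. ennreal (norm (f (t, x))) \<partial>\<Omega> \<partial>?T)"
    proof (rule nn_integral_cong)
      fix t assume t: "t \<in> space ?T"
      have "(\<lambda>x. ennreal (norm (f (t, x)))) \<in> borel_measurable \<Omega>" using t by measurable
      from U.nn_integral_fst[OF this]
      show "(\<integral>\<^sup>+a. \<integral>\<^sup>+s. ennreal (norm (f (t, a, s))) \<partial>unit_lborel \<partial>\<mu>) = (\<integral>\<^sup>+x. ennreal (norm (f (t, x))) \<partial>\<Omega>)" by simp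
    qed
    also have "\<dots> = (\<integral>\<^sup>+x. ennreal (norm (f x)) \<partial>\<Lambda> \<tau>)" by (rule Pi.P.nn_integral_fst) measurable
    also have "\<dots> < \<infinity>" using f by (simp add: integrable_iff_bounded)
    finally show "(\<integral>\<^sup>+y. ennreal (norm (?g y)) \<partial>(?T \<Otimes>\<^sub>M \<mu>)) < \<infinity>" .
  qed
  then have "integrable (?T \<Otimes>\<^sub>M \<mu>) (\<lambda>(t, a). LINT s|unit_lborel. f (t, a, s))" by (simp add: case_prod_beta')
  from M.Fubini_integral[OF this] show ?thesis unfolding integral_\<Lambda>_iterated[OF f] by simp
qed

abbreviation "initial_energy a \<equiv> LINT s|unit_lborel. (norm (Xs 0 a s))\<^sup>2"

lemma sq_\<Omega>_measurable: "t \<ge> 0 \<Longrightarrow> (\<lambda>x. (norm (Xs t (fst x) (snd x)))\<^sup>2) \<in> borel_measurable \<Omega>"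
  using Xs_\<Omega>[of t] by (simp add: case_prod_beta')

lemma nn_sq:
  assumes "t \<ge> 0"
  shows "(\<integral>\<^sup>+x. ennreal ((norm (Xs t (fst x) (snd x)))\<^sup>2) \<partial>\<Omega>) = (\<integral>\<^sup>+a. ennreal (LINT s|unit_lborel. (norm (Xs t a s))\<^sup>2) \<partial>\<mu>)"
proof -
  have "(\<lambda>x. ennreal ((norm (Xs t (fst x) (snd x)))\<^sup>2)) \<in> borel_measurable \<Omega>"
    using sq_\<Omega>_measurable[OF assms] by simp
  from U.nn_integral_fst[OF this]
  have "(\<integral>\<^sup>+x. ennreal ((norm (Xs t (fst x) (snd x)))\<^sup>2) \<partial>\<Omega>) = (\<integral>\<^sup>+a. \<integral>\<^sup>+s. ennreal ((norm (Xs t a s))\<^sup>2) \<partial>unit_lborel \<partial>\<mu>)" by simp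
  also have "\<dots> = (\<integral>\<^sup>+a. ennreal (LINT s|unit_lborel. (norm (Xs t a s))\<^sup>2) \<partial>\<mu>)"
  proof (rule nn_integral_cong)
    fix a assume "a \<in> space \<mu>"
    then interpret heat_loop "\<lambda>s. X0 s a" "\<lambda>t s. X t s a" by (rule heat_loop)
    show "(\<integral>\<^sup>+s. ennreal ((norm (Xs t a s))\<^sup>2) \<partial>unit_lborel) = ennreal (LINT s|unit_lborel. (norm (Xs t a s))\<^sup>2)"
      unfolding Xs_def by (intro nn_integral_eq_integral Ds_integrable_sq(1) assms) auto
  qed
  finally show ?thesis .
qed

lemma loop_energy_eq: "loop_energy \<mu> X0 = (\<integral>\<^sup>+x. ennreal ((norm (Xs 0 (fst x) (snd x)))\<^sup>2) \<partial>\<Omega>)"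
proof -
  have "loop_energy \<mu> X0 = (\<integral>\<^sup>+a. (\<integral>\<^sup>+s\<in>{0..1}. ennreal ((norm (loop_deriv X0 s a))\<^sup>2) \<partial>lborel) \<partial>\<mu>)"
    unfolding loop_energy_def by (simp add: nn_integral_completion)
  also have "\<dots> = (\<integral>\<^sup>+a. ennreal (initial_energy a) \<partial>\<mu>)"
  proof (rule nn_integral_cong)
    fix a assume a: "a \<in> space \<mu>"
    then interpret heat_loop "\<lambda>s. X0 s a" "\<lambda>t s. X t s a" by (rule heat_loop)
    have "(\<integral>\<^sup>+s\<in>{0..1}. ennreal ((norm (loop_deriv X0 s a))\<^sup>2) \<partial>lborel) = (\<integral>\<^sup>+s\<in>{0..1}. ennreal ((norm (Xs 0 a s))\<^sup>2) \<partial>lborel)"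
    proof (rule nn_integral_cong_AE)
      show "AE s in lborel. ennreal ((norm (loop_deriv X0 s a))\<^sup>2) * indicator {0..1} s = ennreal ((norm (Xs 0 a s))\<^sup>2) * indicator {0..1} s"
        using AE_Ds[OF order_refl]
      proof eventually_elim
        case (elim s)
        then show ?case by (simp add: Xs_def Y_0 vector_derivative_at)
      qed
    qed
    also have "\<dots> = (\<integral>\<^sup>+s. ennreal ((norm (Xs 0 a s))\<^sup>2) \<partial>unit_lborel)"
      by (subst nn_integral_restrict_space) auto
    also have "\<dots> = ennreal (initial_energy a)"
      unfolding Xs_def by (intro nn_integral_eq_integral Ds_integrable_sq(1)) auto
    finally show "(\<integral>\<^sup>+s\<in>{0..1}. ennreal ((norm (loop_deriv X0 s a))\<^sup>2) \<partial>lborel) = ennreal (initial_energy a)" .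
  qed
  finally show ?thesis using nn_sq[of 0] by simp
qed

lemma energy_at:
  assumes "a \<in> space \<mu>" "t \<ge> 0"
  shows "(LINT s|unit_lborel. (norm (Xs t a s))\<^sup>2) \<le> initial_energy a"
proof -
  interpret heat_loop "\<lambda>s. X0 s a" "\<lambda>t s. X t s a" using assms(1) by (rule heat_loop)
  show ?thesis unfolding Xs_def by (rule Ds_energy_le[OF assms(2)])
qed

lemma nn_sq_le:
  assumes "t \<ge> 0"
  shows "(\<integral>\<^sup>+x. ennreal ((norm (Xs t (fst x) (snd x)))\<^sup>2) \<partial>\<Omega>) \<le> loop_energy \<mu> X0"
  unfolding loop_energy_eq nn_sq[OF assms] nn_sq[OF order_refl]
  by (intro nn_integral_mono ennreal_leI energy_at assms) simp

lemma Xs_sq_integrable: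
  assumes "t \<ge> 0"
  shows "integrable \<Omega> (\<lambda>x. (norm (Xs t (fst x) (snd x)))\<^sup>2)"
  using nn_sq_le[OF assms] energy_finite sq_\<Omega>_measurable[OF assms]
  by (intro integrableI_nonneg) (auto intro: le_less_trans)

lemma initial_energy_integrable: "integrable \<mu> initial_energy"
  using Pi.integrable_fst'[OF Xs_sq_integrable[OF order_refl]] by simp

lemma loop_energy_eq_integral: "loop_energy \<mu> X0 = ennreal (LINT x|\<Omega>. (norm (Xs 0 (fst x) (snd x)))\<^sup>2)"
  unfolding loop_energy_eq using Xs_sq_integrable[OF order_refl] by (intro nn_integral_eq_integral) auto

lemma Xs_energy_le:
  assumes "t \<ge> 0"
  shows "(LINT x|\<Omega>. (norm (Xs t (fst x) (snd x)))\<^sup>2) \<le> (LINT x|\<Omega>. (norm (Xs 0 (fst x) (snd x)))\<^sup>2)"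
proof -
  have "ennreal (LINT x|\<Omega>. (norm (Xs t (fst x) (snd x)))\<^sup>2) \<le> ennreal (LINT x|\<Omega>. (norm (Xs 0 (fst x) (snd x)))\<^sup>2)"
    using nn_sq_le[OF assms] Xs_sq_integrable[OF assms] unfolding loop_energy_eq_integral
    by (subst nn_integral_eq_integral[symmetric]) auto
  then show ?thesis by (subst (asm) ennreal_le_iff) auto
qed

lemma XS_sq_integrable: "integrable (\<Lambda> \<tau>) (\<lambda>x. (norm (XS x))\<^sup>2)"
proof (rule integrableI_nonneg)
  interpret T: finite_measure "interval_lborel 0 \<tau>" by (rule finite_measure_interval_lborel)
  have [measurable]: "XS \<in> borel_measurable (\<Lambda> \<tau>)" by (rule XS_measurable)
  show "(\<lambda>x. (norm (XS x))\<^sup>2) \<in> borel_measurable (\<Lambda> \<tau>)" by measurable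
  have "(\<integral>\<^sup>+x. ennreal ((norm (XS x))\<^sup>2) \<partial>\<Lambda> \<tau>) = (\<integral>\<^sup>+t. \<integral>\<^sup>+x. ennreal ((norm (XS (t, x)))\<^sup>2) \<partial>\<Omega> \<partial>interval_lborel 0 \<tau>)"
    by (rule Pi.P.nn_integral_fst[symmetric]) measurable
  also have "\<dots> \<le> (\<integral>\<^sup>+t. loop_energy \<mu> X0 \<partial>interval_lborel 0 \<tau>)"
    by (intro nn_integral_mono) (simp add: XS_def nn_sq_le space_interval_lborel)
  also have "\<dots> < \<infinity>"
    using energy_finite T.emeasure_finite[of "space (interval_lborel 0 \<tau>)"]
    by (simp add: ennreal_mult_less_top less_top del: T.emeasure_finite)
  finally show "(\<integral>\<^sup>+x. ennreal ((norm (XS x))\<^sup>2) \<partial>\<Lambda> \<tau>) < \<infinity>" .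
qed simp

text \<open>Tonelli's theorem moves the loop variable outside, where the dissipation of each loop is
  at most half its initial energy.\<close>

lemma XT_sq_integrable: "integrable (\<Lambda> \<tau>) (\<lambda>x. (norm (XT x))\<^sup>2)"
proof (cases "\<tau> > 0")
  case True
  interpret M: pair_sigma_finite "interval_lborel 0 \<tau>" \<mu> by (rule pair_\<mu>)
  have [measurable]: "XT \<in> borel_measurable (\<Lambda> \<tau>)" by (rule XT_measurable)
  let ?T = "interval_lborel 0 \<tau>"
  show ?thesis
  proof (rule integrableI_nonneg)
    show "(\<lambda>x. (norm (XT x))\<^sup>2) \<in> borel_measurable (\<Lambda> \<tau>)" by measurable
    have "(\<lambda>y. ennreal ((norm (XT (fst (fst y), snd (fst y), snd y)))\<^sup>2)) \<in> borel_measurable ((?T \<Otimes>\<^sub>M \<mu>) \<Otimes>\<^sub>M unit_lborel)"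
      by measurable
    then have nm: "(\<lambda>(y, s). ennreal ((norm (XT (fst y, snd y, s)))\<^sup>2)) \<in> borel_measurable ((?T \<Otimes>\<^sub>M \<mu>) \<Otimes>\<^sub>M unit_lborel)"
      by (simp add: case_prod_beta')
    have m2: "(\<lambda>(t, a). \<integral>\<^sup>+s. ennreal ((norm (XT (t, a, s)))\<^sup>2) \<partial>unit_lborel) \<in> borel_measurable (?T \<Otimes>\<^sub>M \<mu>)"
      using U.borel_measurable_nn_integral_fst[OF nm] by (simp add: case_prod_beta')
    have "(\<integral>\<^sup>+x. ennreal ((norm (XT x))\<^sup>2) \<partial>\<Lambda> \<tau>) = (\<integral>\<^sup>+t. \<integral>\<^sup>+x. ennreal ((norm (XT (t, x)))\<^sup>2) \<partial>\<Omega> \<partial>?T)"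
      by (rule Pi.P.nn_integral_fst[symmetric]) measurable
    also have "\<dots> = (\<integral>\<^sup>+t. \<integral>\<^sup>+a. \<integral>\<^sup>+s. ennreal ((norm (XT (t, a, s)))\<^sup>2) \<partial>unit_lborel \<partial>\<mu> \<partial>?T)"
    proof (rule nn_integral_cong)
      fix t assume t: "t \<in> space ?T"
      have "(\<lambda>x. ennreal ((norm (XT (t, x)))\<^sup>2)) \<in> borel_measurable \<Omega>" using t by measurable
      from U.nn_integral_fst[OF this]
      show "(\<integral>\<^sup>+x. ennreal ((norm (XT (t, x)))\<^sup>2) \<partial>\<Omega>) = (\<integral>\<^sup>+a. \<integral>\<^sup>+s. ennreal ((norm (XT (t, a, s)))\<^sup>2) \<partial>unit_lborel \<partial>\<mu>)" by simp
    qed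
    also have "\<dots> = (\<integral>\<^sup>+a. \<integral>\<^sup>+t. \<integral>\<^sup>+s. ennreal ((norm (XT (t, a, s)))\<^sup>2) \<partial>unit_lborel \<partial>?T \<partial>\<mu>)"
      using M.Fubini'[OF m2] by simp
    also have "\<dots> \<le> (\<integral>\<^sup>+a. ennreal (initial_energy a / 2) \<partial>\<mu>)"
    proof (rule nn_integral_mono)
      fix a assume a: "a \<in> space \<mu>"
      then interpret heat_loop "\<lambda>s. X0 s a" "\<lambda>t s. X t s a" by (rule heat_loop)
      show "(\<integral>\<^sup>+t. \<integral>\<^sup>+s. ennreal ((norm (XT (t, a, s)))\<^sup>2) \<partial>unit_lborel \<partial>?T) \<le> ennreal (initial_energy a / 2)"
        unfolding XT_def Xt_def Xs_def using nn_Dt_energy_le[OF True] by simp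
    qed
    also have "\<dots> = ennreal (LINT a|\<mu>. initial_energy a / 2)"
      using initial_energy_integrable by (intro nn_integral_eq_integral) auto
    also have "\<dots> < \<infinity>" by simp
    finally show "(\<integral>\<^sup>+x. ennreal ((norm (XT x))\<^sup>2) \<partial>\<Lambda> \<tau>) < \<infinity>" .
  qed simp
next
  \<comment> \<open>The time interval is empty or a single point, hence a null set.\<close>
  case False
  let ?T = "interval_lborel 0 \<tau>"
  have [measurable]: "XT \<in> borel_measurable (\<Lambda> \<tau>)" by (rule XT_measurable)
  have "emeasure ?T (space ?T) = 0"
    using False by (cases "\<tau> = 0") (simp_all add: space_interval_lborel emeasure_restrict_space)
  then have "AE t in ?T. False" by (intro AE_I[of _ _ "space ?T"] sets.top) auto
  then have "(\<integral>\<^sup>+t. \<integral>\<^sup>+x. ennreal ((norm (XT (t, x)))\<^sup>2) \<partial>\<Omega> \<partial>?T) = (\<integral>\<^sup>+t. 0 \<partial>?T)"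
    by (intro nn_integral_cong_AE) auto
  moreover have "(\<integral>\<^sup>+x. ennreal ((norm (XT x))\<^sup>2) \<partial>\<Lambda> \<tau>) = (\<integral>\<^sup>+t. \<integral>\<^sup>+x. ennreal ((norm (XT (t, x)))\<^sup>2) \<partial>\<Omega> \<partial>?T)"
    by (rule Pi.P.nn_integral_fst[symmetric]) measurable
  ultimately have "(\<integral>\<^sup>+x. ennreal ((norm (XT x))\<^sup>2) \<partial>\<Lambda> \<tau>) < \<infinity>" by simp
  then show ?thesis by (intro integrableI_nonneg) auto
qed

end

lemma loop_integral_cong:
  "(\<And>a s. a \<in> space \<mu> \<Longrightarrow> g s a = h s a) \<Longrightarrow> loop_integral \<mu> g = loop_integral \<mu> h"
  unfolding loop_integral_def by (intro Bochner_Integration.integral_cong) simp_all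

lemma integrable_bounded_inner:
  fixes f w :: "'a \<Rightarrow> real ^ 'm::finite"
  assumes f: "f \<in> borel_measurable M" "\<And>x. x \<in> space M \<Longrightarrow> norm (f x) \<le> K"
    and w: "w \<in> borel_measurable M" "integrable M (\<lambda>x. norm (w x))"
  shows "integrable M (\<lambda>x. f x \<bullet> w x)"
proof (rule Bochner_Integration.integrable_bound)
  show "integrable M (\<lambda>x. K * norm (w x))" using w by simp
  show "(\<lambda>x. f x \<bullet> w x) \<in> borel_measurable M" using f w by (intro borel_measurable_inner)
  show "AE x in M. norm (f x \<bullet> w x) \<le> norm (K * norm (w x))"
  proof (rule AE_I2)
    fix x assume "x \<in> space M"
    have "norm (f x \<bullet> w x) \<le> norm (f x) * norm (w x)" using Cauchy_Schwarz_ineq2 by simp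
    also have "\<dots> \<le> K * norm (w x)" using f(2)[OF \<open>x \<in> space M\<close>] by (intro mult_right_mono) auto
    finally show "norm (f x \<bullet> w x) \<le> norm (K * norm (w x))" by simp
  qed
qed

lemma (in finite_measure) integrable_norm_of_sq:
  fixes w :: "'a \<Rightarrow> real ^ 'm::finite"
  assumes w: "w \<in> borel_measurable M" "integrable M (\<lambda>x. (norm (w x))\<^sup>2)"
  shows "integrable M (\<lambda>x. norm (w x))"
  using integrable_mult_L2[of "\<lambda>_. 1" M "\<lambda>x. norm (w x)"] w by simp

section \<open>The functionals B, rho and P as integrals over the ensemble\<close>

context loop_ensemble
begin

lemma loop_functionals_X_0: "loop_B \<mu> X0 = loop_B \<mu> (X 0)" "loop_\<rho> \<mu> X0 = loop_\<rho> \<mu> (X 0)"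
proof -
  have e: "(\<lambda>s. X0 s a) = (\<lambda>s. X 0 s a)" if "a \<in> space \<mu>" for a using X_0[OF that] by auto
  show "loop_B \<mu> X0 = loop_B \<mu> (X 0)" unfolding loop_B_def fun_eq_iff
    by (intro allI loop_integral_cong) (simp add: e X_0[symmetric])
  show "loop_\<rho> \<mu> X0 = loop_\<rho> \<mu> (X 0)" unfolding loop_\<rho>_def fun_eq_iff
    by (intro allI loop_integral_cong) (simp add: X_0)
qed

lemma Xs_norm_integrable:
  assumes "t \<ge> 0"
  shows "integrable \<Omega> (\<lambda>x. norm (Xs t (fst x) (snd x)))"
  using Xs_\<Omega>[OF assms] Xs_sq_integrable[OF assms] by (intro Pi.P.integrable_norm_of_sq) (simp_all add: case_prod_beta')

lemma XS_norm_integrable: "integrable (\<Lambda> \<tau>) (\<lambda>x. norm (XS x))"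
  by (intro finite_measure.integrable_norm_of_sq finite_\<Lambda> XS_measurable XS_sq_integrable)

lemma XT_norm_integrable: "integrable (\<Lambda> \<tau>) (\<lambda>x. norm (XT x))"
  by (intro finite_measure.integrable_norm_of_sq finite_\<Lambda> XT_measurable XT_sq_integrable)

lemma Z_mem: "x \<in> space (\<Lambda> \<tau>) \<Longrightarrow> Z x \<in> {0..\<tau>} \<times> UNIV"
  by (auto simp: space_\<Lambda> Z_def)

lemma field_bounded:
  fixes \<phi> :: "real \<times> 'n torus \<Rightarrow> 'b::real_normed_vector"
  assumes "continuous_on ({0..\<tau>} \<times> UNIV) \<phi>"
  obtains K where "K > 0" "\<And>x. x \<in> space (\<Lambda> \<tau>) \<Longrightarrow> norm (\<phi> (Z x)) \<le> K"
proof -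
  obtain K where "\<And>t x. t \<in> {0..\<tau>} \<Longrightarrow> norm (\<phi> (t, x)) \<le> K" "K > 0"
    by (rule continuous_on_time_torus_bounded[OF assms]) blast
  then show thesis using Z_mem by (intro that[of K]) (auto simp: mem_Times_iff, metis prod.collapse)
qed

lemma field_inner_integrable:
  fixes \<phi> :: "real \<times> 'n torus \<Rightarrow> real ^ 'm::finite"
  assumes \<phi>: "continuous_on ({0..\<tau>} \<times> UNIV) \<phi>" and w: "w \<in> borel_measurable (\<Lambda> \<tau>)" "integrable (\<Lambda> \<tau>) (\<lambda>x. norm (w x))"
  shows "integrable (\<Lambda> \<tau>) (\<lambda>x. \<phi> (Z x) \<bullet> w x)"
proof -
  obtain K where "K > 0" "\<And>x. x \<in> space (\<Lambda> \<tau>) \<Longrightarrow> norm (\<phi> (Z x)) \<le> K" by (rule field_bounded[OF \<phi>]) blast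
  then show ?thesis by (intro integrable_bounded_inner[OF field_\<Lambda>[OF \<phi>] _ w])
qed

lemma field_integrable:
  fixes \<phi> :: "real \<times> 'n torus \<Rightarrow> real"
  assumes \<phi>: "continuous_on ({0..\<tau>} \<times> UNIV) \<phi>"
  shows "integrable (\<Lambda> \<tau>) (\<lambda>x. \<phi> (Z x))"
proof -
  obtain K where "K > 0" "\<And>x. x \<in> space (\<Lambda> \<tau>) \<Longrightarrow> norm (\<phi> (Z x)) \<le> K" by (rule field_bounded[OF \<phi>]) blast
  then have "AE x in \<Lambda> \<tau>. norm (\<phi> (Z x)) \<le> K" by (intro AE_I2)
  then show ?thesis by (rule finite_measure.integrable_const_bound[OF finite_\<Lambda> _ field_\<Lambda>[OF \<phi>]])
qed

lemma field_inner_\<Omega>_integrable: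
  fixes \<phi> :: "'n torus \<Rightarrow> real ^ 'n"
  assumes \<phi>: "continuous_on UNIV \<phi>" and t: "t \<ge> 0"
  shows "integrable \<Omega> (\<lambda>x. \<phi> (abs_torus (X t (snd x) (fst x))) \<bullet> Xs t (fst x) (snd x))"
proof -
  obtain K where "\<And>x. norm (\<phi> x) \<le> K" by (rule continuous_on_torus_bounded[OF \<phi>]) blast
  then show ?thesis
    using field_\<Omega>[OF \<phi> t] Xs_\<Omega>[OF t] Xs_norm_integrable[OF t]
    by (intro integrable_bounded_inner[where K = K]) (simp_all add: case_prod_beta')
qed

lemma field_\<Omega>_integrable:
  fixes \<phi> :: "'n torus \<Rightarrow> real"
  assumes \<phi>: "continuous_on UNIV \<phi>" and t: "t \<ge> 0"
  shows "integrable \<Omega> (\<lambda>x. \<phi> (abs_torus (X t (snd x) (fst x))))"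
proof -
  obtain K where "\<And>x. norm (\<phi> x) \<le> K" by (rule continuous_on_torus_bounded[OF \<phi>]) blast
  then show ?thesis
    using field_\<Omega>[OF \<phi> t] by (intro Pi.P.integrable_const_bound[of _ K]) (simp_all add: case_prod_beta')
qed

lemma loop_\<rho>_eq:
  fixes \<phi> :: "'n torus \<Rightarrow> real"
  assumes \<phi>: "continuous_on UNIV \<phi>" and t: "t \<ge> 0"
  shows "loop_\<rho> \<mu> (X t) \<phi> = (LINT x|\<Omega>. \<phi> (abs_torus (X t (snd x) (fst x))))"
proof -
  have "loop_\<rho> \<mu> (X t) \<phi> = (LINT a|\<mu>. LINT s|unit_lborel. \<phi> (abs_torus (X t s a)))"
    unfolding loop_\<rho>_def by (rule loop_integral_eq_iterated[OF field_\<Omega>[OF \<phi> t]]) simp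
  also have "\<dots> = (LINT x|\<Omega>. \<phi> (abs_torus (X t (snd x) (fst x))))"
    using integral_\<Omega>[OF field_\<Omega>_integrable[OF \<phi> t]] by simp
  finally show ?thesis .
qed

lemma loop_B_eq_iterated:
  fixes \<phi> :: "'n torus \<Rightarrow> real ^ 'n"
  assumes \<phi>: "continuous_on UNIV \<phi>" and t: "t \<ge> 0"
  shows "loop_B \<mu> (X t) \<phi> = (LINT a|\<mu>. LINT s|unit_lborel. \<phi> (abs_torus (X t s a)) \<bullet> Xs t a s)"
  unfolding loop_B_def
proof (rule loop_integral_eq_iterated)
  show "(\<lambda>(a, s). \<phi> (abs_torus (X t s a)) \<bullet> Xs t a s) \<in> borel_measurable \<Omega>"
    using field_inner_\<Omega>_integrable[OF \<phi> t] by (simp add: case_prod_beta')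
  fix a assume a: "a \<in> space \<mu>"
  then interpret heat_loop "\<lambda>s. X0 s a" "\<lambda>t s. X t s a" by (rule heat_loop)
  show "AE s in lborel. s \<in> {0..1} \<longrightarrow> \<phi> (abs_torus (X t s a)) \<bullet> loop_deriv (X t) s a = \<phi> (abs_torus (X t s a)) \<bullet> Xs t a s"
    using AE_Ds[OF t] by eventually_elim (simp add: Xs_def vector_derivative_at)
qed

lemma loop_B_eq:
  fixes \<phi> :: "'n torus \<Rightarrow> real ^ 'n"
  assumes \<phi>: "continuous_on UNIV \<phi>" and t: "t \<ge> 0"
  shows "loop_B \<mu> (X t) \<phi> = (LINT x|\<Omega>. \<phi> (abs_torus (X t (snd x) (fst x))) \<bullet> Xs t (fst x) (snd x))"
  unfolding loop_B_eq_iterated[OF assms]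
  using integral_\<Omega>[OF field_inner_\<Omega>_integrable[OF \<phi> t]] by simp

lemma loop_P_eq:
  fixes \<phi> :: "real \<times> 'n torus \<Rightarrow> real ^ 'n"
  assumes \<phi>: "continuous_on ({0..T} \<times> UNIV) \<phi>"
  shows "loop_P \<mu> T X \<phi> = (LINT x|\<Lambda> T. \<phi> (Z x) \<bullet> XT x)"
proof -
  have i: "integrable (\<Lambda> T) (\<lambda>x. \<phi> (Z x) \<bullet> XT x)"
    by (rule field_inner_integrable[OF \<phi> XT_measurable XT_norm_integrable])
  have m: "(\<lambda>x. \<phi> (Z x) \<bullet> XT x) \<in> borel_measurable (\<Lambda> T)" using i by simp
  have "loop_P \<mu> T X \<phi> = (LINT t|interval_lborel 0 T. LINT a|\<mu>. LINT s|unit_lborel. \<phi> (Z (t, a, s)) \<bullet> XT (t, a, s))"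
    unfolding loop_P_def
  proof (rule set_lebesgue_integral_cong_AE_lborel[OF iterated_integral_measurable[OF m]])
    \<comment> \<open>At time zero the two-sided time derivative need not exist, and
      \<open>X\<close> is arbitrary at negative times; this one time is null.\<close>
    have "AE t in lborel. t \<noteq> (0::real)" by (rule AE_lborel_singleton)
    then show "AE t in lborel. t \<in> {0..T} \<longrightarrow>
      loop_integral \<mu> (\<lambda>s a. \<phi> (t, abs_torus (X t s a)) \<bullet> vector_derivative (\<lambda>\<tau>. X \<tau> s a) (at t))
       = (LINT a|\<mu>. LINT s|unit_lborel. \<phi> (Z (t, a, s)) \<bullet> XT (t, a, s))"
    proof (rule eventually_mono, intro impI)
      fix t assume "t \<noteq> 0" "t \<in> {0..T}"
      then have t: "t \<in> {0..T}" "t > 0" by auto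
      show "loop_integral \<mu> (\<lambda>s a. \<phi> (t, abs_torus (X t s a)) \<bullet> vector_derivative (\<lambda>\<tau>. X \<tau> s a) (at t))
       = (LINT a|\<mu>. LINT s|unit_lborel. \<phi> (Z (t, a, s)) \<bullet> XT (t, a, s))"
      proof (rule loop_integral_eq_iterated)
        have "t \<in> space (interval_lborel 0 T)" using t by (simp add: space_interval_lborel)
        from measurable_Pair2[OF m this]
        show "(\<lambda>(a, s). \<phi> (Z (t, a, s)) \<bullet> XT (t, a, s)) \<in> borel_measurable \<Omega>" by (simp add: case_prod_beta')
        fix a assume "a \<in> space \<mu>"
        then interpret heat_loop "\<lambda>s. X0 s a" "\<lambda>t s. X t s a" by (rule heat_loop)
        show "AE s in lborel. s \<in> {0..1} \<longrightarrow> \<phi> (t, abs_torus (X t s a)) \<bullet> vector_derivative (\<lambda>\<tau>. X \<tau> s a) (at t)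
          = \<phi> (Z (t, a, s)) \<bullet> XT (t, a, s)"
          by (simp add: Z_def XT_def Xt_def vector_derivative_at[OF Dt[OF t(2)]])
      qed
    qed
  qed
  then show ?thesis using integral_\<Lambda>_iterated[OF i] by simp
qed

lemma spacetime_\<rho>_eq:
  fixes \<phi> :: "real \<times> 'n torus \<Rightarrow> real"
  assumes \<phi>: "continuous_on ({0..\<tau>} \<times> UNIV) \<phi>"
  shows "spacetime \<tau> (\<lambda>t. loop_\<rho> \<mu> (X t)) \<phi> = (LINT x|\<Lambda> \<tau>. \<phi> (Z x))"
  unfolding spacetime_def lebesgue_integral_interval_lborel[symmetric] integral_\<Lambda>[OF field_integrable[OF \<phi>]]
proof (rule Bochner_Integration.integral_cong)
  fix t assume "t \<in> space (interval_lborel 0 \<tau>)"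
  then have t: "t \<in> {0..\<tau>}" by (simp add: space_interval_lborel)
  show "loop_\<rho> \<mu> (X t) (\<lambda>x. \<phi> (t, x)) = (LINT x|\<Omega>. \<phi> (Z (t, x)))"
    using t by (subst loop_\<rho>_eq[OF continuous_on_time_section[OF \<phi> t]]) (simp_all add: Z_def case_prod_beta)
qed simp

lemma spacetime_B_eq:
  fixes \<phi> :: "real \<times> 'n torus \<Rightarrow> real ^ 'n"
  assumes \<phi>: "continuous_on ({0..\<tau>} \<times> UNIV) \<phi>"
  shows "spacetime \<tau> (\<lambda>t. loop_B \<mu> (X t)) \<phi> = (LINT x|\<Lambda> \<tau>. \<phi> (Z x) \<bullet> XS x)"
  unfolding spacetime_def lebesgue_integral_interval_lborel[symmetric]
    integral_\<Lambda>[OF field_inner_integrable[OF \<phi> XS_measurable XS_norm_integrable]]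
proof (rule Bochner_Integration.integral_cong)
  fix t assume "t \<in> space (interval_lborel 0 \<tau>)"
  then have t: "t \<in> {0..\<tau>}" by (simp add: space_interval_lborel)
  show "loop_B \<mu> (X t) (\<lambda>x. \<phi> (t, x)) = (LINT x|\<Omega>. \<phi> (Z (t, x)) \<bullet> XS (t, x))"
    using t by (subst loop_B_eq[OF continuous_on_time_section[OF \<phi> t]]) (simp_all add: Z_def XS_def case_prod_beta)
qed simp

lemma integral_\<Lambda>_time_restrict:
  fixes f :: "real \<times> 'a \<times> real \<Rightarrow> real"
  assumes \<tau>: "\<tau> \<le> T" and f: "integrable (\<Lambda> T) (\<lambda>x. indicator {..\<tau>} (fst x) * f x)" "integrable (\<Lambda> \<tau>) f"
  shows "(LINT x|\<Lambda> T. indicator {..\<tau>} (fst x) * f x) = integral\<^sup>L (\<Lambda> \<tau>) f"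
proof -
  have "(LINT x|\<Lambda> T. indicator {..\<tau>} (fst x) * f x) = (LINT t|interval_lborel 0 T. indicator {..\<tau>} t * (LINT x|\<Omega>. f (t, x)))"
    unfolding integral_\<Lambda>[OF f(1)] by simp
  also have "\<dots> = (LINT t|lborel. indicator {0..\<tau>} t *\<^sub>R (LINT x|\<Omega>. f (t, x)))"
    unfolding lebesgue_integral_interval_lborel set_lebesgue_integral_def using \<tau>
    by (intro Bochner_Integration.integral_cong) (auto split: split_indicator)
  also have "\<dots> = integral\<^sup>L (\<Lambda> \<tau>) f"
    unfolding integral_\<Lambda>[OF f(2)] lebesgue_integral_interval_lborel set_lebesgue_integral_def ..
  finally show ?thesis .
qed

text \<open>The cut-offs lie between 0 and 1 and converge to the indicator of
  \<open>{..\<tau>}\<close>, so dominated convergence applies with an integrable majorant that is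
  linear in the t-derivative. The values frozen after \<tau> disappear in the limit.\<close>

lemma restrict_time_P_eq:
  fixes \<phi> :: "real \<times> 'n torus \<Rightarrow> real ^ 'n"
  assumes \<tau>: "0 \<le> \<tau>" "\<tau> \<le> T" and \<phi>: "continuous_on ({0..\<tau>} \<times> UNIV) \<phi>"
  shows "restrict_time \<tau> (loop_P \<mu> T X) \<phi> = (LINT x|\<Lambda> \<tau>. \<phi> (Z x) \<bullet> XT x)"
proof -
  define c where "c n t = max 0 (1 - real n * max 0 (t - \<tau>))" for n :: nat and t
  have c01: "0 \<le> c n t" "c n t \<le> 1" for n t by (auto simp: c_def)
  define \<psi> where "\<psi> z = \<phi> (min (fst z) \<tau>, snd z)" for z
  have \<psi>c: "continuous_on ({0..T} \<times> UNIV) \<psi>"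
    unfolding \<psi>_def
    by (rule continuous_on_compose2[OF \<phi>]) (use \<tau> in \<open>auto intro!: continuous_intros\<close>)
  have cc: "continuous_on ({0..T} \<times> UNIV) (\<lambda>z :: real \<times> 'n torus. c n (fst z))" for n
    unfolding c_def by (intro continuous_intros)
  have P: "loop_P \<mu> T X (\<lambda>(s, x). max 0 (1 - real n * max 0 (s - \<tau>)) *\<^sub>R \<phi> (min s \<tau>, x))
      = (LINT x|\<Lambda> T. c n (fst x) * (\<psi> (Z x) \<bullet> XT x))" for n
  proof -
    have "continuous_on ({0..T} \<times> UNIV) (\<lambda>z. c n (fst z) *\<^sub>R \<psi> z)"
      by (intro continuous_on_scaleR cc \<psi>c)
    from loop_P_eq[OF this]
    have "loop_P \<mu> T X (\<lambda>z. c n (fst z) *\<^sub>R \<psi> z) = (LINT x|\<Lambda> T. c n (fst x) * (\<psi> (Z x) \<bullet> XT x))"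
      by (simp add: Z_def case_prod_beta)
    then show ?thesis by (simp add: c_def \<psi>_def case_prod_beta')
  qed
  have i: "integrable (\<Lambda> T) (\<lambda>x. \<psi> (Z x) \<bullet> XT x)"
    by (rule field_inner_integrable[OF \<psi>c XT_measurable XT_norm_integrable])
  have fm: "(\<lambda>x. fst x) \<in> borel_measurable (\<Lambda> T)"
    by (rule measurable_compose[OF measurable_fst]) (rule measurable_restrict_space1, simp)
  have lim: "(\<lambda>n. LINT x|\<Lambda> T. c n (fst x) * (\<psi> (Z x) \<bullet> XT x)) \<longlonglongrightarrow> (LINT x|\<Lambda> T. indicator {..\<tau>} (fst x) * (\<psi> (Z x) \<bullet> XT x))"
  proof (rule integral_dominated_convergence[where w = "\<lambda>x. \<bar>\<psi> (Z x) \<bullet> XT x\<bar>"])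
    show "(\<lambda>x. indicator {..\<tau>} (fst x) * (\<psi> (Z x) \<bullet> XT x)) \<in> borel_measurable (\<Lambda> T)"
      using i fm by (intro borel_measurable_times borel_measurable_indicator') auto
    show "(\<lambda>x. c n (fst x) * (\<psi> (Z x) \<bullet> XT x)) \<in> borel_measurable (\<Lambda> T)" for n
      unfolding c_def using i fm by (intro borel_measurable_times borel_measurable_max borel_measurable_diff borel_measurable_const) auto
    show "integrable (\<Lambda> T) (\<lambda>x. \<bar>\<psi> (Z x) \<bullet> XT x\<bar>)" using i by simp
    show "AE x in \<Lambda> T. norm (c n (fst x) * (\<psi> (Z x) \<bullet> XT x)) \<le> \<bar>\<psi> (Z x) \<bullet> XT x\<bar>" for n
      using c01 by (intro AE_I2) (simp add: abs_mult mult_left_le_one_le)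
    show "AE x in \<Lambda> T. (\<lambda>n. c n (fst x) * (\<psi> (Z x) \<bullet> XT x)) \<longlonglongrightarrow> indicator {..\<tau>} (fst x) * (\<psi> (Z x) \<bullet> XT x)"
    proof (intro AE_I2 tendsto_mult tendsto_const)
      fix x :: "real \<times> 'a \<times> real"
      show "(\<lambda>n. c n (fst x)) \<longlonglongrightarrow> indicator {..\<tau>} (fst x)"
      proof (cases "fst x \<le> \<tau>")
        case True
        then show ?thesis by (simp add: c_def)
      next
        case False
        obtain k where k: "1 / (fst x - \<tau>) < real k" using reals_Archimedean2 by blast
        have "\<forall>\<^sub>F n in sequentially. c n (fst x) = 0"
          unfolding eventually_sequentially
        proof (intro exI[of _ k] allI impI)
          fix n assume "k \<le> n"
          then have "1 / (fst x - \<tau>) < real n" using k by simp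
          then show "c n (fst x) = 0" using False by (simp add: c_def field_simps)
        qed
        then show ?thesis using False by (simp add: tendsto_eventually)
      qed
    qed
  qed
  have e: "indicator {..\<tau>} (fst x) * (\<psi> (Z x) \<bullet> XT x) = indicator {..\<tau>} (fst x) * (\<phi> (Z x) \<bullet> XT x)" for x
    by (simp add: \<psi>_def Z_def case_prod_beta split: split_indicator)
  have "restrict_time \<tau> (loop_P \<mu> T X) \<phi> = (LINT x|\<Lambda> T. indicator {..\<tau>} (fst x) * (\<phi> (Z x) \<bullet> XT x))"
    unfolding restrict_time_def P using limI[OF lim] by (simp only: e)
  also have "\<dots> = (LINT x|\<Lambda> \<tau>. \<phi> (Z x) \<bullet> XT x)"
  proof (rule integral_\<Lambda>_time_restrict[OF \<tau>(2)])
    have "integrable (\<Lambda> T) (\<lambda>x. indicator {..\<tau>} (fst x) * (\<psi> (Z x) \<bullet> XT x))"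
      using i fm by (intro Bochner_Integration.integrable_bound[OF i] borel_measurable_times borel_measurable_indicator')
        (auto split: split_indicator)
    then show "integrable (\<Lambda> T) (\<lambda>x. indicator {..\<tau>} (fst x) * (\<phi> (Z x) \<bullet> XT x))" by (simp only: e)
    show "integrable (\<Lambda> \<tau>) (\<lambda>x. \<phi> (Z x) \<bullet> XT x)"
      by (rule field_inner_integrable[OF \<phi> XT_measurable XT_norm_integrable])
  qed
  finally show ?thesis .
qed

text \<open>Each loop contributes a continuous function of time, also at time zero, and the
  contributions are dominated, uniformly in time, by a multiple of
  \<open>1 + initial_energy a\<close>.\<close>

lemma B_continuous:
  fixes \<phi> :: "real \<times> 'n torus \<Rightarrow> real ^ 'n"
  assumes \<phi>: "continuous_on ({0..T} \<times> UNIV) \<phi>" and T: "T > 0"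
  shows "continuous_on {0..T} (\<lambda>t. loop_B \<mu> (X t) (\<lambda>x. \<phi> (t, x)))"
proof -
  obtain K where K: "\<And>t x. t \<in> {0..T} \<Longrightarrow> norm (\<phi> (t, x)) \<le> K" "K > 0"
    by (rule continuous_on_time_torus_bounded[OF \<phi>]) blast
  have "continuous_on {0..T} (\<lambda>t. LINT a|\<mu>. LINT s|unit_lborel. \<phi> (t, abs_torus (X t s a)) \<bullet> Xs t a s)"
  proof (rule continuous_on_integral_dominated)
    fix a assume a: "a \<in> space \<mu>"
    then interpret heat_loop "\<lambda>s. X0 s a" "\<lambda>t s. X t s a" by (rule heat_loop)
    show "continuous_on {0..T} (\<lambda>t. LINT s|unit_lborel. \<phi> (t, abs_torus (X t s a)) \<bullet> Xs t a s)"
      unfolding Xs_def by (rule loop_B_continuous[OF \<phi> T])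
  next
    fix t assume t: "t \<in> {0..T}"
    then show "(\<lambda>a. LINT s|unit_lborel. \<phi> (t, abs_torus (X t s a)) \<bullet> Xs t a s) \<in> borel_measurable \<mu>"
      using field_inner_\<Omega>_integrable[OF continuous_on_time_section[OF \<phi> t], of t]
      by (intro U.borel_measurable_lebesgue_integral) (auto simp: case_prod_beta')
    fix a assume a: "a \<in> space \<mu>"
    then interpret heat_loop "\<lambda>s. X0 s a" "\<lambda>t s. X t s a" by (rule heat_loop)
    have "continuous_on ({0..T} \<times> {0..1}) (\<lambda>(t, s). \<phi> (t, abs_torus (X t s a)))"
      by (rule test_field_continuous[OF \<phi>]) simp
    from continuous_on_section[OF this t]
    have c: "continuous_on {0..1} (\<lambda>s. \<phi> (t, abs_torus (X t s a)))" .
    show "\<bar>LINT s|unit_lborel. \<phi> (t, abs_torus (X t s a)) \<bullet> Xs t a s\<bar> \<le> K * ((1 + initial_energy a) / 2)"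
      unfolding Xs_def using t K(1)[OF t] by (intro inner_Ds_bound[OF c]) auto
  next
    show "integrable \<mu> (\<lambda>a. K * ((1 + initial_energy a) / 2))" using initial_energy_integrable by simp
  qed
  then show ?thesis
    by (rule continuous_on_eq) (simp add: loop_B_eq_iterated continuous_on_time_section[OF \<phi>])
qed

lemma \<rho>_continuous:
  fixes \<phi> :: "real \<times> 'n torus \<Rightarrow> real"
  assumes \<phi>: "continuous_on ({0..T} \<times> UNIV) \<phi>"
  shows "continuous_on {0..T} (\<lambda>t. loop_\<rho> \<mu> (X t) (\<lambda>x. \<phi> (t, x)))"
proof -
  obtain K where K: "\<And>t x. t \<in> {0..T} \<Longrightarrow> norm (\<phi> (t, x)) \<le> K" "K > 0"
    by (rule continuous_on_time_torus_bounded[OF \<phi>]) blast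
  have "continuous_on {0..T} (\<lambda>t. LINT x|\<Omega>. \<phi> (t, abs_torus (X t (snd x) (fst x))))"
  proof (rule continuous_on_integral_dominated)
    fix x assume "x \<in> space \<Omega>"
    then have a: "fst x \<in> space \<mu>" by (auto simp: space_\<Omega>)
    have "continuous_on {0..T} (\<lambda>t. X t (snd x) (fst x))"
      by (rule continuous_on_subset[OF X_time_continuous[OF a]]) auto
    then have "continuous_on {0..T} (\<lambda>t. (t, X t (snd x) (fst x)))" by (intro continuous_intros)
    from continuous_on_compose2[OF \<phi>[unfolded continuous_on_time_torus] this]
    show "continuous_on {0..T} (\<lambda>t. \<phi> (t, abs_torus (X t (snd x) (fst x))))" by auto
  next
    fix t assume t: "t \<in> {0..T}"
    then show "(\<lambda>x. \<phi> (t, abs_torus (X t (snd x) (fst x)))) \<in> borel_measurable \<Omega>"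
      using field_\<Omega>_integrable[OF continuous_on_time_section[OF \<phi> t], of t] by auto
    show "\<bar>\<phi> (t, abs_torus (X t (snd x) (fst x)))\<bar> \<le> K" for x using K(1)[OF t] by simp
  qed simp
  then show ?thesis
    by (rule continuous_on_eq) (simp add: loop_\<rho>_eq continuous_on_time_section[OF \<phi>])
qed

lemma abs_integral_inner_le:
  fixes f w :: "'c \<Rightarrow> real ^ 'm::finite"
  assumes f: "f \<in> borel_measurable M" "\<And>x. x \<in> space M \<Longrightarrow> norm (f x) \<le> K"
    and w: "w \<in> borel_measurable M" "integrable M (\<lambda>x. norm (w x))"
  shows "\<bar>LINT x|M. f x \<bullet> w x\<bar> \<le> K * (LINT x|M. norm (w x))"
proof -
  have i: "integrable M (\<lambda>x. f x \<bullet> w x)" by (rule integrable_bounded_inner[OF assms])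
  have "\<bar>LINT x|M. f x \<bullet> w x\<bar> \<le> (LINT x|M. \<bar>f x \<bullet> w x\<bar>)"
    using integral_norm_bound[of M "\<lambda>x. f x \<bullet> w x"] by simp
  also have "\<dots> \<le> (LINT x|M. K * norm (w x))"
  proof (rule integral_mono)
    fix x assume "x \<in> space M"
    have "\<bar>f x \<bullet> w x\<bar> \<le> norm (f x) * norm (w x)" by (rule Cauchy_Schwarz_ineq2)
    also have "\<dots> \<le> K * norm (w x)" using f(2)[OF \<open>x \<in> space M\<close>] by (intro mult_right_mono) auto
    finally show "\<bar>f x \<bullet> w x\<bar> \<le> K * norm (w x)" .
  qed (use i w in auto)
  finally show ?thesis by simp
qed

section \<open>Duality bounds, weak continuity and the two linear equations\<close>

lemma cdual_B:
  assumes t: "t \<ge> 0"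
  shows "cdual UNIV (loop_B \<mu> (X t))"
  unfolding cdual_def
proof (intro conjI allI impI exI)
  fix \<phi> \<psi> :: "'n torus \<Rightarrow> real ^ 'n" assume c: "continuous_on UNIV \<phi>" "continuous_on UNIV \<psi>"
  show "loop_B \<mu> (X t) (\<lambda>x. \<phi> x + \<psi> x) = loop_B \<mu> (X t) \<phi> + loop_B \<mu> (X t) \<psi>"
    using field_inner_\<Omega>_integrable[OF c(1) t] field_inner_\<Omega>_integrable[OF c(2) t]
    by (simp add: loop_B_eq c continuous_on_add t inner_add_left)
next
  fix k and \<phi> :: "'n torus \<Rightarrow> real ^ 'n" assume c: "continuous_on UNIV \<phi>"
  show "loop_B \<mu> (X t) (\<lambda>x. k *\<^sub>R \<phi> x) = k * loop_B \<mu> (X t) \<phi>"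
    by (simp add: loop_B_eq c continuous_on_scaleR t)
next
  fix \<phi> :: "'n torus \<Rightarrow> real ^ 'n" and K assume c: "continuous_on UNIV \<phi>" and K: "\<forall>x\<in>UNIV. norm (\<phi> x) \<le> K"
  show "\<bar>loop_B \<mu> (X t) \<phi>\<bar> \<le> (LINT x|\<Omega>. norm (Xs t (fst x) (snd x))) * K"
    unfolding loop_B_eq[OF c t] using field_\<Omega>[OF c t] Xs_\<Omega>[OF t] Xs_norm_integrable[OF t] K
    by (subst mult.commute, intro abs_integral_inner_le) (simp_all add: case_prod_beta')
qed

lemma cdual_\<rho>:
  assumes t: "t \<ge> 0"
  shows "cdual UNIV (loop_\<rho> \<mu> (X t))"
  unfolding cdual_def
proof (intro conjI allI impI exI)
  fix \<phi> \<psi> :: "'n torus \<Rightarrow> real" assume c: "continuous_on UNIV \<phi>" "continuous_on UNIV \<psi>"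
  show "loop_\<rho> \<mu> (X t) (\<lambda>x. \<phi> x + \<psi> x) = loop_\<rho> \<mu> (X t) \<phi> + loop_\<rho> \<mu> (X t) \<psi>"
    using field_\<Omega>_integrable[OF c(1) t] field_\<Omega>_integrable[OF c(2) t]
    by (simp add: loop_\<rho>_eq c continuous_on_add t)
next
  fix k and \<phi> :: "'n torus \<Rightarrow> real" assume c: "continuous_on UNIV \<phi>"
  show "loop_\<rho> \<mu> (X t) (\<lambda>x. k *\<^sub>R \<phi> x) = k * loop_\<rho> \<mu> (X t) \<phi>"
    using continuous_on_scaleR[OF continuous_on_const c, of k] by (simp add: loop_\<rho>_eq c t)
next
  fix \<phi> :: "'n torus \<Rightarrow> real" and K assume c: "continuous_on UNIV \<phi>" and K: "\<forall>x\<in>UNIV. norm (\<phi> x) \<le> K"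
  have "\<bar>LINT x|\<Omega>. \<phi> (abs_torus (X t (snd x) (fst x)))\<bar> \<le> (LINT x|\<Omega>. \<bar>\<phi> (abs_torus (X t (snd x) (fst x)))\<bar>)"
    using integral_norm_bound[of \<Omega> "\<lambda>x. \<phi> (abs_torus (X t (snd x) (fst x)))"] by simp
  also have "\<dots> \<le> (LINT x|\<Omega>. K)"
    using field_\<Omega>_integrable[OF c t] K by (intro integral_mono) auto
  also have "\<dots> = 1 * K" using Pi.P.prob_space by simp
  finally show "\<bar>loop_\<rho> \<mu> (X t) \<phi>\<bar> \<le> 1 * K" unfolding loop_\<rho>_eq[OF c t] .
qed

lemma nonneg_\<rho>:
  assumes t: "t \<ge> 0"
  shows "nonneg_on UNIV (loop_\<rho> \<mu> (X t))"
  unfolding nonneg_on_def using t by (auto simp: loop_\<rho>_eq intro!: Bochner_Integration.integral_nonneg)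

lemma cdual_P: "cdual ({0..T} \<times> UNIV) (loop_P \<mu> T X)"
  unfolding cdual_def
proof (intro conjI allI impI exI)
  fix \<phi> \<psi> :: "real \<times> 'n torus \<Rightarrow> real ^ 'n"
  assume c: "continuous_on ({0..T} \<times> UNIV) \<phi>" "continuous_on ({0..T} \<times> UNIV) \<psi>"
  show "loop_P \<mu> T X (\<lambda>x. \<phi> x + \<psi> x) = loop_P \<mu> T X \<phi> + loop_P \<mu> T X \<psi>"
    using field_inner_integrable[OF c(1) XT_measurable XT_norm_integrable] field_inner_integrable[OF c(2) XT_measurable XT_norm_integrable]
    by (simp add: loop_P_eq c continuous_on_add inner_add_left)
next
  fix k and \<phi> :: "real \<times> 'n torus \<Rightarrow> real ^ 'n" assume c: "continuous_on ({0..T} \<times> UNIV) \<phi>"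
  show "loop_P \<mu> T X (\<lambda>x. k *\<^sub>R \<phi> x) = k * loop_P \<mu> T X \<phi>"
    by (simp add: loop_P_eq c continuous_on_scaleR)
next
  fix \<phi> :: "real \<times> 'n torus \<Rightarrow> real ^ 'n" and K
  assume c: "continuous_on ({0..T} \<times> UNIV) \<phi>" and K: "\<forall>x\<in>{0..T} \<times> UNIV. norm (\<phi> x) \<le> K"
  show "\<bar>loop_P \<mu> T X \<phi>\<bar> \<le> (LINT x|\<Lambda> T. norm (XT x)) * K"
    unfolding loop_P_eq[OF c] using K Z_mem
    by (subst mult.commute, intro abs_integral_inner_le field_\<Lambda>[OF c] XT_measurable XT_norm_integrable) blast
qed

lemma continuous_on_time_constant:
  "continuous_on UNIV \<phi> \<Longrightarrow> continuous_on (I \<times> UNIV) (\<lambda>z. \<phi> (snd z))"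
  by (rule continuous_on_compose2[of UNIV \<phi>]) (auto intro!: continuous_intros)

lemma weak_star_continuous_B: "T > 0 \<Longrightarrow> weak_star_continuous T (\<lambda>t. loop_B \<mu> (X t))"
  unfolding weak_star_continuous_def
  using B_continuous[OF continuous_on_time_constant, of _ T] by (auto intro: cdual_B)

lemma weak_star_continuous_\<rho>: "weak_star_continuous T (\<lambda>t. loop_\<rho> \<mu> (X t))"
  unfolding weak_star_continuous_def
  using \<rho>_continuous[OF continuous_on_time_constant, of _ T] by (auto intro: cdual_\<rho>)

lemma divergence_free_B:
  assumes t: "t \<ge> 0"
  shows "divergence_free (loop_B \<mu> (X t))"
  unfolding divergence_free_def
proof (intro allI impI)
  fix \<phi> :: "'n torus \<Rightarrow> real" assume \<phi>: "smooth_fun (\<lambda>y. \<phi> (abs_torus y))"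
  note c = torus_grad_continuous[OF \<phi>]
  have pos: "loop_B \<mu> (X t) (torus_grad \<phi>) = 0" if t: "t > 0" for t
  proof -
    have "loop_B \<mu> (X t) (torus_grad \<phi>) = (LINT a|\<mu>. LINT s|unit_lborel. torus_grad \<phi> (abs_torus (X t s a)) \<bullet> Xs t a s)"
      using t by (intro loop_B_eq_iterated[OF c]) simp
    also have "\<dots> = (LINT a|\<mu>. 0)"
    proof (rule Bochner_Integration.integral_cong)
      fix a assume "a \<in> space \<mu>"
      then interpret heat_loop "\<lambda>s. X0 s a" "\<lambda>t s. X t s a" by (rule heat_loop)
      show "(LINT s|unit_lborel. torus_grad \<phi> (abs_torus (X t s a)) \<bullet> Xs t a s) = 0"
        unfolding Xs_def by (rule grad_integral_zero[OF \<phi> t])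
    qed simp
    finally show ?thesis by simp
  qed
  show "loop_B \<mu> (X t) (torus_grad \<phi>) = 0"
  proof (cases "t = 0")
    case True
    let ?f = "\<lambda>t. loop_B \<mu> (X t) (torus_grad \<phi>)"
    \<comment> \<open>The tangent of an initial loop exists only almost everywhere, so the identity
      at time zero is obtained as a limit from positive times by weak continuity.\<close>
    have "continuous_on {0..1} ?f"
      using weak_star_continuous_B[of 1] c unfolding weak_star_continuous_def by simp
    then have "(?f \<longlongrightarrow> ?f 0) (at 0 within {0..1})" by (auto simp: continuous_on_def)
    moreover have "(?f \<longlongrightarrow> 0) (at 0 within {0..1})"
      by (rule tendsto_eventually) (auto simp: eventually_at_filter pos intro!: always_eventually)
    moreover have "at (0::real) within {0..1} \<noteq> bot" by (simp add: at_within_Icc_at_right)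
    ultimately show ?thesis using tendsto_unique True by blast
  next
    case False
    then show ?thesis using pos t by simp
  qed
qed

text \<open>Fubini with time innermost: for each fixed label \<open>(a, s)\<close> the integrand is
  the time derivative of a function that vanishes near both ends.\<close>

lemma continuity_equation_\<rho>:
  assumes T: "T > 0"
  shows "continuity_equation T (\<lambda>t. loop_\<rho> \<mu> (X t)) (loop_P \<mu> T X)"
  unfolding continuity_equation_def
proof (intro allI impI)
  fix \<phi> :: "real \<times> 'n torus \<Rightarrow> real"
  assume \<phi>: "smooth_fun (\<lambda>(t, y). \<phi> (t, abs_torus y))"
    and "\<exists>\<alpha> \<beta>. 0 < \<alpha> \<and> \<beta> < T \<and> (\<forall>t p. t \<notin> {\<alpha>..\<beta>} \<longrightarrow> \<phi> (t, p) = 0)"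
  then obtain \<alpha> \<beta> where ab: "0 < \<alpha>" "\<beta> < T" "\<And>t p. t \<notin> {\<alpha>..\<beta>} \<Longrightarrow> \<phi> (t, p) = 0" by blast
  interpret L: pair_sigma_finite "interval_lborel 0 T" \<Omega> by (rule pair_\<Lambda>)
  let ?g = "\<lambda>(t, p). torus_grad (\<lambda>q. \<phi> (t, q)) p"
  let ?h = "\<lambda>x. time_deriv UNIV \<phi> (Z x) + ?g (Z x) \<bullet> XT x"
  note c = time_torus_derivatives(3,4)[OF \<phi>, of "{0..T} \<times> UNIV"]
  have i: "integrable (\<Lambda> T) (\<lambda>x. time_deriv UNIV \<phi> (Z x))" "integrable (\<Lambda> T) (\<lambda>x. ?g (Z x) \<bullet> XT x)"
    by (rule field_integrable[OF c(1)]) (rule field_inner_integrable[OF c(2) XT_measurable XT_norm_integrable])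
  then have "integrable (\<Lambda> T) ?h" by (rule Bochner_Integration.integrable_add)
  then have ih: "integrable (\<Lambda> T) (\<lambda>(t, x). ?h (t, x))" by (simp only: case_prod_beta' prod.collapse)
  have "spacetime T (\<lambda>t. loop_\<rho> \<mu> (X t)) (time_deriv UNIV \<phi>) + loop_P \<mu> T X ?g = integral\<^sup>L (\<Lambda> T) ?h"
    unfolding spacetime_\<rho>_eq[OF c(1)] loop_P_eq[OF c(2)] using i by simp
  also have "\<dots> = (LINT x|\<Omega>. LINT t|interval_lborel 0 T. ?h (t, x))"
    using L.integral_snd[OF ih] by (simp only: case_prod_beta' prod.collapse)
  also have "\<dots> = (LINT x|\<Omega>. 0)"
  proof (rule Bochner_Integration.integral_cong)
    fix x assume "x \<in> space \<Omega>"
    then obtain a s where x: "x = (a, s)" "a \<in> space \<mu>" by (auto simp: space_\<Omega>)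
    then interpret heat_loop "\<lambda>s. X0 s a" "\<lambda>t s. X t s a" by (intro heat_loop)
    show "(LINT t|interval_lborel 0 T. ?h (t, x)) = 0"
      using transport_integral_zero[OF \<phi> ab(1,2) T ab(3), of s] by (simp add: x Z_def XT_def Xt_def)
  qed simp
  finally show "spacetime T (\<lambda>t. loop_\<rho> \<mu> (X t)) (time_deriv UNIV \<phi>) + loop_P \<mu> T X ?g = 0" by simp
qed

text \<open>At every loop point the constraint and the completed square |\<Theta> - (p - b)|^2 \<ge>
  0 give \<theta> + \<Theta> \<bullet> (p - b) \<le> |p - b|^2 / 2. The loop energy is stated in
  expanded form, because its three terms behave differently in time.\<close>

lemma kinetic_le:
  fixes b :: "real \<times> 'n torus \<Rightarrow> real ^ 'n"
  assumes b: "continuous_on ({0..T} \<times> UNIV) b" and t: "t \<in> {0..T}"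
  shows "energy (\<lambda>t. loop_B \<mu> (X t)) (\<lambda>t. loop_\<rho> \<mu> (X t)) b t
    \<le> ereal ((LINT x|\<Omega>. (norm (Xs t (fst x) (snd x)))\<^sup>2) / 2 - loop_B \<mu> (X t) (\<lambda>x. b (t, x))
       + loop_\<rho> \<mu> (X t) (\<lambda>x. (norm (b (t, x)))\<^sup>2) / 2)"
  unfolding energy_def kinetic_def
proof (rule SUP_least, clarify)
  fix \<theta> :: "'n torus \<Rightarrow> real" and \<Theta> :: "'n torus \<Rightarrow> real ^ 'n"
  assume c: "continuous_on UNIV \<theta>" "continuous_on UNIV \<Theta>" and le: "\<forall>x\<in>UNIV. \<theta> x + (norm (\<Theta> x))\<^sup>2 / 2 \<le> 0"
  have t0: "t \<ge> 0" using t by simp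
  have bc: "continuous_on UNIV (\<lambda>x. b (t, x))" by (rule continuous_on_time_section[OF b t])
  let ?x = "\<lambda>x. abs_torus (X t (snd x) (fst x))" and ?p = "\<lambda>x. Xs t (fst x) (snd x)"
  have c': "continuous_on UNIV (\<lambda>x. \<Theta> x \<bullet> b (t, x))" "continuous_on UNIV (\<lambda>x. (norm (b (t, x)))\<^sup>2)"
    by (intro continuous_intros c bc)+
  note i = field_\<Omega>_integrable[OF c(1) t0] field_inner_\<Omega>_integrable[OF c(2) t0] field_\<Omega>_integrable[OF c'(1) t0]
    field_\<Omega>_integrable[OF c'(2) t0] field_inner_\<Omega>_integrable[OF bc t0] Xs_sq_integrable[OF t0]
  have "loop_\<rho> \<mu> (X t) \<theta> + (loop_B \<mu> (X t) \<Theta> - loop_\<rho> \<mu> (X t) (\<lambda>x. \<Theta> x \<bullet> b (t, x)))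
     = (LINT x|\<Omega>. \<theta> (?x x) + (\<Theta> (?x x) \<bullet> ?p x - \<Theta> (?x x) \<bullet> b (t, ?x x)))"
    unfolding loop_\<rho>_eq[OF c(1) t0] loop_\<rho>_eq[OF c'(1) t0] loop_B_eq[OF c(2) t0] using i by simp
  also have "\<dots> \<le> (LINT x|\<Omega>. (norm (?p x))\<^sup>2 / 2 - b (t, ?x x) \<bullet> ?p x + (norm (b (t, ?x x)))\<^sup>2 / 2)"
  proof (rule integral_mono)
    fix x
    have "0 \<le> (norm (\<Theta> (?x x) - (?p x - b (t, ?x x))))\<^sup>2 / 2" by simp
    also have "\<dots> = (norm (\<Theta> (?x x)))\<^sup>2 / 2 - \<Theta> (?x x) \<bullet> ?p x + \<Theta> (?x x) \<bullet> b (t, ?x x) + (norm (?p x))\<^sup>2 / 2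
       - b (t, ?x x) \<bullet> ?p x + (norm (b (t, ?x x)))\<^sup>2 / 2"
      by (simp add: power2_norm_eq_inner inner_simps inner_commute field_simps)
    finally show "\<theta> (?x x) + (\<Theta> (?x x) \<bullet> ?p x - \<Theta> (?x x) \<bullet> b (t, ?x x))
       \<le> (norm (?p x))\<^sup>2 / 2 - b (t, ?x x) \<bullet> ?p x + (norm (b (t, ?x x)))\<^sup>2 / 2"
      using le[rule_format, of "?x x"] by simp
  qed (use i in auto)
  also have "\<dots> = (LINT x|\<Omega>. (norm (?p x))\<^sup>2) / 2 - loop_B \<mu> (X t) (\<lambda>x. b (t, x)) + loop_\<rho> \<mu> (X t) (\<lambda>x. (norm (b (t, x)))\<^sup>2) / 2"
    unfolding loop_\<rho>_eq[OF c'(2) t0] loop_B_eq[OF bc t0] using i by simp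
  finally show "ereal (loop_\<rho> \<mu> (X t) \<theta> + (loop_B \<mu> (X t) \<Theta> - loop_\<rho> \<mu> (X t) (\<lambda>x. \<Theta> x \<bullet> b (t, x))))
    \<le> ereal ((LINT x|\<Omega>. (norm (?p x))\<^sup>2) / 2 - loop_B \<mu> (X t) (\<lambda>x. b (t, x)) + loop_\<rho> \<mu> (X t) (\<lambda>x. (norm (b (t, x)))\<^sup>2) / 2)"
    by simp
qed

text \<open>The substitution \<open>(\<theta>, \<Theta>) \<mapsto> (\<theta> + \<Theta> \<bullet> b - |b|\<^sup>2/2, \<Theta> - b)\<close> preserves the constraint
  \<open>\<theta> + |\<Theta>|\<^sup>2/2 \<le> 0\<close>.\<close>

lemma kinetic_ge:
  fixes b :: "real \<times> 'n torus \<Rightarrow> real ^ 'n"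
  assumes b: "continuous_on ({0..T} \<times> UNIV) b" and t: "t \<in> {0..T}"
  shows "kinetic UNIV (loop_\<rho> \<mu> (X t)) (loop_B \<mu> (X t))
    \<le> energy (\<lambda>t. loop_B \<mu> (X t)) (\<lambda>t. loop_\<rho> \<mu> (X t)) b t
      + ereal (loop_B \<mu> (X t) (\<lambda>x. b (t, x)) - loop_\<rho> \<mu> (X t) (\<lambda>x. (norm (b (t, x)))\<^sup>2) / 2)"
  unfolding kinetic_def[of UNIV "loop_\<rho> \<mu> (X t)" "loop_B \<mu> (X t)"]
proof (rule SUP_least, clarify)
  fix \<theta> :: "'n torus \<Rightarrow> real" and \<Theta> :: "'n torus \<Rightarrow> real ^ 'n"
  assume c: "continuous_on UNIV \<theta>" "continuous_on UNIV \<Theta>" and le: "\<forall>x\<in>UNIV. \<theta> x + (norm (\<Theta> x))\<^sup>2 / 2 \<le> 0"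
  have t0: "t \<ge> 0" using t by simp
  have bc: "continuous_on UNIV (\<lambda>x. b (t, x))" by (rule continuous_on_time_section[OF b t])
  let ?\<theta> = "\<lambda>x. \<theta> x + \<Theta> x \<bullet> b (t, x) - (norm (b (t, x)))\<^sup>2 / 2" and ?\<Theta> = "\<lambda>x. \<Theta> x - b (t, x)"
  let ?x = "\<lambda>x. abs_torus (X t (snd x) (fst x))" and ?p = "\<lambda>x. Xs t (fst x) (snd x)"
  have c': "continuous_on UNIV ?\<theta>" "continuous_on UNIV ?\<Theta>" "continuous_on UNIV (\<lambda>x. ?\<Theta> x \<bullet> b (t, x))"
      "continuous_on UNIV (\<lambda>x. (norm (b (t, x)))\<^sup>2)" "continuous_on UNIV (\<lambda>x. \<Theta> x \<bullet> b (t, x))"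
    by (intro continuous_intros c bc; simp)+
  note i = field_\<Omega>_integrable[OF c(1) t0] field_inner_\<Omega>_integrable[OF c(2) t0] field_\<Omega>_integrable[OF c'(5) t0]
    field_\<Omega>_integrable[OF c'(4) t0] field_inner_\<Omega>_integrable[OF bc t0]
  have "\<forall>x\<in>UNIV. ?\<theta> x + (norm (?\<Theta> x))\<^sup>2 / 2 \<le> 0"
  proof
    fix x
    have "?\<theta> x + (norm (?\<Theta> x))\<^sup>2 / 2 = \<theta> x + (norm (\<Theta> x))\<^sup>2 / 2"
      by (simp add: power2_norm_eq_inner inner_simps inner_commute field_simps)
    then show "?\<theta> x + (norm (?\<Theta> x))\<^sup>2 / 2 \<le> 0" using le[rule_format, OF UNIV_I, of x] by linarith
  qed
  then have "(?\<theta>, ?\<Theta>) \<in> {(\<theta>, \<Theta>). continuous_on UNIV \<theta> \<and> continuous_on UNIV \<Theta> \<and> (\<forall>x\<in>UNIV. \<theta> x + (norm (\<Theta> x))\<^sup>2 / 2 \<le> 0)}"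
    using c' by simp
  then have up: "ereal (loop_\<rho> \<mu> (X t) ?\<theta> + (loop_B \<mu> (X t) ?\<Theta> - loop_\<rho> \<mu> (X t) (\<lambda>x. ?\<Theta> x \<bullet> b (t, x))))
    \<le> energy (\<lambda>t. loop_B \<mu> (X t)) (\<lambda>t. loop_\<rho> \<mu> (X t)) b t"
    unfolding energy_def kinetic_def by (rule SUP_upper2) simp
  have "loop_\<rho> \<mu> (X t) \<theta> + loop_B \<mu> (X t) \<Theta>
     = (loop_\<rho> \<mu> (X t) ?\<theta> + (loop_B \<mu> (X t) ?\<Theta> - loop_\<rho> \<mu> (X t) (\<lambda>x. ?\<Theta> x \<bullet> b (t, x))))
      + (loop_B \<mu> (X t) (\<lambda>x. b (t, x)) - loop_\<rho> \<mu> (X t) (\<lambda>x. (norm (b (t, x)))\<^sup>2) / 2)"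
    unfolding loop_\<rho>_eq[OF c(1) t0] loop_\<rho>_eq[OF c'(1) t0] loop_\<rho>_eq[OF c'(3) t0] loop_\<rho>_eq[OF c'(4) t0]
      loop_B_eq[OF c(2) t0] loop_B_eq[OF c'(2) t0] loop_B_eq[OF bc t0]
    using i by (simp add: inner_diff_left power2_norm_eq_inner)
  then have "ereal (loop_\<rho> \<mu> (X t) \<theta> + loop_B \<mu> (X t) \<Theta>)
     = ereal (loop_\<rho> \<mu> (X t) ?\<theta> + (loop_B \<mu> (X t) ?\<Theta> - loop_\<rho> \<mu> (X t) (\<lambda>x. ?\<Theta> x \<bullet> b (t, x))))
      + ereal (loop_B \<mu> (X t) (\<lambda>x. b (t, x)) - loop_\<rho> \<mu> (X t) (\<lambda>x. (norm (b (t, x)))\<^sup>2) / 2)" by simp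
  also have "\<dots> \<le> energy (\<lambda>t. loop_B \<mu> (X t)) (\<lambda>t. loop_\<rho> \<mu> (X t)) b t
      + ereal (loop_B \<mu> (X t) (\<lambda>x. b (t, x)) - loop_\<rho> \<mu> (X t) (\<lambda>x. (norm (b (t, x)))\<^sup>2) / 2)"
    by (intro add_mono up order_refl)
  finally show "ereal (loop_\<rho> \<mu> (X t) \<theta> + loop_B \<mu> (X t) \<Theta>)
    \<le> energy (\<lambda>t. loop_B \<mu> (X t)) (\<lambda>t. loop_\<rho> \<mu> (X t)) b t
      + ereal (loop_B \<mu> (X t) (\<lambda>x. b (t, x)) - loop_\<rho> \<mu> (X t) (\<lambda>x. (norm (b (t, x)))\<^sup>2) / 2)" .
qed

end

section \<open>Measurability, integrability and positivity of the quadratic form\<close>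

lemma pair_vec_measurable:
  fixes p q :: "'a \<Rightarrow> real ^ 'n::finite"
  assumes [measurable]: "p \<in> borel_measurable M" "q \<in> borel_measurable M"
  shows "(\<lambda>x. pair_vec (p x) (q x)) \<in> borel_measurable M"
  unfolding pair_vec_def
proof (rule borel_measurable_vec_lambda)
  fix I :: "'n + 'n"
  show "(\<lambda>x. case I of Inl i \<Rightarrow> p x $ i | Inr i \<Rightarrow> q x $ i) \<in> borel_measurable M" by (cases I) simp_all
qed

lemma norm_pair_vec_sq: "(norm (pair_vec p q))\<^sup>2 = (norm p)\<^sup>2 + (norm q)\<^sup>2"
  by (simp add: power2_norm_eq_inner inner_pair_vec_pair_vec)

lemma (in finite_measure) integrable_sq_diff_bounded:
  fixes f w :: "'a \<Rightarrow> real ^ 'm::finite"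
  assumes w: "w \<in> borel_measurable M" "integrable M (\<lambda>x. (norm (w x))\<^sup>2)"
    and f: "f \<in> borel_measurable M" "\<And>x. x \<in> space M \<Longrightarrow> norm (f x) \<le> K"
  shows "integrable M (\<lambda>x. (norm (w x - f x))\<^sup>2)"
proof (rule Bochner_Integration.integrable_bound)
  show "integrable M (\<lambda>x. 2 * (norm (w x))\<^sup>2 + 2 * K\<^sup>2)" using w by simp
  show "AE x in M. norm ((norm (w x - f x))\<^sup>2) \<le> norm (2 * (norm (w x))\<^sup>2 + 2 * K\<^sup>2)"
  proof (rule AE_I2)
    fix x assume x: "x \<in> space M"
    have "norm (w x - f x) \<le> norm (w x) + K" using norm_triangle_ineq4[of "w x" "f x"] f(2)[OF x] by linarith
    then have "(norm (w x - f x))\<^sup>2 \<le> (norm (w x) + K)\<^sup>2" by (intro power_mono) auto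
    also have "\<dots> \<le> 2 * (norm (w x))\<^sup>2 + 2 * K\<^sup>2"
      using zero_le_power2[of "norm (w x) - K"] by (simp add: power2_eq_square algebra_simps)
    finally show "norm ((norm (w x - f x))\<^sup>2) \<le> norm (2 * (norm (w x))\<^sup>2 + 2 * K\<^sup>2)" by simp
  qed
qed (use w f in measurable)

lemma integrable_quadratic_form:
  fixes Z :: "'a \<Rightarrow> 'b::topological_space" and w :: "'a \<Rightarrow> real ^ 'm::finite"
  assumes Z [measurable]: "Z \<in> M \<rightarrow>\<^sub>M restrict_space borel S"
    and w [measurable]: "w \<in> borel_measurable M" and w2: "integrable M (\<lambda>x. (norm (w x))\<^sup>2)"
    and S: "compact S" and Q: "continuous_on S Q"
  shows "integrable M (\<lambda>x. w x \<bullet> (Q (Z x) *v w x))"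
  unfolding inner_matrix_vector_sum
proof (intro Bochner_Integration.integrable_sum)
  fix i j
  have Qc: "continuous_on S (\<lambda>z. Q z $ i $ j)" by (intro continuous_intros Q)
  have Qm [measurable]: "(\<lambda>z. Q z $ i $ j) \<in> borel_measurable (restrict_space borel S)"
    by (rule borel_measurable_continuous_on_restrict[OF Qc])
  obtain K where K: "\<And>y. y \<in> S \<Longrightarrow> \<bar>Q y $ i $ j\<bar> \<le> K"
    using compact_imp_bounded[OF compact_continuous_image[OF Qc S]] unfolding bounded_iff by auto
  have ww: "integrable M (\<lambda>x. w x $ i * w x $ j)"
    by (intro integrable_mult_L2 integrable_component_sq w w2) simp_all
  show "integrable M (\<lambda>x. Q (Z x) $ i $ j * w x $ i * w x $ j)"
  proof (rule Bochner_Integration.integrable_bound)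
    show "integrable M (\<lambda>x. K * (w x $ i * w x $ j))" using ww by simp
    show "AE x in M. norm (Q (Z x) $ i $ j * w x $ i * w x $ j) \<le> norm (K * (w x $ i * w x $ j))"
    proof (rule AE_I2)
      fix x assume "x \<in> space M"
      then have "Z x \<in> S" using measurable_space[OF Z] by (simp add: space_restrict_space)
      then have "\<bar>Q (Z x) $ i $ j\<bar> \<le> \<bar>K\<bar>" using K[of "Z x"] by simp
      then show "norm (Q (Z x) $ i $ j * w x $ i * w x $ j) \<le> norm (K * (w x $ i * w x $ j))"
        by (simp add: abs_mult mult.assoc mult_right_mono)
    qed
  qed measurable
qed

context C1_fields
begin

lemma Q_continuous: "continuous_on ({0..T} \<times> UNIV) (Q_matrix r b v)"
proof -
  note J = b.space_jacobian_continuous v.space_jacobian_continuous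
  have "continuous_on ({0..T} \<times> UNIV) (\<lambda>z. Q_matrix r b v z $ I $ J)" for I J
    by (cases I; cases J) (auto simp: Q_matrix_def Let_def transpose_def intro!: continuous_intros J)
  note q = this
  have "continuous_on ({0..T} \<times> UNIV) (\<lambda>z. \<chi> I J. Q_matrix r b v z $ I $ J)"
    by (intro continuous_on_vec_lambda q)
  moreover have "(\<lambda>z. \<chi> I J. Q_matrix r b v z $ I $ J) = Q_matrix r b v" by (simp add: fun_eq_iff vec_eq_iff)
  ultimately show ?thesis by simp
qed

text \<open>Raising \<open>r\<close> adds a nonnegative multiple of the identity in the first block,
  so the form stays above the one at \<open>r0\<close>, which dominates the identity.\<close>

lemma Q_ge:
  assumes Q0: "Q_ge_id T r0 b v" and r: "r0 \<le> r" and z: "fst z \<in> {0..T}"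
  shows "0 \<le> \<xi> \<bullet> (Q_matrix r b v z *v \<xi>)"
proof -
  let ?p = "\<chi> i. \<xi> $ Inl i" and ?q = "\<chi> i. \<xi> $ Inr i"
  have "0 \<le> \<xi> \<bullet> \<xi>" by simp
  also have "\<dots> \<le> \<xi> \<bullet> (Q_matrix r0 b v z *v \<xi>)" using Q0 z unfolding Q_ge_id_def by (metis prod.collapse)
  also have "\<dots> \<le> \<xi> \<bullet> (Q_matrix r b v z *v \<xi>)"
    using mult_right_mono[OF r inner_ge_zero[of ?p]]
    by (subst (1 2 3 4) pair_vec_components[of \<xi>]) (simp add: inner_Q_matrix_pair_vec)
  finally show ?thesis .
qed

end

section \<open>The dissipation inequality\<close>

locale dissipative_setting = loop_ensemble \<mu> X0 X + C1_fields T b Db v Dv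
  for \<mu> :: "'a measure" and X0 :: "real \<Rightarrow> 'a \<Rightarrow> real ^ 'n::finite" and X and T :: real
    and b v :: "real \<times> 'n torus \<Rightarrow> real ^ 'n" and Db Dv +
  fixes r0 r :: real
  assumes Q_r0: "Q_ge_id T r0 b v" and r: "r0 \<le> r"
begin

lemma restricted:
  assumes "continuous_on ({0..T} \<times> UNIV) f" "\<tau> \<le> T"
  shows "continuous_on ({0..\<tau>} \<times> UNIV) f"
  by (rule continuous_on_subset[OF assms(1)]) (use assms(2) in auto)

text \<open>The relative velocities along the loops; their conditional expectation given
  \<open>Z\<close> is the density of the vector measure \<open>U_tilde\<close>.\<close>

definition "w x = pair_vec (XS x - b (Z x)) (XT x - v (Z x))"

abbreviation "diss x \<equiv> exp (- r * fst x) * dissipation r (Z x) (XS x) (XT x)"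

text \<open>The energy of the loops before averaging. It dominates \<open>energy\<close> at all
  times and coincides with it at time zero under the assumption on the initial loops.\<close>

definition "E t = (LINT x|\<Omega>. (norm (Xs t (fst x) (snd x) - b (t, abs_torus (X t (snd x) (fst x)))))\<^sup>2 / 2)"

lemma fst_Z [simp]: "fst (Z x) = fst x"
  by (simp add: Z_def case_prod_beta)

lemma w_measurable:
  assumes "\<tau> \<le> T"
  shows "w \<in> borel_measurable (\<Lambda> \<tau>)"
  unfolding w_def[abs_def]
  by (intro pair_vec_measurable borel_measurable_diff XS_measurable XT_measurable
      field_\<Lambda> restricted[OF _ assms] b.field_continuous v.field_continuous)

lemma w_sq_integrable:
  assumes \<tau>: "\<tau> \<le> T"
  shows "integrable (\<Lambda> \<tau>) (\<lambda>x. (norm (w x))\<^sup>2)"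
proof -
  interpret L: finite_measure "\<Lambda> \<tau>" by (rule finite_\<Lambda>)
  note c = restricted[OF b.field_continuous \<tau>] restricted[OF v.field_continuous \<tau>]
  obtain K where K: "\<And>x. x \<in> space (\<Lambda> \<tau>) \<Longrightarrow> norm (b (Z x)) \<le> K" by (rule field_bounded[OF c(1)]) blast
  obtain K' where K': "\<And>x. x \<in> space (\<Lambda> \<tau>) \<Longrightarrow> norm (v (Z x)) \<le> K'" by (rule field_bounded[OF c(2)]) blast
  have "integrable (\<Lambda> \<tau>) (\<lambda>x. (norm (XS x - b (Z x)))\<^sup>2 + (norm (XT x - v (Z x)))\<^sup>2)"
    by (intro Bochner_Integration.integrable_add L.integrable_sq_diff_bounded[OF _ _ _ K] L.integrable_sq_diff_bounded[OF _ _ _ K']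
      XS_measurable XT_measurable XS_sq_integrable XT_sq_integrable field_\<Lambda> c)
  then show ?thesis by (simp add: w_def norm_pair_vec_sq)
qed

lemma Icc_UNIV_compact: "compact ({0..\<tau> :: real} \<times> (UNIV :: 'n torus set))"
  by (intro compact_Times compact_Icc compact_torus)

lemma Qr_continuous:
  assumes "\<tau> \<le> T"
  shows "continuous_on ({0..\<tau>} \<times> UNIV) (\<lambda>z. exp (- r * fst z) *\<^sub>R Q_matrix r b v z)"
  by (intro continuous_intros restricted[OF Q_continuous assms])

lemma exp_continuous: "continuous_on S (\<lambda>z :: real \<times> 'n torus. exp (- r * fst z))"
  by (intro continuous_intros)

lemma L_exp_continuous:
  assumes "\<tau> \<le> T"
  shows "continuous_on ({0..\<tau>} \<times> UNIV) (\<lambda>z. exp (- r * fst z) * L1 T b v z)"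
    and "continuous_on ({0..\<tau>} \<times> UNIV) (\<lambda>z. exp (- r * fst z) *\<^sub>R L2 T b v z)"
    and "continuous_on ({0..\<tau>} \<times> UNIV) (\<lambda>z. exp (- r * fst z) *\<^sub>R L3 b v z)"
  by (intro continuous_on_mult continuous_on_scaleR exp_continuous restricted[OF L_continuous(1) assms]
      restricted[OF L_continuous(2) assms] restricted[OF L_continuous(3) assms])+

lemma diss_decomposition:
  "diss x = (w x \<bullet> ((exp (- r * fst (Z x)) *\<^sub>R Q_matrix r b v (Z x)) *v w x)) / 2
     - (exp (- r * fst (Z x)) * L1 T b v (Z x) + (exp (- r * fst (Z x)) *\<^sub>R L2 T b v (Z x)) \<bullet> XS x
        + (exp (- r * fst (Z x)) *\<^sub>R L3 b v (Z x)) \<bullet> XT x)"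
  by (simp add: dissipation_def w_def scaleR_matrix_vector_assoc[symmetric] algebra_simps inner_commute)

lemma L_integrable:
  assumes \<tau>: "\<tau> \<le> T"
  shows "integrable (\<Lambda> \<tau>) (\<lambda>x. exp (- r * fst (Z x)) * L1 T b v (Z x))"
    and "integrable (\<Lambda> \<tau>) (\<lambda>x. (exp (- r * fst (Z x)) *\<^sub>R L2 T b v (Z x)) \<bullet> XS x)"
    and "integrable (\<Lambda> \<tau>) (\<lambda>x. (exp (- r * fst (Z x)) *\<^sub>R L3 b v (Z x)) \<bullet> XT x)"
  by (rule field_integrable[OF L_exp_continuous(1)[OF \<tau>]]
      field_inner_integrable[OF L_exp_continuous(2)[OF \<tau>] XS_measurable XS_norm_integrable]
      field_inner_integrable[OF L_exp_continuous(3)[OF \<tau>] XT_measurable XT_norm_integrable])+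

lemma quad_integrable:
  assumes \<tau>: "\<tau> \<le> T"
  shows "integrable (\<Lambda> \<tau>) (\<lambda>x. w x \<bullet> ((exp (- r * fst (Z x)) *\<^sub>R Q_matrix r b v (Z x)) *v w x))"
  by (rule integrable_quadratic_form[OF Z_measurable w_measurable[OF \<tau>] w_sq_integrable[OF \<tau>] Icc_UNIV_compact Qr_continuous[OF \<tau>]])

lemma diss_integrable:
  assumes \<tau>: "\<tau> \<le> T"
  shows "integrable (\<Lambda> \<tau>) diss"
  unfolding diss_decomposition using L_integrable[OF \<tau>] quad_integrable[OF \<tau>] by simp

lemma indicator_diss:
  assumes \<tau>: "\<tau> \<le> T" and S: "S \<in> sets borel"
  shows "(\<lambda>x. indicator S (fst x) * diss x) \<in> borel_measurable (\<Lambda> \<tau>)"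
    and "integrable (\<Lambda> \<tau>) (\<lambda>x. indicator S (fst x) * diss x)"
proof -
  have "(\<lambda>x. fst x) \<in> borel_measurable (\<Lambda> \<tau>)"
    by (rule measurable_compose[OF measurable_fst]) (rule measurable_restrict_space1, simp)
  from measurable_compose[OF this borel_measurable_indicator[OF S]]
  show m: "(\<lambda>x. indicator S (fst x) * diss x) \<in> borel_measurable (\<Lambda> \<tau>)"
    by (rule borel_measurable_times[OF _ borel_measurable_integrable[OF diss_integrable[OF \<tau>]]])
  show "integrable (\<Lambda> \<tau>) (\<lambda>x. indicator S (fst x) * diss x)"
  proof (rule Bochner_Integration.integrable_bound[OF diss_integrable[OF \<tau>] m])
    show "AE x in \<Lambda> \<tau>. norm (indicator S (fst x) * diss x) \<le> norm (diss x)"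
      by (intro AE_I2) (simp split: split_indicator)
  qed
qed

lemma R_integral_eq:
  assumes \<tau>: "0 \<le> \<tau>" "\<tau> \<le> T"
  shows "R_integral T (\<lambda>t. loop_B \<mu> (X t)) (\<lambda>t. loop_\<rho> \<mu> (X t)) (loop_P \<mu> T X) b v r \<tau>
    = (LINT x|\<Lambda> \<tau>. exp (- r * fst (Z x)) * L1 T b v (Z x)) + (LINT x|\<Lambda> \<tau>. (exp (- r * fst (Z x)) *\<^sub>R L2 T b v (Z x)) \<bullet> XS x)
      + (LINT x|\<Lambda> \<tau>. (exp (- r * fst (Z x)) *\<^sub>R L3 b v (Z x)) \<bullet> XT x)"
  unfolding R_integral_def spacetime_\<rho>_eq[OF L_exp_continuous(1)[OF \<tau>(2)]]
    spacetime_B_eq[OF L_exp_continuous(2)[OF \<tau>(2)]] restrict_time_P_eq[OF \<tau> L_exp_continuous(3)[OF \<tau>(2)]] ..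

lemma U_tilde_eq:
  assumes \<tau>: "0 \<le> \<tau>" "\<tau> \<le> T" and \<Theta>: "continuous_on ({0..\<tau>} \<times> UNIV) \<Theta>"
  shows "U_tilde (\<lambda>t. loop_B \<mu> (X t)) (\<lambda>t. loop_\<rho> \<mu> (X t)) (loop_P \<mu> T X) b v \<tau> \<Theta> = (LINT x|\<Lambda> \<tau>. \<Theta> (Z x) \<bullet> w x)"
proof -
  let ?l = "\<lambda>z. \<chi> i. \<Theta> z $ Inl i" and ?r = "\<lambda>z. \<chi> i. \<Theta> z $ Inr i"
  have c: "continuous_on ({0..\<tau>} \<times> UNIV) ?l" "continuous_on ({0..\<tau>} \<times> UNIV) ?r"
    by (intro continuous_intros \<Theta>)+
  have cb: "continuous_on ({0..\<tau>} \<times> UNIV) (\<lambda>z. ?l z \<bullet> b z)" "continuous_on ({0..\<tau>} \<times> UNIV) (\<lambda>z. ?r z \<bullet> v z)"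
    by (intro continuous_on_inner c restricted[OF b.field_continuous \<tau>(2)] restricted[OF v.field_continuous \<tau>(2)])+
  note i = field_inner_integrable[OF c(1) XS_measurable XS_norm_integrable] field_inner_integrable[OF c(2) XT_measurable XT_norm_integrable]
    field_integrable[OF cb(1)] field_integrable[OF cb(2)]
  have "U_tilde (\<lambda>t. loop_B \<mu> (X t)) (\<lambda>t. loop_\<rho> \<mu> (X t)) (loop_P \<mu> T X) b v \<tau> \<Theta>
     = (LINT x|\<Lambda> \<tau>. (?l (Z x) \<bullet> XS x - ?l (Z x) \<bullet> b (Z x)) + (?r (Z x) \<bullet> XT x - ?r (Z x) \<bullet> v (Z x)))"
    unfolding U_tilde_def Let_def spacetime_\<rho>_eq[OF cb(1)] spacetime_\<rho>_eq[OF cb(2)] spacetime_B_eq[OF c(1)]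
      restrict_time_P_eq[OF \<tau> c(2)] using i by simp
  then show ?thesis by (simp add: w_def inner_pair_vec inner_diff_right)
qed

lemma quad_minus_R_le:
  assumes \<tau>: "0 \<le> \<tau>" "\<tau> \<le> T"
  shows "quad_energy ({0..\<tau>} \<times> UNIV) (\<lambda>z. exp (- r * fst z) *\<^sub>R Q_matrix r b v z)
          (spacetime \<tau> (\<lambda>t. loop_\<rho> \<mu> (X t))) (U_tilde (\<lambda>t. loop_B \<mu> (X t)) (\<lambda>t. loop_\<rho> \<mu> (X t)) (loop_P \<mu> T X) b v \<tau>)
        - ereal (R_integral T (\<lambda>t. loop_B \<mu> (X t)) (\<lambda>t. loop_\<rho> \<mu> (X t)) (loop_P \<mu> T X) b v r \<tau>)
     \<le> ereal (LINT x|\<Lambda> \<tau>. diss x)" (is "?q - ereal ?R \<le> _")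
proof -
  let ?Q = "\<lambda>z. exp (- r * fst z) *\<^sub>R Q_matrix r b v z"
  have "?q \<le> ereal (LINT x|\<Lambda> \<tau>. (w x \<bullet> (?Q (Z x) *v w x)) / 2)"
  proof (rule quad_energy_le[OF finite_\<Lambda> Z_measurable w_measurable[OF \<tau>(2)] w_sq_integrable[OF \<tau>(2)] Icc_UNIV_compact Qr_continuous[OF \<tau>(2)]])
    fix z \<xi> assume "z \<in> {0..\<tau>} \<times> (UNIV :: 'n torus set)"
    then have "fst z \<in> {0..T}" using \<tau> by auto
    from Q_ge[OF Q_r0 r this, of \<xi>] show "0 \<le> \<xi> \<bullet> (?Q z *v \<xi>)"
      by (simp add: scaleR_matrix_vector_assoc[symmetric])
  qed (use spacetime_\<rho>_eq U_tilde_eq[OF \<tau>] in auto)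
  then have "?q - ereal ?R \<le> ereal (LINT x|\<Lambda> \<tau>. (w x \<bullet> (?Q (Z x) *v w x)) / 2) - ereal ?R"
    by (intro ereal_minus_mono) auto
  also have "\<dots> = ereal (LINT x|\<Lambda> \<tau>. diss x)"
    unfolding diss_decomposition R_integral_eq[OF \<tau>]
    using L_integrable[OF \<tau>(2)] quad_integrable[OF \<tau>(2)] by simp
  finally show ?thesis .
qed

lemma E_eq:
  assumes t: "t \<in> {0..T}"
  shows "E t = (LINT x|\<Omega>. (norm (Xs t (fst x) (snd x)))\<^sup>2) / 2 - loop_B \<mu> (X t) (\<lambda>x. b (t, x))
       + loop_\<rho> \<mu> (X t) (\<lambda>x. (norm (b (t, x)))\<^sup>2) / 2"
    and "integrable \<Omega> (\<lambda>x. (norm (Xs t (fst x) (snd x) - b (t, abs_torus (X t (snd x) (fst x)))))\<^sup>2 / 2)"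
proof -
  have t0: "t \<ge> 0" using t by simp
  have bc: "continuous_on UNIV (\<lambda>x. b (t, x))" by (rule continuous_on_time_section[OF b.field_continuous t])
  then have b2: "continuous_on UNIV (\<lambda>x. (norm (b (t, x)))\<^sup>2)" by (intro continuous_intros)
  note i = field_\<Omega>_integrable[OF b2 t0] field_inner_\<Omega>_integrable[OF bc t0] Xs_sq_integrable[OF t0]
  let ?p = "\<lambda>x. Xs t (fst x) (snd x)" and ?b = "\<lambda>x. b (t, abs_torus (X t (snd x) (fst x)))"
  have e: "(norm (?p x - ?b x))\<^sup>2 / 2 = (norm (?p x))\<^sup>2 / 2 - ?b x \<bullet> ?p x + (norm (?b x))\<^sup>2 / 2" for x
    by (simp add: power2_norm_eq_inner inner_simps inner_commute field_simps)
  show "E t = (LINT x|\<Omega>. (norm (Xs t (fst x) (snd x)))\<^sup>2) / 2 - loop_B \<mu> (X t) (\<lambda>x. b (t, x))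
       + loop_\<rho> \<mu> (X t) (\<lambda>x. (norm (b (t, x)))\<^sup>2) / 2"
    unfolding E_def e loop_\<rho>_eq[OF b2 t0] loop_B_eq[OF bc t0] using i by simp
  show "integrable \<Omega> (\<lambda>x. (norm (?p x - ?b x))\<^sup>2 / 2)" unfolding e using i by simp
qed

text \<open>The balance of a single loop, integrated over the ensemble. An indicator in place of a
  shorter time interval keeps the measure \<open>\<Lambda> \<tau>\<close> fixed while
  \<open>a\<close> tends to 0.\<close>

lemma balance:
  assumes a: "0 < a" "a \<le> \<tau>" "\<tau> \<le> T"
  shows "exp (- r * \<tau>) * E \<tau> + (LINT x|\<Lambda> \<tau>. indicator {a..} (fst x) * diss x) = exp (- r * a) * E a"
proof -
  let ?e = "\<lambda>t \<omega>. LINT s|unit_lborel. (norm (Xs t \<omega> s - b (t, abs_torus (X t s \<omega>))))\<^sup>2 / 2"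
  let ?d = "\<lambda>\<omega>. LINT t|interval_lborel 0 \<tau>. LINT s|unit_lborel. indicator {a..} t * diss (t, \<omega>, s)"
  have E: "E t = (LINT \<omega>|\<mu>. ?e t \<omega>)" "integrable \<mu> (?e t)" if "t \<in> {0..T}" for t
    using integral_\<Omega>[OF E_eq(2)[OF that]] Pi.integrable_fst'[OF E_eq(2)[OF that]] by (simp_all add: E_def)
  have i: "integrable (\<Lambda> \<tau>) (\<lambda>x. indicator {a..} (fst x) * diss x)"
    by (rule indicator_diss(2)[OF a(3)]) simp
  have loopwise: "?d \<omega> = exp (- r * a) * ?e a \<omega> - exp (- r * \<tau>) * ?e \<tau> \<omega>" if \<omega>: "\<omega> \<in> space \<mu>" for \<omega>
  proof -
    interpret heat_loop "\<lambda>s. X0 s \<omega>" "\<lambda>t s. X t s \<omega>" using \<omega> by (rule heat_loop)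
    let ?k = "\<lambda>t. LINT s|unit_lborel. diss (t, \<omega>, s)"
    have "?d \<omega> = (LINT t|lborel. indicator {a..\<tau>} t *\<^sub>R ?k t)"
      unfolding lebesgue_integral_interval_lborel set_lebesgue_integral_def using a
      by (intro Bochner_Integration.integral_cong) (auto split: split_indicator)
    also have "\<dots> = (LINT t|interval_lborel a \<tau>. ?k t)"
      unfolding lebesgue_integral_interval_lborel set_lebesgue_integral_def ..
    also have "\<dots> = exp (- r * a) * ?e a \<omega> - exp (- r * \<tau>) * ?e \<tau> \<omega>"
      using dissipation_balance(2)[OF C1_fields_axioms a, of r]
      by (simp add: XS_def XT_def Z_def Xs_def Xt_def)
    finally show ?thesis .
  qed
  have "(LINT x|\<Lambda> \<tau>. indicator {a..} (fst x) * diss x) = (LINT \<omega>|\<mu>. ?d \<omega>)"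
    using integral_\<Lambda>_swap[OF i] by simp
  also have "\<dots> = (LINT \<omega>|\<mu>. exp (- r * a) * ?e a \<omega> - exp (- r * \<tau>) * ?e \<tau> \<omega>)"
    by (intro Bochner_Integration.integral_cong loopwise) simp_all
  also have "\<dots> = exp (- r * a) * E a - exp (- r * \<tau>) * E \<tau>"
  proof -
    have t: "a \<in> {0..T}" "\<tau> \<in> {0..T}" using a by auto
    have "(LINT \<omega>|\<mu>. exp (- r * a) * ?e a \<omega> - exp (- r * \<tau>) * ?e \<tau> \<omega>)
      = (LINT \<omega>|\<mu>. exp (- r * a) * ?e a \<omega>) - (LINT \<omega>|\<mu>. exp (- r * \<tau>) * ?e \<tau> \<omega>)"
      by (intro Bochner_Integration.integral_diff integrable_mult_right E(2) t)
    then show ?thesis unfolding E(1)[OF t(1)] E(1)[OF t(2)] by (simp only: integral_mult_right_zero)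
  qed
  finally show ?thesis by simp
qed

text \<open>In \<open>balance\<close>, \<open>a\<close> tends to 0. The dissipation integral
  converges by domination, whereas the energy at \<open>a\<close> is only bounded from above,
  through energy decay; hence an inequality.\<close>

lemma energy_inequality:
  assumes \<tau>: "0 \<le> \<tau>" "\<tau> \<le> T"
  shows "exp (- r * \<tau>) * E \<tau> + (LINT x|\<Lambda> \<tau>. diss x) \<le> E 0"
proof (cases "\<tau> = 0")
  \<comment> \<open>The time interval degenerates to a point, so the dissipation integral
    vanishes.\<close>
  case True
  have "(LINT x|\<Lambda> 0. diss x) = (LINT t|interval_lborel 0 0. LINT x|\<Omega>. diss (t, x))"
    by (rule integral_\<Lambda>[OF diss_integrable]) (use b.T_pos in simp)
  also have "\<dots> = (LINT t|interval_lborel 0 0. 0)"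
  proof (rule integral_cong_AE)
    have "AE t in interval_lborel 0 0. False"
      unfolding AE_interval_lborel using AE_lborel_singleton[of "0::real"] by eventually_elim simp
    then show "AE t in interval_lborel 0 0. (LINT x|\<Omega>. diss (t, x)) = 0" by eventually_elim simp
    show "(\<lambda>t. LINT x|\<Omega>. diss (t, x)) \<in> borel_measurable (interval_lborel 0 0)"
    proof (rule Pi.P.borel_measurable_lebesgue_integral)
      show "(\<lambda>(t, x). diss (t, x)) \<in> borel_measurable (\<Lambda> 0)"
        using borel_measurable_integrable[OF diss_integrable[of 0]] b.T_pos by (simp add: case_prod_beta')
    qed
  qed simp
  finally show ?thesis by (simp add: True)
next
  case False
  then have pos: "\<tau> > 0" using \<tau> by simp
  define a where "a n = \<tau> / real (Suc n)" for n
  have a: "0 < a n" "a n \<le> \<tau>" for n using pos by (auto simp: a_def divide_le_eq_1 field_simps)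
  have a0: "a \<longlonglongrightarrow> 0"
    unfolding a_def using tendsto_mult_left[OF LIMSEQ_inverse_real_of_nat, of \<tau>] by (simp add: divide_inverse)
  note di = diss_integrable[OF \<tau>(2)]
  have fm: "(\<lambda>x. fst x) \<in> borel_measurable (\<Lambda> \<tau>)"
    by (rule measurable_compose[OF measurable_fst]) (rule measurable_restrict_space1, simp)
  have 1: "(\<lambda>n. LINT x|\<Lambda> \<tau>. indicator {a n..} (fst x) * diss x) \<longlonglongrightarrow> (LINT x|\<Lambda> \<tau>. indicator {0<..} (fst x) * diss x)"
  proof (rule integral_dominated_convergence[where w = "\<lambda>x. \<bar>diss x\<bar>"])
    show "(\<lambda>x. indicator {0<..} (fst x) * diss x) \<in> borel_measurable (\<Lambda> \<tau>)"
      "(\<lambda>x. indicator {a n..} (fst x) * diss x) \<in> borel_measurable (\<Lambda> \<tau>)" for n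
      by (rule indicator_diss(1)[OF \<tau>(2)], simp)+
    show "integrable (\<Lambda> \<tau>) (\<lambda>x. \<bar>diss x\<bar>)" using di by simp
    show "AE x in \<Lambda> \<tau>. norm (indicator {a n..} (fst x) * diss x) \<le> \<bar>diss x\<bar>" for n
      by (intro AE_I2) (simp split: split_indicator)
    show "AE x in \<Lambda> \<tau>. (\<lambda>n. indicator {a n..} (fst x) * diss x) \<longlonglongrightarrow> indicator {0<..} (fst x) * diss x"
    proof (intro AE_I2 tendsto_mult tendsto_const)
      fix x :: "real \<times> 'a \<times> real"
      show "(\<lambda>n. indicator {a n..} (fst x) :: real) \<longlonglongrightarrow> indicator {0<..} (fst x)"
      proof (cases "fst x > 0")
        case True
        then have "\<forall>\<^sub>F n in sequentially. a n < fst x" using order_tendstoD(2)[OF a0] by simp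
        then have "\<forall>\<^sub>F n in sequentially. indicator {a n..} (fst x) = (1::real)" by eventually_elim simp
        then show ?thesis using True by (simp add: tendsto_eventually)
      next
        case False
        then have "fst x \<notin> {a n..}" for n using a(1)[of n] by auto
        then show ?thesis using False by simp
      qed
    qed
  qed
  have "(LINT x|\<Lambda> \<tau>. indicator {0<..} (fst x) * diss x) = (LINT x|\<Lambda> \<tau>. diss x)"
  proof (rule integral_cong_AE)
    interpret L: pair_sigma_finite "interval_lborel 0 \<tau>" \<Omega> by (rule pair_\<Lambda>)
    have "AE t in interval_lborel 0 \<tau>. t \<noteq> (0::real)"
      unfolding AE_interval_lborel using AE_lborel_singleton[of "0::real"] by eventually_elim simp
    then have "AE t in interval_lborel 0 \<tau>. AE x in \<Omega>. fst (t, x) \<noteq> 0" by eventually_elim simp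
    then have "AE x in \<Lambda> \<tau>. fst x \<noteq> 0"
    proof (rule L.AE_pair_measure[rotated])
      show "{x \<in> space (\<Lambda> \<tau>). fst x \<noteq> 0} \<in> sets (\<Lambda> \<tau>)" using fm by measurable
    qed
    then show "AE x in \<Lambda> \<tau>. indicator {0<..} (fst x) * diss x = diss x"
    proof (rule AE_mp, intro AE_I2 impI)
      fix x assume "x \<in> space (\<Lambda> \<tau>)" "fst x \<noteq> 0"
      then have "fst x > 0" by (auto simp: space_\<Lambda>)
      then show "indicator {0<..} (fst x) * diss x = diss x" by simp
    qed
    show "(\<lambda>x. indicator {0<..} (fst x) * diss x) \<in> borel_measurable (\<Lambda> \<tau>)"
      by (rule indicator_diss(1)[OF \<tau>(2)]) simp
  qed (use di in simp)
  with 1 have lhs: "(\<lambda>n. exp (- r * \<tau>) * E \<tau> + (LINT x|\<Lambda> \<tau>. indicator {a n..} (fst x) * diss x))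
      \<longlonglongrightarrow> exp (- r * \<tau>) * E \<tau> + (LINT x|\<Lambda> \<tau>. diss x)"
    by (intro tendsto_add tendsto_const) simp
  \<comment> \<open>\<open>E\<close> itself need not be continuous at \<open>0\<close>, where \<open>\<partial>\<^sub>s X\<close> converges only weakly; in the continuous
    majorant \<open>h\<close> the integral of \<open>|\<partial>\<^sub>s X|\<^sup>2\<close> is replaced by its value at \<open>0\<close>.\<close>
  define h where "h t = exp (- r * t) * ((LINT x|\<Omega>. (norm (Xs 0 (fst x) (snd x)))\<^sup>2) / 2 - loop_B \<mu> (X t) (\<lambda>x. b (t, x))
       + loop_\<rho> \<mu> (X t) (\<lambda>x. (norm (b (t, x)))\<^sup>2) / 2)" for t
  have "continuous_on {0..T} h"
  proof -
    have "continuous_on ({0..T} \<times> UNIV) (\<lambda>z. (norm (b z))\<^sup>2)" by (intro continuous_intros b.field_continuous)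
    from \<rho>_continuous[OF this] B_continuous[OF b.field_continuous b.T_pos]
    show ?thesis unfolding h_def by (intro continuous_intros) auto
  qed
  then have "(\<lambda>n. h (a n)) \<longlonglongrightarrow> h 0"
  proof (rule continuous_on_tendsto_compose[OF _ a0])
    have "a n \<in> {0..T}" for n using a[of n] \<tau> by auto
    then show "\<forall>\<^sub>F n in sequentially. a n \<in> {0..T}" by (intro always_eventually allI)
  qed (use b.T_pos in simp)
  moreover have "h 0 = E 0" unfolding h_def using E_eq(1)[of 0] b.T_pos by simp
  ultimately have rhs: "(\<lambda>n. h (a n)) \<longlonglongrightarrow> E 0" by simp
  show ?thesis
  proof (rule LIMSEQ_le[OF lhs rhs], intro exI allI impI)
    fix n
    have an: "a n \<in> {0..T}" using a[of n] \<tau> by auto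
    have "exp (- r * a n) * E (a n) \<le> h (a n)"
      unfolding h_def E_eq(1)[OF an] using Xs_energy_le[of "a n"] an by (intro mult_left_mono) auto
    then show "exp (- r * \<tau>) * E \<tau> + (LINT x|\<Lambda> \<tau>. indicator {a n..} (fst x) * diss x) \<le> h (a n)"
      using balance[OF a(1) a(2) \<tau>(2), of n] by simp
  qed
qed

end

lemma (in dissipative_setting) dissipation_inequality:
  assumes \<tau>: "\<tau> \<in> {0..T}"
    and wp: "2 * kinetic UNIV (loop_\<rho> \<mu> X0) (loop_B \<mu> X0) = enn2ereal (loop_energy \<mu> X0)"
  shows "dissipation_inequality T (\<lambda>t. loop_B \<mu> (X t)) (\<lambda>t. loop_\<rho> \<mu> (X t)) (loop_P \<mu> T X) b v r \<tau>"
proof -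
  have \<tau>': "0 \<le> \<tau>" "\<tau> \<le> T" and 0: "0 \<in> {0..T}" using \<tau> b.T_pos by auto
  let ?en = "energy (\<lambda>t. loop_B \<mu> (X t)) (\<lambda>t. loop_\<rho> \<mu> (X t)) b"
  let ?k = "kinetic UNIV (loop_\<rho> \<mu> X0) (loop_B \<mu> X0)"
  let ?I = "LINT x|\<Omega>. (norm (Xs 0 (fst x) (snd x)))\<^sup>2"
  let ?c = "loop_B \<mu> (X 0) (\<lambda>x. b (0, x)) - loop_\<rho> \<mu> (X 0) (\<lambda>x. (norm (b (0, x)))\<^sup>2) / 2"
  have up: "?en t \<le> ereal (E t)" if "t \<in> {0..T}" for t
    unfolding E_eq(1)[OF that] by (rule kinetic_le[OF b.field_continuous that])
  \<comment> \<open>The factor 2 undoes the one half inside \<open>kinetic\<close>. Together with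
    \<open>kinetic_ge\<close> the assumption yields \<open>low\<close>, the reverse of
    \<open>up\<close> at time zero: averaging loses no initial energy.\<close>
  have "2 * ?k = ereal ?I"
    unfolding wp loop_energy_eq_integral by (simp add: enn2ereal_ennreal)
  then have "?k = ereal (?I / 2)"
    by (cases ?k) auto
  then have "ereal (?I / 2) \<le> ?en 0 + ereal ?c"
    using kinetic_ge[OF b.field_continuous 0] by (simp add: loop_functionals_X_0)
  then have low: "ereal (E 0) \<le> ?en 0"
    unfolding E_eq(1)[OF 0] by (cases "?en 0") auto
  have "?en \<tau> * ereal (exp (- r * \<tau>)) \<le> ereal (E \<tau>) * ereal (exp (- r * \<tau>))"
    by (intro ereal_mult_right_mono up \<tau>) simp
  then have "?en \<tau> * ereal (exp (- r * \<tau>))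
    + (quad_energy ({0..\<tau>} \<times> UNIV) (\<lambda>z. exp (- r * fst z) *\<^sub>R Q_matrix r b v z)
          (spacetime \<tau> (\<lambda>t. loop_\<rho> \<mu> (X t))) (U_tilde (\<lambda>t. loop_B \<mu> (X t)) (\<lambda>t. loop_\<rho> \<mu> (X t)) (loop_P \<mu> T X) b v \<tau>)
        - ereal (R_integral T (\<lambda>t. loop_B \<mu> (X t)) (\<lambda>t. loop_\<rho> \<mu> (X t)) (loop_P \<mu> T X) b v r \<tau>))
    \<le> ereal (E \<tau>) * ereal (exp (- r * \<tau>)) + ereal (LINT x|\<Lambda> \<tau>. diss x)"
    by (intro add_mono quad_minus_R_le \<tau>')
  also have "\<dots> \<le> ereal (E 0)"
    using energy_inequality[OF \<tau>'] by (simp add: mult.commute)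
  also note low
  finally show ?thesis
    unfolding dissipation_inequality_def using up[OF 0] by (auto intro: le_less_trans)
qed

lemma (in loop_ensemble) dissipative_solution:
  assumes T: "T > 0"
    and wp: "2 * kinetic UNIV (loop_\<rho> \<mu> X0) (loop_B \<mu> X0) = enn2ereal (loop_energy \<mu> X0)"
  shows "dissipative_solution T (loop_B \<mu> X0) (loop_\<rho> \<mu> X0)
     (\<lambda>t. loop_B \<mu> (X t)) (\<lambda>t. loop_\<rho> \<mu> (X t)) (loop_P \<mu> T X)"
  unfolding dissipative_solution_def
proof (intro conjI allI impI ballI)
  show "cdual UNIV (loop_B \<mu> X0)" "cdual UNIV (loop_\<rho> \<mu> X0)" "nonneg_on UNIV (loop_\<rho> \<mu> X0)"
    unfolding loop_functionals_X_0 by (rule cdual_B cdual_\<rho> nonneg_\<rho>; simp)+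
  fix b v :: "real \<times> 'n torus \<Rightarrow> real ^ 'n" and r0 t r
  assume C1: "C1_field T b" "C1_field T v" and Q: "Q_ge_id T r0 b v" and t: "t \<in> {0..T}" and r: "r0 \<le> r"
  obtain Db where "C1_derivative T b Db" by (rule C1_field_obtain[OF C1(1) T])
  moreover obtain Dv where "C1_derivative T v Dv" by (rule C1_field_obtain[OF C1(2) T])
  ultimately interpret C1_fields T b Db v Dv by (rule C1_fields.intro)
  interpret dissipative_setting \<mu> X0 X T b v Db Dv r0 r by unfold_locales (rule Q, rule r)
  show "dissipation_inequality T (\<lambda>t. loop_B \<mu> (X t)) (\<lambda>t. loop_\<rho> \<mu> (X t)) (loop_P \<mu> T X) b v r t"
    by (rule dissipation_inequality[OF t wp])
qed (use T in \<open>auto simp: loop_functionals_X_0 intro: weak_star_continuous_B weak_star_continuous_\<rho> cdual_P divergence_free_B continuity_equation_\<rho>\<close>)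

lemma loop_integral_cong_AE:
  assumes "AE a in \<mu>. \<forall>s. g s a = h s a"
  shows "loop_integral \<mu> g = loop_integral \<mu> h"
  unfolding loop_integral_def
proof (rule integral_completion_cong_AE)
  show "AE a in \<mu>. (LINT s:{0..1}|lebesgue. g s a) = (LINT s:{0..1}|lebesgue. h s a)"
    using assms by eventually_elim simp
qed

theorem theorem0p2:
  fixes \<mu> :: "'a measure"
    and X0 :: "real \<Rightarrow> 'a \<Rightarrow> real ^ 'n::finite"
    and X :: "real \<Rightarrow> real \<Rightarrow> 'a \<Rightarrow> real ^ 'n"
  assumes "prob_space \<mu>"
    and "(\<lambda>(s, a). X0 s a) \<in> borel_measurable (borel \<Otimes>\<^sub>M \<mu>)"
    and "AE a in \<mu>. is_loop (\<lambda>s. X0 s a)"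
    and "2 * kinetic UNIV (loop_\<rho> \<mu> X0) (loop_B \<mu> X0) = enn2ereal (loop_energy \<mu> X0)"
    and "loop_energy \<mu> X0 < \<infinity>"
    and "\<And>t. t \<ge> 0 \<Longrightarrow> (\<lambda>(s, a). X t s a) \<in> borel_measurable (borel \<Otimes>\<^sub>M \<mu>)"
    and "AE a in \<mu>. heat_solution (\<lambda>s. X0 s a) (\<lambda>t s. X t s a)"
  shows "\<forall>T>0. dissipative_solution T (loop_B \<mu> X0) (loop_\<rho> \<mu> X0)
           (\<lambda>t. loop_B \<mu> (X t)) (\<lambda>t. loop_\<rho> \<mu> (X t)) (loop_P \<mu> T X)"
proof (intro allI impI)
  fix T :: real assume T: "T > 0"
  have "AE a in \<mu>. heat_loop (\<lambda>s. X0 s a) (\<lambda>t s. X t s a)"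
    using assms(3,7) by eventually_elim (rule heat_loop.intro)
  then obtain N where N: "N \<in> null_sets \<mu>" "{a \<in> space \<mu>. \<not> heat_loop (\<lambda>s. X0 s a) (\<lambda>t s. X t s a)} \<subseteq> N"
    unfolding eventually_ae_filter by blast
  \<comment> \<open>On the null set \<open>N\<close> every loop is replaced by the constant zero
    loop, which solves the heat equation. Joint measurability survives because \<open>N\<close> is
    measurable.\<close>
  define X0' where "X0' s a = (if a \<in> N then 0 else X0 s a)" for s a
  define X' where "X' t s a = (if a \<in> N then 0 else X t s a)" for t s a
  have AE: "AE a in \<mu>. a \<notin> N" by (rule AE_not_in[OF N(1)])
  have zero: "heat_loop (\<lambda>s. 0 :: real ^ 'n) (\<lambda>t s. 0)"
  proof
    have "0-lipschitz_on UNIV (\<lambda>s :: real. 0 :: real ^ 'n)" by (rule lipschitz_onI) simp_all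
    then have "\<exists>C. C-lipschitz_on UNIV (\<lambda>s :: real. 0 :: real ^ 'n)" by (rule exI)
    moreover have "\<exists>N :: real ^ 'n. (\<forall>i. N $ i \<in> \<int>) \<and> (\<forall>s :: real. 0 = 0 + N)" by (rule exI[of _ 0]) simp
    ultimately show "is_loop (\<lambda>s. 0 :: real ^ 'n)" unfolding is_loop_def by (rule conjI)
    have "\<exists>N :: real ^ 'n. (\<forall>i. N $ i \<in> \<int>) \<and> (\<forall>t :: real\<ge>0. \<forall>s :: real. 0 = 0 + N)" by (rule exI[of _ 0]) simp
    moreover have "continuous_on S (\<lambda>(t :: real, s :: real). 0 :: real ^ 'n)" for S
      by (simp add: case_prod_beta')
    moreover from this have "\<exists>Ys Yss :: real \<Rightarrow> real \<Rightarrow> real ^ 'n.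
        continuous_on ({0<..} \<times> UNIV) (\<lambda>(t, s). Ys t s) \<and> continuous_on ({0<..} \<times> UNIV) (\<lambda>(t, s). Yss t s) \<and>
        (\<forall>t>0. \<forall>s. ((\<lambda>\<sigma>. 0) has_vector_derivative Ys t s) (at s) \<and>
           ((\<lambda>\<sigma>. Ys t \<sigma>) has_vector_derivative Yss t s) (at s) \<and>
           ((\<lambda>\<tau>. 0) has_vector_derivative Yss t s) (at t))"
      by (intro exI[of _ "\<lambda>_ _. 0"]) simp
    ultimately show "heat_solution (\<lambda>s. 0 :: real ^ 'n) (\<lambda>t s. 0)" unfolding heat_solution_def by simp
  qed
  \<comment> \<open>All functionals are integrals over the completed measure and do not see
    \<open>N\<close>. The derivatives in \<open>s\<close> and \<open>t\<close> are taken with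
    \<open>a\<close> fixed, so outside \<open>N\<close> they are unchanged too.\<close>
  have eq: "loop_integral \<mu> g = loop_integral \<mu> h" if "\<And>a s. a \<notin> N \<Longrightarrow> g s a = h s a" for g h
  proof (rule loop_integral_cong_AE)
    show "AE a in \<mu>. \<forall>s. g s a = h s a" using AE by (rule eventually_mono) (use that in blast)
  qed
  have \<rho>: "loop_\<rho> \<mu> Y = loop_\<rho> \<mu> Y'" and B: "loop_B \<mu> Y = loop_B \<mu> Y'"
    if "\<And>a s. a \<notin> N \<Longrightarrow> Y s a = Y' s a" for Y Y' :: "real \<Rightarrow> 'a \<Rightarrow> real ^ 'n"
  proof -
    show "loop_\<rho> \<mu> Y = loop_\<rho> \<mu> Y'"
    proof (rule ext)
      show "loop_\<rho> \<mu> Y \<phi> = loop_\<rho> \<mu> Y' \<phi>" for \<phi>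
        unfolding loop_\<rho>_def by (rule eq) (simp add: that)
    qed
    show "loop_B \<mu> Y = loop_B \<mu> Y'"
    proof (rule ext)
      show "loop_B \<mu> Y \<phi> = loop_B \<mu> Y' \<phi>" for \<phi>
        unfolding loop_B_def by (rule eq) (simp add: that)
    qed
  qed
  have X0': "X0 s a = X0' s a" if "a \<notin> N" for s a using that by (simp add: X0'_def)
  have X': "X t s a = X' t s a" if "a \<notin> N" for t s a using that by (simp add: X'_def)
  have P: "loop_P \<mu> T X = loop_P \<mu> T X'"
  proof (rule ext)
    fix \<phi> :: "real \<times> 'n torus \<Rightarrow> real ^ 'n"
    have "loop_integral \<mu> (\<lambda>s a. \<phi> (t, abs_torus (X t s a)) \<bullet> vector_derivative (\<lambda>\<tau>. X \<tau> s a) (at t))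
      = loop_integral \<mu> (\<lambda>s a. \<phi> (t, abs_torus (X' t s a)) \<bullet> vector_derivative (\<lambda>\<tau>. X' \<tau> s a) (at t))" for t
      by (rule eq) (simp add: X')
    then show "loop_P \<mu> T X \<phi> = loop_P \<mu> T X' \<phi>" unfolding loop_P_def by simp
  qed
  have en: "loop_energy \<mu> X0 = loop_energy \<mu> X0'"
    unfolding loop_energy_def
  proof (rule nn_integral_cong_AE)
    show "AE a in completion \<mu>. (\<integral>\<^sup>+s\<in>{0..1}. ennreal ((norm (loop_deriv X0 s a))\<^sup>2) \<partial>lebesgue)
       = (\<integral>\<^sup>+s\<in>{0..1}. ennreal ((norm (loop_deriv X0' s a))\<^sup>2) \<partial>lebesgue)"
      using AE_completion[OF AE] by eventually_elim (simp add: X0')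
  qed
  have init: "loop_\<rho> \<mu> X0 = loop_\<rho> \<mu> X0'" "loop_B \<mu> X0 = loop_B \<mu> X0'"
    by (rule \<rho> B, rule X0', assumption)+
  have later: "loop_\<rho> \<mu> (X t) = loop_\<rho> \<mu> (X' t)" "loop_B \<mu> (X t) = loop_B \<mu> (X' t)" for t
    by (rule \<rho> B, rule X', assumption)+
  interpret loop_ensemble \<mu> X0' X'
  proof (intro loop_ensemble.intro loop_ensemble_axioms.intro)
    show "prob_space \<mu>" by (rule assms(1))
  next
    fix t :: real assume "t \<ge> 0"
    have "(\<lambda>x. if snd x \<in> N then 0 else X t (fst x) (snd x)) \<in> borel_measurable (borel \<Otimes>\<^sub>M \<mu>)"
    proof (rule measurable_If)
      show "(\<lambda>x. X t (fst x) (snd x)) \<in> borel_measurable (borel \<Otimes>\<^sub>M \<mu>)"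
        using assms(6)[OF \<open>t \<ge> 0\<close>] by (simp add: case_prod_beta')
      have "snd -` N \<inter> space (borel \<Otimes>\<^sub>M \<mu>) \<in> sets (borel \<Otimes>\<^sub>M \<mu>)"
        by (rule measurable_sets[OF measurable_snd null_setsD2[OF N(1)]])
      then show "{x \<in> space (borel \<Otimes>\<^sub>M \<mu>). snd x \<in> N} \<in> sets (borel \<Otimes>\<^sub>M \<mu>)"
        by (simp add: vimage_def Int_def conj_commute)
    qed simp
    then show "(\<lambda>(s, a). X' t s a) \<in> borel_measurable (borel \<Otimes>\<^sub>M \<mu>)" by (simp add: X'_def case_prod_beta')
  next
    fix a assume "a \<in> space \<mu>"
    then show "heat_loop (\<lambda>s. X0' s a) (\<lambda>t s. X' t s a)"
      using N(2) zero by (cases "a \<in> N") (auto simp: X0'_def X'_def)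
  next
    show "loop_energy \<mu> X0' < \<infinity>" using assms(5) en by simp
  qed
  show "dissipative_solution T (loop_B \<mu> X0) (loop_\<rho> \<mu> X0)
           (\<lambda>t. loop_B \<mu> (X t)) (\<lambda>t. loop_\<rho> \<mu> (X t)) (loop_P \<mu> T X)"
    using dissipative_solution[OF T] assms(4) unfolding init later P en by blast
qed

end
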